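(* Let $\mathcal X,\mathcal Y$ be countable sets, $\lambda>0$, and let $c\colon\mathcal X\times\mathcal Y\to\mathbb R$ admit dominating functions $c_{\mathcal X}^-,c_{\mathcal X}^+,c_{\mathcal Y}^-,c_{\mathcal Y}^+$ such that $\|c_{\mathcal X}^+-c_{\mathcal X}^-\|_{\ell^\infty(\mathcal X)}<\infty$, with weights $\mathcal C_{\mathcal X},\mathcal C_{\mathcal Y},\phi_{\mathcal X},\phi_{\mathcal Y}$. Let $r\in\mathcal P(\mathcal X)$, $s\in\mathcal P(\mathcal Y)$, let $\pi^\lambda(\cdot,\cdot)$ denote the EROT plan, and let $D=\mathcal D^H_{|(r,s)}\pi^\lambda$ be the linear operator (the Hadamard derivative of $\pi^\lambda$ at $(r,s)$) given explicitly in the context. (i) (One sample from $r$) Let $\hat r_n=\frac1n\sum_{i=1}^n\delta_{X_i}$ with $X_1,\dots,X_n$ i.i.d. $\sim r$ and assume $\sum_{x}\mathcal C_{\mathcal X}(x)\sqrt{r_x}<\infty$ and $\sum_{y}\mathcal C_{\mathcal Y}(y)\phi_{\mathcal Y}^4(y)s_y<\infty$. Then, as $n\to\infty$, $$\sqrt n\big(\pi^\lambda(\hat r_n,s)-\pi^\lambda(r,s)\big)\xrightarrow{\ \mathcal D\ }D(G_r,0)\quad\text{in }\ell^1_{\mathcal C_{\mathcal X}\oplus\mathcal C_{\mathcal Y}}(\mathcal X\times\mathcal Y),$$ where $G_r$ is a tight centered Gaussian process in $\ell^1_{\mathcal C_{\mathcal X}}(\mathcal X)$ with covariance $\Sigma(r)_{xx'}=r_x(1-r_x)$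 if $x=x'$ and $\Sigma(r)_{xx'}=-r_xr_{x'}$ if $x\ne x'$. The limit is a centered Gaussian process, whose covariance is denoted $\Sigma_{\lambda,\pi^\lambda}(r|s)$. (ii) (One sample from $s$) Let $\hat s_m=\frac1m\sum_{i=1}^m\delta_{Y_i}$ with $Y_1,\dots,Y_m$ i.i.d. $\sim s$ and assume $\sum_x\mathcal C_{\mathcal X}(x)r_x<\infty$ and $\sum_y\mathcal C_{\mathcal Y}(y)\phi_{\mathcal Y}^4(y)\sqrt{s_y}<\infty$. Then, as $m\to\infty$, $$\sqrt m\big(\pi^\lambda(r,\hat s_m)-\pi^\lambda(r,s)\big)\xrightarrow{\ \mathcal D\ }D(0,G_s)\quad\text{in }\ell^1_{\mathcal C_{\mathcal X}\oplus\mathcal C_{\mathcal Y}}(\mathcal X\times\mathcal Y),$$ where $G_s$ is a tight centered Gaussian process in $\ell^1_{\mathcal C_{\mathcal Y}\phi_{\mathcal Y}^4}(\mathcal Y)$ with covariance $\Sigma(s)$ (same formula as $\Sigma(r)$ with $s$ in place of $r$). The limit is a centered Gaussian process, whose covariance is denoted $\Sigma_{\lambda,\pi^\lambda}(s|r)$. (iii) (Two samples) Suppose that $\hat r_n$ and $\hat s_m$ as in (i), (ii) are based on independent random variables and that $\sum_x\mathcal C_{\mathcal X}(x)\sqrt{r_x}<\infty$ and $\sum_y\mathcal C_{\mathcal Y}(y)\phi_{\mathcal Y}^4(y)\sqrt{s_y}<\infty$. Then, for $\min(m,n)\to\infty$ with $\frac m{m+n}\to\delta\in(0,1)$, $$\sqrt{\tfrac{nm}{n+m}}\big(\pi^\lambda(\hat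 r_n,\hat s_m)-\pi^\lambda(r,s)\big)\xrightarrow{\ \mathcal D\ }D\big(\sqrt\delta\,G_r,\sqrt{1-\delta}\,G_s\big)\quad\text{in }\ell^1_{\mathcal C_{\mathcal X}\oplus\mathcal C_{\mathcal Y}}(\mathcal X\times\mathcal Y),$$ where $G_r$ and $G_s$ are independent Gaussian processes in $\ell^1_{\mathcal C_{\mathcal X}}(\mathcal X)$ and $\ell^1_{\mathcal C_{\mathcal Y}\phi_{\mathcal Y}^4}(\mathcal Y)$ as in (i) and (ii); the limit is a centered Gaussian process with covariance $\delta\,\Sigma_{\lambda,\pi^\lambda}(r|s)+(1-\delta)\,\Sigma_{\lambda,\pi^\lambda}(s|r)$.
   Context: $\mathcal P(\mathcal X)$: probability measures $r=(r_x)$ on the countable set $\mathcal X$. For a positive function $f$ on a countable set $Z$: $\ell^1_f(Z)$ has norm $\|a\|=\sum_zf(z)|a_z|$ and $\ell^\infty_f(Z)$ has norm $\|b\|=\sup_z|b_z|/f(z)$. $(\mathcal C_{\mathcal X}\oplus\mathcal C_{\mathcal Y})(x,y)=\mathcal C_{\mathcal X}(x)+\mathcal C_{\mathcal Y}(y)$. $\xrightarrow{\mathcal D}$ is weak convergence. EROT: $\Pi(r,s)$ is the set of couplings of $r,s$; $M(\pi)=\sum_{x,y}\pi_{xy}\log(\pi_{xy}/(r_xs_y))$ (with $0\log 0=0$). If $c$ is $r\otimes s$-integrable, the EROT plan $\pi^\lambda(r,s)$ is the unique minimizer of $\pi\mapsto\langle c,\pi\rangle+\lambda M(\pi)$ over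 $\Pi(r,s)$. Dominating functions for $c$: real functions $c_{\mathcal X}^-\le c_{\mathcal X}^+$ on $\mathcal X$, $c_{\mathcal Y}^-\le c_{\mathcal Y}^+$ on $\mathcal Y$ with $c_{\mathcal X}^-(x)+c_{\mathcal Y}^-(y)\le c(x,y)\le c_{\mathcal X}^+(x)+c_{\mathcal Y}^+(y)$ for all $(x,y)$. Weights: $\mathcal C_{\mathcal X}=1+|c_{\mathcal X}^+|+|c_{\mathcal X}^-|$, $\mathcal C_{\mathcal Y}=1+|c_{\mathcal Y}^+|+|c_{\mathcal Y}^-|$, $\phi_{\mathcal X}=\exp((c_{\mathcal X}^+-c_{\mathcal X}^-)/\lambda)$, $\phi_{\mathcal Y}=\exp((c_{\mathcal Y}^+-c_{\mathcal Y}^-)/\lambda)$. The operator $D=\mathcal D^H_{|(r,s)}\pi^\lambda$. Put $X'=\mathrm{supp}(r)$, $Y'=\mathrm{supp}(s)$, fix $y_1\in Y'$, write $\pi=\pi^\lambda(r,s)$, and define bounded linear operators - $\mathcal A^{\mathcal X}\colon\ell^\infty_{\phi_{\mathcal Y}}(Y'\setminus\{y_1\})\to\ell^\infty(X')$, $(\mathcal A^{\mathcal X}b)_x=\sum_{y\in Y'\setminus\{y_1\}}\frac{\pi_{xy}}{r_x}b_y$; - $\mathcal A^{\mathcal Y}\colon\ell^\infty(X')\to\ell^\infty_{\phi_{\mathcal Y}}(Y'\setminus\{y_1\})$, $(\mathcal A^{\mathcal Y}a)_y=\sum_{x\in X'}\frac{\pi_{xy}}{s_y}a_x$; - $\mathcal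 B^{\mathcal X}\colon\ell^1_{\mathcal C_{\mathcal Y}\phi_{\mathcal Y}^4}(Y')\to\ell^\infty(X')$, $(\mathcal B^{\mathcal X}h)_x=\sum_{y\in Y'}\frac{\pi_{xy}}{r_xs_y}h_y$; - $\mathcal B^{\mathcal Y}\colon\ell^1_{\mathcal C_{\mathcal X}}(X')\to\ell^\infty_{\phi_{\mathcal Y}}(Y'\setminus\{y_1\})$, $(\mathcal B^{\mathcal Y}h)_y=\sum_{x\in X'}\frac{\pi_{xy}}{r_xs_y}h_x$. The operators $\mathrm{Id}-\mathcal A^{\mathcal X}\mathcal A^{\mathcal Y}$ and $\mathrm{Id}-\mathcal A^{\mathcal Y}\mathcal A^{\mathcal X}$ are invertible with bounded inverse. For $(h^{\mathcal X},h^{\mathcal Y})\in\ell^1_{\mathcal C_{\mathcal X}}(X')\times\ell^1_{\mathcal C_{\mathcal Y}\phi_{\mathcal Y}^4}(Y')$ with $\sum_xh^{\mathcal X}_x=\sum_yh^{\mathcal Y}_y=0$ set $$\begin{pmatrix} a \\ b \end{pmatrix}=\begin{pmatrix} (\mathrm{Id}-\mathcal A^{\mathcal X}\mathcal A^{\mathcal Y})^{-1} & -(\mathrm{Id}-\mathcal A^{\mathcal X}\mathcal A^{\mathcal Y})^{-1}\mathcal A^{\mathcal X} \\ -\mathcal A^{\mathcal Y}(\mathrm{Id}-\mathcal A^{\mathcal X}\mathcal A^{\mathcal Y})^{-1} & (\mathrm{Id}-\mathcal A^{\mathcal Y}\mathcal A^{\mathcal X})^{-1} \end{pmatrix}\begin{pmatrix}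 \mathcal B^{\mathcal X}h^{\mathcal Y} \\ \mathcal B^{\mathcal Y}h^{\mathcal X} \end{pmatrix},\qquad b_{y_1}:=0,$$ and $D(h^{\mathcal X},h^{\mathcal Y})_{xy}=\frac{\pi_{xy}}{r_xs_y}\big(r_xh^{\mathcal Y}_y+h^{\mathcal X}_xs_y\big)-\pi_{xy}(a_x+b_y)$ for $(x,y)\in X'\times Y'$, and $0$ for other $(x,y)$. ($G_r$ and $G_s$ are a.s. supported on $X'$, $Y'$ and have total mass $0$.) *)

theory Defs
  imports "HOL-Probability.Probability"
begin

section \<open>Weighted sequence spaces\<close>

definition l1_set :: "('z \<Rightarrow> real) \<Rightarrow> ('z \<Rightarrow> real) set" where
  "l1_set f = {a. (\<lambda>z. f z * \<bar>a z\<bar>) summable_on UNIV}"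

definition l1_dist :: "('z \<Rightarrow> real) \<Rightarrow> ('z \<Rightarrow> real) \<Rightarrow> ('z \<Rightarrow> real) \<Rightarrow> real" where
  "l1_dist f a b = (\<Sum>\<^sub>\<infinity>z. f z * \<bar>a z - b z\<bar>)"

lemma l1_set_diff:
  assumes f: "\<And>z. f z > 0" and a: "a \<in> l1_set f" and b: "b \<in> l1_set f"
  shows "(\<lambda>z. f z * \<bar>a z - b z\<bar>) summable_on UNIV"
proof (rule summable_on_comparison_test)
  show "(\<lambda>z. f z * \<bar>a z\<bar> + f z * \<bar>b z\<bar>) summable_on UNIV"
    using a b by (auto simp: l1_set_def intro: summable_on_add)
  show "f z * \<bar>a z - b z\<bar> \<le> f z * \<bar>a z\<bar> + f z * \<bar>b z\<bar>" for z
    using mult_left_mono[OF abs_triangle_ineq4[of "a z" "b z"], of "f z"] less_imp_le[OF f[of z]]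
    by (simp add: distrib_left)
  show "0 \<le> f z * \<bar>a z - b z\<bar>" for z
    using less_imp_le[OF f[of z]] by simp
qed

lemma Metric_space_l1:
  assumes f: "\<And>z. f z > 0"
  shows "Metric_space (l1_set f) (l1_dist f)"
proof
  note f0 = less_imp_le[OF f]
  show "0 \<le> l1_dist f a b" for a b
    unfolding l1_dist_def by (rule infsum_nonneg) (simp add: f0)
  show "l1_dist f a b = l1_dist f b a" for a b
    unfolding l1_dist_def by (simp add: abs_minus_commute)
  show "l1_dist f a b = 0 \<longleftrightarrow> a = b" if "a \<in> l1_set f" "b \<in> l1_set f" for a b
  proof
    assume "l1_dist f a b = 0"
    then have "f z * \<bar>a z - b z\<bar> = 0" for z
      using l1_set_diff[OF f that] f0
      by (intro nonneg_infsum_le_0D[where A=UNIV]) (auto simp: l1_dist_def)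
    then have "a z = b z" for z
      using f[of z] by (metis abs_eq_0 eq_iff_diff_eq_0 less_irrefl mult_eq_0_iff)
    then show "a = b" by blast
  qed (simp add: l1_dist_def)
  show "l1_dist f a c \<le> l1_dist f a b + l1_dist f b c"
    if "a \<in> l1_set f" "b \<in> l1_set f" "c \<in> l1_set f" for a b c
  proof -
    have "f z * \<bar>a z - c z\<bar> \<le> f z * \<bar>a z - b z\<bar> + f z * \<bar>b z - c z\<bar>" for z
      using mult_left_mono[OF _ f0[of z], of "\<bar>a z - c z\<bar>" "\<bar>a z - b z\<bar> + \<bar>b z - c z\<bar>"]
      by (simp add: distrib_left)
    then have "l1_dist f a c \<le> (\<Sum>\<^sub>\<infinity>z. f z * \<bar>a z - b z\<bar> + f z * \<bar>b z - c z\<bar>)"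
      unfolding l1_dist_def
      by (intro infsum_mono summable_on_add l1_set_diff[OF f] that)
    also have "\<dots> = l1_dist f a b + l1_dist f b c"
      unfolding l1_dist_def by (intro infsum_add l1_set_diff[OF f] that)
    finally show ?thesis .
  qed
qed

definition l1_space :: "('z \<Rightarrow> real) \<Rightarrow> ('z \<Rightarrow> real) metric" where
  "l1_space f = metric (l1_set f, l1_dist f)"

lemma l1_space_simps:
  assumes "\<And>z. f z > 0"
  shows "mspace (l1_space f) = l1_set f" "mdist (l1_space f) = l1_dist f"
  unfolding l1_space_def
  using Metric_space.mspace_metric[OF Metric_space_l1] Metric_space.mdist_metric[OF Metric_space_l1] assms
  by metis+

text \<open>A function on a subset \<open>Z\<close> of the type is represented by its extension by \<open>0\<close>,
  so that \<open>linf_set Z f\<close> is the carrier of $\ell^\infty_f(Z)$.\<close>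

definition linf_set :: "'z set \<Rightarrow> ('z \<Rightarrow> real) \<Rightarrow> ('z \<Rightarrow> real) set" where
  "linf_set Z f = {b. (\<forall>z. z \<notin> Z \<longrightarrow> b z = 0) \<and> bdd_above ((\<lambda>z. \<bar>b z\<bar> / f z) ` Z)}"

section \<open>Random elements of a metric space\<close>

definition borel_metric :: "'z metric \<Rightarrow> 'z measure" where
  "borel_metric m = sigma (mspace m) {U. openin (mtopology_of m) U}"

definition converges_in_distribution ::
  "'z metric \<Rightarrow> 'w measure \<Rightarrow> (nat \<Rightarrow> 'w \<Rightarrow> 'z) \<Rightarrow> 'g measure \<Rightarrow> ('g \<Rightarrow> 'z) \<Rightarrow> bool" where
  "converges_in_distribution m M Z N L \<longleftrightarrow>
     (\<forall>n. Z n \<in> M \<rightarrow>\<^sub>M borel_metric m) \<and> L \<in> N \<rightarrow>\<^sub>M borel_metric m \<and>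
     (\<forall>f. continuous_map (mtopology_of m) euclideanreal f \<and> bounded (f ` mspace m) \<longrightarrow>
        (\<lambda>n. \<integral>\<omega>. f (Z n \<omega>) \<partial>M) \<longlonglongrightarrow> (\<integral>\<omega>. f (L \<omega>) \<partial>N))"

definition tight_element :: "'z metric \<Rightarrow> 'g measure \<Rightarrow> ('g \<Rightarrow> 'z) \<Rightarrow> bool" where
  "tight_element m N G \<longleftrightarrow>
     (\<forall>\<epsilon>>0. \<exists>K. compactin (mtopology_of m) K \<and> measure N {\<omega> \<in> space N. G \<omega> \<in> K} \<ge> 1 - \<epsilon>)"

text \<open>Point mass at \<open>0\<close> counts as a (degenerate) centered normal distribution.\<close>

definition centered_normal :: "'g measure \<Rightarrow> ('g \<Rightarrow> real) \<Rightarrow> bool" where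
  "centered_normal N Z \<longleftrightarrow> Z \<in> borel_measurable N \<and>
     (distr N borel Z = return borel 0 \<or>
      (\<exists>\<sigma>>0. distr N borel Z = density lborel (normal_density 0 \<sigma>)))"

definition centered_gaussian :: "('z \<Rightarrow> real) metric \<Rightarrow> 'g measure \<Rightarrow> ('g \<Rightarrow> 'z \<Rightarrow> real) \<Rightarrow> bool" where
  "centered_gaussian m N G \<longleftrightarrow> G \<in> N \<rightarrow>\<^sub>M borel_metric m \<and>
     (\<forall>F t. finite F \<longrightarrow> centered_normal N (\<lambda>\<omega>. \<Sum>z\<in>F. t z * G \<omega> z))"

definition covariance_fun :: "'g measure \<Rightarrow> ('g \<Rightarrow> 'z \<Rightarrow> real) \<Rightarrow> 'z \<Rightarrow> 'z \<Rightarrow> real" where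
  "covariance_fun N G z z' =
     (\<integral>\<omega>. (G \<omega> z - (\<integral>\<omega>. G \<omega> z \<partial>N)) * (G \<omega> z' - (\<integral>\<omega>. G \<omega> z' \<partial>N)) \<partial>N)"

text \<open>The library's \<open>indep_var\<close> forces both variables to have the same value type; this is its
  characterization \<open>indep_var_eq\<close> for two value types.\<close>

definition indep_elements ::
  "'w measure \<Rightarrow> 'u measure \<Rightarrow> ('w \<Rightarrow> 'u) \<Rightarrow> 'v measure \<Rightarrow> ('w \<Rightarrow> 'v) \<Rightarrow> bool" where
  "indep_elements M S U T V \<longleftrightarrow> U \<in> M \<rightarrow>\<^sub>M S \<and> V \<in> M \<rightarrow>\<^sub>M T \<and>
     prob_space.indep_set M
       (sigma_sets (space M) {U -` A \<inter> space M | A. A \<in> sets S})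
       (sigma_sets (space M) {V -` B \<inter> space M | B. B \<in> sets T})"

section \<open>Samples and the multinomial limit process\<close>

definition iid_sample :: "'w measure \<Rightarrow> (nat \<Rightarrow> 'w \<Rightarrow> 'x) \<Rightarrow> 'x pmf \<Rightarrow> bool" where
  "iid_sample M X p \<longleftrightarrow> prob_space M \<and>
     prob_space.indep_vars M (\<lambda>_. count_space UNIV) X UNIV \<and>
     (\<forall>i. distr M (count_space UNIV) (X i) = measure_pmf p)"

text \<open>Both samples, as random sequences, are independent of each other.\<close>

definition indep_samples :: "'w measure \<Rightarrow> (nat \<Rightarrow> 'w \<Rightarrow> 'x) \<Rightarrow> (nat \<Rightarrow> 'w \<Rightarrow> 'y) \<Rightarrow> bool" where
  "indep_samples M X Y \<longleftrightarrow>
     indep_elements M (\<Pi>\<^sub>M i\<in>UNIV. count_space UNIV) (\<lambda>\<omega> i. X i \<omega>)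
                      (\<Pi>\<^sub>M j\<in>UNIV. count_space UNIV) (\<lambda>\<omega> j. Y j \<omega>)"

text \<open>The observations are \<open>X 0, \<dots>, X (n - 1)\<close>; for \<open>n = 0\<close> the value is unspecified.\<close>

definition empirical_pmf :: "(nat \<Rightarrow> 'w \<Rightarrow> 'x) \<Rightarrow> nat \<Rightarrow> 'w \<Rightarrow> 'x pmf" where
  "empirical_pmf X n \<omega> = map_pmf (\<lambda>i. X i \<omega>) (pmf_of_set {..<n})"

definition multinomial_cov :: "'x pmf \<Rightarrow> 'x \<Rightarrow> 'x \<Rightarrow> real" where
  "multinomial_cov p x x' =
     (if x = x' then pmf p x * (1 - pmf p x) else - pmf p x * pmf p x')"

definition limit_process :: "('x \<Rightarrow> real) \<Rightarrow> 'x pmf \<Rightarrow> 'g measure \<Rightarrow> ('g \<Rightarrow> 'x \<Rightarrow> real) \<Rightarrow> bool" where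
  "limit_process f p N G \<longleftrightarrow> prob_space N \<and>
     centered_gaussian (l1_space f) N G \<and> tight_element (l1_space f) N G \<and>
     covariance_fun N G = multinomial_cov p"

section \<open>Entropy regularized optimal transport\<close>

definition couplings :: "'x pmf \<Rightarrow> 'y pmf \<Rightarrow> ('x \<times> 'y) pmf set" where
  "couplings r s = {\<pi>. map_pmf fst \<pi> = r \<and> map_pmf snd \<pi> = s}"

text \<open>For a coupling, the negative parts of the summands below always have a finite sum, so a
  sum that does not converge (absolutely) has the value \<open>\<infinity>\<close>.\<close>

definition coupling_entropy :: "'x pmf \<Rightarrow> 'y pmf \<Rightarrow> ('x \<times> 'y) pmf \<Rightarrow> ereal" where
  "coupling_entropy r s \<pi> =
     (let g = (\<lambda>(x, y). pmf \<pi> (x, y) * ln (pmf \<pi> (x, y) / (pmf r x * pmf s y)))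
      in if g summable_on UNIV then ereal (\<Sum>\<^sub>\<infinity>z. g z) else \<infinity>)"

text \<open>Couplings under which the cost is not integrable are excluded by giving them the value
  \<open>\<infinity>\<close>. There are none if \<open>c\<close> has dominating functions integrable for the marginals.\<close>

definition erot_objective ::
  "('x \<times> 'y \<Rightarrow> real) \<Rightarrow> real \<Rightarrow> 'x pmf \<Rightarrow> 'y pmf \<Rightarrow> ('x \<times> 'y) pmf \<Rightarrow> ereal" where
  "erot_objective c lam r s \<pi> =
     (if (\<lambda>z. c z * pmf \<pi> z) summable_on UNIV
      then ereal (\<Sum>\<^sub>\<infinity>z. c z * pmf \<pi> z) + ereal lam * coupling_entropy r s \<pi> else \<infinity>)"

definition erot_plan ::
  "('x \<times> 'y \<Rightarrow> real) \<Rightarrow> real \<Rightarrow> 'x pmf \<Rightarrow> 'y pmf \<Rightarrow> ('x \<times> 'y) pmf" where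
  "erot_plan c lam r s =
     (THE \<pi>. is_arg_min (erot_objective c lam r s) (\<lambda>\<pi>. \<pi> \<in> couplings r s) \<pi>)"

definition dominating ::
  "('x \<times> 'y \<Rightarrow> real) \<Rightarrow> ('x \<Rightarrow> real) \<Rightarrow> ('x \<Rightarrow> real) \<Rightarrow> ('y \<Rightarrow> real) \<Rightarrow> ('y \<Rightarrow> real) \<Rightarrow> bool" where
  "dominating c cXm cXp cYm cYp \<longleftrightarrow>
     (\<forall>x. cXm x \<le> cXp x) \<and> (\<forall>y. cYm y \<le> cYp y) \<and>
     (\<forall>x y. cXm x + cYm y \<le> c (x, y) \<and> c (x, y) \<le> cXp x + cYp y)"

definition cost_weight :: "('z \<Rightarrow> real) \<Rightarrow> ('z \<Rightarrow> real) \<Rightarrow> 'z \<Rightarrow> real" where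
  "cost_weight cm cp z = 1 + \<bar>cp z\<bar> + \<bar>cm z\<bar>"

definition exp_weight :: "real \<Rightarrow> ('z \<Rightarrow> real) \<Rightarrow> ('z \<Rightarrow> real) \<Rightarrow> 'z \<Rightarrow> real" where
  "exp_weight lam cm cp z = exp ((cp z - cm z) / lam)"

definition weight_sum :: "('x \<Rightarrow> real) \<Rightarrow> ('y \<Rightarrow> real) \<Rightarrow> 'x \<times> 'y \<Rightarrow> real" where
  "weight_sum f g = (\<lambda>(x, y). f x + g y)"

section \<open>The derivative of the plan\<close>

context
  fixes r :: "'x pmf" and s :: "'y pmf" and \<pi> :: "('x \<times> 'y) pmf"
    and \<phi> :: "'y \<Rightarrow> real" and y1 :: 'y
begin

definition AX :: "('y \<Rightarrow> real) \<Rightarrow> 'x \<Rightarrow> real" where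
  "AX b x = (if x \<in> set_pmf r
     then \<Sum>\<^sub>\<infinity>y\<in>set_pmf s - {y1}. pmf \<pi> (x, y) / pmf r x * b y else 0)"

definition AY :: "('x \<Rightarrow> real) \<Rightarrow> 'y \<Rightarrow> real" where
  "AY a y = (if y \<in> set_pmf s - {y1}
     then \<Sum>\<^sub>\<infinity>x\<in>set_pmf r. pmf \<pi> (x, y) / pmf s y * a x else 0)"

definition BX :: "('y \<Rightarrow> real) \<Rightarrow> 'x \<Rightarrow> real" where
  "BX h x = (if x \<in> set_pmf r
     then \<Sum>\<^sub>\<infinity>y\<in>set_pmf s. pmf \<pi> (x, y) / (pmf r x * pmf s y) * h y else 0)"

definition BY :: "('x \<Rightarrow> real) \<Rightarrow> 'y \<Rightarrow> real" where
  "BY h y = (if y \<in> set_pmf s - {y1}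
     then \<Sum>\<^sub>\<infinity>x\<in>set_pmf r. pmf \<pi> (x, y) / (pmf r x * pmf s y) * h x else 0)"

text \<open>The inverses of $\mathrm{Id} - A^X A^Y$ on $\ell^\infty(X')$ and of $\mathrm{Id} - A^Y A^X$ on
  $\ell^\infty_\phi(Y' - \{y_1\})$. For the plan of the theorem both operators are bijections of these
  spaces, so that \<open>inv_into\<close> is the two-sided inverse there.\<close>

definition invXY :: "('x \<Rightarrow> real) \<Rightarrow> 'x \<Rightarrow> real" where
  "invXY = inv_into (linf_set (set_pmf r) (\<lambda>_. 1)) (\<lambda>a x. a x - AX (AY a) x)"

definition invYX :: "('y \<Rightarrow> real) \<Rightarrow> 'y \<Rightarrow> real" where
  "invYX = inv_into (linf_set (set_pmf s - {y1}) \<phi>) (\<lambda>b y. b y - AY (AX b) y)"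

definition deriv_a :: "('x \<Rightarrow> real) \<Rightarrow> ('y \<Rightarrow> real) \<Rightarrow> 'x \<Rightarrow> real" where
  "deriv_a hX hY x = invXY (BX hY) x - invXY (AX (BY hX)) x"

definition deriv_b :: "('x \<Rightarrow> real) \<Rightarrow> ('y \<Rightarrow> real) \<Rightarrow> 'y \<Rightarrow> real" where
  "deriv_b hX hY y = (if y = y1 then 0 else - AY (invXY (BX hY)) y + invYX (BY hX) y)"

definition plan_deriv :: "('x \<Rightarrow> real) \<Rightarrow> ('y \<Rightarrow> real) \<Rightarrow> 'x \<times> 'y \<Rightarrow> real" where
  "plan_deriv hX hY = (\<lambda>(x, y).
     if x \<in> set_pmf r \<and> y \<in> set_pmf s
     then pmf \<pi> (x, y) / (pmf r x * pmf s y) * (pmf r x * hY y + hX x * pmf s y)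
          - pmf \<pi> (x, y) * (deriv_a hX hY x + deriv_b hX hY y)
     else 0)"

end

end

theory Submission
  imports Defs
begin

text \<open>The plan has the density \<open>K x y * u x * v y\<close> with respect to the product of the marginals, where
  \<open>(u, v)\<close> solves the Schroedinger system. Since \<open>c\<^sub>X\<^sup>+ - c\<^sub>X\<^sup>-\<close> is bounded, the rows of the kernel
  \<open>K\<close> are comparable up to a multiple of \<open>\<phi> y\<close>. Hence Sinkhorn's iteration contracts in oscillation, the system
  is solvable for all marginals with finite weighted mass, and the potentials obey bounds that are
  uniform near \<open>(r, s)\<close>. The same minorization makes \<open>Id - A\<^sup>X A\<^sup>Y\<close> invertible. Subtracting the systems
  for two pairs of marginals shows that the difference of the logarithmic potentials solves the
  linearized system up to quadratic errors, so that the plan has the claimed derivative with a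
  remainder that is quadratic in the weighted \<open>\<ell>\<^sup>1\<close> distance of the marginals.

  The empirical process has \<open>x\<close>-th second moment at most \<open>r\<^sub>x\<close>. By the summability of
  \<open>C\<^sub>X(x) \<surd>r\<^sub>x\<close> its weighted \<open>\<ell>\<^sup>1\<close> norm has bounded expectation with uniformly small tails. For
  bounded Lipschitz functions convergence in distribution therefore reduces to finitely many
  coordinates, and there, by Weierstrass approximation with trigonometric polynomials, to
  characteristic functions. Combined with the quadratic remainder this gives the limits, which are
  Gaussian because \<open>D\<close> is linear and bounded.\<close>

section \<open>Countable sums\<close>

text \<open>Boundedness is assumed on the \<open>x\<close> side only, and this asymmetry shapes
  everything. Potentials in \<open>x\<close> are bounded, those in \<open>y\<close> may grow like
  \<open>\<phi>\<close>; contraction is obtained only for functions of \<open>x\<close> in sup norm,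
  so the \<open>y\<close> component is always eliminated first and recovered afterwards. Potentials
  are determined only up to a constant moved from one side to the other, which would make the
  linearized system singular. Prescribing the value \<open>0\<close> at \<open>y1\<close> removes
  this freedom, and the mass that each row puts on the deleted column \<open>y1\<close>, bounded
  below uniformly in \<open>x\<close>, is the contraction gap. The fourth power of
  \<open>\<phi>\<close> is the price of the quadratic remainder: the kernel costs one factor, the
  squared difference of log-potentials two, and the resulting error of the \<open>y\<close>
  potential is multiplied by the kernel once more. The empirical process is never bounded pathwise:
  the remainder is used on the event that its norm is below a fixed level, and a first-moment bound
  disposes of the rest.\<close>

lemma summable_on_abs_le:
  fixes f g :: "'i \<Rightarrow> real"
  assumes "g summable_on A" "\<And>x. x \<in> A \<Longrightarrow> \<bar>f x\<bar> \<le> g x"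
  shows "f summable_on A"
proof -
  have "(\<lambda>x. norm (f x)) summable_on A"
    by (rule summable_on_comparison_test[OF assms(1)]) (use assms(2) in auto)
  then show ?thesis by (rule summable_on_iff_abs_summable_on_real[THEN iffD2])
qed

lemma infsum_abs_le:
  fixes f g :: "'i \<Rightarrow> real"
  assumes "g summable_on A" "\<And>x. x \<in> A \<Longrightarrow> \<bar>f x\<bar> \<le> g x"
  shows "\<bar>infsum f A\<bar> \<le> infsum g A"
proof -
  have f: "f summable_on A" by (rule summable_on_abs_le[OF assms])
  have "infsum f A \<le> infsum g A"
    by (rule infsum_mono[OF f assms(1)]) (use assms(2) in force)
  moreover have "- infsum f A \<le> infsum g A"
    unfolding infsum_uminus[symmetric]
    by (rule infsum_mono) (use f assms in \<open>force simp: summable_on_uminus\<close>)+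
  ultimately show ?thesis by linarith
qed

lemma infsum_diff_real:
  fixes f g :: "'i \<Rightarrow> real"
  assumes "f summable_on A" "g summable_on A"
  shows "infsum (\<lambda>x. f x - g x) A = infsum f A - infsum g A"
  using infsum_add[OF assms(1) summable_on_uminus[THEN iffD2, OF assms(2)]]
  by (simp add: infsum_uminus)

lemma summable_on_diff_real:
  fixes f g :: "'i \<Rightarrow> real"
  assumes "f summable_on A" "g summable_on A"
  shows "(\<lambda>x. f x - g x) summable_on A"
  using summable_on_add[OF assms(1) summable_on_uminus[THEN iffD2, OF assms(2)]] by simp

lemma pmf_has_sum: "(pmf p has_sum 1) UNIV"
proof -
  have "Infinite_Set_Sum.abs_summable_on (pmf p) UNIV" by (rule pmf_abs_summable)
  then show ?thesis
    using infsetsum_infsum[of "pmf p" UNIV] infsetsum_pmf_eq_1[of p UNIV]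
      abs_summable_equivalent[of "pmf p" UNIV]
    by (metis abs_summable_summable has_sum_infsum top_greatest)
qed

lemma pmf_summable [simp]: "pmf p summable_on UNIV"
  and infsum_pmf [simp]: "(\<Sum>\<^sub>\<infinity>x. pmf p x) = 1"
  using pmf_has_sum[of p] by (auto simp: has_sum_iff)

lemma summable_on_prod:
  fixes f :: "'a \<Rightarrow> real" and g :: "'b \<Rightarrow> real"
  assumes "f summable_on UNIV" "g summable_on UNIV"
  shows "(\<lambda>(x, y). f x * g y) summable_on UNIV"
proof -
  have f: "(\<lambda>x. \<bar>f x\<bar>) summable_on UNIV" and g: "(\<lambda>x. \<bar>g x\<bar>) summable_on UNIV"
    using assms summable_on_iff_abs_summable_on_real by fastforce+
  have "(\<lambda>(x, y). \<bar>f x\<bar> * \<bar>g y\<bar>) summable_on (UNIV \<times> UNIV)"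
  proof (rule summable_on_SigmaI[where g="\<lambda>x. \<bar>f x\<bar> * (\<Sum>\<^sub>\<infinity>y. \<bar>g y\<bar>)"])
    show "((\<lambda>y. case (x, y) of (x, y) \<Rightarrow> \<bar>f x\<bar> * \<bar>g y\<bar>) has_sum \<bar>f x\<bar> * (\<Sum>\<^sub>\<infinity>y. \<bar>g y\<bar>)) UNIV" for x
      unfolding prod.case by (intro has_sum_cmult_right has_sum_infsum g)
    show "(\<lambda>x. \<bar>f x\<bar> * (\<Sum>\<^sub>\<infinity>y. \<bar>g y\<bar>)) summable_on UNIV"
      by (intro summable_on_cmult_left f)
  qed auto
  from summable_on_abs_le[OF this, of "\<lambda>(x, y). f x * g y"] show ?thesis
    by (auto simp: abs_mult)
qed

lemma infsum_prod_dom: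
  fixes f :: "'a \<Rightarrow> 'b \<Rightarrow> real"
  assumes "g summable_on UNIV" "h summable_on UNIV" "\<And>x y. \<bar>f x y\<bar> \<le> g x * h y"
  shows "(\<lambda>(x, y). f x y) summable_on UNIV"
    and "(\<Sum>\<^sub>\<infinity>(x, y). f x y) = (\<Sum>\<^sub>\<infinity>x. \<Sum>\<^sub>\<infinity>y. f x y)"
    and "(\<Sum>\<^sub>\<infinity>(x, y). f x y) = (\<Sum>\<^sub>\<infinity>y. \<Sum>\<^sub>\<infinity>x. f x y)"
proof -
  show *: "(\<lambda>(x, y). f x y) summable_on UNIV"
    by (rule summable_on_abs_le[OF summable_on_prod[OF assms(1,2)]]) (use assms(3) in auto)
  show 1: "(\<Sum>\<^sub>\<infinity>(x, y). f x y) = (\<Sum>\<^sub>\<infinity>x. \<Sum>\<^sub>\<infinity>y. f x y)"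
    using infsum_Sigma'_banach[of f UNIV "\<lambda>_. UNIV"] * by simp
  show "(\<Sum>\<^sub>\<infinity>(x, y). f x y) = (\<Sum>\<^sub>\<infinity>y. \<Sum>\<^sub>\<infinity>x. f x y)"
    unfolding 1 by (rule infsum_swap_banach) (use * in simp)
qed

text \<open>The limit is uniform in \<open>i\<close> and comes with its rate, the tail of a
  geometric series. It serves twice: for the logarithms of the Sinkhorn iterates and for the Neumann
  series of the linearized system.\<close>

lemma geometric_limit:
  fixes f :: "nat \<Rightarrow> 'i \<Rightarrow> real"
  assumes q: "0 \<le> q" "q < 1" and f: "\<And>n i. \<bar>f (Suc n) i - f n i\<bar> \<le> C * q ^ n"
  obtains g where "\<And>n i. \<bar>g i - f n i\<bar> \<le> C / (1 - q) * q ^ n"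
proof -
  have *: "\<bar>f (n + k) i - f n i\<bar> \<le> C * q ^ n * (1 - q ^ k) / (1 - q)" for n k i
  proof (induction k)
    case (Suc k)
    have "\<bar>f (n + Suc k) i - f n i\<bar> \<le> C * q ^ n * (1 - q ^ k) / (1 - q) + C * q ^ (n + k)"
      using Suc f[of "n + k" i] unfolding add_Suc_right by linarith
    also have "\<dots> = C * q ^ n * (1 - q ^ Suc k) / (1 - q)"
      using q by (simp add: field_simps power_add)
    finally show ?case .
  qed auto
  have C: "C \<ge> 0" using order_trans[OF abs_ge_zero f[of 0 undefined]] by simp
  have lim0: "(\<lambda>n. C / (1 - q) * q ^ n) \<longlonglongrightarrow> 0"
    using q by (intro tendsto_mult_right_zero LIMSEQ_power_zero) auto
  have bd: "\<bar>f m i - f n i\<bar> \<le> C / (1 - q) * q ^ n" if "n \<le> m" for n m i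
  proof -
    obtain k where m: "m = n + k" using le_Suc_ex \<open>n \<le> m\<close> by blast
    have "C * q ^ n * (1 - q ^ k) / (1 - q) \<le> C * q ^ n * 1 / (1 - q)"
      using q C by (intro divide_right_mono mult_left_mono) auto
    with *[of n k i] show ?thesis by (simp add: m)
  qed
  have "Cauchy (\<lambda>n. f n i)" for i
  proof (rule CauchyI')
    fix e :: real assume "e > 0"
    then obtain N where N: "\<And>n. n \<ge> N \<Longrightarrow> \<bar>C / (1 - q) * q ^ n\<bar> < e"
      using LIMSEQ_D[OF lim0] by force
    show "\<exists>M. \<forall>m\<ge>M. \<forall>n>m. dist (f m i) (f n i) < e"
    proof (intro exI allI impI)
      fix m n assume "m \<ge> N" "n > m"
      then show "dist (f m i) (f n i) < e"
        using le_less_trans[OF order_trans[OF bd[of m n i] abs_ge_self] N[of m]]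
        by (simp add: dist_real_def abs_minus_commute)
    qed
  qed
  then have lim: "(\<lambda>n. f n i) \<longlonglongrightarrow> lim (\<lambda>n. f n i)" for i
    by (simp add: Cauchy_convergent_iff convergent_LIMSEQ_iff)
  have "\<bar>lim (\<lambda>n. f n i) - f n i\<bar> \<le> C / (1 - q) * q ^ n" for n i
  proof (rule tendsto_upperbound)
    show "(\<lambda>m. \<bar>f m i - f n i\<bar>) \<longlonglongrightarrow> \<bar>lim (\<lambda>n. f n i) - f n i\<bar>"
      by (intro tendsto_intros lim)
    show "\<forall>\<^sub>F m in sequentially. \<bar>f m i - f n i\<bar> \<le> C / (1 - q) * q ^ n"
      by (rule eventually_sequentiallyI[of n]) (rule bd)
  qed simp
  then show thesis by (rule that)
qed

section \<open>The Schroedinger system\<close>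

text \<open>The lower bound may degenerate in \<open>y\<close> but not in \<open>x\<close>: two
  entries of \<open>K\<close> in the same column differ at most by the factor
  \<open>B * \<phi> y\<close>. This makes potentials in \<open>x\<close> bounded and leaves the
  growth \<open>\<phi>\<close> to those in \<open>y\<close>.\<close>

locale bounded_kernel =
  fixes K :: "'x \<Rightarrow> 'y \<Rightarrow> real" and B :: real and \<phi> :: "'y \<Rightarrow> real"
    and r :: "'x pmf" and s :: "'y pmf"
  assumes K_le: "\<And>x y. K x y \<le> 1" and K_ge: "\<And>x y. 1 / (B * \<phi> y) \<le> K x y"
    and \<phi>_ge: "\<And>y. \<phi> y \<ge> 1" and B_ge: "B \<ge> 1"
    and \<phi>_sum: "(\<lambda>y. \<phi> y * pmf s y) summable_on UNIV"
begin

lemma \<phi>_pos: "\<phi> y > 0" using \<phi>_ge[of y] by linarith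
lemma B_pos: "B > 0" using B_ge by linarith
lemma K_pos: "K x y > 0"
  using K_ge[where x=x and y=y] \<phi>_pos[of y] B_pos by (meson divide_pos_pos less_le_trans mult_pos_pos zero_less_one)
lemma K_nonneg: "K x y \<ge> 0" using K_pos[of x y] by linarith

definition positive_bounded :: "('x \<Rightarrow> real) \<Rightarrow> bool" where
  "positive_bounded u \<longleftrightarrow> (\<exists>m M. 0 < m \<and> (\<forall>x. m \<le> u x \<and> u x \<le> M))"

definition mass :: "('x \<Rightarrow> real) \<Rightarrow> real" where "mass u = (\<Sum>\<^sub>\<infinity>x. u x * pmf r x)"
definition \<Phi> :: real where "\<Phi> = (\<Sum>\<^sub>\<infinity>y. \<phi> y * pmf s y)"
definition \<Psi> :: real where "\<Psi> = (\<Sum>\<^sub>\<infinity>y. pmf s y / \<phi> y)"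

text \<open>The half steps of Sinkhorn's iteration, each enforcing one marginal. \<open>upot\<close>
  already contains the \<open>y\<close> half step, so it acts on functions of \<open>x\<close>
  alone, and its fixed points \<open>u\<close>, paired with \<open>vpot u\<close>, solve the
  Schroedinger system.\<close>

definition vpot :: "('x \<Rightarrow> real) \<Rightarrow> 'y \<Rightarrow> real" where
  "vpot u y = 1 / (\<Sum>\<^sub>\<infinity>x. K x y * u x * pmf r x)"
definition upot :: "('x \<Rightarrow> real) \<Rightarrow> 'x \<Rightarrow> real" where
  "upot u x = 1 / (\<Sum>\<^sub>\<infinity>y. K x y * vpot u y * pmf s y)"

lemma psi_sum: "(\<lambda>y. pmf s y / \<phi> y) summable_on UNIV"
proof (rule summable_on_abs_le[OF pmf_summable[of s]])
  show "\<bar>pmf s y / \<phi> y\<bar> \<le> pmf s y" for y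
    using \<phi>_ge[of y] mult_left_mono[of 1 "\<phi> y" "pmf s y"] by (simp add: divide_le_eq)
qed

lemma \<Phi>_ge: "\<Phi> \<ge> 1"
proof -
  have "(\<Sum>\<^sub>\<infinity>y. pmf s y) \<le> \<Phi>" unfolding \<Phi>_def
    by (rule infsum_mono[OF pmf_summable \<phi>_sum])
       (use \<phi>_ge mult_right_mono[of 1 _ "pmf s _"] in auto)
  then show ?thesis by simp
qed

lemma \<Psi>_le: "\<Psi> \<le> 1"
proof -
  have "\<Psi> \<le> (\<Sum>\<^sub>\<infinity>y. pmf s y)" unfolding \<Psi>_def
  proof (rule infsum_mono[OF psi_sum pmf_summable])
    show "pmf s y / \<phi> y \<le> pmf s y" for y
      using \<phi>_ge[of y] mult_left_mono[of 1 "\<phi> y" "pmf s y"] by (simp add: divide_le_eq)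
  qed
  then show ?thesis by simp
qed

lemma infsum_pos:
  fixes f :: "'a \<Rightarrow> real"
  assumes "f summable_on UNIV" "\<And>x. f x \<ge> 0" "f z > 0"
  shows "infsum f UNIV > 0"
proof -
  have "infsum f {z} \<le> infsum f UNIV" by (rule infsum_mono2) (use assms in auto)
  with assms(3) show ?thesis by simp
qed

lemma \<Psi>_pos: "\<Psi> > 0"
proof -
  obtain y where y: "y \<in> set_pmf s" using set_pmf_not_empty by fast
  show ?thesis unfolding \<Psi>_def
    by (rule infsum_pos[where z=y, OF psi_sum])
       (use y \<phi>_pos in \<open>auto simp: pmf_positive less_imp_le\<close>)
qed

lemma pb_sum:
  assumes "positive_bounded u"
  shows "(\<lambda>x. u x * pmf r x) summable_on UNIV" "(\<lambda>x. K x y * u x * pmf r x) summable_on UNIV"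
    "mass u > 0" "u x > 0"
proof -
  obtain m M where m: "0 < m" "\<And>x. m \<le> u x" "\<And>x. u x \<le> M"
    using assms by (auto simp: positive_bounded_def)
  have u0: "u x \<ge> 0" for x using m(1) m(2)[of x] by linarith
  have s: "(\<lambda>x. M * pmf r x) summable_on UNIV" by (intro summable_on_cmult_right pmf_summable)
  show 1: "(\<lambda>x. u x * pmf r x) summable_on UNIV"
    by (rule summable_on_abs_le[OF s]) (auto simp: abs_mult u0 intro!: mult_right_mono m)
  show "(\<lambda>x. K x y * u x * pmf r x) summable_on UNIV"
  proof (rule summable_on_abs_le[OF 1])
    show "\<bar>K x y * u x * pmf r x\<bar> \<le> u x * pmf r x" for x
      using mult_right_mono[OF K_le[of x y], of "u x * pmf r x"] u0[of x]  K_nonneg[of x y]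
      by (simp add: abs_mult mult.assoc)
  qed
  have "(\<Sum>\<^sub>\<infinity>x. m * pmf r x) \<le> mass u" unfolding mass_def
    by (rule infsum_mono[OF _ 1]) (auto intro!: mult_right_mono m summable_on_cmult_right)
  with m(1) show "mass u > 0" by (simp add: infsum_cmult_right')
  show "u x > 0" using m(1) m(2)[of x] by linarith
qed

lemma Kur_bounds:
  assumes "positive_bounded u"
  shows "mass u / (B * \<phi> y) \<le> (\<Sum>\<^sub>\<infinity>x. K x y * u x * pmf r x)"
    "(\<Sum>\<^sub>\<infinity>x. K x y * u x * pmf r x) \<le> mass u"
proof -
  note s = pb_sum[OF assms]
  have "(\<Sum>\<^sub>\<infinity>x. 1 / (B * \<phi> y) * (u x * pmf r x)) \<le> (\<Sum>\<^sub>\<infinity>x. K x y * u x * pmf r x)"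
    unfolding mult.assoc[of "K _ _"]
    by (intro infsum_mono summable_on_cmult_right s mult_right_mono K_ge)
       (use s(2)[of y] less_imp_le[OF s(4)] in \<open>auto simp: mult.assoc\<close>)
  then show "mass u / (B * \<phi> y) \<le> (\<Sum>\<^sub>\<infinity>x. K x y * u x * pmf r x)"
    unfolding infsum_cmult_right' mass_def by simp
  show "(\<Sum>\<^sub>\<infinity>x. K x y * u x * pmf r x) \<le> mass u"
    unfolding mass_def
  proof (rule infsum_mono[OF s(2) s(1)])
    show "K x y * u x * pmf r x \<le> u x * pmf r x" for x
      using mult_right_mono[OF K_le[of x y], of "u x * pmf r x"] s(4)[of x]
      by (simp add: mult.assoc)
  qed
qed

lemma vpot_bounds:
  assumes "positive_bounded u"
  shows "1 / mass u \<le> vpot u y" "vpot u y \<le> B * \<phi> y / mass u" "vpot u y > 0"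
proof -
  note k = Kur_bounds[OF assms, of y] and U = pb_sum(3)[OF assms]
  have p: "0 < mass u / (B * \<phi> y)" using U B_pos \<phi>_pos by simp
  then have q: "0 < (\<Sum>\<^sub>\<infinity>x. K x y * u x * pmf r x)" using k(1) by linarith
  then show "vpot u y > 0" by (simp add: vpot_def)
  show "1 / mass u \<le> vpot u y" unfolding vpot_def
    by (rule divide_left_mono[OF k(2)]) (use U q in simp_all)
  have "vpot u y \<le> 1 / (mass u / (B * \<phi> y))" unfolding vpot_def
    by (rule divide_left_mono[OF k(1) zero_le_one mult_pos_pos[OF q p]])
  then show "vpot u y \<le> B * \<phi> y / mass u" by simp
qed

lemma KVs_bounds:
  assumes "positive_bounded u"
  shows "(\<lambda>y. K x y * vpot u y * pmf s y) summable_on UNIV"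
    "\<Psi> / (B * mass u) \<le> (\<Sum>\<^sub>\<infinity>y. K x y * vpot u y * pmf s y)"
    "(\<Sum>\<^sub>\<infinity>y. K x y * vpot u y * pmf s y) \<le> B * \<Phi> / mass u"
    "(1 / (B * mass u)) * (pmf s y / \<phi> y) \<le> K x y * vpot u y * pmf s y"
    "K x y * vpot u y * pmf s y \<le> (B / mass u) * (\<phi> y * pmf s y)"
proof -
  note v = vpot_bounds[OF assms] and U = pb_sum(3)[OF assms]
  have ub: "K x y * vpot u y * pmf s y \<le> (B / mass u) * (\<phi> y * pmf s y)" for y
    using mult_mono[OF K_le[of x y] v(2)[of y]] v(3)[of y] mult_right_mono[of _ _ "pmf s y"]
    by (fastforce simp: mult_ac)
  have lb: "(1 / (B * mass u)) * (pmf s y / \<phi> y) \<le> K x y * vpot u y * pmf s y" for y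
  proof -
    have "1 / (B * \<phi> y) * (1 / mass u) \<le> K x y * vpot u y"
      by (rule mult_mono[OF K_ge v(1)]) (use K_nonneg U in auto)
    from mult_right_mono[OF this, of "pmf s y"] show ?thesis by (simp add: mult_ac)
  qed
  show sm: "(\<lambda>y. K x y * vpot u y * pmf s y) summable_on UNIV"
    by (rule summable_on_abs_le[OF summable_on_cmult_right[OF \<phi>_sum, of "B / mass u"]])
       (use ub v(3) K_nonneg in \<open>simp add: abs_mult less_imp_le\<close>)
  show "K x y * vpot u y * pmf s y \<le> (B / mass u) * (\<phi> y * pmf s y)"
    "(1 / (B * mass u)) * (pmf s y / \<phi> y) \<le> K x y * vpot u y * pmf s y" by fact+
  have "(\<Sum>\<^sub>\<infinity>y. K x y * vpot u y * pmf s y) \<le> (\<Sum>\<^sub>\<infinity>y. (B / mass u) * (\<phi> y * pmf s y))"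
    by (rule infsum_mono[OF sm summable_on_cmult_right[OF \<phi>_sum] ub])
  then show "(\<Sum>\<^sub>\<infinity>y. K x y * vpot u y * pmf s y) \<le> B * \<Phi> / mass u"
    by (simp only: infsum_cmult_right' \<Phi>_def) simp
  have "(\<Sum>\<^sub>\<infinity>y. (1 / (B * mass u)) * (pmf s y / \<phi> y)) \<le> (\<Sum>\<^sub>\<infinity>y. K x y * vpot u y * pmf s y)"
    by (rule infsum_mono[OF summable_on_cmult_right[OF psi_sum] sm lb])
  then show "\<Psi> / (B * mass u) \<le> (\<Sum>\<^sub>\<infinity>y. K x y * vpot u y * pmf s y)"
    unfolding infsum_cmult_right' \<Psi>_def by simp
qed

text \<open>Both bounds see \<open>u\<close> only through its mass. Hence one Sinkhorn step brings
  the ratio of supremum and infimum of any admissible \<open>u\<close> below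
  \<open>B\<^sup>2 * \<Phi> / \<Psi>\<close>, and a normalized fixed point has explicit
  bounds.\<close>

lemma upot_bounds:
  assumes "positive_bounded u"
  shows "mass u / (B * \<Phi>) \<le> upot u x" "upot u x \<le> B * mass u / \<Psi>" "upot u x > 0"
    "(\<Sum>\<^sub>\<infinity>y. K x y * vpot u y * pmf s y) > 0"
proof -
  note k = KVs_bounds[OF assms, where x=x] and U = pb_sum(3)[OF assms]
  have p: "0 < \<Psi> / (B * mass u)" using U B_pos \<Psi>_pos by simp
  then show q: "0 < (\<Sum>\<^sub>\<infinity>y. K x y * vpot u y * pmf s y)" using k(2) by linarith
  then show "upot u x > 0" by (simp add: upot_def)
  have "1 / (B * \<Phi> / mass u) \<le> upot u x" unfolding upot_def
    by (rule divide_left_mono[OF k(3)]) (use U q \<Phi>_ge B_pos in simp_all)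
  then show "mass u / (B * \<Phi>) \<le> upot u x" by simp
  have "upot u x \<le> 1 / (\<Psi> / (B * mass u))" unfolding upot_def
    by (rule divide_left_mono[OF k(2) zero_le_one mult_pos_pos[OF q p]])
  then show "upot u x \<le> B * mass u / \<Psi>" by simp
qed

lemma pb_upot: "positive_bounded u \<Longrightarrow> positive_bounded (upot u)"
  unfolding positive_bounded_def[of "upot u"]
  using upot_bounds(1,2) pb_sum(3) B_pos \<Phi>_ge
  by (intro exI[of _ "mass u / (B * \<Phi>)"] exI[of _ "B * mass u / \<Psi>"]) auto

text \<open>The double sum of \<open>u x * K x y * vpot u y\<close> against both marginals is
  \<open>1\<close>, since \<open>vpot u\<close> normalizes the columns; summing in the other order
  gives the claim. It fixes the scale: \<open>u / upot u\<close> averages to \<open>1\<close> under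
  \<open>r\<close>, so its infimum is at most \<open>1\<close> and its supremum at least
  \<open>1\<close>.\<close>

lemma mass_identity:
  assumes "positive_bounded u"
  shows "((\<lambda>x. u x / upot u x * pmf r x) has_sum 1) UNIV"
proof -
  note s = pb_sum[OF assms] and v = vpot_bounds[OF assms] and k = KVs_bounds[OF assms]
  let ?f = "\<lambda>x y. u x * pmf r x * (K x y * vpot u y * pmf s y)"
  have dom: "\<bar>?f x y\<bar> \<le> (u x * pmf r x) * (B / mass u * (\<phi> y * pmf s y))" for x y
    using k(5)[of x y] less_imp_le[OF s(4)[of x]] K_nonneg[of x y] less_imp_le[OF v(3)[of y]]
    using mult_left_mono[of "K x y * vpot u y * pmf s y" "B / mass u * (\<phi> y * pmf s y)" "u x * pmf r x"]
    by (simp add: abs_mult)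
  note fub = infsum_prod_dom[OF s(1) summable_on_cmult_right[OF \<phi>_sum] dom]
  have x: "(\<Sum>\<^sub>\<infinity>y. ?f x y) = u x / upot u x * pmf r x" for x
    by (simp add: infsum_cmult_right' upot_def)
  have y: "(\<Sum>\<^sub>\<infinity>x. ?f x y) = pmf s y" for y
  proof -
    have "(\<Sum>\<^sub>\<infinity>x. ?f x y) = (\<Sum>\<^sub>\<infinity>x. (vpot u y * pmf s y) * (K x y * u x * pmf r x))"
      by (rule infsum_cong) (simp add: mult_ac)
    also have "\<dots> = vpot u y * pmf s y * (1 / vpot u y)"
      unfolding infsum_cmult_right' by (simp add: vpot_def)
    finally show ?thesis using v(3)[of y] by simp
  qed
  have "(\<lambda>x. \<Sum>\<^sub>\<infinity>y. ?f x y) summable_on UNIV"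
    using summable_on_Sigma_banach[of ?f UNIV "\<lambda>_. UNIV"] fub(1) by simp
  moreover have "(\<Sum>\<^sub>\<infinity>x. \<Sum>\<^sub>\<infinity>y. ?f x y) = 1"
    using fub(2,3) by (simp add: y)
  ultimately show ?thesis unfolding x by (simp add: has_sum_iff)
qed

text \<open>The half steps reverse order and are homogeneous of degree \<open>-1\<close>. Two of
  them therefore preserve order and ratios, which is what \<open>upot_ratio\<close> records.\<close>

lemma vpot_ratio:
  assumes u: "positive_bounded u" "positive_bounded u'" and m: "m > 0"
    and "\<And>x. m * u x \<le> u' x"
  shows "vpot u' y \<le> vpot u y / m"
proof -
  have "m * (\<Sum>\<^sub>\<infinity>x. K x y * u x * pmf r x) \<le> (\<Sum>\<^sub>\<infinity>x. K x y * u' x * pmf r x)"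
    unfolding infsum_cmult_right'[symmetric]
  proof (rule infsum_mono[OF summable_on_cmult_right[OF pb_sum(2)[OF u(1)]] pb_sum(2)[OF u(2)]])
    show "m * (K x y * u x * pmf r x) \<le> K x y * u' x * pmf r x" for x
      using mult_left_mono[OF assms(4)[of x], of "K x y * pmf r x"] K_nonneg[of x y]
      by (simp add: mult_ac)
  qed
  moreover have "(\<Sum>\<^sub>\<infinity>x. K x y * u x * pmf r x) > 0" "(\<Sum>\<^sub>\<infinity>x. K x y * u' x * pmf r x) > 0"
    using vpot_bounds(3)[OF u(1), of y] vpot_bounds(3)[OF u(2), of y] by (auto simp: vpot_def)
  ultimately show ?thesis using m by (simp add: vpot_def field_simps)
qed

lemma upot_ratio:
  assumes u: "positive_bounded u" "positive_bounded u'" and m: "m > 0"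
    and "\<And>x. m * u x \<le> u' x"
  shows "m * upot u x \<le> upot u' x"
proof -
  have "(\<Sum>\<^sub>\<infinity>y. K x y * vpot u' y * pmf s y) \<le> (1 / m) * (\<Sum>\<^sub>\<infinity>y. K x y * vpot u y * pmf s y)"
    unfolding infsum_cmult_right'[symmetric]
  proof (rule infsum_mono[OF KVs_bounds(1)[OF u(2)] summable_on_cmult_right[OF KVs_bounds(1)[OF u(1)]]])
    show "K x y * vpot u' y * pmf s y \<le> (1 / m) * (K x y * vpot u y * pmf s y)" for y
      using mult_left_mono[OF vpot_ratio[OF assms, of y], of "K x y * pmf s y"] K_nonneg[of x y]
      by (simp add: mult_ac)
  qed
  then show ?thesis
    using upot_bounds(4)[OF u(1), of x] upot_bounds(4)[OF u(2), of x] m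
    by (simp add: upot_def field_simps)
qed

text \<open>The Doeblin constant of the Sinkhorn step: every row
  \<open>K x y * vpot u y * pmf s y\<close>, divided by its sum, dominates
  \<open>pmf s y / (B\<^sup>2 * \<Phi> * \<phi> y)\<close>, a measure independent of
  \<open>x\<close> with total mass \<open>\<eta>\<close>.\<close>

definition \<eta> :: real where "\<eta> = \<Psi> / (B\<^sup>2 * \<Phi>)"

lemma \<eta>_pos: "\<eta> > 0" using \<Psi>_pos B_pos \<Phi>_ge by (simp add: \<eta>_def)
lemma \<eta>_le: "\<eta> \<le> 1"
proof -
  have "1 * 1 \<le> B\<^sup>2 * \<Phi>" by (rule mult_mono) (use B_ge \<Phi>_ge in auto)
  then show ?thesis using \<Psi>_le by (simp add: \<eta>_def divide_le_eq)
qed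

text \<open>Hilbert's projective metric without logarithms: the distance of \<open>u\<close> and
  \<open>upot u\<close> is at most \<open>ln R\<close>. The scale \<open>m\<close> stays free
  because the contraction argument compares functions only up to constant factors.\<close>

definition osc :: "real \<Rightarrow> ('x \<Rightarrow> real) \<Rightarrow> bool" where
  "osc R u \<longleftrightarrow> (\<exists>m>0. \<forall>x. m * u x \<le> upot u x \<and> upot u x \<le> m * R * u x)"

text \<open>Birkhoff's contraction of the projective metric, in the elementary form given by the
  minorization \<open>K V s \<ge> \<epsilon> s / \<phi>\<close>, which is uniform in the first variable.\<close>

lemma osc_contract:
  assumes u: "positive_bounded u" and R: "R \<ge> 1" and o: "osc R u"
  shows "osc ((1 - \<eta>) * R + \<eta>) (upot u)"
proof -
  obtain m where m: "m > 0" "\<And>x. m * u x \<le> upot u x" "\<And>x. upot u x \<le> m * R * u x"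
    using o by (auto simp: osc_def)
  define M where "M = m * R"
  have M: "M > 0" using m R by (simp add: M_def)
  let ?u' = "upot u"
  have u': "positive_bounded ?u'" by (rule pb_upot[OF u])
  \<comment> \<open>\<open>\<theta>\<close> compares the new \<open>y\<close> potential with the old
    one. It takes values in \<open>[1/M, 1/m]\<close>, whose endpoints have the ratio
    \<open>R\<close> of the given oscillation.\<close>
  define \<theta> where "\<theta> y = vpot ?u' y / vpot u y" for y
  note v = vpot_bounds(3)[OF u] and v' = vpot_bounds(3)[OF u']
  have th_le: "\<theta> y \<le> 1 / m" for y
    using vpot_ratio[OF u u' m(1,2), of y] v[of y] m(1) by (simp add: \<theta>_def field_simps)
  have th_ge: "1 / M \<le> \<theta> y" for y
  proof -
    have "(1 / M) * ?u' x \<le> u x" for x using m(3)[of x] M by (simp add: M_def field_simps)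
    from vpot_ratio[OF u' u _ this, of y] show ?thesis using M v[of y] by (simp add: \<theta>_def field_simps)
  qed
  have th0: "\<theta> y \<ge> 0" for y using th_ge[of y] M by (meson divide_nonneg_pos order_trans zero_le_one)
  define \<epsilon> where "\<epsilon> = 1 / (B\<^sup>2 * \<Phi>)"
  have eps: "\<epsilon> > 0" "\<epsilon> * \<Psi> = \<eta>" using B_pos \<Phi>_ge by (auto simp: \<epsilon>_def \<eta>_def)
  define W where "W = (\<Sum>\<^sub>\<infinity>y. pmf s y / \<phi> y * \<theta> y)"
  have Wsum: "(\<lambda>y. pmf s y / \<phi> y * \<theta> y) summable_on UNIV"
    by (rule summable_on_abs_le[OF summable_on_cmult_right[OF psi_sum, of "1 / m"]])
       (use mult_right_mono[OF th_le, of "pmf s _ / \<phi> _"] \<phi>_pos th0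
         in \<open>simp add: abs_mult less_imp_le mult.commute\<close>)
  have "(\<Sum>\<^sub>\<infinity>y. (1 / M) * (pmf s y / \<phi> y)) \<le> W" unfolding W_def
    by (rule infsum_mono[OF summable_on_cmult_right[OF psi_sum] Wsum])
       (use mult_right_mono[OF th_ge, of "pmf s _ / \<phi> _"] \<phi>_pos in \<open>simp add: less_imp_le mult.commute\<close>)
  then have W: "\<Psi> / M \<le> W" by (simp only: infsum_cmult_right' \<Psi>_def) simp
  define l where "l = (1 - \<eta>) / M + \<epsilon> * W"
  define h where "h = (1 - \<eta>) / m + \<epsilon> * W"
  define D where "D x = (\<Sum>\<^sub>\<infinity>y. K x y * vpot u y * pmf s y)" for x
  define D' where "D' x = (\<Sum>\<^sub>\<infinity>y. K x y * vpot ?u' y * pmf s y)" for x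
  have Dpos: "D x > 0" "D' x > 0" for x
    using upot_bounds(4)[OF u] upot_bounds(4)[OF u'] by (auto simp: D_def D'_def)
  have l_pos: "l > 0"
  proof -
    have "\<epsilon> * W > 0" using eps W M \<Psi>_pos by (meson divide_pos_pos less_le_trans mult_pos_pos)
    moreover have "(1 - \<eta>) / M \<ge> 0" using \<eta>_le M by simp
    ultimately show ?thesis by (simp add: l_def)
  qed
  have bounds: "l * D x \<le> D' x \<and> D' x \<le> h * D x" for x
  proof -
    define p where "p y = K x y * vpot u y * pmf s y" for y
    have psum: "p summable_on UNIV" unfolding p_def by (rule KVs_bounds(1)[OF u])
    have p_ge: "D x * \<epsilon> * (pmf s y / \<phi> y) \<le> p y" for y
    proof -
      have "D x * \<epsilon> \<le> (B * \<Phi> / mass u) * \<epsilon>"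
        using KVs_bounds(3)[OF u, of x] eps by (intro mult_right_mono) (auto simp: D_def)
      also have "\<dots> = 1 / (B * mass u)"
        using B_pos \<Phi>_ge by (simp add: \<epsilon>_def field_simps power2_eq_square)
      finally have "D x * \<epsilon> * (pmf s y / \<phi> y) \<le> 1 / (B * mass u) * (pmf s y / \<phi> y)"
        using \<phi>_pos[of y] by (intro mult_right_mono) (auto simp: less_imp_le)
      also have "\<dots> \<le> p y" unfolding p_def by (rule KVs_bounds(4)[OF u])
      finally show ?thesis .
    qed
    \<comment> \<open>Each row is split into a part of the same shape for all \<open>x\<close>,
      namely \<open>D x * \<epsilon> * (pmf s y / \<phi> y)\<close>, and a nonnegative rest
      \<open>g\<close>. The first part averages \<open>\<theta>\<close> to a number proportional to
      \<open>W\<close> for every \<open>x\<close>, so only the rest, of relative mass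
      \<open>1 - \<eta>\<close>, can make \<open>D' / D\<close> vary.\<close>
    define g where "g y = p y - D x * \<epsilon> * (pmf s y / \<phi> y)" for y
    have g0: "g y \<ge> 0" for y using p_ge[of y] by (simp add: g_def)
    have gsum: "g summable_on UNIV" unfolding g_def
      by (intro summable_on_diff_real psum summable_on_cmult_right psi_sum)
    have gD: "infsum g UNIV = D x * (1 - \<eta>)"
    proof -
      have "infsum g UNIV = infsum p UNIV - D x * \<epsilon> * \<Psi>" unfolding g_def
        unfolding \<Psi>_def infsum_cmult_right'[symmetric]
        by (intro infsum_diff_real psum summable_on_cmult_right psi_sum)
      moreover have "infsum p UNIV = D x" unfolding D_def p_def[abs_def] ..
      moreover have "D x * \<epsilon> * \<Psi> = D x * \<eta>" unfolding eps(2)[symmetric] by simp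
      ultimately show ?thesis by (simp add: right_diff_distrib)
    qed
    have gth: "(\<lambda>y. g y * \<theta> y) summable_on UNIV"
      by (rule summable_on_abs_le[OF summable_on_cmult_left[OF gsum, of "1 / m"]])
         (use g0 th0 mult_left_mono[OF th_le g0] in \<open>simp add: abs_mult\<close>)
    have "D' x = (\<Sum>\<^sub>\<infinity>y. g y * \<theta> y + D x * \<epsilon> * (pmf s y / \<phi> y * \<theta> y))" unfolding D'_def
      by (rule infsum_cong) (use v in \<open>simp add: g_def p_def \<theta>_def field_simps less_imp_neq[symmetric]\<close>)
    also have "\<dots> = (\<Sum>\<^sub>\<infinity>y. g y * \<theta> y) + D x * \<epsilon> * W"
      unfolding W_def infsum_cmult_right'[symmetric]
      by (intro infsum_add gth summable_on_cmult_right Wsum)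
    finally have D': "D' x = (\<Sum>\<^sub>\<infinity>y. g y * \<theta> y) + D x * \<epsilon> * W" .
    have "(\<Sum>\<^sub>\<infinity>y. g y * \<theta> y) \<le> (\<Sum>\<^sub>\<infinity>y. g y * (1 / m))"
      by (intro infsum_mono gth summable_on_cmult_left gsum mult_left_mono th_le g0)
    moreover have "(\<Sum>\<^sub>\<infinity>y. g y * (1 / M)) \<le> (\<Sum>\<^sub>\<infinity>y. g y * \<theta> y)"
      by (intro infsum_mono gth summable_on_cmult_left gsum mult_left_mono th_ge g0)
    ultimately show ?thesis unfolding D' infsum_cmult_left' gD l_def h_def
      by (auto simp: algebra_simps diff_divide_distrib)
  qed
  \<comment> \<open>The difference of the two sides factors, and the claim amounts to
    \<open>\<eta> / M \<le> \<epsilon> * W\<close>, which is the lower bound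
    \<open>\<Psi> / M \<le> W\<close> multiplied by \<open>\<epsilon>\<close>.\<close>
  have h_le: "h \<le> ((1 - \<eta>) * R + \<eta>) * l"
  proof -
    have mM: "1 / m = R * (1 / M)" using m(1) R by (simp add: M_def)
    have h: "h = (1 - \<eta>) * R * (1 / M) + \<epsilon> * W"
      unfolding h_def divide_inverse using mM by (simp add: divide_inverse)
    have l: "l = (1 - \<eta>) * (1 / M) + \<epsilon> * W" by (simp add: l_def)
    have "h - ((1 - \<eta>) * R + \<eta>) * l = (1 - \<eta>) * (R - 1) * (\<eta> * (1 / M) - \<epsilon> * W)"
      unfolding h l by (simp add: algebra_simps)
    moreover have "\<eta> * (1 / M) \<le> \<epsilon> * W"
      using mult_left_mono[OF W, of \<epsilon>] eps by simp
    ultimately show ?thesis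
      using R \<eta>_le mult_nonneg_nonpos[of "(1 - \<eta>) * (R - 1)" "\<eta> * (1 / M) - \<epsilon> * W"] by simp
  qed
  have h_pos: "h > 0"
  proof (rule ccontr)
    assume "\<not> h > 0"
    then have "h * D x \<le> 0" for x using Dpos(1)[of x] by (simp add: mult_nonpos_nonneg)
    then show False using bounds[of undefined] Dpos(2)[of undefined] by (meson leD order_trans)
  qed
  have "(1 / h) * upot u x \<le> upot ?u' x \<and> upot ?u' x \<le> 1 / h * ((1 - \<eta>) * R + \<eta>) * upot u x" for x
  proof -
    have U: "upot u x = 1 / D x" "upot ?u' x = 1 / D' x" by (auto simp: upot_def D_def D'_def)
    have "1 / D' x \<le> 1 / (l * D x)"
      using bounds[of x] Dpos[of x] l_pos by (intro divide_left_mono) auto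
    also have "\<dots> \<le> 1 / h * ((1 - \<eta>) * R + \<eta>) * (1 / D x)"
      using h_le l_pos h_pos Dpos(1)[of x] by (simp add: field_simps)
    finally show ?thesis
      using bounds[of x] Dpos[of x] h_pos unfolding U by (simp add: field_simps)
  qed
  then show ?thesis using h_pos unfolding osc_def by (intro exI[of _ "1 / h"]) auto
qed

text \<open>By \<open>mass_identity\<close> the free scale satisfies
  \<open>m \<le> 1 \<le> m * R\<close>, so the projective bound becomes a bound on the logarithms
  themselves. The cruder \<open>R - 1\<close> replaces \<open>ln R\<close> because it is the
  quantity that contracts linearly.\<close>

lemma osc_step:
  assumes u: "positive_bounded u" and R: "R \<ge> 1" and o: "osc R u"
  shows "\<bar>ln (upot u x) - ln (u x)\<bar> \<le> R - 1"
proof -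
  obtain m where m: "m > 0" "\<And>x. m * u x \<le> upot u x" "\<And>x. upot u x \<le> m * R * u x"
    using o by (auto simp: osc_def)
  note up = pb_sum(4)[OF u] and Fp = upot_bounds(3)[OF u] and mi = mass_identity[OF u]
  have "(\<Sum>\<^sub>\<infinity>x. u x / upot u x * pmf r x) \<le> (\<Sum>\<^sub>\<infinity>x. 1 / m * pmf r x)"
  proof (rule infsum_mono)
    show "u x / upot u x * pmf r x \<le> 1 / m * pmf r x" for x
      using m(1) m(2)[of x] Fp[of x] by (intro mult_right_mono) (auto simp: field_simps)
  qed (use mi in \<open>auto simp only: has_sum_iff intro!: summable_on_cmult_right pmf_summable\<close>)
  then have "1 \<le> 1 / m" using mi unfolding has_sum_iff infsum_cmult_right' by simp
  then have m1: "m \<le> 1" using m(1) by (simp add: field_simps)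
  have "(\<Sum>\<^sub>\<infinity>x. 1 / (m * R) * pmf r x) \<le> (\<Sum>\<^sub>\<infinity>x. u x / upot u x * pmf r x)"
  proof (rule infsum_mono)
    show "1 / (m * R) * pmf r x \<le> u x / upot u x * pmf r x" for x
      using m(1) m(3)[of x] Fp[of x] R by (intro mult_right_mono) (auto simp: field_simps)
  qed (use mi in \<open>auto simp only: has_sum_iff intro!: summable_on_cmult_right pmf_summable\<close>)
  then have "1 / (m * R) \<le> 1" using mi unfolding has_sum_iff infsum_cmult_right' by simp
  then have mR: "1 \<le> m * R" using m(1) R by (simp add: field_simps)
  have "upot u x \<le> R * u x"
    using m(3)[of x] mult_right_mono[OF m1, of "R * u x"] R up[of x] by (simp add: mult.assoc order_trans)
  then have "ln (upot u x) \<le> ln (R * u x)" using Fp[of x] R up[of x] by simp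
  then have 1: "ln (upot u x) - ln (u x) \<le> ln R" using R up[of x] by (simp add: ln_mult)
  have "u x \<le> R * upot u x"
    using order_trans[OF mult_right_mono[OF mR, of "u x"], of "R * upot u x"]
      mult_left_mono[OF m(2)[of x], of R] R up[of x] by (simp add: mult_ac)
  then have "ln (u x) \<le> ln (R * upot u x)" using Fp[of x] R up[of x] by simp
  then have 2: "ln (u x) - ln (upot u x) \<le> ln R" using R Fp[of x] by (simp add: ln_mult)
  have "ln R \<le> R - 1" using R by (intro ln_le_minus_one) auto
  with 1 2 show ?thesis by linarith
qed

text \<open>The map \<open>R \<mapsto> (1 - \<eta>) * R + \<eta>\<close> fixes \<open>1\<close>, so
  \<open>R - 1\<close> decays geometrically along Sinkhorn's iteration and the logarithms of the
  iterates converge uniformly. Their limit is a fixed point because \<open>upot\<close> preserves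
  ratio bounds.\<close>

lemma schroedinger_fixed_point: "\<exists>u. positive_bounded u \<and> (\<forall>x. upot u x = u x)"
proof -
  define un where "un n = (upot ^^ n) (\<lambda>_. 1)" for n
  have un_Suc: "un (Suc n) = upot (un n)" for n by (simp add: un_def)
  have pb: "positive_bounded (un n)" for n
    by (induction n) (auto simp: un_Suc intro: pb_upot, auto simp: un_def positive_bounded_def intro!: exI[of _ 1])
  obtain m M where mM: "0 < m" "\<And>x. m \<le> un 1 x" "\<And>x. un 1 x \<le> M"
    using pb[of 1] by (auto simp: positive_bounded_def)
  have "m \<le> M" using mM(2)[of undefined] mM(3)[of undefined] by linarith
  define C where "C = M / m - 1"
  have C: "C \<ge> 0" using \<open>m \<le> M\<close> mM(1) by (simp add: C_def)
  define q where "q = 1 - \<eta>"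
  have q: "0 \<le> q" "q < 1" using \<eta>_pos \<eta>_le by (auto simp: q_def)
  have osc: "osc (1 + C * q ^ n) (un n)" for n
  proof (induction n)
    case 0
    have "osc (M / m) (un 0)" unfolding osc_def
      using mM by (intro exI[of _ m]) (auto simp: un_def)
    then show ?case by (simp add: C_def)
  next
    case (Suc n)
    have "osc ((1 - \<eta>) * (1 + C * q ^ n) + \<eta>) (un (Suc n))"
      unfolding un_Suc by (rule osc_contract[OF pb _ Suc]) (use C q in simp)
    moreover have "(1 - \<eta>) * (1 + C * q ^ n) + \<eta> = 1 + C * q ^ Suc n"
      by (simp add: q_def algebra_simps)
    ultimately show ?case by simp
  qed
  have step: "\<bar>ln (un (Suc n) x) - ln (un n x)\<bar> \<le> C * q ^ n" for n x
    using osc_step[OF pb _ osc, of n x] C q by (simp add: un_Suc)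
  from geometric_limit[OF q, of "\<lambda>n x. ln (un n x)", OF step]
  obtain f where f: "\<And>n x. \<bar>f x - ln (un n x)\<bar> \<le> C / (1 - q) * q ^ n" by blast
  define d where "d n = C / (1 - q) * q ^ n" for n
  have d: "d \<longlonglongrightarrow> 0" unfolding d_def
    using q by (intro tendsto_mult_right_zero LIMSEQ_power_zero) auto
  define u where "u x = exp (f x)" for x
  have pbu: "positive_bounded u"
  proof -
    have "exp (- d 0) \<le> u x \<and> u x \<le> exp (d 0)" for x
      using f[of x 0] by (simp add: u_def d_def un_def abs_le_iff)
    then show ?thesis unfolding positive_bounded_def
      by (intro exI[of _ "exp (- d 0)"] exI[of _ "exp (d 0)"]) auto
  qed
  \<comment> \<open>Uniform closeness of the logarithms, rewritten as two-sided ratio bounds, the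
    form that \<open>upot_ratio\<close> carries through the map.\<close>
  have exp_up: "exp (- d n) * un n x \<le> u x" and exp_dn: "exp (- d n) * u x \<le> un n x" for n x
  proof -
    have "un n x = exp (ln (un n x))" using pb_sum(4)[OF pb] by simp
    then show "exp (- d n) * un n x \<le> u x" "exp (- d n) * u x \<le> un n x"
      using f[of x n] by (metis (no_types) abs_le_iff d_def u_def exp_add exp_le_cancel_iff
          add.commute diff_le_eq minus_diff_eq uminus_add_conv_diff)+
  qed
  have "\<bar>ln (upot u x) - f x\<bar> \<le> d n + d (Suc n)" for n x
  proof -
    note a = upot_ratio[OF pb pbu exp_gt_zero exp_up, of n x] and b = upot_ratio[OF pbu pb exp_gt_zero exp_dn, of n x]
    note p = upot_bounds(3)[OF pbu, of x] and p' = upot_bounds(3)[OF pb, of n x]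
    have "ln (exp (- d n) * upot (un n) x) \<le> ln (upot u x)" "ln (exp (- d n) * upot u x) \<le> ln (upot (un n) x)"
      using a b p p' by simp_all
    then have "\<bar>ln (upot u x) - ln (un (Suc n) x)\<bar> \<le> d n"
      using p p' by (simp add: ln_mult un_Suc)
    with f[of x "Suc n"] show ?thesis unfolding d_def by linarith
  qed
  then have "\<bar>ln (upot u x) - f x\<bar> \<le> 0" for x
    by (intro tendsto_lowerbound[of "\<lambda>n. d n + d (Suc n)" _ sequentially])
       (use tendsto_add[OF d LIMSEQ_Suc[OF d]] in auto)
  then have "upot u x = u x" for x
    using upot_bounds(3)[OF pbu, of x] by (metis abs_le_zero_iff eq_iff_diff_eq_0 exp_ln u_def)
  with pbu show ?thesis by blast
qed

text \<open>The normalization \<open>mass u = 1\<close> makes the bounds explicit.\<close>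

lemma schroedinger_solution:
  obtains u v where "\<And>x. 1 / (B * \<Phi>) \<le> u x" "\<And>x. u x \<le> B / \<Psi>" "\<And>y. 1 \<le> v y" "\<And>y. v y \<le> B * \<phi> y"
    "\<And>x. ((\<lambda>y. K x y * u x * v y * pmf s y) has_sum 1) UNIV"
    "\<And>y. ((\<lambda>x. K x y * u x * v y * pmf r x) has_sum 1) UNIV"
proof -
  obtain w where w: "positive_bounded w" "\<And>x. upot w x = w x" using schroedinger_fixed_point by blast
  define U where "U = mass w"
  have U: "U > 0" using pb_sum(3)[OF w(1)] by (simp add: U_def)
  note wp = pb_sum[OF w(1)] and vb = vpot_bounds[OF w(1)] and ub = upot_bounds[OF w(1), unfolded w(2)]
  show thesis
  proof (rule that[of "\<lambda>x. w x / U" "\<lambda>y. U * vpot w y"])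
    show "1 / (B * \<Phi>) \<le> w x / U" "w x / U \<le> B / \<Psi>" for x
      using ub(1,2)[of x] U B_pos \<Phi>_ge \<Psi>_pos by (simp_all add: U_def field_simps)
    show "1 \<le> U * vpot w y" "U * vpot w y \<le> B * \<phi> y" for y
      using vb(1,2)[of y] U by (simp_all add: U_def field_simps)
    show "((\<lambda>y. K x y * (w x / U) * (U * vpot w y) * pmf s y) has_sum 1) UNIV" for x
    proof -
      have "((\<lambda>y. w x * (K x y * vpot w y * pmf s y)) has_sum (w x * (1 / upot w x))) UNIV"
        unfolding upot_def[of w x] by (intro has_sum_cmult_right) (simp add: KVs_bounds(1)[OF w(1)])
      then show ?thesis using U wp(4)[of x] w(2)[of x] by (simp add: mult_ac)
    qed
    show "((\<lambda>x. K x y * (w x / U) * (U * vpot w y) * pmf r x) has_sum 1) UNIV" for y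
    proof -
      have "((\<lambda>x. vpot w y * (K x y * w x * pmf r x)) has_sum (vpot w y * (1 / vpot w y))) UNIV"
        unfolding vpot_def[of w y] by (intro has_sum_cmult_right) (simp add: wp(2))
      then show ?thesis using U vb(3)[of y] by (simp add: mult_ac)
    qed
  qed
qed

end

section \<open>The plan in terms of potentials\<close>

text \<open>The logarithm lies below its tangent at \<open>1\<close> and touches it only there.
  Consequently the integrand of relative entropy, with the difference of the masses subtracted, is
  nonnegative and vanishes only where both densities agree.\<close>

lemma ln_ge_one_minus_inverse:
  assumes "t > 0" "q > 0"
  shows "t * ln (t / q) \<ge> t - (q::real)" "t * ln (t / q) = t - q \<Longrightarrow> t = q"
proof -
  have "ln (q / t) \<le> q / t - 1" using assms by (intro ln_le_minus_one) simp
  moreover have e: "ln (q / t) = - ln (t / q)" using assms by (simp add: ln_div)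
  ultimately have "t * ln (t / q) \<ge> t * (1 - q / t)" using assms by (intro mult_left_mono) auto
  moreover have f: "t * (1 - q / t) = t - q" using assms by (simp add: field_simps)
  ultimately show "t * ln (t / q) \<ge> t - q" by simp
  assume "t * ln (t / q) = t - q"
  then have "t * ln (t / q) = t * (1 - q / t)" using f by simp
  then have "ln (q / t) = q / t - 1" using assms e by simp
  then have "q / t = 1" using assms by (intro ln_eq_minus_one) auto
  then show "t = q" using assms by simp
qed

text \<open>Change of variables is applied to integrals against \<open>measure_pmf\<close>; the
  auxiliary facts \<open>i\<close> and \<open>e\<close> identify these with infinite sums, also in
  the divergent case, where both values are \<open>0\<close>.\<close>

lemma has_sum_map_pmf:
  fixes f :: "'a \<Rightarrow> real"
  shows "((\<lambda>z. f (g z) * pmf p z) summable_on UNIV) \<longleftrightarrow> (\<lambda>x. f x * pmf (map_pmf g p) x) summable_on UNIV"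
    and "(\<Sum>\<^sub>\<infinity>z. f (g z) * pmf p z) = (\<Sum>\<^sub>\<infinity>x. f x * pmf (map_pmf g p) x)"
proof -
  have i: "integrable (measure_pmf q) h \<longleftrightarrow> (\<lambda>x. h x * pmf q x) summable_on UNIV"
    and e: "(\<integral>x. h x \<partial>measure_pmf q) = (\<Sum>\<^sub>\<infinity>x. h x * pmf q x)" for h :: "'z \<Rightarrow> real" and q
  proof -
    have "integrable (measure_pmf q) h \<longleftrightarrow> integrable (count_space UNIV) (\<lambda>x. pmf q x *\<^sub>R h x)"
      unfolding measure_pmf_eq_density by (subst integrable_density) auto
    also have "\<dots> \<longleftrightarrow> Infinite_Set_Sum.abs_summable_on (\<lambda>x. h x * pmf q x) UNIV"
      by (simp add: Infinite_Set_Sum.abs_summable_on_def mult.commute)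
    also have "\<dots> \<longleftrightarrow> (\<lambda>x. h x * pmf q x) summable_on UNIV"
      unfolding abs_summable_equivalent[symmetric] by (rule summable_on_iff_abs_summable_on_real[symmetric])
    finally show i: "integrable (measure_pmf q) h \<longleftrightarrow> (\<lambda>x. h x * pmf q x) summable_on UNIV" .
    have "(\<integral>x. h x \<partial>measure_pmf q) = (\<integral>x. pmf q x *\<^sub>R h x \<partial>count_space UNIV)"
      unfolding measure_pmf_eq_density by (subst integral_density) auto
    also have "\<dots> = infsetsum (\<lambda>x. h x * pmf q x) UNIV"
      by (simp add: infsetsum_def mult.commute)
    also have "\<dots> = (\<Sum>\<^sub>\<infinity>x. h x * pmf q x)"
    proof (cases "Infinite_Set_Sum.abs_summable_on (\<lambda>x. h x * pmf q x) UNIV")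
      case True then show ?thesis by (rule infsetsum_infsum)
    next
      case False
      then have "\<not> (\<lambda>x. h x * pmf q x) summable_on UNIV"
        unfolding abs_summable_equivalent[symmetric] summable_on_iff_abs_summable_on_real[symmetric] .
      with False show ?thesis by (simp add: not_summable_infsetsum_eq infsum_not_exists)
    qed
    finally show "(\<integral>x. h x \<partial>measure_pmf q) = (\<Sum>\<^sub>\<infinity>x. h x * pmf q x)" .
  qed
  show "((\<lambda>z. f (g z) * pmf p z) summable_on UNIV) \<longleftrightarrow> (\<lambda>x. f x * pmf (map_pmf g p) x) summable_on UNIV"
    unfolding i[symmetric] by (simp add: integrable_map_pmf_eq)
  show "(\<Sum>\<^sub>\<infinity>z. f (g z) * pmf p z) = (\<Sum>\<^sub>\<infinity>x. f x * pmf (map_pmf g p) x)"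
    unfolding e[symmetric] by simp
qed

text \<open>Only the marginals enter, so the value is common to all couplings: in the variational
  argument the potentials contribute a constant. The same fact supplies the majorant that makes the
  cost summable.\<close>

lemma coupling_sums:
  fixes f :: "'x \<Rightarrow> real" and g :: "'y \<Rightarrow> real"
  assumes p: "p \<in> couplings r s" and f: "(\<lambda>x. f x * pmf r x) summable_on UNIV"
    and g: "(\<lambda>y. g y * pmf s y) summable_on UNIV"
  shows "((\<lambda>(x, y). (f x + g y) * pmf p (x, y)) has_sum
    ((\<Sum>\<^sub>\<infinity>x. f x * pmf r x) + (\<Sum>\<^sub>\<infinity>y. g y * pmf s y))) UNIV"
proof -
  have m: "map_pmf fst p = r" "map_pmf snd p = s" using p by (auto simp: couplings_def)
  have "((\<lambda>z. f (fst z) * pmf p z) has_sum (\<Sum>\<^sub>\<infinity>x. f x * pmf r x)) UNIV"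
    using has_sum_map_pmf[of f fst p] f m by (simp add: has_sum_iff)
  moreover have "((\<lambda>z. g (snd z) * pmf p z) has_sum (\<Sum>\<^sub>\<infinity>y. g y * pmf s y)) UNIV"
    using has_sum_map_pmf[of g snd p] g m by (simp add: has_sum_iff)
  ultimately show ?thesis
    by (auto dest: has_sum_add simp: case_prod_unfold algebra_simps)
qed

lemma pmf_coupling_zero:
  assumes p: "p \<in> couplings r s"
  shows "pmf r x = 0 \<Longrightarrow> pmf p (x, y) = 0" "pmf s y = 0 \<Longrightarrow> pmf p (x, y) = 0"
proof -
  have "x \<in> set_pmf r \<and> y \<in> set_pmf s" if "(x, y) \<in> set_pmf p"
    using p that unfolding couplings_def by force
  then show "pmf r x = 0 \<Longrightarrow> pmf p (x, y) = 0" "pmf s y = 0 \<Longrightarrow> pmf p (x, y) = 0"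
    by (auto simp: set_pmf_iff)
qed

text \<open>With \<open>c = \<alpha> + \<beta> - lam ln k\<close> for the density \<open>k\<close> of \<open>\<pi>\<close>, the objective is
  \<open>lam\<close> times the relative entropy with respect to \<open>\<pi>\<close>, up to a constant.\<close>

lemma erot_plan_eqI:
  fixes c :: "'x \<times> 'y \<Rightarrow> real"
  assumes lam: "lam > 0"
    and c: "\<And>x y. \<bar>c (x, y)\<bar> \<le> f x + g y"
    and f: "(\<lambda>x. f x * pmf r x) summable_on UNIV" and g: "(\<lambda>y. g y * pmf s y) summable_on UNIV"
    and \<alpha>: "\<And>x. \<bar>\<alpha> x\<bar> \<le> A * f x" and \<beta>: "\<And>y. \<bar>\<beta> y\<bar> \<le> A * g y"
    and \<pi>: "\<pi> \<in> couplings r s"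
    and dens: "\<And>x y. pmf \<pi> (x, y) = exp ((\<alpha> x + \<beta> y - c (x, y)) / lam) * pmf r x * pmf s y"
  shows "erot_plan c lam r s = \<pi>"
proof -
  have sm\<alpha>: "(\<lambda>x. \<alpha> x * pmf r x) summable_on UNIV"
    by (rule summable_on_abs_le[OF summable_on_cmult_right[OF f, of A]])
       (use mult_right_mono[OF \<alpha>] in \<open>simp add: abs_mult mult.assoc\<close>)
  have sm\<beta>: "(\<lambda>y. \<beta> y * pmf s y) summable_on UNIV"
    by (rule summable_on_abs_le[OF summable_on_cmult_right[OF g, of A]])
       (use mult_right_mono[OF \<beta>] in \<open>simp add: abs_mult mult.assoc\<close>)
  define C where "C = (\<Sum>\<^sub>\<infinity>x. \<alpha> x * pmf r x) + (\<Sum>\<^sub>\<infinity>y. \<beta> y * pmf s y)"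
  have pot: "((\<lambda>(x, y). (\<alpha> x + \<beta> y) * pmf p (x, y)) has_sum C) UNIV" if "p \<in> couplings r s" for p
    unfolding C_def by (rule coupling_sums[OF that sm\<alpha> sm\<beta>])
  have csum: "(\<lambda>z. c z * pmf p z) summable_on UNIV" if "p \<in> couplings r s" for p
  proof (rule summable_on_abs_le[OF has_sum_imp_summable[OF coupling_sums[OF that f g]]])
    show "\<bar>c z * pmf p z\<bar> \<le> (case z of (x, y) \<Rightarrow> (f x + g y) * pmf p (x, y))" for z
      using mult_right_mono[OF c[of "fst z" "snd z"], of "pmf p z"] by (auto simp: abs_mult split: prod.split)
  qed
  define h where "h p = (\<lambda>(x, y). pmf p (x, y) * ln (pmf p (x, y) / (pmf r x * pmf s y)))" for p :: "('x \<times> 'y) pmf"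
  define kl where "kl p = (\<lambda>z. pmf p z * ln (pmf p z / pmf \<pi> z))" for p :: "('x \<times> 'y) pmf"
  \<comment> \<open>The logarithm of the density formula turns entropy plus cost into relative
    entropy with respect to \<open>\<pi>\<close> plus a separable term. Where \<open>pmf p\<close>
    vanishes both sides are \<open>0\<close>.\<close>
  have kl_h: "lam * kl p z = lam * h p z + c z * pmf p z - (case z of (x, y) \<Rightarrow> (\<alpha> x + \<beta> y) * pmf p (x, y))"
    if p: "p \<in> couplings r s" for p z
  proof (cases z)
    case (Pair x y)
    show ?thesis
    proof (cases "pmf p (x, y) = 0")
      case True then show ?thesis by (simp add: Pair kl_def h_def)
    next
      case False
      then have nz: "pmf r x \<noteq> 0" "pmf s y \<noteq> 0" using pmf_coupling_zero[OF p] by blast+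
      then have pos: "pmf r x > 0" "pmf s y > 0" "pmf p (x, y) > 0"
        using False by (simp_all add: pmf_pos)
      have "ln (pmf p (x, y) / pmf \<pi> (x, y)) =
          ln (pmf p (x, y) / (pmf r x * pmf s y)) - (\<alpha> x + \<beta> y - c (x, y)) / lam"
        unfolding dens using pos by (simp add: ln_div ln_mult)
      then have "lam * ln (pmf p (x, y) / pmf \<pi> (x, y)) =
          lam * ln (pmf p (x, y) / (pmf r x * pmf s y)) + c (x, y) - (\<alpha> x + \<beta> y)"
        using lam by (simp add: field_simps)
      from arg_cong[OF this, of "\<lambda>u. u * pmf p (x, y)"] show ?thesis
        by (simp add: Pair kl_def h_def algebra_simps)
    qed
  qed
  have kl_sum: "kl p summable_on UNIV" "lam * infsum (h p) UNIV + (\<Sum>\<^sub>\<infinity>z. c z * pmf p z) = C + lam * infsum (kl p) UNIV"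
    if p: "p \<in> couplings r s" and hs: "h p summable_on UNIV" for p
  proof -
    have "((\<lambda>z. lam * h p z + c z * pmf p z - (case z of (x, y) \<Rightarrow> (\<alpha> x + \<beta> y) * pmf p (x, y))) has_sum
        (lam * infsum (h p) UNIV + (\<Sum>\<^sub>\<infinity>z. c z * pmf p z)) + - C) UNIV"
      unfolding diff_conv_add_uminus
      by (intro has_sum_add has_sum_cmult_right has_sum_infsum has_sum_uminusI hs csum[OF p] pot[OF p])
    then have 1: "((\<lambda>z. lam * kl p z) has_sum
        (lam * infsum (h p) UNIV + (\<Sum>\<^sub>\<infinity>z. c z * pmf p z)) + - C) UNIV"
      unfolding kl_h[OF p] .
    then have 2: "(\<lambda>z. (1 / lam) * (lam * kl p z)) summable_on UNIV"
      by (intro summable_on_cmult_right has_sum_imp_summable)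
    then show s: "kl p summable_on UNIV" using lam by simp
    from infsumI[OF 1] show "lam * infsum (h p) UNIV + (\<Sum>\<^sub>\<infinity>z. c z * pmf p z) = C + lam * infsum (kl p) UNIV"
      by (simp add: infsum_cmult_right')
  qed
  have gap: "kl p z \<ge> pmf p z - pmf \<pi> z" "kl p z = pmf p z - pmf \<pi> z \<Longrightarrow> pmf p z = pmf \<pi> z"
    if p: "p \<in> couplings r s" for p z
  proof -
    \<comment> \<open>The exponential factor in the density of \<open>\<pi>\<close> is positive, so
      \<open>\<pi>\<close> charges every point that a coupling can charge.\<close>
    have *: "pmf p z > 0 \<Longrightarrow> pmf \<pi> z > 0"
      using pmf_coupling_zero(1)[OF p, of "fst z" "snd z"] pmf_coupling_zero(2)[OF p, of "snd z" "fst z"]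
      by (cases z) (force simp: dens less_le intro!: mult_pos_pos)
    show "kl p z \<ge> pmf p z - pmf \<pi> z"
      using ln_ge_one_minus_inverse(1)[of "pmf p z" "pmf \<pi> z"] *
      by (cases "pmf p z = 0") (auto simp: kl_def pmf_pos)
    show "kl p z = pmf p z - pmf \<pi> z \<Longrightarrow> pmf p z = pmf \<pi> z"
      using ln_ge_one_minus_inverse(2)[of "pmf p z" "pmf \<pi> z"] *
      by (cases "pmf p z = 0") (auto simp: kl_def pmf_pos)
  qed
  have kl0: "infsum (kl p) UNIV \<ge> 0" "infsum (kl p) UNIV = 0 \<Longrightarrow> p = \<pi>"
    if p: "p \<in> couplings r s" and hs: "h p summable_on UNIV" for p
  proof -
    \<comment> \<open>Both masses are \<open>1\<close>, so subtracting
      \<open>pmf p z - pmf \<pi> z\<close> leaves the sum unchanged while making every summand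
      nonnegative.\<close>
    have s: "((\<lambda>z. kl p z - (pmf p z - pmf \<pi> z)) has_sum (infsum (kl p) UNIV + - (1 + - 1))) UNIV"
      unfolding diff_conv_add_uminus
      by (intro has_sum_add has_sum_uminusI has_sum_infsum kl_sum(1)[OF that] pmf_has_sum)
    show "infsum (kl p) UNIV \<ge> 0"
      using has_sum_nonneg[OF s] gap(1)[OF p] by simp
    assume z: "infsum (kl p) UNIV = 0"
    have "kl p z - (pmf p z - pmf \<pi> z) = 0" for z
      by (rule nonneg_has_sum_le_0D[OF s]) (use z gap(1)[OF p] in auto)
    then show "p = \<pi>" using gap(2)[OF p] by (intro pmf_eqI) simp
  qed
  have obj: "erot_objective c lam r s p =
      (if h p summable_on UNIV then ereal (C + lam * infsum (kl p) UNIV) else \<infinity>)"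
    if p: "p \<in> couplings r s" for p
    using csum[OF p] kl_sum(2)[OF p] lam
    by (auto simp: erot_objective_def coupling_entropy_def Let_def h_def[symmetric] add.commute)
  have klpi: "kl \<pi> z = 0" for z by (cases "pmf \<pi> z = 0") (auto simp: kl_def)
  \<comment> \<open>The candidate itself has finite entropy: as \<open>kl \<pi>\<close> vanishes,
    \<open>h \<pi>\<close> is a combination of the potentials and the cost, all summable. Couplings
    for which \<open>h\<close> is not summable have objective \<open>\<infinity>\<close> and lose
    against it.\<close>
  have hpi: "h \<pi> summable_on UNIV"
  proof -
    have "(\<lambda>z. (1 / lam) * ((case z of (x, y) \<Rightarrow> (\<alpha> x + \<beta> y) * pmf \<pi> (x, y)) - c z * pmf \<pi> z)) summable_on UNIV"
      by (intro summable_on_cmult_right summable_on_diff_real csum[OF \<pi>] has_sum_imp_summable[OF pot[OF \<pi>]])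
    moreover have "h \<pi> z = (1 / lam) * ((case z of (x, y) \<Rightarrow> (\<alpha> x + \<beta> y) * pmf \<pi> (x, y)) - c z * pmf \<pi> z)" for z
      using kl_h[OF \<pi>, of z] lam by (simp add: klpi field_simps)
    ultimately show ?thesis using summable_on_cong[of UNIV "h \<pi>"] by simp
  qed
  have opi: "erot_objective c lam r s \<pi> = ereal C"
    using obj[OF \<pi>] hpi by (simp add: infsum_0[of UNIV "kl \<pi>"] klpi)
  show ?thesis unfolding erot_plan_def
  proof (rule the_equality)
    show "is_arg_min (erot_objective c lam r s) (\<lambda>\<pi>. \<pi> \<in> couplings r s) \<pi>"
      unfolding is_arg_min_linorder using \<pi> obj opi kl0(1) lam by auto
    fix p assume a: "is_arg_min (erot_objective c lam r s) (\<lambda>\<pi>. \<pi> \<in> couplings r s) p"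
    then have p: "p \<in> couplings r s" and "erot_objective c lam r s p \<le> ereal C"
      using opi \<pi> unfolding is_arg_min_linorder by force+
    then have hs: "h p summable_on UNIV" and "lam * infsum (kl p) UNIV \<le> 0"
      unfolding obj[OF p] by (auto split: if_splits)
    then have "infsum (kl p) UNIV = 0" using kl0(1)[OF p hs] lam
      by (simp add: mult_le_0_iff)
    then show "p = \<pi>" by (rule kl0(2)[OF p hs])
  qed
qed

section \<open>The linearized system\<close>

text \<open>Apply \<open>step\<close> to the supremum itself and absorb \<open>(1 - e) * M\<close>
  on the left. The crude bound \<open>M0\<close> guarantees that the supremum is finite and
  disappears from the estimate, so solutions known merely to be bounded receive quantitative
  bounds.\<close>

lemma sup_contraction:
  fixes a :: "'i \<Rightarrow> real"
  assumes bdd: "\<And>x. \<bar>a x\<bar> \<le> M0" and e: "0 < e" "e \<le> 1"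
    and step: "\<And>M x. (\<And>x. \<bar>a x\<bar> \<le> M) \<Longrightarrow> \<bar>a x\<bar> \<le> F + (1 - e) * M"
  shows "\<bar>a x\<bar> \<le> F / e"
proof -
  define M where "M = (SUP x. \<bar>a x\<bar>)"
  have "bdd_above (range (\<lambda>x. \<bar>a x\<bar>))" using bdd unfolding bdd_above_def by auto
  then have ub: "\<bar>a x\<bar> \<le> M" for x unfolding M_def by (rule cSUP_upper2) auto
  have "M \<le> F + (1 - e) * M" unfolding M_def
    by (rule cSUP_least) (use step[OF ub] in \<open>auto simp: M_def\<close>)
  then have "M \<le> F / e" using e by (simp add: field_simps)
  with ub[of x] show ?thesis by linarith
qed

lemma linf_set_iff:
  assumes "\<And>z. f z > 0"
  shows "b \<in> linf_set Z f \<longleftrightarrow> (\<forall>z. z \<notin> Z \<longrightarrow> b z = 0) \<and> (\<exists>C\<ge>0. \<forall>z. \<bar>b z\<bar> \<le> C * f z)"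
proof
  assume b: "b \<in> linf_set Z f"
  then obtain C where C: "\<And>z. z \<in> Z \<Longrightarrow> \<bar>b z\<bar> / f z \<le> C" by (auto simp: linf_set_def bdd_above_def)
  have "\<bar>b z\<bar> \<le> max C 0 * f z" for z
  proof (cases "z \<in> Z")
    case True
    have "\<bar>b z\<bar> \<le> C * f z" using C[OF True] assms[of z] by (simp add: divide_le_eq)
    also have "\<dots> \<le> max C 0 * f z" using assms[of z] by (intro mult_right_mono) auto
    finally show ?thesis .
  qed (use b assms[of z] in \<open>auto simp: linf_set_def\<close>)
  then show "(\<forall>z. z \<notin> Z \<longrightarrow> b z = 0) \<and> (\<exists>C\<ge>0. \<forall>z. \<bar>b z\<bar> \<le> C * f z)"
    using b by (auto simp: linf_set_def intro!: exI[of _ "max C 0"])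
next
  assume "(\<forall>z. z \<notin> Z \<longrightarrow> b z = 0) \<and> (\<exists>C\<ge>0. \<forall>z. \<bar>b z\<bar> \<le> C * f z)"
  then show "b \<in> linf_set Z f"
    using assms by (auto simp: linf_set_def bdd_above_def divide_le_eq)
qed

text \<open>\<open>k\<close> is the density of the plan with respect to the product of its
  marginals. The lower bound on \<open>k\<close> drives the contraction; the upper bound decides how
  much growth in \<open>\<phi>\<close> can be afforded.\<close>

locale plan_density =
  fixes k :: "'x \<Rightarrow> 'y \<Rightarrow> real" and Q :: real and \<phi> :: "'y \<Rightarrow> real"
    and CX :: "'x \<Rightarrow> real" and CY :: "'y \<Rightarrow> real"
    and r :: "'x pmf" and s :: "'y pmf" and \<pi> :: "('x \<times> 'y) pmf" and y1 :: 'y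
  assumes k_le: "\<And>x y. k x y \<le> Q * \<phi> y" and k_ge: "\<And>x y. 1 / (Q * \<phi> y) \<le> k x y"
    and \<phi>_ge: "\<And>y. \<phi> y \<ge> 1" and Q_ge: "Q \<ge> 1"
    and CX_ge: "\<And>x. CX x \<ge> 1" and CY_ge: "\<And>y. CY y \<ge> 1"
    and ks: "\<And>x. ((\<lambda>y. k x y * pmf s y) has_sum 1) UNIV"
    and kr: "\<And>y. ((\<lambda>x. k x y * pmf r x) has_sum 1) UNIV"
    and rsum: "(\<lambda>x. CX x * pmf r x) summable_on UNIV"
    and ssum: "(\<lambda>y. CY y * \<phi> y ^ 4 * pmf s y) summable_on UNIV"
    and y1: "y1 \<in> set_pmf s"
    and \<pi>: "\<And>x y. pmf \<pi> (x, y) = k x y * pmf r x * pmf s y"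
begin

abbreviation "AA \<equiv> AX r s \<pi> y1"
abbreviation "BB \<equiv> AY r s \<pi> y1"
abbreviation "FF \<equiv> BX r s \<pi>"
abbreviation "GG \<equiv> BY r s \<pi> y1"
abbreviation "IA \<equiv> invXY r s \<pi> y1"
abbreviation "IB \<equiv> invYX r s \<pi> \<phi> y1"
abbreviation "da \<equiv> deriv_a r s \<pi> y1"
abbreviation "db \<equiv> deriv_b r s \<pi> \<phi> y1"
abbreviation "DD \<equiv> plan_deriv r s \<pi> \<phi> y1"
abbreviation "WY \<equiv> \<lambda>y. CY y * \<phi> y ^ 4"
abbreviation "nX h \<equiv> (\<Sum>\<^sub>\<infinity>x. CX x * \<bar>h x\<bar>)"
abbreviation "nY h \<equiv> (\<Sum>\<^sub>\<infinity>y. WY y * \<bar>h y\<bar>)"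

lemma \<phi>_pos: "\<phi> y > 0" using \<phi>_ge[of y] by linarith
lemma Q_pos: "Q > 0" using Q_ge by linarith
lemma k_pos: "k x y > 0"
proof -
  have "0 < 1 / (Q * \<phi> y)" using Q_pos \<phi>_pos by simp
  with k_ge[of y x] show ?thesis by linarith
qed
lemma k_nonneg: "k x y \<ge> 0" using k_pos[of x y] by linarith
lemma \<phi>_mono: "i \<le> j \<Longrightarrow> \<phi> y ^ i \<le> \<phi> y ^ j" by (rule power_increasing[OF _ \<phi>_ge])
lemma \<phi>_pow_ge: "1 \<le> \<phi> y ^ i" by (rule one_le_power[OF \<phi>_ge])
lemma \<phi>_le_pow: "1 \<le> j \<Longrightarrow> \<phi> y \<le> \<phi> y ^ j" using \<phi>_mono[of 1 j y] by simp
lemma WY_ge: "\<phi> y ^ 4 \<le> WY y" "1 \<le> WY y"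
proof -
  show 1: "\<phi> y ^ 4 \<le> WY y" using mult_right_mono[OF CY_ge[of y], of "\<phi> y ^ 4"] \<phi>_pow_ge[of y 4] by simp
  show "1 \<le> WY y" using 1 \<phi>_pow_ge[of y 4] by linarith
qed
lemma CX_pos: "CX x > 0" and CY_pos: "CY y > 0" and WY_pos: "WY y > 0"
  using CX_ge[of x] CY_ge[of y] WY_ge(2)[of y] by linarith+

definition S4 :: real where "S4 = (\<Sum>\<^sub>\<infinity>y. \<phi> y ^ 4 * pmf s y)"

lemma s4: "(\<lambda>y. \<phi> y ^ 4 * pmf s y) summable_on UNIV"
  by (rule summable_on_abs_le[OF ssum])
     (use mult_right_mono[OF WY_ge(1)] \<phi>_pow_ge[of _ 4] \<phi>_pos in \<open>simp add: abs_mult\<close>)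

lemma S4_nonneg: "S4 \<ge> 0"
  unfolding S4_def by (rule infsum_nonneg) (simp add: \<phi>_pos less_imp_le)

text \<open>A lower bound, uniform in \<open>x\<close>, for the mass that the row
  \<open>k x y * pmf s y\<close> puts on the column \<open>y1\<close>. Removing this column turns
  averaging over the row into a contraction with factor \<open>1 - eps\<close>.\<close>

definition eps :: real where "eps = pmf s y1 / (Q * \<phi> y1)"

lemma eps_pos: "eps > 0" using y1 Q_pos \<phi>_pos by (simp add: eps_def pmf_positive)
lemma eps_le: "eps \<le> k x y1 * pmf s y1"
  using mult_right_mono[OF k_ge[of y1 x], of "pmf s y1"] by (simp add: eps_def)
lemma eps_le1: "eps \<le> 1"
proof -
  have "infsum (\<lambda>y. k undefined y * pmf s y) {y1} \<le> infsum (\<lambda>y. k undefined y * pmf s y) UNIV"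
    using ks[of undefined] k_nonneg by (intro infsum_mono2) (auto simp: has_sum_iff)
  then show ?thesis using eps_le[of undefined] ks[of undefined] by (auto simp: has_sum_iff)
qed

text \<open>On the supports the quotients of the definition reduce to \<open>k\<close> times a
  marginal, and off them the summands vanish, so sums may run over the whole type. The deleted point
  \<open>y1\<close> is encoded by the value \<open>0\<close>.\<close>

lemma AX_eq: "AA b x = (if x \<in> set_pmf r
  then \<Sum>\<^sub>\<infinity>y. k x y * pmf s y * (if y = y1 then 0 else b y) else 0)"
  unfolding AX_def by (auto intro!: infsum_cong_neutral simp: \<pi> set_pmf_iff split: if_splits)

lemma AY_eq: "BB a y = (if y \<in> set_pmf s - {y1}
  then \<Sum>\<^sub>\<infinity>x. k x y * pmf r x * a x else 0)"
  unfolding AY_def by (auto intro!: infsum_cong_neutral simp: \<pi> set_pmf_iff)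

lemma BX_eq: "FF h x = (if x \<in> set_pmf r
  then \<Sum>\<^sub>\<infinity>y. k x y * (if y \<in> set_pmf s then h y else 0) else 0)"
  unfolding BX_def by (auto intro!: infsum_cong_neutral simp: \<pi> set_pmf_iff)

lemma BY_eq: "GG h y = (if y \<in> set_pmf s - {y1}
  then \<Sum>\<^sub>\<infinity>x. k x y * (if x \<in> set_pmf r then h x else 0) else 0)"
  unfolding BY_def by (auto intro!: infsum_cong_neutral simp: \<pi> set_pmf_iff)

text \<open>Cubic growth in \<open>\<phi>\<close> is what the finite fourth moment \<open>S4\<close>
  can pay for: the kernel \<open>k\<close> contributes the remaining factor.\<close>

lemma ks_sum3:
  assumes "\<And>y. \<bar>b y\<bar> \<le> G * \<phi> y ^ 3" "G \<ge> 0"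
  shows "(\<lambda>y. k x y * pmf s y * b y) summable_on UNIV"
    and "\<bar>\<Sum>\<^sub>\<infinity>y. k x y * pmf s y * b y\<bar> \<le> Q * G * S4"
proof -
  have le: "\<bar>k x y * pmf s y * b y\<bar> \<le> Q * G * (\<phi> y ^ 4 * pmf s y)" for y
  proof -
    have "\<bar>k x y * pmf s y * b y\<bar> = k x y * \<bar>b y\<bar> * pmf s y"
      using k_nonneg[of x y] by (simp add: abs_mult)
    also have "\<dots> \<le> (Q * \<phi> y) * (G * \<phi> y ^ 3) * pmf s y"
      by (intro mult_right_mono mult_mono k_le assms) (use Q_pos \<phi>_pos in \<open>auto simp: less_imp_le\<close>)
    also have "\<dots> = Q * G * (\<phi> y ^ 4 * pmf s y)" by (simp add: eval_nat_numeral)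
    finally show ?thesis .
  qed
  show "(\<lambda>y. k x y * pmf s y * b y) summable_on UNIV"
    by (rule summable_on_abs_le[OF summable_on_cmult_right[OF s4] le])
  show "\<bar>\<Sum>\<^sub>\<infinity>y. k x y * pmf s y * b y\<bar> \<le> Q * G * S4"
    using infsum_abs_le[OF summable_on_cmult_right[OF s4] le] unfolding infsum_cmult_right' S4_def .
qed

lemma kr_sum:
  assumes "\<And>x. \<bar>a x\<bar> \<le> A"
  shows "(\<lambda>x. k x y * pmf r x * a x) summable_on UNIV"
    and "\<bar>\<Sum>\<^sub>\<infinity>x. k x y * pmf r x * a x\<bar> \<le> A"
proof -
  have le: "\<bar>k x y * pmf r x * a x\<bar> \<le> k x y * pmf r x * A" for x
    using mult_left_mono[OF assms[of x], of "k x y * pmf r x"] k_nonneg[of x y]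
    by (simp add: abs_mult)
  have s: "((\<lambda>x. k x y * pmf r x * A) has_sum 1 * A) UNIV"
    by (intro has_sum_cmult_left kr)
  show "(\<lambda>x. k x y * pmf r x * a x) summable_on UNIV"
    by (rule summable_on_abs_le[OF has_sum_imp_summable[OF s] le])
  show "\<bar>\<Sum>\<^sub>\<infinity>x. k x y * pmf r x * a x\<bar> \<le> A"
    using infsum_abs_le[OF has_sum_imp_summable[OF s] le] infsumI[OF s] by simp
qed

text \<open>Rows have total mass \<open>1\<close>, and at least \<open>eps\<close> of it sits on the
  deleted column. The contraction is for bounded \<open>b\<close>; for growing \<open>b\<close> the
  cruder \<open>AX_bound3\<close> gives boundedness only.\<close>

lemma AX_bound:
  assumes b: "\<And>y. \<bar>b y\<bar> \<le> \<beta>"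
  shows "\<bar>AA b x\<bar> \<le> (1 - eps) * \<beta>"
proof (cases "x \<in> set_pmf r")
  case True
  have \<beta>: "\<beta> \<ge> 0" using b[of undefined] by linarith
  let ?g = "\<lambda>y. k x y * pmf s y * \<beta> - (if y = y1 then k x y1 * pmf s y1 * \<beta> else 0)"
  have s: "(?g has_sum 1 * \<beta> - k x y1 * pmf s y1 * \<beta>) UNIV"
    unfolding diff_conv_add_uminus
    by (intro has_sum_add has_sum_uminusI has_sum_cmult_left ks)
       (rule has_sum_finite_neutralI[of "{y1}"], auto)
  have le: "\<bar>k x y * pmf s y * (if y = y1 then 0 else b y)\<bar> \<le> ?g y" for y
    using mult_left_mono[OF b[of y], of "k x y * pmf s y"] k_nonneg[of x y] by (auto simp: abs_mult)
  have "\<bar>AA b x\<bar> \<le> 1 * \<beta> - k x y1 * pmf s y1 * \<beta>"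
    using infsum_abs_le[OF has_sum_imp_summable[OF s] le] infsumI[OF s] True by (simp add: AX_eq)
  also have "\<dots> \<le> (1 - eps) * \<beta>" using mult_right_mono[OF eps_le[of x] \<beta>] by (simp add: algebra_simps)
  finally show ?thesis .
next
  case False
  have "\<beta> \<ge> 0" using b[of undefined] by linarith
  with False show ?thesis using eps_le1 by (simp add: AX_eq)
qed

lemma AX_bound3:
  assumes "\<And>y. \<bar>b y\<bar> \<le> G * \<phi> y ^ 3" "G \<ge> 0"
  shows "\<bar>AA b x\<bar> \<le> Q * G * S4"
proof -
  have "\<bar>if y = y1 then 0 else b y\<bar> \<le> G * \<phi> y ^ 3" for y
    using assms(1)[of y] assms(2) \<phi>_pos[of y] by (auto simp: less_imp_le)
  from ks_sum3(2)[OF this assms(2)] show ?thesis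
    using Q_pos assms(2) S4_nonneg by (simp add: AX_eq)
qed

lemma AY_bound: "(\<And>x. \<bar>a x\<bar> \<le> A) \<Longrightarrow> \<bar>BB a y\<bar> \<le> A"
  using kr_sum(2)[of a A y] order_trans[OF abs_ge_zero, of "a undefined" A] by (auto simp: AY_eq)

text \<open>Infinite sums are additive for summable families, hence the growth conditions on both
  arguments.\<close>

lemma AX_lin:
  assumes b: "\<And>y. \<bar>b y\<bar> \<le> G * \<phi> y ^ 3" "G \<ge> 0" and c: "\<And>y. \<bar>c y\<bar> \<le> H * \<phi> y ^ 3" "H \<ge> 0"
  shows "AA (\<lambda>y. u * b y + v * c y) x = u * AA b x + v * AA c x"
proof -
  have b': "\<bar>if y = y1 then 0 else b y\<bar> \<le> G * \<phi> y ^ 3" and c': "\<bar>if y = y1 then 0 else c y\<bar> \<le> H * \<phi> y ^ 3" for y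
    using b(1)[of y] b(2) c(1)[of y] c(2) \<phi>_pos[of y] by (auto simp: less_imp_le)
  have "(\<Sum>\<^sub>\<infinity>y. k x y * pmf s y * (if y = y1 then 0 else u * b y + v * c y)) =
    (\<Sum>\<^sub>\<infinity>y. u * (k x y * pmf s y * (if y = y1 then 0 else b y)) + v * (k x y * pmf s y * (if y = y1 then 0 else c y)))"
    by (intro infsum_cong) (auto simp: algebra_simps)
  also have "\<dots> = u * (\<Sum>\<^sub>\<infinity>y. k x y * pmf s y * (if y = y1 then 0 else b y))
      + v * (\<Sum>\<^sub>\<infinity>y. k x y * pmf s y * (if y = y1 then 0 else c y))"
    unfolding infsum_cmult_right'[symmetric]
    by (intro infsum_add summable_on_cmult_right ks_sum3(1)[OF b' b(2)] ks_sum3(1)[OF c' c(2)])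
  finally show ?thesis by (simp add: AX_eq)
qed

lemma AY_lin:
  assumes a: "\<And>x. \<bar>a x\<bar> \<le> A" and c: "\<And>x. \<bar>c x\<bar> \<le> C"
  shows "BB (\<lambda>x. u * a x + v * c x) y = u * BB a y + v * BB c y"
proof -
  have "(\<Sum>\<^sub>\<infinity>x. k x y * pmf r x * (u * a x + v * c x)) =
    (\<Sum>\<^sub>\<infinity>x. u * (k x y * pmf r x * a x) + v * (k x y * pmf r x * c x))"
    by (intro infsum_cong) (auto simp: algebra_simps)
  also have "\<dots> = u * (\<Sum>\<^sub>\<infinity>x. k x y * pmf r x * a x) + v * (\<Sum>\<^sub>\<infinity>x. k x y * pmf r x * c x)"
    unfolding infsum_cmult_right'[symmetric]
    by (intro infsum_add summable_on_cmult_right kr_sum(1)[OF a] kr_sum(1)[OF c])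
  finally show ?thesis by (simp add: AY_eq)
qed

lemma bounded_growth3: "\<bar>t\<bar> \<le> B \<Longrightarrow> \<bar>t\<bar> \<le> B * \<phi> y ^ 3"
  using mult_left_mono[OF \<phi>_pow_ge[of y 3], of B] by linarith

text \<open>Coercivity of the linearized system; it also yields uniqueness, hence linearity, of
  its solutions.\<close>

lemma linear_stability:
  assumes bdd: "\<And>x. \<bar>a x\<bar> \<le> M0"
    and g: "\<And>y. \<bar>g y\<bar> \<le> G * \<phi> y ^ 3" "G \<ge> 0" and f: "\<And>x. \<bar>f x\<bar> \<le> F"
    and b: "\<And>y. b y = g y - BB a y" and a: "\<And>x. a x = f x - AA b x"
  shows "\<bar>a x\<bar> \<le> (F + Q * G * S4) / eps"
proof (rule sup_contraction[OF bdd eps_pos eps_le1])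
  fix M x assume M: "\<And>x. \<bar>a x\<bar> \<le> M"
  have M0: "M \<ge> 0" using M[of undefined] by linarith
  have ba: "\<bar>BB a y\<bar> \<le> M" for y by (rule AY_bound[OF M])
  \<comment> \<open>Eliminate \<open>b\<close>: the part \<open>BB a\<close> is bounded by
    \<open>M\<close> and is contracted by \<open>AA\<close>, while the growing part \<open>g\<close>
    contributes only a constant.\<close>
  have "b = (\<lambda>y. 1 * g y + (- 1) * BB a y)" using b by auto
  with AX_lin[where b=g and c="BB a" and u=1 and v="- 1" and x=x, OF g bounded_growth3[OF ba] M0]
  have "AA b x = 1 * AA g x + (- 1) * AA (BB a) x" by simp
  then have "\<bar>AA b x\<bar> \<le> Q * G * S4 + (1 - eps) * M"
    using AX_bound3[where b=g and x=x, OF g] AX_bound[where b="BB a" and x=x, OF ba] by linarith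
  then show "\<bar>a x\<bar> \<le> F + Q * G * S4 + (1 - eps) * M"
    using a[of x] f[of x] by linarith
qed

text \<open>Picard iteration from \<open>0\<close>, that is, the Neumann series of
  \<open>Id - AA BB\<close>, which converges since \<open>BB\<close> averages over \<open>x\<close>
  and \<open>AA\<close> contracts bounded functions.\<close>

lemma solution_exists:
  assumes f: "\<And>x. \<bar>f x\<bar> \<le> F"
  obtains a where "\<And>x. a x = f x + AA (BB a) x" "\<And>x. \<bar>a x\<bar> \<le> F / eps"
proof -
  have F: "F \<ge> 0" using f[of undefined] by linarith
  define an where "an n = ((\<lambda>a x. f x + AA (BB a) x) ^^ n) (\<lambda>_. 0)" for n
  have an_Suc: "an (Suc n) = (\<lambda>x. f x + AA (BB (an n)) x)" for n by (simp add: an_def)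
  have an0: "an 0 = (\<lambda>_. 0)" by (simp add: an_def)
  have contr: "\<bar>AA (BB a) x - AA (BB a') x\<bar> \<le> (1 - eps) * d"
    if "\<And>x. \<bar>a x\<bar> \<le> A" "\<And>x. \<bar>a' x\<bar> \<le> A'" "\<And>x. \<bar>a x - a' x\<bar> \<le> d" for a a' A A' d x
  proof -
    have A0: "A \<ge> 0" "A' \<ge> 0" using that(1,2)[of undefined] by linarith+
    have e: "BB (\<lambda>x. a x - a' x) = (\<lambda>y. 1 * BB a y + (- 1) * BB a' y)"
      using AY_lin[where a=a and c=a' and u=1 and v="- 1", OF that(1,2)] by auto
    have "AA (BB (\<lambda>x. a x - a' x)) x = 1 * AA (BB a) x + (- 1) * AA (BB a') x"
      unfolding e
      by (rule AX_lin[OF bounded_growth3[OF AY_bound[OF that(1)]] A0(1) bounded_growth3[OF AY_bound[OF that(2)]] A0(2)])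
    with AX_bound[where b="BB (\<lambda>x. a x - a' x)" and x=x, OF AY_bound[OF that(3)]] show ?thesis by simp
  qed
  have bdd: "\<exists>A. \<forall>x. \<bar>an n x\<bar> \<le> A" for n
  proof (induction n)
    case (Suc n)
    then obtain A where A: "\<And>x. \<bar>an n x\<bar> \<le> A" by blast
    have "\<bar>an (Suc n) x\<bar> \<le> F + (1 - eps) * A" for x
      using f[of x] AX_bound[where b="BB (an n)" and x=x, OF AY_bound[OF A]] unfolding an_Suc by linarith
    then show ?case by blast
  qed (auto simp: an0)
  have step: "\<bar>an (Suc n) x - an n x\<bar> \<le> F * (1 - eps) ^ n" for n x
  proof (induction n arbitrary: x)
    case 0
    have "AA (BB (\<lambda>_. 0)) x = 0" using AX_bound[where b="BB (\<lambda>_. 0)" and x=x, OF AY_bound[of "\<lambda>_. 0" 0]] by simp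
    then show ?case using f[of x] by (simp add: an_Suc an0)
  next
    case (Suc n)
    obtain A A' where A: "\<And>x. \<bar>an n x\<bar> \<le> A" "\<And>x. \<bar>an (Suc n) x\<bar> \<le> A'" using bdd by metis
    have "\<bar>AA (BB (an (Suc n))) x - AA (BB (an n)) x\<bar> \<le> (1 - eps) * (F * (1 - eps) ^ n)"
      by (rule contr[OF A(2,1) Suc.IH])
    then show ?case by (simp add: an_Suc[of "Suc n"] an_Suc[of n] mult_ac)
  qed
  have q: "0 \<le> 1 - eps" "1 - eps < 1" using eps_pos eps_le1 by auto
  from geometric_limit[where f=an, OF q step] obtain a
    where a: "\<And>n x. \<bar>a x - an n x\<bar> \<le> F / eps * (1 - eps) ^ n" by auto
  have a_bd: "\<bar>a x\<bar> \<le> F / eps" for x using a[of x 0] by (simp add: an0)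
  have lim0: "(\<lambda>n. F / eps * (1 - eps) ^ n) \<longlonglongrightarrow> 0"
    using q by (intro tendsto_mult_right_zero LIMSEQ_power_zero) auto
  have "\<bar>a x - (f x + AA (BB a) x)\<bar> \<le> 0" for x
  proof (rule tendsto_lowerbound)
    show "(\<lambda>n. F / eps * (1 - eps) ^ Suc n + (1 - eps) * (F / eps * (1 - eps) ^ n)) \<longlonglongrightarrow> 0"
    proof -
      have "c * (q * p) + q * (c * p) = 2 * q * (c * p)" for c q p :: real by (simp add: algebra_simps)
      then show ?thesis unfolding power_Suc by (simp only: tendsto_mult_right_zero[OF lim0])
    qed
    show "\<forall>\<^sub>F n in sequentially. \<bar>a x - (f x + AA (BB a) x)\<bar>
        \<le> F / eps * (1 - eps) ^ Suc n + (1 - eps) * (F / eps * (1 - eps) ^ n)"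
    proof (intro always_eventually allI)
      fix n
      obtain A where A: "\<And>x. \<bar>an n x\<bar> \<le> A" using bdd by metis
      have "\<bar>AA (BB (an n)) x - AA (BB a) x\<bar> \<le> (1 - eps) * (F / eps * (1 - eps) ^ n)"
        by (rule contr[OF A a_bd]) (use a in \<open>simp add: abs_minus_commute\<close>)
      with a[of x "Suc n"] show "\<bar>a x - (f x + AA (BB a) x)\<bar>
        \<le> F / eps * (1 - eps) ^ Suc n + (1 - eps) * (F / eps * (1 - eps) ^ n)"
        unfolding an_Suc by linarith
    qed
  qed simp
  then have "a x = f x + AA (BB a) x" for x by (meson abs_le_zero_iff eq_iff_diff_eq_0)
  with a_bd show thesis using that by blast
qed

lemma AX_off: "x \<notin> set_pmf r \<Longrightarrow> AA b x = 0" by (simp add: AX_eq)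
lemma AY_off: "y \<notin> set_pmf s - {y1} \<Longrightarrow> BB a y = 0" unfolding AY_eq by argo

text \<open>\<open>inv_into\<close> yields a preimage as soon as one exists, and
  \<open>solution_exists\<close> provides one in the right space. Uniqueness, where it matters,
  comes from \<open>linear_stability\<close>.\<close>

lemma invXY_solves:
  assumes f: "\<And>x. \<bar>f x\<bar> \<le> F" "\<And>x. x \<notin> set_pmf r \<Longrightarrow> f x = 0"
  shows "IA f x = f x + AA (BB (IA f)) x" "\<exists>A. \<forall>x. \<bar>IA f x\<bar> \<le> A"
proof -
  obtain a where a: "\<And>x. a x = f x + AA (BB a) x" "\<And>x. \<bar>a x\<bar> \<le> F / eps"
    using solution_exists[where f=f, OF f(1)] by metis
  have "F \<ge> 0" using f(1)[of undefined] by linarith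
  then have "a \<in> linf_set (set_pmf r) (\<lambda>_. 1)"
    using a f(2) AX_off eps_pos by (subst linf_set_iff) (auto intro!: exI[of _ "F / eps"])
  then have "f \<in> (\<lambda>a x. a x - AA (BB a) x) ` linf_set (set_pmf r) (\<lambda>_. 1)"
    using a(1) by (intro image_eqI[where x=a] ext) (simp_all add: algebra_simps)
  from f_inv_into_f[OF this] inv_into_into[OF this]
  have "(\<lambda>x. IA f x - AA (BB (IA f)) x) = f" and i: "IA f \<in> linf_set (set_pmf r) (\<lambda>_. 1)"
    by (auto simp: invXY_def)
  then show "IA f x = f x + AA (BB (IA f)) x" by (metis add.commute diff_add_cancel)
  show "\<exists>A. \<forall>x. \<bar>IA f x\<bar> \<le> A" using i by (subst (asm) linf_set_iff) auto
qed

lemma growth1_3: "\<bar>t\<bar> \<le> B * \<phi> y \<Longrightarrow> \<bar>t\<bar> \<le> B * \<phi> y ^ 3"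
proof -
  assume a: "\<bar>t\<bar> \<le> B * \<phi> y"
  then have "0 \<le> B * \<phi> y" by linarith
  then have "B \<ge> 0" using \<phi>_pos[of y] by (simp add: zero_le_mult_iff)
  then have "B * \<phi> y \<le> B * \<phi> y ^ 3" by (intro mult_left_mono \<phi>_le_pow) auto
  with a show ?thesis by linarith
qed

text \<open>Contraction is established for bounded functions, not for growth \<open>\<phi>\<close>.
  The inverse is therefore reduced to the other side through
  \<open>(Id - BA)^{-1} = Id + B (Id - AB)^{-1} A\<close>; here \<open>w\<close> is
  \<open>(Id - AB)^{-1} A\<close> applied to \<open>g\<close>.\<close>

lemma invYX_solves:
  assumes g: "\<And>y. \<bar>g y\<bar> \<le> G * \<phi> y" "G \<ge> 0" "\<And>y. y \<notin> set_pmf s - {y1} \<Longrightarrow> g y = 0"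
  shows "IB g y = g y + BB (AA (IB g)) y" "\<exists>B\<ge>0. \<forall>y. \<bar>IB g y\<bar> \<le> B * \<phi> y"
proof -
  note g3 = growth1_3[OF g(1)]
  have Ag: "\<bar>AA g x\<bar> \<le> Q * G * S4" for x by (rule AX_bound3[OF g3 g(2)])
  obtain w where w: "\<And>x. w x = AA g x + AA (BB w) x" "\<And>x. \<bar>w x\<bar> \<le> Q * G * S4 / eps"
    using solution_exists[where f="AA g", OF Ag] by metis
  define W where "W = Q * G * S4 / eps"
  have W0: "W \<ge> 0" using w(2)[of undefined] unfolding W_def by linarith
  note wW = w(2)[folded W_def]
  define b where "b y = g y + BB w y" for y
  have b_eq: "b = (\<lambda>y. 1 * g y + 1 * BB w y)" by (auto simp: b_def)
  have Ab: "AA b x = w x" for x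
    unfolding b_eq using AX_lin[where b=g and c="BB w" and u=1 and v=1 and x=x, OF g3 g(2) bounded_growth3[OF AY_bound[OF wW]] W0] w(1)[of x] by simp
  have bg: "\<bar>b y\<bar> \<le> (G + W) * \<phi> y" for y
    using g(1)[of y] AY_bound[where a=w and y=y, OF wW] mult_left_mono[OF \<phi>_ge[of y] W0]
    unfolding b_def by (simp add: distrib_right)
  have "b \<in> linf_set (set_pmf s - {y1}) \<phi>"
    using bg g(2,3) W0 AY_off by (subst linf_set_iff) (auto simp: \<phi>_pos b_def intro!: exI[of _ "G + W"])
  moreover have "(\<lambda>y. b y - BB (AA b) y) = g"
    proof -
    have "AA b = w" using Ab by auto
    then show ?thesis by (auto simp: b_def)
  qed
  ultimately have "g \<in> (\<lambda>b y. b y - BB (AA b) y) ` linf_set (set_pmf s - {y1}) \<phi>" by (intro image_eqI[where x=b]) auto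
  from f_inv_into_f[OF this] inv_into_into[OF this]
  have "(\<lambda>y. IB g y - BB (AA (IB g)) y) = g" and i: "IB g \<in> linf_set (set_pmf s - {y1}) \<phi>"
    by (auto simp: invYX_def)
  then show "IB g y = g y + BB (AA (IB g)) y" by (metis add.commute diff_add_cancel)
  show "\<exists>B\<ge>0. \<forall>y. \<bar>IB g y\<bar> \<le> B * \<phi> y" using i by (subst (asm) linf_set_iff) (auto simp: \<phi>_pos)
qed

lemma BX_sum:
  assumes h: "h \<in> l1_set WY"
  shows "(\<lambda>y. k x y * (if y \<in> set_pmf s then h y else 0)) summable_on UNIV"
    "\<bar>FF h x\<bar> \<le> Q * nY h"
proof -
  have sm: "(\<lambda>y. Q * (WY y * \<bar>h y\<bar>)) summable_on UNIV"
    using h by (intro summable_on_cmult_right) (simp add: l1_set_def)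
  have le: "\<bar>k x y * (if y \<in> set_pmf s then h y else 0)\<bar> \<le> Q * (WY y * \<bar>h y\<bar>)" for y
  proof -
    have "\<bar>k x y * (if y \<in> set_pmf s then h y else 0)\<bar> \<le> k x y * \<bar>h y\<bar>"
      using k_nonneg[of x y] by (auto simp: abs_mult)
    also have "\<dots> \<le> (Q * WY y) * \<bar>h y\<bar>"
      using k_le[of x y] mult_left_mono[OF order_trans[OF \<phi>_le_pow[of 4 y] WY_ge(1)[of y]], of Q] Q_pos
      by (intro mult_right_mono) (auto intro: order_trans)
    finally show ?thesis by simp
  qed
  show "(\<lambda>y. k x y * (if y \<in> set_pmf s then h y else 0)) summable_on UNIV"
    by (rule summable_on_abs_le[OF sm le])
  have "nY h \<ge> 0" by (rule infsum_nonneg) (simp add: WY_pos less_imp_le)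
  then show "\<bar>FF h x\<bar> \<le> Q * nY h"
    using infsum_abs_le[OF sm le] Q_pos unfolding BX_eq infsum_cmult_right' by auto
qed

lemma BY_sum:
  assumes h: "h \<in> l1_set CX"
  shows "(\<lambda>x. k x y * (if x \<in> set_pmf r then h x else 0)) summable_on UNIV"
    "\<bar>GG h y\<bar> \<le> Q * nX h * \<phi> y"
proof -
  have sm: "(\<lambda>x. Q * \<phi> y * (CX x * \<bar>h x\<bar>)) summable_on UNIV"
    using h by (intro summable_on_cmult_right) (simp add: l1_set_def)
  have le: "\<bar>k x y * (if x \<in> set_pmf r then h x else 0)\<bar> \<le> Q * \<phi> y * (CX x * \<bar>h x\<bar>)" for x
  proof -
    have "\<bar>k x y * (if x \<in> set_pmf r then h x else 0)\<bar> \<le> k x y * \<bar>h x\<bar>"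
      using k_nonneg[of x y] by (auto simp: abs_mult)
    also have "\<dots> \<le> (Q * \<phi> y) * (CX x * \<bar>h x\<bar>)"
      using k_le[of x y] mult_right_mono[OF CX_ge[of x], of "\<bar>h x\<bar>"] k_nonneg[of x y]
      by (intro mult_mono) auto
    finally show ?thesis .
  qed
  show "(\<lambda>x. k x y * (if x \<in> set_pmf r then h x else 0)) summable_on UNIV"
    by (rule summable_on_abs_le[OF sm le])
  have "nX h \<ge> 0" by (rule infsum_nonneg) (simp add: CX_pos less_imp_le)
  then show "\<bar>GG h y\<bar> \<le> Q * nX h * \<phi> y"
    using infsum_abs_le[OF sm le] Q_pos \<phi>_pos[of y] unfolding BY_eq infsum_cmult_right'
    by (auto simp: mult_ac less_imp_le)
qed

lemma nX_nonneg: "nX h \<ge> 0" by (rule infsum_nonneg) (simp add: CX_pos less_imp_le)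
lemma nY_nonneg: "nY h \<ge> 0" by (rule infsum_nonneg) (simp add: WY_pos less_imp_le)

definition cA :: real where "cA = (Q + Q\<^sup>2 * S4) / eps"
definition cB :: real where "cB = Q + cA"

lemma cA_nonneg: "cA \<ge> 0" using Q_pos S4_nonneg eps_pos by (simp add: cA_def)

text \<open>The block matrix of inverses is traded for the system that it solves,
  \<open>a + A b = F h\<close> and \<open>b + B a = G h\<close>, the form in which the derivative is
  used from here on. The two inverses fit together because
  \<open>A (Id - BA)^{-1} = (Id - AB)^{-1} A\<close>.\<close>

lemma deriv_eqs:
  assumes hX: "hX \<in> l1_set CX" and hY: "hY \<in> l1_set WY"
  shows "da hX hY x = FF hY x - AA (db hX hY) x"
    "db hX hY y = GG hX y - BB (da hX hY) y"
    "\<bar>da hX hY x\<bar> \<le> cA * (nX hX + nY hY)"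
    "\<bar>db hX hY y\<bar> \<le> cB * (nX hX + nY hY) * \<phi> y"
proof -
  note f = BX_sum(2)[OF hY] and g = BY_sum(2)[OF hX]
  define u where "u = IA (FF hY)"
  define w where "w = IA (AA (GG hX))"
  define z where "z = IB (GG hX)"
  have G0: "Q * nX hX \<ge> 0" using Q_pos nX_nonneg by simp
  have off: "x \<notin> set_pmf r \<Longrightarrow> FF hY x = 0" "y \<notin> set_pmf s - {y1} \<Longrightarrow> GG hX y = 0" for x y
    unfolding BX_eq BY_eq by argo+
  have u: "u x = FF hY x + AA (BB u) x" "\<exists>A. \<forall>x. \<bar>u x\<bar> \<le> A" for x
    unfolding u_def using invXY_solves[where f="FF hY", OF f off(1)] by blast+
  note g3 = growth1_3[OF g]
  have Ag: "\<bar>AA (GG hX) x\<bar> \<le> Q * (Q * nX hX) * S4" for x by (rule AX_bound3[OF g3 G0])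
  have w: "w x = AA (GG hX) x + AA (BB w) x" "\<exists>A. \<forall>x. \<bar>w x\<bar> \<le> A" for x
    unfolding w_def using invXY_solves[where f="AA (GG hX)", OF Ag AX_off] by blast+
  have z: "z y = GG hX y + BB (AA z) y" "\<exists>B\<ge>0. \<forall>y. \<bar>z y\<bar> \<le> B * \<phi> y" for y
    unfolding z_def using invYX_solves[where g="GG hX", OF g G0 off(2)] by blast+
  obtain A A' B where A: "\<And>x. \<bar>u x\<bar> \<le> A" and A': "\<And>x. \<bar>w x\<bar> \<le> A'"
    and B: "\<And>y. \<bar>z y\<bar> \<le> B * \<phi> y" "B \<ge> 0"
    using u(2) w(2) z(2) by metis
  have A0: "A \<ge> 0" "A' \<ge> 0" using A[of undefined] A'[of undefined] by linarith+
  have Az: "\<bar>AA z x\<bar> \<le> Q * B * S4" for x by (rule AX_bound3[OF growth1_3[OF B(1)] B(2)])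
  \<comment> \<open>Both \<open>AA z\<close> and \<open>w\<close> solve the equation
    \<open>f = AA (GG hX) + AA (BB f)\<close>. Their difference solves the homogeneous equation and
    vanishes by \<open>linear_stability\<close>.\<close>
  define e where "e x = AA z x - w x" for x
  have e_bd: "\<bar>e x\<bar> \<le> Q * B * S4 + A'" for x
    using Az[of x] A'[of x] unfolding e_def by linarith
  have "\<bar>e x\<bar> \<le> (0 + Q * 0 * S4) / eps" for x
  proof (rule linear_stability[where b="\<lambda>y. - BB e y" and g="\<lambda>_. 0" and f="\<lambda>_. 0", OF e_bd])
    show "e x = 0 - AA (\<lambda>y. - BB e y) x" for x
    proof -
      have Z0: "Q * B * S4 \<ge> 0" using Az[of undefined] by linarith
      have 1: "AA z x = AA (GG hX) x + AA (BB (AA z)) x"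
      proof -
        have "z = (\<lambda>y. 1 * GG hX y + 1 * BB (AA z) y)" using z(1) by auto
        then show ?thesis
          using AX_lin[where b="GG hX" and c="BB (AA z)" and u=1 and v=1 and x=x, OF g3 G0 bounded_growth3[OF AY_bound[OF Az]] Z0] by simp
      qed
      have 2: "BB e = (\<lambda>y. 1 * BB (AA z) y + (- 1) * BB w y)"
      proof -
        have "e = (\<lambda>x. 1 * AA z x + (- 1) * w x)" by (auto simp: e_def)
        then show ?thesis using AY_lin[where a="AA z" and c=w and u=1 and v="- 1", OF Az A'] by auto
      qed
      have 3: "AA (\<lambda>y. (- 1) * BB (AA z) y + 1 * BB w y) x = (- 1) * AA (BB (AA z)) x + 1 * AA (BB w) x"
        by (rule AX_lin[OF bounded_growth3[OF AY_bound[OF Az]] Z0 bounded_growth3[OF AY_bound[OF A']] A0(2)])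
      have "(\<lambda>y. - BB e y) = (\<lambda>y. (- 1) * BB (AA z) y + 1 * BB w y)" unfolding 2 by auto
      then show ?thesis using 1 3 w(1)[of x] by (simp add: e_def)
    qed
  qed auto
  then have "AA z = w" unfolding e_def by fastforce
  then have zw: "z y = GG hX y + BB w y" for y using z(1) by simp
  have da: "da hX hY = (\<lambda>x. 1 * u x + (- 1) * w x)" by (auto simp: deriv_a_def u_def w_def)
  have Bda: "BB (da hX hY) y = BB u y - BB w y" for y
    unfolding da using AY_lin[where a=u and c=w and u=1 and v="- 1" and y=y, OF A A'] by simp
  show db: "db hX hY y = GG hX y - BB (da hX hY) y" for y
  proof (cases "y = y1")
    case True
    then show ?thesis by (simp add: deriv_b_def AY_off off)
  next
    case False
    then show ?thesis unfolding Bda by (simp add: deriv_b_def u_def[symmetric] z_def[symmetric] zw)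
  qed
  have dab: "\<bar>da hX hY x\<bar> \<le> A + A'" for x
    using A[of x] A'[of x] unfolding da by linarith
  show daf: "da hX hY x = FF hY x - AA (db hX hY) x" for x
  proof -
    have 1: "AA (db hX hY) x = AA (GG hX) x - AA (BB (da hX hY)) x"
    proof -
      have "db hX hY = (\<lambda>y. 1 * GG hX y + (- 1) * BB (da hX hY) y)" using db by auto
      then show ?thesis using AX_lin[where b="GG hX" and c="BB (da hX hY)" and u=1 and v="- 1" and x=x, OF g3 G0 bounded_growth3[OF AY_bound[OF dab]]] A0 by simp
    qed
    have 2: "AA (BB (da hX hY)) x = AA (BB u) x - AA (BB w) x"
    proof -
      have "BB (da hX hY) = (\<lambda>y. 1 * BB u y + (- 1) * BB w y)" using Bda by auto
      then show ?thesis
        using AX_lin[where b="BB u" and c="BB w" and u=1 and v="- 1" and x=x, OF bounded_growth3[OF AY_bound[OF A]] A0(1) bounded_growth3[OF AY_bound[OF A']] A0(2)] by simp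
    qed
    show ?thesis using u(1)[of x] w(1)[of x] unfolding 1 2 by (simp add: da)
  qed
  have "\<bar>da hX hY x\<bar> \<le> (Q * nY hY + Q * (Q * nX hX) * S4) / eps" for x
    by (rule linear_stability[OF dab g3 G0 f db daf])
  also have "\<dots> \<le> cA * (nX hX + nY hY)"
  proof -
    have "Q * nY hY + Q * (Q * nX hX) * S4 \<le> (Q + Q\<^sup>2 * S4) * (nX hX + nY hY)"
      using Q_pos S4_nonneg nX_nonneg[of hX] nY_nonneg[of hY]
      by (simp add: algebra_simps power2_eq_square)
    then show ?thesis using eps_pos by (simp add: cA_def divide_right_mono)
  qed
  finally show dac: "\<bar>da hX hY x\<bar> \<le> cA * (nX hX + nY hY)" for x .
  show "\<bar>db hX hY y\<bar> \<le> cB * (nX hX + nY hY) * \<phi> y"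
  proof -
    have n0: "cA * (nX hX + nY hY) \<ge> 0" using dac[of undefined] by linarith
    have "\<bar>db hX hY y\<bar> \<le> Q * nX hX * \<phi> y + cA * (nX hX + nY hY)"
      using g[of y] AY_bound[where a="da hX hY" and y=y, OF dac] unfolding db[of y] by linarith
    also have "\<dots> \<le> Q * (nX hX + nY hY) * \<phi> y + cA * (nX hX + nY hY) * \<phi> y"
      using Q_pos nX_nonneg[of hX] nY_nonneg[of hY] \<phi>_pos[of y] mult_left_mono[OF \<phi>_ge[of y] n0]
      by (intro add_mono mult_right_mono mult_left_mono) auto
    finally show ?thesis by (simp add: cB_def algebra_simps)
  qed
qed

end

section \<open>The quadratic remainder\<close>

text \<open>The factor \<open>max 1 (exp (- t))\<close> avoids any smallness of \<open>t\<close>: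
  multiplied by \<open>k\<close> it becomes the larger of the two densities \<open>k\<close> and
  \<open>k'\<close>, which has a uniform bound even where \<open>t\<close> grows like
  \<open>\<phi>\<close>.\<close>

lemma exp_remainder: "\<bar>exp (- t) - 1 + t\<bar> \<le> t\<^sup>2 * max 1 (exp (- t :: real))"
proof -
  have lo: "exp (- t) - 1 + t \<ge> 0" using exp_ge_add_one_self[of "- t"] by simp
  show ?thesis
  proof (cases "t \<ge> 0")
    case True
    have "1 - exp (- t) \<le> t" using exp_ge_add_one_self[of "- t"] by simp
    moreover have "exp (- t) - 1 + t \<le> t * (1 - exp (- t))"
    proof -
      have "(1 + t) * exp (- t) \<le> exp t * exp (- t)"
        using exp_ge_add_one_self[of t] by (intro mult_right_mono) auto
      then show ?thesis by (simp add: algebra_simps exp_minus)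
    qed
    ultimately have "exp (- t) - 1 + t \<le> t * t"
      using mult_left_mono[of "1 - exp (- t)" t t] True by linarith
    moreover have "t * t \<le> t\<^sup>2 * max 1 (exp (- t))"
      using mult_left_mono[of 1 "max 1 (exp (- t))" "t\<^sup>2"] by (simp add: power2_eq_square)
    ultimately show ?thesis using lo by simp
  next
    case False
    define u where "u = - t"
    have u: "u \<ge> 0" using False by (simp add: u_def)
    have "(1 - u) * exp u \<le> exp (- u) * exp u"
      using exp_ge_add_one_self[of "- u"] by (intro mult_right_mono) auto
    then have 1: "exp u - 1 \<le> u * exp u" by (simp add: algebra_simps exp_minus)
    have "1 \<le> exp u" using u by simp
    then have "u \<le> u * exp u" using mult_left_mono[of 1 "exp u" u] u by simp
    have "(exp u - 1) - u \<le> u * exp u - u" using 1 by simp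
    also have "\<dots> = u * (exp u - 1)" by (simp add: algebra_simps)
    also have "\<dots> \<le> u * (u * exp u)" by (rule mult_left_mono[OF 1 u])
    finally have "exp u - 1 - u \<le> u * u * exp u" by simp
    moreover have "u * u * exp u \<le> t\<^sup>2 * max 1 (exp (- t))"
      by (simp add: u_def power2_eq_square mult_left_mono)
    ultimately show ?thesis using lo by (simp add: u_def)
  qed
qed

text \<open>By the mean value theorem \<open>(1 - exp (- t)) / t\<close> lies between
  \<open>1\<close> and \<open>exp (- t)\<close>. Hence \<open>k * w t\<close> lies between the two
  densities and inherits their bounds, while \<open>k * w t * t\<close> is exactly their
  difference.\<close>

lemma exp_divided_difference:
  obtains w :: "real \<Rightarrow> real" where "\<And>t. w t * t = 1 - exp (- t)"
    "\<And>t. min 1 (exp (- t)) \<le> w t" "\<And>t. w t \<le> max 1 (exp (- t))"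
proof -
  define w where "w t = (if t = 0 then 1 else (1 - exp (- t)) / t)" for t :: real
  have a: "1 - exp (- t) \<le> t" for t :: real using exp_ge_add_one_self[of "- t"] by simp
  have b: "t * exp (- t) \<le> 1 - exp (- t)" for t :: real
  proof -
    have "(1 + t) * exp (- t) \<le> exp t * exp (- t)"
      using exp_ge_add_one_self[of t] by (intro mult_right_mono) auto
    then show ?thesis by (simp add: algebra_simps exp_minus)
  qed
  show thesis
  proof (rule that[of w])
    show "w t * t = 1 - exp (- t)" for t by (simp add: w_def)
    show "min 1 (exp (- t)) \<le> w t" for t
    proof (cases t "0 :: real" rule: linorder_cases)
      case less
      then show ?thesis using a[of t] by (simp add: w_def min_def le_divide_eq)
    next
      case greater
      then show ?thesis using b[of t] by (simp add: w_def min_def le_divide_eq mult.commute)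
    qed (simp add: w_def)
    show "w t \<le> max 1 (exp (- t))" for t
    proof (cases t "0 :: real" rule: linorder_cases)
      case less
      then show ?thesis using b[of t] by (simp add: w_def max_def divide_le_eq mult.commute)
    next
      case greater
      then show ?thesis using a[of t] by (simp add: w_def max_def divide_le_eq)
    qed (simp add: w_def)
  qed
qed

context plan_density begin

definition "wsum = weight_sum CX CY"

lemma wsum_le: "wsum (x, y) \<le> 2 * (CX x * CY y)" "wsum (x, y) > 0"
proof -
  have "CX x * 1 \<le> CX x * CY y" "1 * CY y \<le> CX x * CY y"
    using CX_ge[of x] CY_ge[of y] by (intro mult_left_mono mult_right_mono; simp)+
  then show "wsum (x, y) \<le> 2 * (CX x * CY y)" by (simp add: wsum_def weight_sum_def)
  show "wsum (x, y) > 0" using CX_ge[of x] CY_ge[of y] by (simp add: wsum_def weight_sum_def)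
qed

text \<open>Introducing the constants by equations makes visible that they do not depend on the
  perturbed marginals. The bound is pointwise, by a product \<open>U x * V y\<close> whose sums stay
  bounded; for this the perturbations enter \<open>U\<close> and \<open>V\<close> divided by their
  size \<open>N\<close>. \<open>\<alpha>\<close> and \<open>\<beta>\<close> are the decreases of the
  log-potentials, shifted so that \<open>\<beta> y1 = 0\<close>.\<close>

lemma frechet_bound:
  fixes k' :: "'x \<Rightarrow> 'y \<Rightarrow> real" and r' :: "'x pmf" and s' :: "'y pmf"
  assumes k'_le: "\<And>x y. k' x y \<le> Q * \<phi> y" and k'_ge: "\<And>x y. 1 / (Q * \<phi> y) \<le> k' x y"
    and ks': "\<And>x. ((\<lambda>y. k' x y * pmf s' y) has_sum 1) UNIV"
    and kr': "\<And>y. ((\<lambda>x. k' x y * pmf r' x) has_sum 1) UNIV"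
    and k': "\<And>x y. k' x y = k x y * exp (- (\<alpha> x + \<beta> y))"
    and \<alpha>: "\<And>x. \<bar>\<alpha> x\<bar> \<le> M0" and \<beta>: "\<beta> y1 = 0"
    and supp: "set_pmf r' \<subseteq> set_pmf r" "set_pmf s' \<subseteq> set_pmf s"
    and rsum': "(\<lambda>x. CX x * pmf r' x) summable_on UNIV"
    and ssum': "(\<lambda>y. WY y * pmf s' y) summable_on UNIV"
    and hX: "hX = (\<lambda>x. pmf r' x - pmf r x)" and hY: "hY = (\<lambda>y. pmf s' y - pmf s y)"
    and N: "N = nX hX + nY hY" and small: "N \<le> 1" "N \<le> pmf s y1 / 2"
    and S_def: "S = S4 + 1"
    and e1_def: "e1 = pmf s y1 / (2 * Q * \<phi> y1)"
    and C2_def: "C2 = (Q + Q\<^sup>2 * S) / e1 * (Q * S) / e1"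
    and C4_def: "C4 = 2 * C2 + Q"
    and C5_def: "C5 = Q * C4 + Q * C4\<^sup>2 * (S + 1)"
    and C6_def: "C6 = (C5 + Q * C5 * S4) / eps"
    and E_def: "E = Q * C4\<^sup>2 + Q * C4 + Q * (2 * C6 + C5) + Q"
    and U_def: "U = (\<lambda>x. CX x * (pmf r x + pmf r' x + \<bar>hX x\<bar> / N))"
    and V_def: "V = (\<lambda>y. WY y * (pmf s y + pmf s' y + \<bar>hY y\<bar> / N))"
    and Npos: "N > 0"
  shows "wsum (x, y) * \<bar>k' x y * pmf r' x * pmf s' y - pmf \<pi> (x, y) - DD hX hY (x, y)\<bar>
    \<le> 2 * E * N\<^sup>2 * (U x * V y)"
proof -
  have k'_pos: "k' x y > 0" for x y using k_pos[of x y] by (simp add: k')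
  have sX: "(\<lambda>x. CX x * \<bar>hX x\<bar>) summable_on UNIV"
    by (rule summable_on_abs_le[OF summable_on_add[OF rsum rsum']])
       (use CX_pos pmf_nonneg in \<open>auto simp: hX abs_mult less_imp_le distrib_left[symmetric] abs_le_iff intro!: mult_left_mono\<close>)
  have sY: "(\<lambda>y. WY y * \<bar>hY y\<bar>) summable_on UNIV"
    by (rule summable_on_abs_le[OF summable_on_add[OF ssum ssum']])
       (use WY_pos pmf_nonneg in \<open>auto simp: hY abs_mult less_imp_le distrib_left[symmetric] CY_pos \<phi>_pos abs_le_iff intro!: mult_left_mono\<close>)
  have hXl: "hX \<in> l1_set CX" and hYl: "hY \<in> l1_set WY" using sX sY by (auto simp: l1_set_def)
  have NX: "nX hX \<le> N" and NY: "nY hY \<le> N" using nX_nonneg[of hX] nY_nonneg[of hY] by (auto simp: N)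
  have N0: "N \<ge> 0" using Npos by simp
  have S0: "S \<ge> 1" using S4_nonneg by (simp add: S_def)
  have e1: "e1 > 0" using y1 Q_pos \<phi>_pos by (simp add: e1_def pmf_positive)
  have C2: "C2 \<ge> 0" using Q_pos S0 e1 by (simp add: C2_def)
  have C4: "C4 \<ge> 0" "C2 \<le> C4" using C2 Q_pos by (auto simp: C4_def)

  \<comment> \<open>Sums against the perturbations and the perturbed marginals\<close>
  have sumhX: "(\<lambda>x. g x * \<bar>hX x\<bar>) summable_on UNIV \<and> (\<Sum>\<^sub>\<infinity>x. g x * \<bar>hX x\<bar>) \<le> G * N"
    if "\<And>x. 0 \<le> g x" "\<And>x. g x \<le> G" for g G
  proof -
    have le: "\<bar>g x * \<bar>hX x\<bar>\<bar> \<le> G * (CX x * \<bar>hX x\<bar>)" for x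
    proof -
      have "g x \<le> G * CX x" using that[of x] mult_left_mono[OF CX_ge[of x], of G] by linarith
      from mult_right_mono[OF this, of "\<bar>hX x\<bar>"] show ?thesis using that(1)[of x] by (simp add: abs_mult mult.assoc)
    qed
    have G0: "G \<ge> 0" using that[of undefined] by linarith
    have "\<bar>\<Sum>\<^sub>\<infinity>x. g x * \<bar>hX x\<bar>\<bar> \<le> G * nX hX"
      using infsum_abs_le[OF summable_on_cmult_right[OF sX] le] unfolding infsum_cmult_right' .
    also have "\<dots> \<le> G * N" by (rule mult_left_mono[OF NX G0])
    finally show ?thesis using summable_on_abs_le[OF summable_on_cmult_right[OF sX] le] by auto
  qed
  have sumhY: "(\<lambda>y. g y * \<bar>hY y\<bar>) summable_on UNIV \<and> (\<Sum>\<^sub>\<infinity>y. g y * \<bar>hY y\<bar>) \<le> G * N"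
    if "\<And>y. 0 \<le> g y" "\<And>y. g y \<le> G * \<phi> y ^ 4" for g G
  proof -
    have G0: "G \<ge> 0" using that[of undefined] \<phi>_pos[of undefined]
      by (meson order_trans zero_le_mult_iff zero_less_power leD)
    have le: "\<bar>g y * \<bar>hY y\<bar>\<bar> \<le> G * (WY y * \<bar>hY y\<bar>)" for y
    proof -
      have "g y \<le> G * WY y" using that(2)[of y] mult_left_mono[OF WY_ge(1)[of y] G0] by linarith
      from mult_right_mono[OF this, of "\<bar>hY y\<bar>"] show ?thesis using that(1)[of y] by (simp add: abs_mult mult.assoc)
    qed
    have "\<bar>\<Sum>\<^sub>\<infinity>y. g y * \<bar>hY y\<bar>\<bar> \<le> G * nY hY"
      using infsum_abs_le[OF summable_on_cmult_right[OF sY] le] unfolding infsum_cmult_right' .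
    also have "\<dots> \<le> G * N" by (rule mult_left_mono[OF NY G0])
    finally show ?thesis using summable_on_abs_le[OF summable_on_cmult_right[OF sY] le] by auto
  qed
  \<comment> \<open>The fourth moment of \<open>\<phi>\<close> under \<open>s'\<close> exceeds
    \<open>S4\<close> by at most \<open>N \<le> 1\<close>, whence \<open>S = S4 + 1\<close>.\<close>
  have s4': "(\<lambda>y. \<phi> y ^ 4 * pmf s' y) summable_on UNIV" and S4': "(\<Sum>\<^sub>\<infinity>y. \<phi> y ^ 4 * pmf s' y) \<le> S"
  proof -
    have p4: "0 \<le> \<phi> y ^ 4" for y using \<phi>_pos[of y] by simp
    have h: "(\<lambda>y. \<phi> y ^ 4 * \<bar>hY y\<bar>) summable_on UNIV" "(\<Sum>\<^sub>\<infinity>y. \<phi> y ^ 4 * \<bar>hY y\<bar>) \<le> 1 * N"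
      using sumhY[of "\<lambda>y. \<phi> y ^ 4" 1] p4 by auto
    have le: "\<bar>\<phi> y ^ 4 * pmf s' y\<bar> \<le> \<phi> y ^ 4 * pmf s y + \<phi> y ^ 4 * \<bar>hY y\<bar>" for y
      using p4[of y] by (auto simp: hY abs_mult distrib_left[symmetric] intro!: mult_left_mono)
    show "(\<lambda>y. \<phi> y ^ 4 * pmf s' y) summable_on UNIV"
      by (rule summable_on_abs_le[OF summable_on_add[OF s4 h(1)] le])
    have "\<bar>\<Sum>\<^sub>\<infinity>y. \<phi> y ^ 4 * pmf s' y\<bar> \<le> S4 + (\<Sum>\<^sub>\<infinity>y. \<phi> y ^ 4 * \<bar>hY y\<bar>)"
      using infsum_abs_le[OF summable_on_add[OF s4 h(1)] le] unfolding infsum_add[OF s4 h(1)] S4_def .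
    then show "(\<Sum>\<^sub>\<infinity>y. \<phi> y ^ 4 * pmf s' y) \<le> S" using h(2) small(1) by (simp add: S_def)
  qed
  have sums': "(\<lambda>y. g y * pmf s' y) summable_on UNIV \<and> (\<Sum>\<^sub>\<infinity>y. g y * pmf s' y) \<le> G * S"
    if "\<And>y. 0 \<le> g y" "\<And>y. g y \<le> G * \<phi> y ^ 4" for g G
  proof -
    have G0: "G \<ge> 0" using that[of undefined] \<phi>_pos[of undefined]
      by (meson order_trans zero_le_mult_iff zero_less_power leD)
    have le: "\<bar>g y * pmf s' y\<bar> \<le> G * (\<phi> y ^ 4 * pmf s' y)" for y
      using mult_right_mono[OF that(2)[of y], of "pmf s' y"] that(1)[of y] by (simp add: abs_mult mult.assoc)
    have "\<bar>\<Sum>\<^sub>\<infinity>y. g y * pmf s' y\<bar> \<le> G * (\<Sum>\<^sub>\<infinity>y. \<phi> y ^ 4 * pmf s' y)"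
      using infsum_abs_le[OF summable_on_cmult_right[OF s4'] le] unfolding infsum_cmult_right' .
    also have "\<dots> \<le> G * S" by (rule mult_left_mono[OF S4' G0])
    finally show ?thesis using summable_on_abs_le[OF summable_on_cmult_right[OF s4'] le] by auto
  qed
  \<comment> \<open>Since \<open>N \<le> pmf s y1 / 2\<close>, the perturbed mass at
    \<open>y1\<close> is at least half of the original one; accordingly \<open>e1\<close> is
    \<open>eps / 2\<close>.\<close>
  have sY1: "e1 \<le> pmf s' y1 / (Q * \<phi> y1)"
  proof -
    have "infsum (\<lambda>y. WY y * \<bar>hY y\<bar>) {y1} \<le> nY hY"
      by (rule infsum_mono2) (use sY WY_pos in \<open>auto simp: less_imp_le CY_pos \<phi>_pos\<close>)
    then have "WY y1 * \<bar>hY y1\<bar> \<le> N" using NY by simp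
    moreover have "\<bar>hY y1\<bar> \<le> WY y1 * \<bar>hY y1\<bar>" using mult_right_mono[OF WY_ge(2)[of y1], of "\<bar>hY y1\<bar>"] by simp
    ultimately have "pmf s y1 / 2 \<le> pmf s' y1" using small(2) unfolding hY by linarith
    then show ?thesis using Q_pos \<phi>_pos[of y1] by (simp add: e1_def field_simps)
  qed

  \<comment> \<open>Linear bounds for the change of the log-potentials\<close>
  define t where "t x y = \<alpha> x + \<beta> y" for x y
  \<comment> \<open>The column equations bound \<open>\<beta>\<close> by \<open>\<alpha>\<close>:
    \<open>exp (\<beta> y)\<close> is the sum of \<open>exp (- \<alpha> x)\<close> against
    \<open>k x y * pmf r' x\<close>, whose mass is \<open>1\<close> up to the pairing of
    \<open>k\<close> with \<open>hX\<close>. The coefficient of \<open>A\<close> has to be exactly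
    \<open>1\<close>, because it is what the row equations then contract.\<close>
  have \<beta>_bd: "\<bar>\<beta> y\<bar> \<le> A + Q * \<phi> y * N" if A: "\<And>x. \<bar>\<alpha> x\<bar> \<le> A" for A y
  proof -
    have kk: "0 \<le> kk x y \<and> kk x y \<le> Q * \<phi> y" if "kk = k \<or> kk = k'" for kk x
      using that k_pos[of x y] k'_pos[of x y] k_le[of x y] k'_le[of x y] by auto
    have dsum: "(\<lambda>x. kk x y * hX x) summable_on UNIV \<and> \<bar>\<Sum>\<^sub>\<infinity>x. kk x y * hX x\<bar> \<le> Q * \<phi> y * N"
      if "kk = k \<or> kk = k'" for kk
    proof -
      have h: "(\<lambda>x. kk x y * \<bar>hX x\<bar>) summable_on UNIV" "(\<Sum>\<^sub>\<infinity>x. kk x y * \<bar>hX x\<bar>) \<le> Q * \<phi> y * N"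
        using sumhX[of "\<lambda>x. kk x y" "Q * \<phi> y"] kk[OF that] by auto
      have le: "\<bar>kk x y * hX x\<bar> \<le> kk x y * \<bar>hX x\<bar>" for x using kk[OF that] by (simp add: abs_mult)
      show ?thesis using summable_on_abs_le[OF h(1) le] infsum_abs_le[OF h(1) le] h(2) by auto
    qed
    have 1: "((\<lambda>x. k x y * pmf r' x) has_sum (1 + (\<Sum>\<^sub>\<infinity>x. k x y * hX x))) UNIV"
      using has_sum_add[OF kr[of y] has_sum_infsum[OF conjunct1[OF dsum[of k]]]]
      by (simp add: hX algebra_simps)
    have 2: "((\<lambda>x. k' x y * pmf r x) has_sum (1 + - (\<Sum>\<^sub>\<infinity>x. k' x y * hX x))) UNIV"
      using has_sum_add[OF kr'[of y] has_sum_uminusI[OF has_sum_infsum[OF conjunct1[OF dsum[of k']]]]]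
      by (simp add: hX algebra_simps)
    \<comment> \<open>The inequality \<open>1 + z \<le> exp z\<close> passes to exponents without
      any sign condition on \<open>1 + z\<close>.\<close>
    have ex: "exp t \<le> exp (A + z)" if "exp t \<le> exp A * (1 + z)" for t z :: real
      unfolding exp_add by (rule order_trans[OF that mult_left_mono[OF exp_ge_add_one_self]]) simp
    have "exp (\<beta> y) \<le> exp A * (1 + (\<Sum>\<^sub>\<infinity>x. k x y * hX x))"
    proof (rule has_sum_mono)
      show "((\<lambda>x. exp (\<beta> y) * (k' x y * pmf r' x)) has_sum exp (\<beta> y)) UNIV"
        using has_sum_cmult_right[OF kr'[of y], of "exp (\<beta> y)"] by simp
      show "((\<lambda>x. exp A * (k x y * pmf r' x)) has_sum exp A * (1 + (\<Sum>\<^sub>\<infinity>x. k x y * hX x))) UNIV"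
        by (rule has_sum_cmult_right[OF 1])
      show "exp (\<beta> y) * (k' x y * pmf r' x) \<le> exp A * (k x y * pmf r' x)" for x
      proof -
        have "exp (\<beta> y) * k' x y = exp (- \<alpha> x) * k x y"
          by (simp add: k' mult_exp_exp mult.left_commute)
        also have "\<dots> \<le> exp A * k x y" using A[of x] k_nonneg[of x y] by (intro mult_right_mono) auto
        finally show ?thesis using mult_right_mono[of _ _ "pmf r' x"] by (simp add: mult.assoc[symmetric])
      qed
    qed
    then have u: "\<beta> y \<le> A + (\<Sum>\<^sub>\<infinity>x. k x y * hX x)" using ex by auto
    have "exp (- \<beta> y) \<le> exp A * (1 + - (\<Sum>\<^sub>\<infinity>x. k' x y * hX x))"
    proof (rule has_sum_mono)
      show "((\<lambda>x. exp (- \<beta> y) * (k x y * pmf r x)) has_sum exp (- \<beta> y)) UNIV"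
        using has_sum_cmult_right[OF kr[of y], of "exp (- \<beta> y)"] by simp
      show "((\<lambda>x. exp A * (k' x y * pmf r x)) has_sum exp A * (1 + - (\<Sum>\<^sub>\<infinity>x. k' x y * hX x))) UNIV"
        by (rule has_sum_cmult_right[OF 2])
      show "exp (- \<beta> y) * (k x y * pmf r x) \<le> exp A * (k' x y * pmf r x)" for x
      proof -
        have "exp (- \<beta> y) * k x y = exp (\<alpha> x) * k' x y"
          by (simp add: k' mult_exp_exp mult.left_commute)
        also have "\<dots> \<le> exp A * k' x y" using A[of x] k'_pos[of x y] by (intro mult_right_mono) auto
        finally show ?thesis using mult_right_mono[of _ _ "pmf r x"] by (simp add: mult.assoc[symmetric])
      qed
    qed
    then have l: "- \<beta> y \<le> A + - (\<Sum>\<^sub>\<infinity>x. k' x y * hX x)"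
      using ex[of "- \<beta> y" "- (\<Sum>\<^sub>\<infinity>x. k' x y * hX x)"] by simp
    show ?thesis using u l dsum[of k] dsum[of k'] by (simp add: abs_le_iff)
  qed
  obtain w :: "real \<Rightarrow> real" where w: "\<And>t. w t * t = 1 - exp (- t)" "\<And>t. min 1 (exp (- t)) \<le> w t"
    "\<And>t. w t \<le> max 1 (exp (- t))" using exp_divided_difference by blast
  \<comment> \<open>With the divided difference the nonlinear row equations become exactly linear:
    \<open>\<kappa> * t = k - k'\<close>, with \<open>\<kappa>\<close> squeezed between
    \<open>k\<close> and \<open>k'\<close>. No smallness of \<open>t\<close> is presupposed.\<close>
  define \<kappa> where "\<kappa> x y = k x y * w (t x y)" for x y
  have kt: "\<kappa> x y * t x y = k x y - k' x y" for x y
    using arg_cong[OF w(1)[of "t x y"], of "\<lambda>z. k x y * z"]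
    by (simp add: \<kappa>_def k' t_def[symmetric] algebra_simps)
  have kmax: "k x y * max 1 (exp (- t x y)) \<le> Q * \<phi> y" for x y
    using k_le[of x y] k'_le[of x y] by (simp add: k' t_def max_def)
  have \<kappa>_le: "\<kappa> x y \<le> Q * \<phi> y" for x y
    using mult_left_mono[OF w(3)[of "t x y"] k_nonneg[of x y]] kmax[of x y] by (simp add: \<kappa>_def)
  have \<kappa>_ge: "1 / (Q * \<phi> y) \<le> \<kappa> x y" for x y
  proof -
    have "1 / (Q * \<phi> y) \<le> k x y * min 1 (exp (- t x y))"
      using k_ge[of y x] k'_ge[of y x] by (simp add: k' t_def min_def)
    also have "\<dots> \<le> \<kappa> x y" using mult_left_mono[OF w(2)[of "t x y"] k_nonneg[of x y]] by (simp add: \<kappa>_def)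
    finally show ?thesis .
  qed
  have \<kappa>0: "\<kappa> x y \<ge> 0" for x y
    by (rule order_trans[OF _ \<kappa>_ge[of y x]]) (use Q_pos \<phi>_pos[of y] in simp)
  \<comment> \<open>Rows of \<open>k\<close> sum to \<open>1\<close> under \<open>s\<close> and rows
    of \<open>k'\<close> under \<open>s'\<close>, so pairing \<open>k - k'\<close> with
    \<open>s'\<close> leaves only the pairing of \<open>k\<close> with \<open>hY\<close>, which is
    of size \<open>N\<close>.\<close>
  have f_eq: "(\<lambda>y. (k x y - k' x y) * pmf s' y) summable_on UNIV"
    "(\<Sum>\<^sub>\<infinity>y. (k x y - k' x y) * pmf s' y) = (\<Sum>\<^sub>\<infinity>y. k x y * hY y)"
    "\<bar>\<Sum>\<^sub>\<infinity>y. k x y * hY y\<bar> \<le> Q * N" "(\<lambda>y. k x y * hY y) summable_on UNIV" for x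
  proof -
    have g4: "Q * \<phi> y \<le> Q * \<phi> y ^ 4" for y using Q_pos \<phi>_le_pow[of 4 y] by simp
    have h: "(\<lambda>y. k x y * \<bar>hY y\<bar>) summable_on UNIV" "(\<Sum>\<^sub>\<infinity>y. k x y * \<bar>hY y\<bar>) \<le> Q * N"
      using sumhY[of "\<lambda>y. k x y" Q] k_nonneg order_trans[OF k_le g4] by auto
    have le: "\<bar>k x y * hY y\<bar> \<le> k x y * \<bar>hY y\<bar>" for y using k_nonneg[of x y] by (simp add: abs_mult)
    show hs: "(\<lambda>y. k x y * hY y) summable_on UNIV" by (rule summable_on_abs_le[OF h(1) le])
    show "\<bar>\<Sum>\<^sub>\<infinity>y. k x y * hY y\<bar> \<le> Q * N" using infsum_abs_le[OF h(1) le] h(2) by linarith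
    have "((\<lambda>y. (k x y * hY y + k x y * pmf s y) + - (k' x y * pmf s' y)) has_sum ((\<Sum>\<^sub>\<infinity>y. k x y * hY y) + 1) + - 1) UNIV"
      by (intro has_sum_add has_sum_infsum hs ks has_sum_uminusI ks')
    then have "((\<lambda>y. (k x y - k' x y) * pmf s' y) has_sum (\<Sum>\<^sub>\<infinity>y. k x y * hY y)) UNIV"
      by (simp add: hY algebra_simps)
    then show "(\<lambda>y. (k x y - k' x y) * pmf s' y) summable_on UNIV"
      "(\<Sum>\<^sub>\<infinity>y. (k x y - k' x y) * pmf s' y) = (\<Sum>\<^sub>\<infinity>y. k x y * hY y)"
      by (auto simp: has_sum_iff)
  qed
  have \<alpha>_bd: "\<bar>\<alpha> x\<bar> \<le> C2 * N" for x
  proof -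
    \<comment> \<open>The weights \<open>\<kappa> x y * pmf s' y\<close> have a total mass
      \<open>Z\<close> between \<open>e1\<close> and \<open>Q * S\<close>, not \<open>1\<close>.
      Division by \<open>Z\<close> leaves the factor \<open>1 - e1 / Z\<close>, which is at most
      \<open>1 - \<epsilon>\<close> for \<open>\<epsilon> = e1 / (Q * S)\<close>; \<open>C2\<close>
      is \<open>(Q + Q\<^sup>2 * S) / e1\<close> divided by this gap.\<close>
    define \<epsilon> where "\<epsilon> = e1 / (Q * S)"
    define F where "F = (Q + Q\<^sup>2 * S) * N / e1"
    have QS: "Q * S > 0" using Q_pos S0 by simp
    have F0: "F \<ge> 0" using Q_pos S0 N0 e1 by (simp add: F_def)
    have main: "e1 \<le> Z \<and> Z \<le> Q * S \<and> \<bar>\<alpha> x\<bar> * Z \<le> (Q + Q\<^sup>2 * S) * N + (Z - e1) * A"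
      if A: "\<And>x. \<bar>\<alpha> x\<bar> \<le> A" and Z: "Z = (\<Sum>\<^sub>\<infinity>y. \<kappa> x y * pmf s' y)" for A x Z
    proof -
      have A0: "A \<ge> 0" using A[of undefined] by linarith
      have g4: "Q * \<phi> y \<le> Q * \<phi> y ^ 4" for y using Q_pos \<phi>_le_pow[of 4 y] by simp
      have zs: "(\<lambda>y. \<kappa> x y * pmf s' y) summable_on UNIV" and "Z \<le> Q * S"
        using sums'[of "\<lambda>y. \<kappa> x y" Q] \<kappa>0 order_trans[OF \<kappa>_le g4] Z by auto
      have e1k: "e1 \<le> \<kappa> x y1 * pmf s' y1"
        using sY1 mult_right_mono[OF \<kappa>_ge[of y1 x], of "pmf s' y1"] by simp
      have "infsum (\<lambda>y. \<kappa> x y * pmf s' y) {y1} \<le> Z" unfolding Z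
        by (rule infsum_mono2) (use zs \<kappa>0 in auto)
      then have "e1 \<le> Z" using e1k by simp
      \<comment> \<open>At \<open>y1\<close> the summand \<open>A\<close> is missing because
        \<open>\<beta> y1 = 0\<close>. This is where the gap \<open>e1\<close> comes from.\<close>
      have b_y: "\<bar>\<beta> y\<bar> \<le> (if y = y1 then 0 else A) + Q * \<phi> y * N" for y
        using \<beta>_bd[OF A, of y] \<beta> Q_pos \<phi>_pos[of y] N0 by (auto simp: less_imp_le)
      have ph: "(\<lambda>y. (\<kappa> x y * (Q * \<phi> y)) * pmf s' y) summable_on UNIV"
        "(\<Sum>\<^sub>\<infinity>y. (\<kappa> x y * (Q * \<phi> y)) * pmf s' y) \<le> Q\<^sup>2 * S"
      proof -
        have "\<kappa> x y * (Q * \<phi> y) \<le> Q\<^sup>2 * \<phi> y ^ 4" for y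
        proof -
          have "\<kappa> x y * (Q * \<phi> y) \<le> (Q * \<phi> y) * (Q * \<phi> y)"
            by (intro mult_right_mono \<kappa>_le) (use Q_pos \<phi>_pos[of y] in simp)
          also have "\<dots> = Q\<^sup>2 * \<phi> y ^ 2" by (simp add: power2_eq_square)
          also have "\<dots> \<le> Q\<^sup>2 * \<phi> y ^ 4" by (intro mult_left_mono \<phi>_mono) auto
          finally show ?thesis .
        qed
        moreover have "0 \<le> \<kappa> x y * (Q * \<phi> y)" for y using \<kappa>0[of x y] Q_pos \<phi>_pos[of y] by simp
        ultimately show "(\<lambda>y. (\<kappa> x y * (Q * \<phi> y)) * pmf s' y) summable_on UNIV"
          "(\<Sum>\<^sub>\<infinity>y. (\<kappa> x y * (Q * \<phi> y)) * pmf s' y) \<le> Q\<^sup>2 * S"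
          using sums'[of "\<lambda>y. \<kappa> x y * (Q * \<phi> y)" "Q\<^sup>2"] by auto
      qed
      define g where "g y = (\<kappa> x y * pmf s' y * A + - (if y = y1 then \<kappa> x y1 * pmf s' y1 * A else 0))
          + N * ((\<kappa> x y * (Q * \<phi> y)) * pmf s' y)" for y
      have gs: "(g has_sum (Z * A + - (\<kappa> x y1 * pmf s' y1 * A)) + N * (\<Sum>\<^sub>\<infinity>y. (\<kappa> x y * (Q * \<phi> y)) * pmf s' y)) UNIV"
        unfolding g_def Z
        by (intro has_sum_add has_sum_uminusI has_sum_cmult_left has_sum_cmult_right has_sum_infsum zs ph(1))
           (rule has_sum_finite_neutralI[of "{y1}"], auto)
      have gle: "\<bar>\<kappa> x y * pmf s' y * \<beta> y\<bar> \<le> g y" for y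
        using mult_left_mono[OF b_y[of y], of "\<kappa> x y * pmf s' y"] \<kappa>0[of x y]
        by (auto simp: abs_mult g_def algebra_simps)
      have bs: "(\<lambda>y. \<kappa> x y * pmf s' y * \<beta> y) summable_on UNIV"
        by (rule summable_on_abs_le[OF has_sum_imp_summable[OF gs] gle])
      have b1: "\<bar>\<Sum>\<^sub>\<infinity>y. \<kappa> x y * pmf s' y * \<beta> y\<bar> \<le> (Z - e1) * A + N * (Q\<^sup>2 * S)"
        using infsum_abs_le[OF has_sum_imp_summable[OF gs] gle] mult_right_mono[OF e1k A0]
          mult_left_mono[OF ph(2) N0] unfolding infsumI[OF gs] by (simp add: algebra_simps)
      have "((\<lambda>y. \<alpha> x * (\<kappa> x y * pmf s' y) + \<kappa> x y * pmf s' y * \<beta> y) has_sum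
           \<alpha> x * Z + (\<Sum>\<^sub>\<infinity>y. \<kappa> x y * pmf s' y * \<beta> y)) UNIV"
        unfolding Z by (intro has_sum_add has_sum_cmult_right has_sum_infsum zs bs)
      moreover have "\<alpha> x * (\<kappa> x y * pmf s' y) + \<kappa> x y * pmf s' y * \<beta> y = (k x y - k' x y) * pmf s' y" for y
        unfolding kt[symmetric] by (simp add: t_def algebra_simps)
      ultimately have "\<alpha> x * Z + (\<Sum>\<^sub>\<infinity>y. \<kappa> x y * pmf s' y * \<beta> y) = (\<Sum>\<^sub>\<infinity>y. k x y * hY y)"
        using infsumI f_eq(2)[of x] by fastforce
      then have "\<bar>\<alpha> x * Z\<bar> \<le> Q * N + ((Z - e1) * A + N * (Q\<^sup>2 * S))"
        using b1 f_eq(3)[of x] by linarith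
      then show ?thesis using \<open>e1 \<le> Z\<close> \<open>Z \<le> Q * S\<close> e1 by (simp add: abs_mult algebra_simps)
    qed
    have "\<bar>\<alpha> x\<bar> \<le> F / \<epsilon>"
    proof (rule sup_contraction[OF \<alpha>])
      show "0 < \<epsilon>" using e1 QS by (simp add: \<epsilon>_def)
      show "\<epsilon> \<le> 1" using main[OF \<alpha> refl, of undefined] QS by (simp add: \<epsilon>_def divide_le_eq)
      fix A x assume A: "\<And>x. \<bar>\<alpha> x\<bar> \<le> A"
      have A0: "A \<ge> 0" using A[of undefined] by linarith
      define Z where "Z = (\<Sum>\<^sub>\<infinity>y. \<kappa> x y * pmf s' y)"
      note m = main[OF A Z_def]
      then have Zp: "Z > 0" using e1 by linarith
      have "\<bar>\<alpha> x\<bar> \<le> (Q + Q\<^sup>2 * S) * N / Z + (1 - e1 / Z) * A"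
      proof -
        have "\<bar>\<alpha> x\<bar> \<le> ((Q + Q\<^sup>2 * S) * N + (Z - e1) * A) / Z" using m Zp by (simp add: le_divide_eq)
        then show ?thesis using Zp by (simp add: add_divide_distrib left_diff_distrib diff_divide_distrib)
      qed
      also have "(Q + Q\<^sup>2 * S) * N / Z \<le> F" unfolding F_def
        using m e1 Q_pos S0 N0 by (intro divide_left_mono) auto
      also have "(1 - e1 / Z) * A \<le> (1 - \<epsilon>) * A"
        unfolding \<epsilon>_def using m e1 Zp A0 QS by (intro mult_right_mono diff_left_mono divide_left_mono) auto
      finally show "\<bar>\<alpha> x\<bar> \<le> F + (1 - \<epsilon>) * A" by simp
    qed
    also have "F / \<epsilon> = C2 * N" by (simp add: F_def \<epsilon>_def C2_def)
    finally show ?thesis .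
  qed
  have \<beta>_bd2: "\<bar>\<beta> y\<bar> \<le> (C2 + Q) * \<phi> y * N" for y
    using \<beta>_bd[OF \<alpha>_bd, of y] mult_left_mono[OF \<phi>_ge[of y], of "C2 * N"] C2 N0
    by (simp add: algebra_simps)
  have t_bd: "\<bar>t x y\<bar> \<le> C4 * \<phi> y * N" for x y
    using \<beta>_bd2[of y] \<alpha>_bd[of x] mult_left_mono[OF \<phi>_ge[of y], of "C2 * N"] C2 N0
    by (simp add: algebra_simps C4_def t_def)
  have t2: "(t x y)\<^sup>2 \<le> C4\<^sup>2 * \<phi> y ^ 2 * N\<^sup>2" for x y
    using power_mono[OF t_bd[of x y], of 2] by (simp add: power_mult_distrib)

  \<comment> \<open>Quadratic errors in the linearized system\<close>
  define R where "R x y = k x y * (exp (- t x y) - 1 + t x y)" for x y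
  have R_bd: "\<bar>R x y\<bar> \<le> Q * C4\<^sup>2 * \<phi> y ^ 3 * N\<^sup>2" for x y
  proof -
    have "\<bar>R x y\<bar> \<le> k x y * ((t x y)\<^sup>2 * max 1 (exp (- t x y)))"
      using exp_remainder[of "t x y"] k_nonneg[of x y] by (simp add: R_def abs_mult mult_left_mono)
    also have "\<dots> = (t x y)\<^sup>2 * (k x y * max 1 (exp (- t x y)))" by simp
    also have "\<dots> \<le> (C4\<^sup>2 * \<phi> y ^ 2 * N\<^sup>2) * (Q * \<phi> y)"
      by (intro mult_mono t2 kmax) (use k_nonneg in auto)
    also have "\<dots> = Q * C4\<^sup>2 * \<phi> y ^ 3 * N\<^sup>2" by (simp add: eval_nat_numeral)
    finally show ?thesis .
  qed
  have kt_bd: "\<bar>k x y * t x y\<bar> \<le> Q * C4 * \<phi> y ^ 2 * N" for x y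
  proof -
    have "\<bar>k x y * t x y\<bar> \<le> (Q * \<phi> y) * (C4 * \<phi> y * N)"
      unfolding abs_mult using k_nonneg[of x y]
      by (intro mult_mono t_bd) (use k_le[of x y] in auto)
    then show ?thesis by (simp add: power2_eq_square mult_ac)
  qed
  \<comment> \<open>the perturbed potentials solve the linearized system up to quadratic errors\<close>
  define ErrX where "ErrX x = (if x \<in> set_pmf r then (\<Sum>\<^sub>\<infinity>y. R x y * pmf s' y + - (k x y * t x y * hY y)) else 0)" for x
  define ErrY where "ErrY y = (if y \<in> set_pmf s - {y1} then (\<Sum>\<^sub>\<infinity>x. R x y * pmf r' x + - (k x y * t x y * hX x)) else 0)" for y
  \<comment> \<open>Cut off outside the supports, where the operators take the value
    \<open>0\<close>, so that the equations hold at all points.\<close>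
  define a where "a x = (if x \<in> set_pmf r then \<alpha> x else 0)" for x
  define b where "b y = (if y \<in> set_pmf s then \<beta> y else 0)" for y
  have a_bd: "\<bar>a x\<bar> \<le> C2 * N" for x using \<alpha>_bd[of x] C2 N0 by (simp add: a_def)
  have b_bd: "\<bar>b y\<bar> \<le> (C2 + Q) * N * \<phi> y" for y
    using \<beta>_bd2[of y] C2 Q_pos N0 \<phi>_pos[of y] by (simp add: b_def mult_ac less_imp_le)
  have QN: "Q * C4 * N \<ge> 0" "Q * C4\<^sup>2 * N\<^sup>2 \<ge> 0" using Q_pos C4 N0 by auto
  have ErrX_eq: "a x = (FF hY x + ErrX x) - AA b x" and ErrX_bd: "\<bar>ErrX x\<bar> \<le> C5 * N\<^sup>2" for x
  proof -
    have m: "Q * C4\<^sup>2 * N\<^sup>2 * \<phi> y ^ 3 \<le> Q * C4\<^sup>2 * N\<^sup>2 * \<phi> y ^ 4" "Q * C4 * N * \<phi> y ^ 2 \<le> Q * C4 * N * \<phi> y ^ 4" for y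
      using QN by (auto intro!: mult_left_mono \<phi>_mono)
    have h1: "(\<lambda>y. \<bar>R x y\<bar> * pmf s' y) summable_on UNIV" "(\<Sum>\<^sub>\<infinity>y. \<bar>R x y\<bar> * pmf s' y) \<le> Q * C4\<^sup>2 * N\<^sup>2 * S"
      using sums'[of "\<lambda>y. \<bar>R x y\<bar>" "Q * C4\<^sup>2 * N\<^sup>2"] order_trans[OF R_bd[of x] order_trans[OF _ m(1)]] by (auto simp: mult_ac)
    have h2: "(\<lambda>y. \<bar>k x y * t x y\<bar> * \<bar>hY y\<bar>) summable_on UNIV" "(\<Sum>\<^sub>\<infinity>y. \<bar>k x y * t x y\<bar> * \<bar>hY y\<bar>) \<le> Q * C4 * N * N"
      using sumhY[of "\<lambda>y. \<bar>k x y * t x y\<bar>" "Q * C4 * N"] order_trans[OF kt_bd[of x] order_trans[OF _ m(2)]] by (auto simp: mult_ac)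
    have s1: "(\<lambda>y. R x y * pmf s' y) summable_on UNIV"
      by (rule summable_on_abs_le[OF h1(1)]) (simp add: abs_mult)
    have s2: "(\<lambda>y. k x y * t x y * hY y) summable_on UNIV"
      by (rule summable_on_abs_le[OF h2(1)]) (simp add: abs_mult)
    have E: "((\<lambda>y. R x y * pmf s' y + - (k x y * t x y * hY y)) has_sum
        (\<Sum>\<^sub>\<infinity>y. R x y * pmf s' y) + - (\<Sum>\<^sub>\<infinity>y. k x y * t x y * hY y)) UNIV"
      by (intro has_sum_add has_sum_uminusI has_sum_infsum s1 s2)
    have "\<bar>\<Sum>\<^sub>\<infinity>y. R x y * pmf s' y\<bar> \<le> Q * C4\<^sup>2 * N\<^sup>2 * S" "\<bar>\<Sum>\<^sub>\<infinity>y. k x y * t x y * hY y\<bar> \<le> Q * C4 * N * N"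
      using infsum_abs_le[OF h1(1), of "\<lambda>y. R x y * pmf s' y"] infsum_abs_le[OF h2(1), of "\<lambda>y. k x y * t x y * hY y"] h1(2) h2(2)
      by (auto simp: abs_mult)
    then have "\<bar>\<Sum>\<^sub>\<infinity>y. R x y * pmf s' y + - (k x y * t x y * hY y)\<bar> \<le> Q * C4\<^sup>2 * N\<^sup>2 * S + Q * C4 * N * N"
      unfolding infsumI[OF E] by linarith
    also have "\<dots> \<le> C5 * N\<^sup>2" using QN by (simp add: C5_def algebra_simps power2_eq_square)
    finally show "\<bar>ErrX x\<bar> \<le> C5 * N\<^sup>2" using N0 C4 Q_pos S0 by (auto simp: ErrX_def C5_def)
    show "a x = (FF hY x + ErrX x) - AA b x"
    proof (cases "x \<in> set_pmf r")
      case True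
      have bs: "(\<lambda>y. k x y * pmf s y * b y) summable_on UNIV"
        using ks_sum3(1)[OF growth1_3[OF b_bd]] C2 Q_pos N0 by simp
      have Ab: "AA b x = (\<Sum>\<^sub>\<infinity>y. k x y * pmf s y * b y)"
        unfolding AX_eq using True by (auto intro!: infsum_cong simp: b_def \<beta>)
      have Fh: "FF hY x = (\<Sum>\<^sub>\<infinity>y. k x y * hY y)"
        unfolding BX_eq using True supp(2) by (auto intro!: infsum_cong simp: hY set_pmf_iff)
      have L: "((\<lambda>y. \<alpha> x * (k x y * pmf s y) + k x y * pmf s y * b y) has_sum (\<alpha> x * 1 + AA b x)) UNIV"
        unfolding Ab by (intro has_sum_add has_sum_cmult_right ks has_sum_infsum bs)
      \<comment> \<open>By definition \<open>R + (k - k') = k * t\<close>. Pairing this with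
        \<open>s'\<close> and subtracting the pairing of \<open>k * t\<close> with \<open>hY\<close>
        gives \<open>k * t\<close> against \<open>s\<close>, since
        \<open>pmf s' - hY = pmf s\<close>.\<close>
      have pw: "\<alpha> x * (k x y * pmf s y) + k x y * pmf s y * b y =
          (R x y * pmf s' y + - (k x y * t x y * hY y)) + (k x y - k' x y) * pmf s' y" for y
      proof -
        have "pmf s y * b y = pmf s y * \<beta> y" by (auto simp: b_def set_pmf_iff)
        then have "\<alpha> x * (k x y * pmf s y) + k x y * pmf s y * b y = k x y * t x y * pmf s y"
          by (auto simp add: t_def algebra_simps)
        moreover have "k' x y = k x y * exp (- t x y)" by (simp add: k' t_def)
        ultimately show ?thesis by (simp add: R_def hY algebra_simps)
      qed
      have Rr: "((\<lambda>y. (R x y * pmf s' y + - (k x y * t x y * hY y)) + (k x y - k' x y) * pmf s' y) has_sum ErrX x + FF hY x) UNIV"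
      proof -
        have "ErrX x = (\<Sum>\<^sub>\<infinity>y. R x y * pmf s' y) + - (\<Sum>\<^sub>\<infinity>y. k x y * t x y * hY y)"
          using True infsumI[OF E] by (simp only: ErrX_def if_True)
        from E[folded this] show ?thesis
          unfolding Fh f_eq(2)[symmetric] by (intro has_sum_add has_sum_infsum f_eq(1))
      qed
      have "\<alpha> x * 1 + AA b x = ErrX x + FF hY x" using has_sum_unique[OF L] Rr unfolding pw by blast
      then show ?thesis using True by (simp add: a_def)
    qed (simp add: a_def ErrX_def AX_eq BX_eq)
  qed
  have ErrY_eq: "b y = (GG hX y + ErrY y) - BB a y" and ErrY_bd: "\<bar>ErrY y\<bar> \<le> C5 * N\<^sup>2 * \<phi> y ^ 3" for y
  proof -
    have p3: "0 \<le> \<phi> y ^ 3" "0 \<le> \<phi> y ^ 2" "\<phi> y ^ 2 \<le> \<phi> y ^ 3" using \<phi>_pos[of y] \<phi>_mono[of 2 3 y] by auto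
    have h1: "(\<lambda>x. (Q * C4\<^sup>2 * \<phi> y ^ 3 * N\<^sup>2) * pmf r' x) summable_on UNIV" by (intro summable_on_cmult_right pmf_summable)
    have le1: "\<bar>R x y * pmf r' x\<bar> \<le> (Q * C4\<^sup>2 * \<phi> y ^ 3 * N\<^sup>2) * pmf r' x" for x
      using mult_right_mono[OF R_bd[of x y], of "pmf r' x"] by (simp add: abs_mult)
    have h2: "(\<lambda>x. \<bar>k x y * t x y\<bar> * \<bar>hX x\<bar>) summable_on UNIV" "(\<Sum>\<^sub>\<infinity>x. \<bar>k x y * t x y\<bar> * \<bar>hX x\<bar>) \<le> Q * C4 * \<phi> y ^ 2 * N * N"
      using sumhX[of "\<lambda>x. \<bar>k x y * t x y\<bar>", OF _ kt_bd] by auto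
    have s1: "(\<lambda>x. R x y * pmf r' x) summable_on UNIV" by (rule summable_on_abs_le[OF h1 le1])
    have s2: "(\<lambda>x. k x y * t x y * hX x) summable_on UNIV"
      by (rule summable_on_abs_le[OF h2(1)]) (simp add: abs_mult)
    have E: "((\<lambda>x. R x y * pmf r' x + - (k x y * t x y * hX x)) has_sum
        (\<Sum>\<^sub>\<infinity>x. R x y * pmf r' x) + - (\<Sum>\<^sub>\<infinity>x. k x y * t x y * hX x)) UNIV"
      by (intro has_sum_add has_sum_uminusI has_sum_infsum s1 s2)
    have "\<bar>\<Sum>\<^sub>\<infinity>x. R x y * pmf r' x\<bar> \<le> Q * C4\<^sup>2 * \<phi> y ^ 3 * N\<^sup>2"
      using infsum_abs_le[OF h1 le1] by (simp add: infsum_cmult_right')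
    moreover have "\<bar>\<Sum>\<^sub>\<infinity>x. k x y * t x y * hX x\<bar> \<le> Q * C4 * \<phi> y ^ 2 * N * N"
      using infsum_abs_le[OF h2(1), of "\<lambda>x. k x y * t x y * hX x"] h2(2) by (auto simp: abs_mult)
    moreover have "Q * C4 * N * N * \<phi> y ^ 2 \<le> Q * C4 * N * N * \<phi> y ^ 3"
      using QN N0 p3 by (intro mult_left_mono) auto
    ultimately have "\<bar>\<Sum>\<^sub>\<infinity>x. R x y * pmf r' x + - (k x y * t x y * hX x)\<bar> \<le> (Q * C4\<^sup>2 * 1 + Q * C4) * N\<^sup>2 * \<phi> y ^ 3"
      unfolding infsumI[OF E] by (simp add: algebra_simps power2_eq_square)
    also have "\<dots> \<le> C5 * N\<^sup>2 * \<phi> y ^ 3"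
    proof -
      have "Q * C4\<^sup>2 * 1 \<le> Q * C4\<^sup>2 * (S + 1)" using Q_pos S0 by (intro mult_left_mono) auto
      then show ?thesis using p3 by (intro mult_right_mono) (auto simp: C5_def)
    qed
    finally show "\<bar>ErrY y\<bar> \<le> C5 * N\<^sup>2 * \<phi> y ^ 3" using p3 C4 Q_pos S0 by (auto simp: ErrY_def C5_def)
    show "b y = (GG hX y + ErrY y) - BB a y"
    proof (cases "y \<in> set_pmf s - {y1}")
      case True
      have as: "(\<lambda>x. k x y * pmf r x * a x) summable_on UNIV" by (rule kr_sum(1)[OF a_bd])
      have Ba: "BB a y = (\<Sum>\<^sub>\<infinity>x. k x y * pmf r x * a x)" unfolding AY_eq using True by simp
      have Gh: "GG hX y = (\<Sum>\<^sub>\<infinity>x. k x y * hX x)"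
        unfolding BY_eq using True supp(1) by (auto intro!: infsum_cong simp: hX set_pmf_iff)
      have hs: "(\<lambda>x. k x y * hX x) summable_on UNIV"
        by (rule summable_on_abs_le[OF conjunct1[OF sumhX[of "\<lambda>x. k x y" "Q * \<phi> y"]]])
           (use k_nonneg k_le in \<open>auto simp: abs_mult\<close>)
      have f: "((\<lambda>x. (k x y - k' x y) * pmf r' x) has_sum GG hX y) UNIV"
      proof -
        have "((\<lambda>x. (k x y * hX x + k x y * pmf r x) + - (k' x y * pmf r' x)) has_sum (GG hX y + 1) + - 1) UNIV"
          unfolding Gh by (intro has_sum_add has_sum_infsum hs kr has_sum_uminusI kr')
        then show ?thesis by (simp add: hX algebra_simps)
      qed
      have L: "((\<lambda>x. \<beta> y * (k x y * pmf r x) + k x y * pmf r x * a x) has_sum (\<beta> y * 1 + BB a y)) UNIV"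
        unfolding Ba by (intro has_sum_add has_sum_cmult_right kr has_sum_infsum as)
      have pw: "\<beta> y * (k x y * pmf r x) + k x y * pmf r x * a x =
          (R x y * pmf r' x + - (k x y * t x y * hX x)) + (k x y - k' x y) * pmf r' x" for x
      proof -
        have "pmf r x * a x = pmf r x * \<alpha> x" by (auto simp: a_def set_pmf_iff)
        then have "\<beta> y * (k x y * pmf r x) + k x y * pmf r x * a x = k x y * t x y * pmf r x"
          by (auto simp add: t_def algebra_simps)
        moreover have "k' x y = k x y * exp (- t x y)" by (simp add: k' t_def)
        ultimately show ?thesis by (simp add: R_def hX algebra_simps)
      qed
      have Rr: "((\<lambda>x. (R x y * pmf r' x + - (k x y * t x y * hX x)) + (k x y - k' x y) * pmf r' x) has_sum ErrY y + GG hX y) UNIV"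
      proof -
        have "ErrY y = (\<Sum>\<^sub>\<infinity>x. R x y * pmf r' x) + - (\<Sum>\<^sub>\<infinity>x. k x y * t x y * hX x)"
          using True infsumI[OF E] by (simp only: ErrY_def if_True)
        from E[folded this] show ?thesis by (intro has_sum_add f)
      qed
      have "\<beta> y * 1 + BB a y = ErrY y + GG hX y" using has_sum_unique[OF L] Rr unfolding pw by blast
      then show ?thesis using True by (simp add: b_def)
    qed (auto simp: b_def ErrY_def AY_eq BY_eq \<beta>)
  qed
  have C5: "C5 \<ge> 0" using Q_pos C4 S0 by (simp add: C5_def)
  have C6: "C6 \<ge> 0" using Q_pos C5 S4_nonneg eps_pos by (simp add: C6_def)

  \<comment> \<open>Comparison with the potentials of the derivative\<close>
  define da' where "da' x = a x - da hX hY x" for x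
  define db' where "db' y = b y - db hX hY y" for y
  note de = deriv_eqs[OF hXl hYl]
  have da'_M: "\<bar>da' x\<bar> \<le> C2 * N + cA * (nX hX + nY hY)" for x
    using a_bd[of x] de(3)[of x] unfolding da'_def by linarith
  \<comment> \<open>The pair \<open>a\<close>, \<open>b\<close> and the potentials of the derivative
    solve the same system up to \<open>ErrX\<close> and \<open>ErrY\<close>, so
    \<open>linear_stability\<close> controls their difference. The growth \<open>\<phi>^3\<close> of
    \<open>ErrY\<close> is just what it admits.\<close>
  have da'_bd: "\<bar>da' x\<bar> \<le> C6 * N\<^sup>2" for x
  proof -
    have b3: "\<bar>b y\<bar> \<le> (C2 + Q) * N * \<phi> y ^ 3" for y by (rule growth1_3[OF b_bd])
    have db3: "\<bar>db hX hY y\<bar> \<le> cB * (nX hX + nY hY) * \<phi> y ^ 3" for y by (rule growth1_3[OF de(4)])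
    have nn: "(C2 + Q) * N \<ge> 0" "cB * (nX hX + nY hY) \<ge> 0"
      using C2 Q_pos N0 nX_nonneg nY_nonneg cA_nonneg by (auto simp: cB_def)
    have "\<bar>da' x\<bar> \<le> (C5 * N\<^sup>2 + Q * (C5 * N\<^sup>2) * S4) / eps"
    proof (rule linear_stability[where b=db' and g=ErrY and f=ErrX, OF da'_M ErrY_bd _ ErrX_bd])
      show "C5 * N\<^sup>2 \<ge> 0" using C5 by simp
      show "db' y = ErrY y - BB da' y" for y
        using ErrY_eq[of y] de(2)[of y] AY_lin[where a=a and c="da hX hY" and u=1 and v="- 1" and y=y, OF a_bd de(3)]
        by (simp add: db'_def da'_def[abs_def])
      show "da' x = ErrX x - AA db' x" for x
        using ErrX_eq[of x] de(1)[of x] AX_lin[where b=b and c="db hX hY" and u=1 and v="- 1" and x=x, OF b3 nn(1) db3 nn(2)]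
        by (simp add: da'_def db'_def[abs_def])
    qed
    also have "\<dots> = C6 * N\<^sup>2" by (simp add: C6_def algebra_simps)
    finally show ?thesis .
  qed
  have db'_bd: "\<bar>db' y\<bar> \<le> (C5 + C6) * N\<^sup>2 * \<phi> y ^ 3" for y
  proof -
    have "db' y = ErrY y - BB da' y"
      using ErrY_eq[of y] de(2)[of y] AY_lin[where a=a and c="da hX hY" and u=1 and v="- 1" and y=y, OF a_bd de(3)]
      by (simp add: db'_def da'_def[abs_def])
    then have "\<bar>db' y\<bar> \<le> C5 * N\<^sup>2 * \<phi> y ^ 3 + C6 * N\<^sup>2"
      using ErrY_bd[of y] AY_bound[where a=da' and y=y, OF da'_bd] by linarith
    moreover have "C6 * N\<^sup>2 * 1 \<le> C6 * N\<^sup>2 * \<phi> y ^ 3" using C6 \<phi>_pow_ge by (intro mult_left_mono) auto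
    ultimately show ?thesis by (simp add: algebra_simps)
  qed

  \<comment> \<open>Assembly of the pointwise bound\<close>
  have E0: "E \<ge> 0" using Q_pos C4 C5 C6 by (simp add: E_def)
  have U0: "U x \<ge> 0" and V0: "V y \<ge> 0" using CX_pos[of x] WY_pos[of y] N0 by (auto simp: U_def V_def less_imp_le)
  show ?thesis
  proof (cases "x \<in> set_pmf r \<and> y \<in> set_pmf s")
    case False
    then have "pmf r' x * pmf s' y = 0" "pmf r x * pmf s y = 0"
      using supp by (auto simp: set_pmf_iff)
    then have "k' x y * pmf r' x * pmf s' y - pmf \<pi> (x, y) - DD hX hY (x, y) = 0"
      using False by (auto simp: \<pi> plan_deriv_def)
    then show ?thesis using E0 U0 V0 by simp
  next
    case True
    let ?r = "pmf r x" and ?s = "pmf s y" and ?r' = "pmf r' x" and ?s' = "pmf s' y"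
    have pos: "?r > 0" "?s > 0" using True by (auto simp: pmf_positive)
    \<comment> \<open>Insert \<open>k' = k - k * t + R\<close> and
      \<open>r' s' - r s = hX s' + r hY\<close>. The first-order terms cancel against the
      derivative, and each of the four remaining terms is of second order in
      \<open>N\<close>.\<close>
    have eq: "k' x y * ?r' * ?s' - pmf \<pi> (x, y) - DD hX hY (x, y) =
        R x y * (?r' * ?s') - k x y * t x y * (hX x * ?s' + ?r * hY y)
        - k x y * (da' x + db' y) * (?r * ?s) + k x y * (hX x * hY y)"
    proof -
      have "DD hX hY (x, y) = k x y * (?r * hY y + hX x * ?s) - k x y * ?r * ?s * (da hX hY x + db hX hY y)"
        using True pos by (simp add: plan_deriv_def \<pi>)
      moreover have "k' x y = k x y * exp (- t x y)" by (simp add: k' t_def)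
      moreover have "\<alpha> x = a x" "\<beta> y = b y" using True by (auto simp: a_def b_def)
      ultimately show ?thesis
        by (simp add: R_def \<pi> t_def da'_def db'_def hX hY algebra_simps)
    qed
    \<comment> \<open>One product that dominates all the combinations of marginals in the four terms
      once each perturbation is divided by \<open>N\<close>; the powers of \<open>N\<close> taken
      out complete the factor \<open>N\<^sup>2\<close>.\<close>
    define P where "P = (?r + ?r' + \<bar>hX x\<bar> / N) * (?s + ?s' + \<bar>hY y\<bar> / N)"
    have nnX: "\<bar>hX x\<bar> / N \<ge> 0" "\<bar>hY y\<bar> / N \<ge> 0" using N0 by auto
    have P1: "?r' * ?s' \<le> P" and P2: "\<bar>hX x\<bar> * ?s' + ?r * \<bar>hY y\<bar> \<le> N * P" and P3: "?r * ?s \<le> P"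
      and P4: "\<bar>hX x\<bar> * \<bar>hY y\<bar> \<le> N\<^sup>2 * P"
    proof -
      have e: "P = ?r' * ?s' + ?r * ?s + (\<bar>hX x\<bar> / N) * ?s' + ?r * (\<bar>hY y\<bar> / N) + (\<bar>hX x\<bar> / N) * (\<bar>hY y\<bar> / N)
          + (?r * ?s' + ?r' * ?s + ?r' * (\<bar>hY y\<bar> / N) + (\<bar>hX x\<bar> / N) * ?s)"
        by (simp add: P_def algebra_simps)
      have nn: "0 \<le> ?r' * ?s'" "0 \<le> ?r * ?s" "0 \<le> (\<bar>hX x\<bar> / N) * ?s'" "0 \<le> ?r * (\<bar>hY y\<bar> / N)"
        "0 \<le> (\<bar>hX x\<bar> / N) * (\<bar>hY y\<bar> / N)" "0 \<le> ?r * ?s' + ?r' * ?s + ?r' * (\<bar>hY y\<bar> / N) + (\<bar>hX x\<bar> / N) * ?s"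
        by (intro add_nonneg_nonneg mult_nonneg_nonneg nnX pmf_nonneg)+
      show "?r' * ?s' \<le> P" "?r * ?s \<le> P" using nn unfolding e by linarith+
      have "(\<bar>hX x\<bar> / N) * ?s' + ?r * (\<bar>hY y\<bar> / N) \<le> P" using nn unfolding e by linarith
      from mult_left_mono[OF this N0] show "\<bar>hX x\<bar> * ?s' + ?r * \<bar>hY y\<bar> \<le> N * P"
        using Npos by (simp add: distrib_left)
      have "(\<bar>hX x\<bar> / N) * (\<bar>hY y\<bar> / N) \<le> P" using nn unfolding e by linarith
      from mult_left_mono[OF this, of "N\<^sup>2"] show "\<bar>hX x\<bar> * \<bar>hY y\<bar> \<le> N\<^sup>2 * P"
        using Npos by (simp add: power2_eq_square)
    qed
    have P0: "P \<ge> 0" using P1 by (meson mult_nonneg_nonneg order_trans pmf_nonneg)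
    let ?p4 = "\<phi> y ^ 4"
    have p4: "\<phi> y \<le> ?p4" "\<phi> y ^ 2 \<le> ?p4" "\<phi> y ^ 3 \<le> ?p4" "0 \<le> ?p4" "1 \<le> ?p4"
      using \<phi>_mono[of 1 4 y] \<phi>_mono[of 2 4 y] \<phi>_mono[of 3 4 y] \<phi>_pow_ge[of y 4] by auto
    have T1: "\<bar>R x y * (?r' * ?s')\<bar> \<le> (Q * C4\<^sup>2 * N\<^sup>2 * ?p4) * P"
    proof -
      have "Q * C4\<^sup>2 * \<phi> y ^ 3 * N\<^sup>2 \<le> Q * C4\<^sup>2 * N\<^sup>2 * ?p4"
        using mult_left_mono[OF p4(3) QN(2)] by (simp add: mult_ac)
      then have "\<bar>R x y\<bar> \<le> Q * C4\<^sup>2 * N\<^sup>2 * ?p4" using R_bd[of x y] by linarith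
      then show ?thesis unfolding abs_mult[of "R x y"]
        using P1 Q_pos p4 by (intro mult_mono) auto
    qed
    have T2: "\<bar>k x y * t x y * (hX x * ?s' + ?r * hY y)\<bar> \<le> (Q * C4 * N\<^sup>2 * ?p4) * P"
    proof -
      have "\<bar>hX x * ?s' + ?r * hY y\<bar> \<le> N * P"
        using P2 abs_triangle_ineq[of "hX x * ?s'" "?r * hY y"] by (simp add: abs_mult)
      moreover have "\<bar>k x y * t x y\<bar> \<le> Q * C4 * N * ?p4"
        using kt_bd[of x y] mult_left_mono[OF p4(2) QN(1)] by (simp add: mult_ac)
      ultimately have "\<bar>k x y * t x y\<bar> * \<bar>hX x * ?s' + ?r * hY y\<bar> \<le> (Q * C4 * N * ?p4) * (N * P)"
        using QN p4 by (intro mult_mono) auto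
      then show ?thesis by (simp add: abs_mult power2_eq_square mult_ac)
    qed
    have T3: "\<bar>k x y * (da' x + db' y) * (?r * ?s)\<bar> \<le> (Q * (2 * C6 + C5) * N\<^sup>2 * ?p4) * P"
    proof -
      have "\<bar>da' x + db' y\<bar> \<le> (2 * C6 + C5) * N\<^sup>2 * \<phi> y ^ 3"
        using da'_bd[of x] db'_bd[of y] mult_left_mono[OF \<phi>_pow_ge[of y 3], of "C6 * N\<^sup>2"] C6
        by (simp add: algebra_simps)
      then have "\<bar>k x y * (da' x + db' y)\<bar> \<le> (Q * \<phi> y) * ((2 * C6 + C5) * N\<^sup>2 * \<phi> y ^ 3)"
        unfolding abs_mult using k_nonneg[of x y] k_le[of x y] by (intro mult_mono) auto
      also have "\<dots> = Q * (2 * C6 + C5) * N\<^sup>2 * ?p4" by (simp add: eval_nat_numeral)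
      finally show ?thesis unfolding abs_mult[of _ "?r * ?s"]
        using P3 p4 C5 C6 Q_pos by (intro mult_mono) auto
    qed
    have T4: "\<bar>k x y * (hX x * hY y)\<bar> \<le> (Q * N\<^sup>2 * ?p4) * P"
    proof -
      have "k x y \<le> Q * ?p4" using k_le[of x y] mult_left_mono[OF p4(1), of Q] Q_pos by linarith
      then have "k x y * (\<bar>hX x\<bar> * \<bar>hY y\<bar>) \<le> (Q * ?p4) * (N\<^sup>2 * P)"
        using Q_pos p4 by (intro mult_mono[OF _ P4]) auto
      then show ?thesis using k_nonneg[of x y] by (simp add: abs_mult mult_ac)
    qed
    have "\<bar>k' x y * ?r' * ?s' - pmf \<pi> (x, y) - DD hX hY (x, y)\<bar> \<le> E * N\<^sup>2 * (?p4 * P)"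
      using T1 T2 T3 T4 unfolding eq by (simp add: E_def algebra_simps)
    then have "wsum (x, y) * \<bar>k' x y * ?r' * ?s' - pmf \<pi> (x, y) - DD hX hY (x, y)\<bar>
        \<le> (2 * (CX x * CY y)) * (E * N\<^sup>2 * (?p4 * P))"
      using wsum_le[of x y] CX_pos[of x] CY_pos[of y] by (intro mult_mono) auto
    also have "\<dots> = 2 * E * N\<^sup>2 * (U x * V y)" by (simp add: U_def V_def P_def mult_ac)
    finally show ?thesis .
  qed
qed

end

section \<open>Random elements of weighted sequence spaces\<close>

text \<open>An increasing sequence cofinal among the finite subsets. It turns the net of finite
  partial sums into a sequence, to which the limit theorems of measure theory apply.\<close>

definition exhaust :: "nat \<Rightarrow> 'i::countable set" where "exhaust n = {z. to_nat z < n}"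

lemma finite_exhaust [simp]: "finite (exhaust n)"
proof -
  have "finite (to_nat -` {..<n} :: 'a set)" by (rule finite_vimageI) auto
  then show ?thesis by (simp add: exhaust_def vimage_def)
qed

lemma exhaust_mono: "m \<le> n \<Longrightarrow> exhaust m \<subseteq> exhaust n"
  by (auto simp: exhaust_def)

lemma exhaust_at_top: "filterlim exhaust (finite_subsets_at_top (UNIV :: 'i::countable set)) sequentially"
  unfolding filterlim_finite_subsets_at_top
proof (intro allI impI)
  fix X :: "'i set" assume "finite X \<and> X \<subseteq> UNIV"
  then obtain m where m: "\<forall>z\<in>X. to_nat z < m"
    using finite_nat_set_iff_bounded[of "to_nat ` X"] by auto
  show "\<forall>\<^sub>F n in sequentially. finite (exhaust n) \<and> X \<subseteq> exhaust n \<and> exhaust n \<subseteq> UNIV"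
    using eventually_ge_at_top[of m]
  proof eventually_elim
    case (elim n)
    have "X \<subseteq> exhaust n" using m elim by (force simp: exhaust_def)
    then show ?case by simp
  qed
qed

lemma infsum_LIMSEQ:
  fixes f :: "'i::countable \<Rightarrow> real"
  assumes "f summable_on UNIV"
  shows "(\<lambda>n. \<Sum>z\<in>exhaust n. f z) \<longlonglongrightarrow> infsum f UNIV"
  using filterlim_compose[OF infsum_tendsto[OF assms] exhaust_at_top] by (simp add: o_def)

lemma borel_measurable_infsum:
  fixes f :: "'w \<Rightarrow> 'i::countable \<Rightarrow> real"
  assumes "\<And>i. (\<lambda>\<omega>. f \<omega> i) \<in> borel_measurable M" "\<And>\<omega>. \<omega> \<in> space M \<Longrightarrow> f \<omega> summable_on UNIV"
  shows "(\<lambda>\<omega>. \<Sum>\<^sub>\<infinity>i. f \<omega> i) \<in> borel_measurable M"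
  by (rule borel_measurable_LIMSEQ_real[of _ "\<lambda>n \<omega>. \<Sum>i\<in>exhaust n. f \<omega> i"])
     (auto intro!: infsum_LIMSEQ assms borel_measurable_sum)

text \<open>Monotone convergence along \<open>exhaust\<close>; the bound holds for every finite
  partial sum and passes to the limit.\<close>

lemma (in prob_space) expectation_infsum_le:
  fixes h :: "'a \<Rightarrow> 'i::countable \<Rightarrow> real"
  assumes h: "\<And>i. integrable M (\<lambda>\<omega>. h \<omega> i)" "\<And>\<omega> i. h \<omega> i \<ge> 0" "\<And>i. expectation (\<lambda>\<omega>. h \<omega> i) \<le> c i"
    and c: "c summable_on UNIV" and s: "\<And>\<omega>. \<omega> \<in> space M \<Longrightarrow> h \<omega> summable_on UNIV"
  shows "integrable M (\<lambda>\<omega>. \<Sum>\<^sub>\<infinity>i. h \<omega> i)" "expectation (\<lambda>\<omega>. \<Sum>\<^sub>\<infinity>i. h \<omega> i) \<le> infsum c UNIV"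
proof -
  let ?S = "\<lambda>n \<omega>. \<Sum>i\<in>exhaust n. h \<omega> i"
  have int: "integrable M (?S n)" for n using h(1) by auto
  have c0: "c i \<ge> 0" for i
    by (rule order_trans[OF _ h(3)]) (rule Bochner_Integration.integral_nonneg, rule h(2))
  have bd: "expectation (?S n) \<le> infsum c UNIV" for n
  proof -
    have "expectation (?S n) = (\<Sum>i\<in>exhaust n. expectation (\<lambda>\<omega>. h \<omega> i))"
      by (rule Bochner_Integration.integral_sum) (rule h(1))
    also have "\<dots> \<le> sum c (exhaust n)" by (intro sum_mono h)
    also have "\<dots> \<le> infsum c UNIV" by (rule finite_sum_le_infsum[OF c]) (auto simp: c0)
    finally show ?thesis .
  qed
  have mono: "incseq (\<lambda>n. expectation (?S n))"
    by (intro incseq_SucI integral_mono int sum_mono2 finite_exhaust exhaust_mono) (auto simp: h(2))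
  obtain x where x: "(\<lambda>n. expectation (?S n)) \<longlonglongrightarrow> x" "\<forall>i. expectation (?S i) \<le> x"
    using incseq_convergent[OF mono, of "infsum c UNIV"] bd by blast
  have lim: "AE \<omega> in M. (\<lambda>n. ?S n \<omega>) \<longlonglongrightarrow> (\<Sum>\<^sub>\<infinity>i. h \<omega> i)"
    by (rule AE_I2) (rule infsum_LIMSEQ[OF s])
  have mon: "AE \<omega> in M. mono (\<lambda>n. ?S n \<omega>)"
    by (intro AE_I2 monoI sum_mono2 finite_exhaust exhaust_mono) (auto simp: h(2))
  have meas: "(\<lambda>\<omega>. \<Sum>\<^sub>\<infinity>i. h \<omega> i) \<in> borel_measurable M"
    by (rule borel_measurable_infsum) (use h(1) s in auto)
  show "integrable M (\<lambda>\<omega>. \<Sum>\<^sub>\<infinity>i. h \<omega> i)"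
    by (rule integrable_monotone_convergence[OF int mon lim x(1) meas])
  have "expectation (\<lambda>\<omega>. \<Sum>\<^sub>\<infinity>i. h \<omega> i) = x"
    by (rule integral_monotone_convergence[OF int mon lim x(1) meas])
  then show "expectation (\<lambda>\<omega>. \<Sum>\<^sub>\<infinity>i. h \<omega> i) \<le> infsum c UNIV"
    using LIMSEQ_le_const2[OF x(1)] bd by blast
qed

section \<open>Borel measurability in weighted sequence spaces\<close>

lemma space_borel_metric [simp]: "space (borel_metric m) = mspace m"
  unfolding borel_metric_def by (rule space_measure_of) (use openin_subset in fastforce)

lemma sets_borel_metric: "sets (borel_metric m) = sigma_sets (mspace m) {U. openin (mtopology_of m) U}"
  unfolding borel_metric_def by (rule sets_measure_of) (use openin_subset in fastforce)

lemma measurable_borel_metric_continuous: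
  assumes "continuous_map (mtopology_of m) euclideanreal f"
  shows "f \<in> borel_measurable (borel_metric m)"
proof (rule borel_measurableI)
  fix S :: "real set" assume "open S"
  then have "openin (mtopology_of m) {x \<in> mspace m. f x \<in> S}"
    using openin_continuous_map_preimage[OF assms, of S] by simp
  then show "f -` S \<inter> space (borel_metric m) \<in> sets (borel_metric m)"
    unfolding sets_borel_metric by (intro sigma_sets.Basic) (simp add: vimage_def Int_def conj_commute)
qed

lemma lipschitz_continuous_map:
  assumes "\<And>a b. a \<in> mspace m \<Longrightarrow> b \<in> mspace m \<Longrightarrow> \<bar>f a - f b\<bar> \<le> C * mdist m a b"
  shows "continuous_map (mtopology_of m) euclideanreal f"
proof -
  have "Lipschitz_continuous_map m euclidean_metric f"
    unfolding Lipschitz_continuous_map_def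
    using assms by (auto simp: dist_real_def)
  from Lipschitz_continuous_imp_continuous_map[OF this] show ?thesis by simp
qed

lemmas lipschitz_borel_measurable = measurable_borel_metric_continuous[OF lipschitz_continuous_map]

lemma borel_measurable_metric_iff:
  assumes "\<And>\<omega>. \<omega> \<in> space M \<Longrightarrow> Z \<omega> \<in> mspace m"
    and "\<And>U. openin (mtopology_of m) U \<Longrightarrow> {\<omega> \<in> space M. Z \<omega> \<in> U} \<in> sets M"
  shows "Z \<in> M \<rightarrow>\<^sub>M borel_metric m"
  unfolding borel_metric_def
proof (rule measurable_measure_of)
  show "Z -` U \<inter> space M \<in> sets M" if "U \<in> {U. openin (mtopology_of m) U}" for U
    using assms(2)[of U] that by (simp add: vimage_def Int_def conj_commute)
qed (use assms(1) openin_subset in fastforce)+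

lemma l1_truncation_tendsto:
  fixes a :: "'i::countable \<Rightarrow> real"
  assumes a: "a \<in> l1_set w"
  shows "(\<lambda>n. l1_dist w (\<lambda>i. if i \<in> exhaust n then a i else 0) a) \<longlonglongrightarrow> 0"
proof -
  let ?T = "\<lambda>n i. if i \<in> exhaust n then a i else 0"
  have s: "(\<lambda>i. w i * \<bar>a i\<bar>) summable_on UNIV" using a by (simp add: l1_set_def)
  have "l1_dist w (?T n) a = (\<Sum>\<^sub>\<infinity>i. w i * \<bar>a i\<bar>) - (\<Sum>i\<in>exhaust n. w i * \<bar>a i\<bar>)" for n
  proof -
    have "((\<lambda>i. w i * \<bar>a i\<bar> + - (if i \<in> exhaust n then w i * \<bar>a i\<bar> else 0)) has_sum
        (\<Sum>\<^sub>\<infinity>i. w i * \<bar>a i\<bar>) + - (\<Sum>i\<in>exhaust n. w i * \<bar>a i\<bar>)) UNIV"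
      by (intro has_sum_add has_sum_uminusI has_sum_infsum s)
         (rule has_sum_finite_neutralI[of "exhaust n"], auto)
    moreover have "w i * \<bar>a i\<bar> + - (if i \<in> exhaust n then w i * \<bar>a i\<bar> else 0) = w i * \<bar>?T n i - a i\<bar>" for i
      by simp
    ultimately show ?thesis unfolding l1_dist_def by (simp add: infsumI)
  qed
  then show ?thesis using tendsto_diff[OF tendsto_const infsum_LIMSEQ[OF s], of "\<Sum>\<^sub>\<infinity>i. w i * \<bar>a i\<bar>"] by simp
qed

text \<open>On \<open>\<ell>\<^sup>1\<close> over a countable index set, Borel measurability is coordinatewise: \<open>a \<in> U\<close> is
  detected by the finitely supported truncations of \<open>a\<close>, which depend continuously on finitely
  many coordinates.\<close>

lemma measurable_l1_space:
  fixes Z :: "'w \<Rightarrow> 'i::countable \<Rightarrow> real"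
  assumes w: "\<And>i. w i > 0" and Z: "\<And>\<omega>. \<omega> \<in> space M \<Longrightarrow> Z \<omega> \<in> l1_set w"
    and m: "\<And>i. (\<lambda>\<omega>. Z \<omega> i) \<in> borel_measurable M"
  shows "Z \<in> M \<rightarrow>\<^sub>M borel_metric (l1_space w)"
proof (rule borel_measurable_metric_iff)
  interpret l1: Metric_space "l1_set w" "l1_dist w" by (rule Metric_space_l1[OF w])
  note sp = l1_space_simps[of w, OF w]
  show "Z \<omega> \<in> mspace (l1_space w)" if "\<omega> \<in> space M" for \<omega> using Z[OF that] by (simp add: sp)
  fix U assume "openin (mtopology_of (l1_space w)) U"
  then have U: "openin l1.mtopology U" by (simp add: mtopology_of_def sp)
  define T where "T n a = (\<lambda>i. if i \<in> exhaust n then a i else 0)" for n and a :: "'i \<Rightarrow> real"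
  have T_l1: "T n a \<in> l1_set w" for n a
    unfolding l1_set_def mem_Collect_eq
    by (rule finite_nonzero_values_imp_summable_on)
       (rule finite_subset[OF _ finite_exhaust[of n]], auto simp: T_def)
  have lim: "(\<lambda>n. l1_dist w (T n a) a) \<longlonglongrightarrow> 0" if a: "a \<in> l1_set w" for a
    unfolding T_def by (rule l1_truncation_tendsto[OF a])
  \<comment> \<open>Membership in \<open>U\<close> is tested by balls around truncations. Since
    \<open>T n a\<close> depends continuously on finitely many coordinates, \<open>V n k\<close> is
    closed in the product topology: its complement is a union of open sets, possibly uncountable but
    still open.\<close>
  define V where "V n k = {a. l1.mball (T n a) (1 / real (Suc k)) \<subseteq> U}" for n k
  have dist_cont: "continuous_on UNIV (\<lambda>a. l1_dist w (T n a) b)" if b: "b \<in> l1_set w" for n b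
  proof -
    have s: "(\<lambda>i. w i * \<bar>b i\<bar>) summable_on UNIV" using b by (simp add: l1_set_def)
    have "l1_dist w (T n a) b = (\<Sum>\<^sub>\<infinity>i. w i * \<bar>b i\<bar>) + (\<Sum>i\<in>exhaust n. w i * \<bar>a i - b i\<bar> - w i * \<bar>b i\<bar>)" for a
    proof -
      have "((\<lambda>i. w i * \<bar>b i\<bar> + (if i \<in> exhaust n then w i * \<bar>a i - b i\<bar> - w i * \<bar>b i\<bar> else 0)) has_sum
          (\<Sum>\<^sub>\<infinity>i. w i * \<bar>b i\<bar>) + (\<Sum>i\<in>exhaust n. w i * \<bar>a i - b i\<bar> - w i * \<bar>b i\<bar>)) UNIV"
        by (intro has_sum_add has_sum_infsum s)
           (rule has_sum_finite_neutralI[of "exhaust n"], auto)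
      moreover have "w i * \<bar>b i\<bar> + (if i \<in> exhaust n then w i * \<bar>a i - b i\<bar> - w i * \<bar>b i\<bar> else 0) = w i * \<bar>T n a i - b i\<bar>" for i
        by (simp add: T_def)
      ultimately show ?thesis unfolding l1_dist_def by (simp add: infsumI)
    qed
    then show ?thesis by (auto intro!: continuous_intros continuous_on_product_coordinates)
  qed
  have Vb: "V n k \<in> sets borel" for n k
  proof -
    have "- V n k = (\<Union>b\<in>l1_set w - U. {a. l1_dist w (T n a) b < 1 / real (Suc k)})"
      by (auto simp: V_def T_l1 l1.in_mball)
    moreover have "open (\<Union>b\<in>l1_set w - U. {a. l1_dist w (T n a) b < 1 / real (Suc k)})"
      by (intro open_UN ballI open_Collect_less dist_cont continuous_on_const) auto
    ultimately have "closed (V n k)" by (simp add: closed_def)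
    then show ?thesis by simp
  qed
  have Zm: "Z \<in> borel_measurable M" by (rule measurable_coordinatewise_then_product) (rule m)
  \<comment> \<open>Only countable operations are left: a point belongs to \<open>U\<close> iff, for
    some radius \<open>1 / (k + 1)\<close>, the balls around its truncations eventually lie in
    \<open>U\<close>.\<close>
  have eq: "{\<omega> \<in> space M. Z \<omega> \<in> U} = {\<omega> \<in> space M. \<exists>k N. \<forall>n\<ge>N. Z \<omega> \<in> V n k}"
  proof (intro Collect_cong conj_cong refl iffI)
    fix \<omega> assume w: "\<omega> \<in> space M"
    note l = lim[OF Z[OF w]]
    { assume "Z \<omega> \<in> U"
      then obtain r where r: "r > 0" "l1.mball (Z \<omega>) r \<subseteq> U" using U unfolding l1.openin_mtopology by blast
      obtain k where k: "1 / real (Suc k) < r / 2" using r(1) nat_approx_posE[of "r/2"] by auto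
      obtain N where N: "\<And>n. n \<ge> N \<Longrightarrow> l1_dist w (T n (Z \<omega>)) (Z \<omega>) < r / 2"
        using order_tendstoD(2)[OF l, of "r/2"] r(1) unfolding eventually_sequentially by auto
      have "Z \<omega> \<in> V n k" if "n \<ge> N" for n unfolding V_def
      proof (intro CollectI subsetI)
        fix c assume "c \<in> l1.mball (T n (Z \<omega>)) (1 / real (Suc k))"
        then have c: "c \<in> l1_set w" "l1_dist w (T n (Z \<omega>)) c < r / 2" using k by (auto simp: l1.in_mball)
        have "l1_dist w (Z \<omega>) c \<le> l1_dist w (Z \<omega>) (T n (Z \<omega>)) + l1_dist w (T n (Z \<omega>)) c"
          by (rule l1.triangle[OF Z[OF w] T_l1 c(1)])
        then have "l1_dist w (Z \<omega>) c < r" using N[OF that] c(2) by (simp add: l1.commute)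
        then show "c \<in> U" using r(2) c(1) Z[OF w] by (auto simp: l1.in_mball)
      qed
      then show "\<exists>k N. \<forall>n\<ge>N. Z \<omega> \<in> V n k" by blast }
    { assume "\<exists>k N. \<forall>n\<ge>N. Z \<omega> \<in> V n k"
      then obtain k N where N: "\<And>n. n \<ge> N \<Longrightarrow> Z \<omega> \<in> V n k" by blast
      have "\<forall>\<^sub>F n in sequentially. l1_dist w (T n (Z \<omega>)) (Z \<omega>) < 1 / real (Suc k)"
        by (rule order_tendstoD(2)[OF l]) simp
      then obtain n where "n \<ge> N" "l1_dist w (T n (Z \<omega>)) (Z \<omega>) < 1 / real (Suc k)"
        unfolding eventually_sequentially by (metis nle_le)
      then show "Z \<omega> \<in> U" using N[of n] Z[OF w] T_l1 by (auto simp: V_def l1.in_mball) }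
  qed
  show "{\<omega> \<in> space M. Z \<omega> \<in> U} \<in> sets M" unfolding eq
    using Vb Zm by measurable
qed

lemma l1_coordinate:
  assumes w: "\<And>i. w i > 0" and a: "a \<in> l1_set w" "b \<in> l1_set w"
  shows "w i * \<bar>a i - b i\<bar> \<le> l1_dist w a b"
proof -
  have "infsum (\<lambda>i. w i * \<bar>a i - b i\<bar>) {i} \<le> l1_dist w a b"
    unfolding l1_dist_def by (rule infsum_mono2) (use l1_set_diff[OF w a] w in \<open>auto simp: less_imp_le\<close>)
  then show ?thesis by simp
qed

lemma measurable_l1_coordinate:
  assumes w: "\<And>i. w i > 0" and Z: "Z \<in> M \<rightarrow>\<^sub>M borel_metric (l1_space w)"
  shows "(\<lambda>\<omega>. Z \<omega> i) \<in> borel_measurable M" "\<omega> \<in> space M \<Longrightarrow> Z \<omega> \<in> l1_set w"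
proof -
  note sp = l1_space_simps[of w, OF w]
  have "(\<lambda>a. a i) \<in> borel_measurable (borel_metric (l1_space w))"
  proof (rule lipschitz_borel_measurable)
    show "\<bar>a i - b i\<bar> \<le> 1 / w i * mdist (l1_space w) a b"
      if "a \<in> mspace (l1_space w)" "b \<in> mspace (l1_space w)" for a b
      using l1_coordinate[of w a b i, OF w] that w[of i] by (simp add: sp field_simps)
  qed
  from measurable_compose[OF Z this] show "(\<lambda>\<omega>. Z \<omega> i) \<in> borel_measurable M" .
  show "\<omega> \<in> space M \<Longrightarrow> Z \<omega> \<in> l1_set w" using measurable_space[OF Z] by (simp add: sp)
qed

text \<open>A bounded continuous \<open>f\<close> is the limit from below of the Lipschitz functions
  \<open>fk\<close>, its infimal convolutions with multiples of the distance. Convergence for these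
  bounds the limit inferior, and the same argument for \<open>- f\<close> bounds the limit
  superior.\<close>

lemma converges_in_distributionI:
  assumes M: "prob_space M" and N: "prob_space N"
    and Z: "\<And>n. Z n \<in> M \<rightarrow>\<^sub>M borel_metric m" and L: "L \<in> N \<rightarrow>\<^sub>M borel_metric m"
    and lip: "\<And>g B C. (\<And>a. a \<in> mspace m \<Longrightarrow> \<bar>g a\<bar> \<le> B) \<Longrightarrow>
      (\<And>a b. a \<in> mspace m \<Longrightarrow> b \<in> mspace m \<Longrightarrow> \<bar>g a - g b\<bar> \<le> C * mdist m a b) \<Longrightarrow>
      (\<lambda>n. \<integral>\<omega>. g (Z n \<omega>) \<partial>M) \<longlonglongrightarrow> (\<integral>\<omega>. g (L \<omega>) \<partial>N)"
  shows "converges_in_distribution m M Z N L"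
  unfolding converges_in_distribution_def
proof (intro conjI allI impI Z L)
  interpret M: prob_space M by fact
  interpret N: prob_space N by fact
  interpret ms: Metric_space "mspace m" "mdist m" by simp
  have ne: "mspace m \<noteq> {}" using N.not_empty measurable_space[OF L] by fastforce
  have lower: "\<forall>\<^sub>F n in sequentially. (\<integral>\<omega>. f (Z n \<omega>) \<partial>M) > (\<integral>\<omega>. f (L \<omega>) \<partial>N) - e"
    if f: "continuous_map (mtopology_of m) euclideanreal f" and B: "\<And>a. a \<in> mspace m \<Longrightarrow> \<bar>f a\<bar> \<le> B" and e: "e > 0" for f B e
  proof -
    define fk where "fk k x = (INF y\<in>mspace m. f y + real k * mdist m x y)" for k x
    have bdd: "bdd_below ((\<lambda>y. f y + real k * mdist m x y) ` mspace m)" for k x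
      by (rule bdd_belowI2[of _ "- B"]) (use B in \<open>force simp: abs_le_iff intro: add_increasing2\<close>)
    have fk_le: "fk k x \<le> f x" if "x \<in> mspace m" for k x
      unfolding fk_def using cINF_lower[OF bdd that, of k x] that by simp
    have fk_ge: "- B \<le> fk k x" for k x
      unfolding fk_def by (rule cINF_greatest[OF ne]) (use B in \<open>force simp: abs_le_iff intro: add_increasing2\<close>)
    have fk_bd: "\<bar>fk k x\<bar> \<le> B" if "x \<in> mspace m" for k x
      using fk_ge[of k x] fk_le[OF that, of k] B[OF that] by linarith
    have fk_lip: "\<bar>fk k a - fk k b\<bar> \<le> real k * mdist m a b" if ab: "a \<in> mspace m" "b \<in> mspace m" for k a b
    proof -
      have "fk k a \<le> fk k b + real k * mdist m a b" if ab: "a \<in> mspace m" "b \<in> mspace m" for a b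
      proof -
        have "fk k a - real k * mdist m a b \<le> fk k b"
          unfolding fk_def[of k b]
        proof (rule cINF_greatest[OF ne])
          fix y assume y: "y \<in> mspace m"
          have "fk k a \<le> f y + real k * mdist m a y" unfolding fk_def by (rule cINF_lower[OF bdd y])
          moreover have "real k * mdist m a y \<le> real k * (mdist m a b + mdist m b y)"
            by (intro mult_left_mono ms.triangle ab y) auto
          ultimately show "fk k a - real k * mdist m a b \<le> f y + real k * mdist m b y"
            by (simp add: algebra_simps)
        qed
        then show ?thesis by linarith
      qed
      from this[OF ab] this[OF ab(2,1)] show ?thesis by (simp add: ms.commute abs_le_iff)
    qed
    have fk_lim: "(\<lambda>k. fk k x) \<longlonglongrightarrow> f x" if x: "x \<in> mspace m" for x
    proof (rule LIMSEQ_I)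
      fix e :: real assume e: "e > 0"
      have "openin (mtopology_of m) {y \<in> mspace m. f y \<in> {f x - e / 2 <..}}"
        using openin_continuous_map_preimage[OF f, of "{f x - e / 2 <..}"] by simp
      then obtain d where d: "d > 0" "ms.mball x d \<subseteq> {y \<in> mspace m. f y > f x - e / 2}"
        using x e unfolding mtopology_of_def ms.openin_mtopology by force
      \<comment> \<open>Points at distance \<open>d\<close> or more cost at least
        \<open>K * d \<ge> 2 * B\<close>, the largest possible variation of \<open>f\<close>, so the
        infimum is decided near \<open>x\<close>.\<close>
      obtain K :: nat where K: "2 * B / d \<le> real K" using real_arch_simple by blast
      have "\<bar>fk k x - f x\<bar> < e" if k: "k \<ge> K" for k
      proof -
        have "f x - e / 2 \<le> fk k x" unfolding fk_def
        proof (rule cINF_greatest[OF ne])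
          fix y assume y: "y \<in> mspace m"
          show "f x - e / 2 \<le> f y + real k * mdist m x y"
          proof (cases "mdist m x y < d")
            case True
            then have "f y > f x - e / 2" using d(2) x y by (auto simp: ms.in_mball)
            then show ?thesis using e mult_nonneg_nonneg[OF of_nat_0_le_iff[of k] ms.nonneg[of x y]] by linarith
          next
            case False
            have "2 * B \<le> real K * d" using K d(1) by (simp add: divide_le_eq)
            also have "\<dots> \<le> real k * mdist m x y" using k False d(1) by (intro mult_mono) auto
            finally show ?thesis using B[OF x] B[OF y] e by linarith
          qed
        qed
        then show ?thesis using fk_le[OF x, of k] e by linarith
      qed
      then show "\<exists>K. \<forall>k\<ge>K. norm (fk k x - f x) < e" by auto
    qed
    have fm: "f \<in> borel_measurable (borel_metric m)" by (rule measurable_borel_metric_continuous[OF f])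
    have fkm: "fk k \<in> borel_measurable (borel_metric m)" for k
      by (rule lipschitz_borel_measurable) (rule fk_lip)
    have Lsp: "\<omega> \<in> space N \<Longrightarrow> L \<omega> \<in> mspace m" and Zsp: "\<omega>' \<in> space M \<Longrightarrow> Z n \<omega>' \<in> mspace m" for \<omega> \<omega>' n
      using measurable_space[OF L] measurable_space[OF Z[of n]] by auto
    have "(\<lambda>k. \<integral>\<omega>. fk k (L \<omega>) \<partial>N) \<longlonglongrightarrow> (\<integral>\<omega>. f (L \<omega>) \<partial>N)"
      by (rule integral_dominated_convergence[where w="\<lambda>_. B"])
         (auto intro!: measurable_compose[OF L] fm fkm AE_I2 fk_lim fk_bd Lsp)
    then obtain k where k: "(\<integral>\<omega>. fk k (L \<omega>) \<partial>N) > (\<integral>\<omega>. f (L \<omega>) \<partial>N) - e / 2"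
      using e order_tendstoD(1)[of _ "\<integral>\<omega>. f (L \<omega>) \<partial>N" sequentially "(\<integral>\<omega>. f (L \<omega>) \<partial>N) - e / 2"]
      unfolding eventually_sequentially by fastforce
    have "(\<lambda>n. \<integral>\<omega>. fk k (Z n \<omega>) \<partial>M) \<longlonglongrightarrow> (\<integral>\<omega>. fk k (L \<omega>) \<partial>N)"
      by (rule lip[OF fk_bd fk_lip])
    then have "\<forall>\<^sub>F n in sequentially. (\<integral>\<omega>. fk k (Z n \<omega>) \<partial>M) > (\<integral>\<omega>. f (L \<omega>) \<partial>N) - e"
      by (rule order_tendstoD(1)) (use k e in linarith)
    then show ?thesis
    proof eventually_elim
      case (elim n)
      have "(\<integral>\<omega>. fk k (Z n \<omega>) \<partial>M) \<le> (\<integral>\<omega>. f (Z n \<omega>) \<partial>M)"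
        by (intro integral_mono M.integrable_const_bound[of _ B] AE_I2 measurable_compose[OF Z] fm fkm)
           (auto intro!: fk_le fk_bd B Zsp)
      with elim show ?case by linarith
    qed
  qed
  fix f assume "continuous_map (mtopology_of m) euclideanreal f \<and> bounded (f ` mspace m)"
  then have f: "continuous_map (mtopology_of m) euclideanreal f" and "bounded (f ` mspace m)" by auto
  then obtain B where B: "\<And>a. a \<in> mspace m \<Longrightarrow> \<bar>f a\<bar> \<le> B" by (auto simp: bounded_iff)
  have f': "continuous_map (mtopology_of m) euclideanreal (\<lambda>x. - f x)" by (intro continuous_intros f)
  show "(\<lambda>n. \<integral>\<omega>. f (Z n \<omega>) \<partial>M) \<longlonglongrightarrow> (\<integral>\<omega>. f (L \<omega>) \<partial>N)"
  proof (rule tendstoI)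
    fix e :: real assume e: "e > 0"
    from lower[OF f B e] lower[OF f' _ e, of B] B
    have "\<forall>\<^sub>F n in sequentially. (\<integral>\<omega>. f (Z n \<omega>) \<partial>M) > (\<integral>\<omega>. f (L \<omega>) \<partial>N) - e"
      "\<forall>\<^sub>F n in sequentially. (\<integral>\<omega>. - f (Z n \<omega>) \<partial>M) > (\<integral>\<omega>. - f (L \<omega>) \<partial>N) - e" by auto
    then show "\<forall>\<^sub>F n in sequentially. dist (\<integral>\<omega>. f (Z n \<omega>) \<partial>M) (\<integral>\<omega>. f (L \<omega>) \<partial>N) < e"
      by eventually_elim (simp add: dist_real_def abs_less_iff)
  qed
qed

section \<open>Convergence in distribution from cosine moments\<close>

text \<open>The phase \<open>b\<close> makes cosines suffice, since sines are shifted cosines. With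
  it the family is closed under products by the product-to-sum formula.\<close>

definition trig_poly :: "(('i \<Rightarrow> real) \<times> real \<times> real) list \<Rightarrow> 'i set \<Rightarrow> ('i \<Rightarrow> real) \<Rightarrow> real" where
  "trig_poly l F a = (\<Sum>(t, b, c)\<leftarrow>l. c * cos ((\<Sum>i\<in>F. t i * a i) + b))"

lemma trig_poly_append: "trig_poly (l @ l') F a = trig_poly l F a + trig_poly l' F a"
  by (simp add: trig_poly_def)

lemma trig_poly_mult_exists: "\<exists>l''. \<forall>a. trig_poly l F a * trig_poly l' F a = trig_poly l'' F a"
proof (induction l)
  case Nil
  show ?case by (rule exI[of _ "[]"]) (simp add: trig_poly_def)
next
  case (Cons x l)
  obtain t b c where x: "x = (t, b, c)" by (cases x)
  from Cons obtain l1 where l1: "\<And>a. trig_poly l F a * trig_poly l' F a = trig_poly l1 F a" by blast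
  have "\<exists>l2. \<forall>a. c * cos ((\<Sum>i\<in>F. t i * a i) + b) * trig_poly l' F a = trig_poly l2 F a"
  proof (induction l')
    case Nil
    show ?case by (rule exI[of _ "[]"]) (simp add: trig_poly_def)
  next
    case (Cons y l')
    obtain t' b' c' where y: "y = (t', b', c')" by (cases y)
    from Cons obtain l2 where l2: "\<And>a. c * cos ((\<Sum>i\<in>F. t i * a i) + b) * trig_poly l' F a = trig_poly l2 F a" by blast
    show ?case
    proof (intro exI allI)
      fix a
      have "c * cos ((\<Sum>i\<in>F. t i * a i) + b) * (c' * cos ((\<Sum>i\<in>F. t' i * a i) + b')) =
          c * c' / 2 * cos ((\<Sum>i\<in>F. (t i - t' i) * a i) + (b - b')) + c * c' / 2 * cos ((\<Sum>i\<in>F. (t i + t' i) * a i) + (b + b'))"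
      proof -
        let ?A = "(\<Sum>i\<in>F. t i * a i) + b" and ?B = "(\<Sum>i\<in>F. t' i * a i) + b'"
        have 1: "(\<Sum>i\<in>F. (t i - t' i) * a i) + (b - b') = ?A - ?B"
          by (simp add: left_diff_distrib sum_subtractf)
        have 2: "(\<Sum>i\<in>F. (t i + t' i) * a i) + (b + b') = ?A + ?B"
          by (simp add: distrib_right sum.distrib)
        have "c * cos ?A * (c' * cos ?B) = c * c' * (cos ?A * cos ?B)" by simp
        then show ?thesis unfolding 1 2 cos_times_cos[of ?A ?B]
          by (simp only: add_divide_distrib distrib_left times_divide_eq_right times_divide_eq_left)
      qed
      then show "c * cos ((\<Sum>i\<in>F. t i * a i) + b) * trig_poly (y # l') F a =
          trig_poly ((\<lambda>i. t i - t' i, b - b', c * c' / 2) # (\<lambda>i. t i + t' i, b + b', c * c' / 2) # l2) F a"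
        using l2[of a] by (simp add: trig_poly_def y distrib_left)
    qed
  qed
  then obtain l2 where l2: "\<And>a. c * cos ((\<Sum>i\<in>F. t i * a i) + b) * trig_poly l' F a = trig_poly l2 F a" by blast
  have "trig_poly (x # l) F a * trig_poly l' F a = trig_poly (l2 @ l1) F a" for a
    unfolding trig_poly_append l1[symmetric] l2[symmetric] by (simp add: trig_poly_def x distrib_right)
  then show ?case by blast
qed

lemma compact_box: "compact {a :: 'i::countable \<Rightarrow> real. \<forall>i. \<bar>a i\<bar> \<le> b i}"
proof -
  have "compactin (product_topology (\<lambda>_. euclidean) UNIV) (PiE UNIV (\<lambda>i. {- b i..b i}))"
    by (simp add: compactin_PiE)
  then have "compact (PiE UNIV (\<lambda>i. {- b i..b i}))"
    by (simp add: euclidean_product_topology)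
  moreover have "PiE UNIV (\<lambda>i. {- b i..b i}) = {a. \<forall>i. \<bar>a i\<bar> \<le> b i}"
    by (auto simp: abs_le_iff minus_le_iff)
  ultimately show ?thesis by simp
qed

text \<open>Weierstrass approximation after the substitution \<open>a \<mapsto> R sin (a / R)\<close>, which makes the
  approximation uniform on all of the space and costs only a second moment.\<close>

lemma trig_approximation:
  fixes g :: "('i::countable \<Rightarrow> real) \<Rightarrow> real"
  assumes F: "finite F" and R: "R > 0" and e: "e > 0"
    and g: "continuous_on {a. \<forall>i. \<bar>a i\<bar> \<le> (if i \<in> F then R else 0)} g"
  obtains l where "\<And>a. \<bar>g (\<lambda>i. if i \<in> F then R * sin (a i / R) else 0) - trig_poly l F a\<bar> < e"
proof -
  define S where "S = {a :: 'i \<Rightarrow> real. \<forall>i. \<bar>a i\<bar> \<le> (if i \<in> F then R else 0)}"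
  define \<rho> where "\<rho> a = (\<lambda>i. if i \<in> F then R * sin (a i / R) else 0)" for a :: "'i \<Rightarrow> real"
  \<comment> \<open>The algebra of those functions on the box that turn into trigonometric
    polynomials under the substitution \<open>\<rho>\<close>; Stone-Weierstrass is applied to
    it.\<close>
  define P where "P = {p. continuous_on S p \<and> (\<exists>l. \<forall>a. p (\<rho> a) = trig_poly l F a)}"
  have \<rho>S: "\<rho> a \<in> S" for a
  proof -
    have "\<bar>R * sin (a i / R)\<bar> \<le> R" for i
      using mult_left_mono[OF abs_sin_le_one[of "a i / R"], of R] R by (simp add: abs_mult)
    then show ?thesis by (auto simp: \<rho>_def S_def)
  qed
  interpret function_ring_on P S
  proof
    show "compact S" unfolding S_def by (rule compact_box)
    show "continuous_on S f" if "f \<in> P" for f using that by (simp add: P_def)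
    show "(\<lambda>x. f x + h x) \<in> P" if fh: "f \<in> P" "h \<in> P" for f h
    proof -
      obtain l l' where "\<And>a. f (\<rho> a) = trig_poly l F a" "\<And>a. h (\<rho> a) = trig_poly l' F a" using fh by (auto simp: P_def)
      then show ?thesis using fh
        by (auto simp: P_def intro!: continuous_intros exI[of _ "l @ l'"] simp: trig_poly_append)
    qed
    show "(\<lambda>x. f x * h x) \<in> P" if fh: "f \<in> P" "h \<in> P" for f h
    proof -
      obtain l l' where l: "\<And>a. f (\<rho> a) = trig_poly l F a" "\<And>a. h (\<rho> a) = trig_poly l' F a" using fh by (auto simp: P_def)
      obtain l'' where "\<And>a. trig_poly l F a * trig_poly l' F a = trig_poly l'' F a"
        using trig_poly_mult_exists by blast
      then show ?thesis using fh l by (auto simp: P_def intro!: continuous_intros)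
    qed
    show "(\<lambda>_. c) \<in> P" for c
      by (auto simp: P_def trig_poly_def intro!: exI[of _ "[(\<lambda>_. 0, 0, c)]"])
    show "\<exists>f\<in>P. f x \<noteq> f y" if xy: "x \<in> S" "y \<in> S" "x \<noteq> y" for x y
    proof -
      obtain i where i: "x i \<noteq> y i" using xy(3) by blast
      have "z i = 0" if "z \<in> S" "i \<notin> F" for z
        using that abs_le_zero_iff[of "z i"] unfolding S_def mem_Collect_eq by metis
      with i have iF: "i \<in> F" using xy(1,2) by metis
      have "(\<lambda>a. a i) \<in> P"
      proof -
        have "(\<Sum>j\<in>F. (if j = i then 1 / R else 0) * a j) = a i / R" for a :: "'i \<Rightarrow> real"
        proof -
          have "(\<Sum>j\<in>F. (if j = i then 1 / R else 0) * a j) = (\<Sum>j\<in>F. if j = i then a j / R else 0)"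
            by (intro sum.cong) auto
          then show ?thesis using F iF by simp
        qed
        \<comment> \<open>\<open>R * sin (a i / R)\<close> is a cosine with phase
          \<open>- pi / 2\<close>. Thus the coordinates themselves lie in \<open>P\<close>, and they
          separate points.\<close>
        then have "\<rho> a i = trig_poly [(\<lambda>j. if j = i then 1 / R else 0, - pi / 2, R)] F a" for a
          using iF by (simp add: \<rho>_def trig_poly_def cos_add)
        then show ?thesis unfolding P_def
          by (auto intro!: continuous_on_subset[OF continuous_on_product_coordinates])
      qed
      with i show ?thesis by (intro bexI[of _ "\<lambda>a. a i"])
    qed
  qed
  obtain p where p: "p \<in> P" "\<forall>x\<in>S. \<bar>g x - p x\<bar> < e"
    using Stone_Weierstrass_basic[OF g[folded S_def] e] by blast
  obtain l where "\<And>a. p (\<rho> a) = trig_poly l F a" using p(1) by (auto simp: P_def)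
  with p(2) \<rho>S have "\<bar>g (\<rho> a) - trig_poly l F a\<bar> < e" for a by metis
  then show thesis using that unfolding \<rho>_def by blast
qed

text \<open>A quadratic error is the convenient form: its expectation is a second moment divided by
  \<open>R\<close>.\<close>

lemma sin_remainder: "\<bar>R * sin (u / R) - u\<bar> \<le> u\<^sup>2 / R" if "R > 0" for R u :: real
proof -
  have "\<bar>sin (u / R) - (\<Sum>m<2. sin_coeff m * (u / R) ^ m)\<bar> \<le> inverse (fact 2) * \<bar>u / R\<bar> ^ 2"
    by (rule Maclaurin_sin_bound)
  then have "\<bar>sin (u / R) - u / R\<bar> \<le> \<bar>u / R\<bar> ^ 2"
    by (simp add: sin_coeff_def numeral_2_eq_2)
  then have "\<bar>sin (u / R) - u / R\<bar> \<le> (u / R) ^ 2" by (simp only: power2_abs)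
  from mult_left_mono[OF this, of R] that have "\<bar>R * (sin (u / R) - u / R)\<bar> \<le> R * (u / R) ^ 2"
    by (simp add: abs_mult)
  moreover have "R * (sin (u / R) - u / R) = R * sin (u / R) - u" "R * (u / R) ^ 2 = u\<^sup>2 / R"
    using that by (simp_all add: field_simps power2_eq_square)
  ultimately show ?thesis by simp
qed

lemma (in prob_space) expectation_abs_le_sqrt:
  fixes f :: "'a \<Rightarrow> real"
  assumes "f \<in> borel_measurable M" "integrable M (\<lambda>\<omega>. (f \<omega>)\<^sup>2)" "expectation (\<lambda>\<omega>. (f \<omega>)\<^sup>2) \<le> v"
  shows "integrable M f" "expectation (\<lambda>\<omega>. \<bar>f \<omega>\<bar>) \<le> sqrt v"
proof -
  show i: "integrable M f" by (rule square_integrable_imp_integrable[OF assms(1,2)])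
  have "0 \<le> variance (\<lambda>\<omega>. \<bar>f \<omega>\<bar>)" by (rule variance_positive)
  also have "\<dots> = expectation (\<lambda>\<omega>. (f \<omega>)\<^sup>2) - (expectation (\<lambda>\<omega>. \<bar>f \<omega>\<bar>))\<^sup>2"
    using i assms(2) by (subst variance_eq) auto
  finally have "(expectation (\<lambda>\<omega>. \<bar>f \<omega>\<bar>))\<^sup>2 \<le> v" using assms(3) by simp
  then show "expectation (\<lambda>\<omega>. \<bar>f \<omega>\<bar>) \<le> sqrt v" by (rule real_le_rsqrt)
qed

section \<open>Uniform approximation under coordinatewise second moments\<close>

definition moment_bounded :: "'w measure \<Rightarrow> ('w \<Rightarrow> 'i \<Rightarrow> real) \<Rightarrow> ('i \<Rightarrow> real) \<Rightarrow> bool" where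
  "moment_bounded M Z v \<longleftrightarrow> (\<forall>i. (\<lambda>\<omega>. Z \<omega> i) \<in> borel_measurable M \<and> integrable M (\<lambda>\<omega>. (Z \<omega> i)\<^sup>2) \<and>
     (\<integral>\<omega>. (Z \<omega> i)\<^sup>2 \<partial>M) \<le> v i)"

lemma (in prob_space) moment_boundedD:
  assumes "moment_bounded M Z v"
  shows "(\<lambda>\<omega>. Z \<omega> i) \<in> borel_measurable M" "integrable M (\<lambda>\<omega>. (Z \<omega> i)\<^sup>2)"
    "expectation (\<lambda>\<omega>. (Z \<omega> i)\<^sup>2) \<le> v i" "integrable M (\<lambda>\<omega>. Z \<omega> i)"
    "expectation (\<lambda>\<omega>. \<bar>Z \<omega> i\<bar>) \<le> sqrt (v i)"
  using assms expectation_abs_le_sqrt[of "\<lambda>\<omega>. Z \<omega> i" "v i"] unfolding moment_bounded_def by auto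

text \<open>\<open>v\<close> bounds the second moments of the coordinates, hence their first
  absolute moments by \<open>sqrt (v i)\<close>. Summability of \<open>w i * sqrt (v i)\<close> then
  controls the expected norm and its tails by quantities depending on \<open>w\<close> and
  \<open>v\<close> only, a uniform tightness for all sequences of elements that share them.\<close>

locale l1_random =
  fixes M :: "'w measure" and Z :: "'w \<Rightarrow> 'i::countable \<Rightarrow> real" and w v :: "'i \<Rightarrow> real"
  assumes prob: "prob_space M" and w: "\<And>i. w i > 0" and l1: "\<And>\<omega>. \<omega> \<in> space M \<Longrightarrow> Z \<omega> \<in> l1_set w"
    and mom: "moment_bounded M Z v" and wv: "(\<lambda>i. w i * sqrt (v i)) summable_on UNIV"

sublocale l1_random \<subseteq> prob_space M by (rule prob)

context l1_random begin

lemma meas: "Z \<in> M \<rightarrow>\<^sub>M borel_metric (l1_space w)"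
  by (rule measurable_l1_space[OF w l1 moment_boundedD(1)[OF mom]])

lemma v_nonneg: "v i \<ge> 0"
  by (rule order_trans[OF _ moment_boundedD(3)[OF mom]]) simp

lemma expected_tail:
  "integrable M (\<lambda>\<omega>. \<Sum>\<^sub>\<infinity>i. if i \<in> F then 0 else w i * \<bar>Z \<omega> i\<bar>)"
  "expectation (\<lambda>\<omega>. \<Sum>\<^sub>\<infinity>i. if i \<in> F then 0 else w i * \<bar>Z \<omega> i\<bar>) \<le> (\<Sum>\<^sub>\<infinity>i. if i \<in> F then 0 else w i * sqrt (v i))"
proof -
  note md = moment_boundedD[OF mom]
  have *: "integrable M (\<lambda>\<omega>. if i \<in> F then 0 else w i * \<bar>Z \<omega> i\<bar>)" for i
    using md(4)[of i] by (cases "i \<in> F") auto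
  have s1: "(\<lambda>i. if i \<in> F then 0 else w i * sqrt (v i)) summable_on UNIV"
    by (rule summable_on_abs_le[OF wv]) (use w v_nonneg in \<open>auto simp: less_imp_le\<close>)
  have s2: "(\<lambda>i. if i \<in> F then 0 else w i * \<bar>Z \<omega> i\<bar>) summable_on UNIV" if "\<omega> \<in> space M" for \<omega>
    by (rule summable_on_abs_le[of "\<lambda>i. w i * \<bar>Z \<omega> i\<bar>"]) (use l1[OF that] w in \<open>auto simp: l1_set_def less_imp_le abs_mult\<close>)
  have ex: "expectation (\<lambda>\<omega>. if i \<in> F then 0 else w i * \<bar>Z \<omega> i\<bar>) \<le> (if i \<in> F then 0 else w i * sqrt (v i))" for i
    using mult_left_mono[OF md(5)[of i], of "w i"] w[of i] by auto
  note r = expectation_infsum_le[of "\<lambda>\<omega> i. if i \<in> F then 0 else w i * \<bar>Z \<omega> i\<bar>", OF * _ ex s1 s2]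
  show "integrable M (\<lambda>\<omega>. \<Sum>\<^sub>\<infinity>i. if i \<in> F then 0 else w i * \<bar>Z \<omega> i\<bar>)"
    "expectation (\<lambda>\<omega>. \<Sum>\<^sub>\<infinity>i. if i \<in> F then 0 else w i * \<bar>Z \<omega> i\<bar>) \<le> (\<Sum>\<^sub>\<infinity>i. if i \<in> F then 0 else w i * sqrt (v i))"
    using r w by (auto simp: less_imp_le)
qed

lemma integrable_cos: "integrable M (\<lambda>\<omega>. c * cos ((\<Sum>i\<in>F. t i * Z \<omega> i) + b))"
  by (intro integrable_mult_right integrable_const_bound[of _ 1] measurable_compose[OF _ borel_measurable_cos]
      borel_measurable_add borel_measurable_sum borel_measurable_times borel_measurable_const
      moment_boundedD(1)[OF mom] measurable_ident)
     auto

lemma integrable_trig_poly: "integrable M (\<lambda>\<omega>. trig_poly l F (Z \<omega>))"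
proof (induction l)
  case (Cons x l)
  obtain t b c where x: "x = (t, b, c)" by (cases x)
  show ?case using Cons integrable_cos[where c=c and F=F and t=t and b=b] by (simp add: trig_poly_def x)
qed (simp add: trig_poly_def)

lemma expected_norm:
  "integrable M (\<lambda>\<omega>. \<Sum>\<^sub>\<infinity>i. w i * \<bar>Z \<omega> i\<bar>)"
  "expectation (\<lambda>\<omega>. \<Sum>\<^sub>\<infinity>i. w i * \<bar>Z \<omega> i\<bar>) \<le> (\<Sum>\<^sub>\<infinity>i. w i * sqrt (v i))"
  using expected_tail[of "{}"] by simp_all

end

lemma tail_small:
  fixes f :: "'i::countable \<Rightarrow> real"
  assumes f: "f summable_on UNIV" and e: "e > 0"
  obtains F where "finite F" "(\<Sum>\<^sub>\<infinity>i. if i \<in> F then 0 else f i) < e"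
proof -
  have "\<forall>\<^sub>F n in sequentially. (\<Sum>z\<in>exhaust n. f z) > infsum f UNIV - e"
    using order_tendstoD(1)[OF infsum_LIMSEQ[OF f], of "infsum f UNIV - e"] e by simp
  then obtain n where n: "(\<Sum>z\<in>exhaust n. f z) > infsum f UNIV - e"
    unfolding eventually_sequentially by blast
  have "((\<lambda>i. f i + - (if i \<in> exhaust n then f i else 0)) has_sum infsum f UNIV + - (\<Sum>i\<in>exhaust n. f i)) UNIV"
    by (intro has_sum_add has_sum_uminusI has_sum_infsum f) (rule has_sum_finite_neutralI[of "exhaust n"], auto)
  moreover have "f i + - (if i \<in> exhaust n then f i else 0) = (if i \<in> exhaust n then 0 else f i)" for i by simp
  ultimately have "(\<Sum>\<^sub>\<infinity>i. if i \<in> exhaust n then 0 else f i) = infsum f UNIV + - (\<Sum>i\<in>exhaust n. f i)"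
    by (simp only: infsumI)
  with n show thesis by (intro that[of "exhaust n"]) auto
qed

text \<open>Three errors add up: coordinates outside \<open>F\<close> are discarded, those inside
  are replaced by \<open>R * sin (a / R)\<close>, and \<open>g\<close> is replaced there by the
  trigonometric polynomial. The law of \<open>Z\<close> enters the bound only through
  \<open>v\<close>, so it is uniform along a sequence.\<close>

lemma (in l1_random) lipschitz_approximation:
  fixes g :: "('i \<Rightarrow> real) \<Rightarrow> real"
  assumes gB: "\<And>a. a \<in> l1_set w \<Longrightarrow> \<bar>g a\<bar> \<le> B"
    and gC: "\<And>a b. a \<in> l1_set w \<Longrightarrow> b \<in> l1_set w \<Longrightarrow> \<bar>g a - g b\<bar> \<le> C * l1_dist w a b"
    and C: "C \<ge> 0" and F: "finite F" and R: "R > 0"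
    and q: "\<And>a. \<bar>g (\<lambda>i. if i \<in> F then R * sin (a i / R) else 0) - trig_poly l F a\<bar> < e"
  shows "\<bar>expectation (\<lambda>\<omega>. g (Z \<omega>)) - expectation (\<lambda>\<omega>. trig_poly l F (Z \<omega>))\<bar>
    \<le> C * (\<Sum>\<^sub>\<infinity>i. if i \<in> F then 0 else w i * sqrt (v i)) + C * (\<Sum>i\<in>F. w i * v i) / R + e"
proof -
  note sp = l1_space_simps[of w, OF w] and md = moment_boundedD[OF mom]
  have gm: "g \<in> borel_measurable (borel_metric (l1_space w))"
    by (rule lipschitz_borel_measurable[of _ _ C]) (use gC in \<open>simp add: sp\<close>)
  have int1: "integrable M (\<lambda>\<omega>. g (Z \<omega>))"
    by (rule integrable_const_bound[of _ B]) (auto intro!: AE_I2 gB l1 measurable_compose[OF meas gm])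
  note int2 = integrable_trig_poly[where l=l and F=F]
  define h where "h \<omega> = C * (\<Sum>\<^sub>\<infinity>i. if i \<in> F then 0 else w i * \<bar>Z \<omega> i\<bar>) + (C / R) * (\<Sum>i\<in>F. w i * (Z \<omega> i)\<^sup>2) + e" for \<omega>
  have hint: "integrable M h" unfolding h_def using expected_tail(1) md(2) by auto
  have hE: "expectation h \<le> C * (\<Sum>\<^sub>\<infinity>i. if i \<in> F then 0 else w i * sqrt (v i)) + (C / R) * (\<Sum>i\<in>F. w i * v i) + e"
  proof -
    have "expectation h = C * expectation (\<lambda>\<omega>. \<Sum>\<^sub>\<infinity>i. if i \<in> F then 0 else w i * \<bar>Z \<omega> i\<bar>)
        + (C / R) * (\<Sum>i\<in>F. w i * expectation (\<lambda>\<omega>. (Z \<omega> i)\<^sup>2)) + e"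
      unfolding h_def using expected_tail(1)[of F] md(2) by (simp add: prob_space)
    also have "\<dots> \<le> C * (\<Sum>\<^sub>\<infinity>i. if i \<in> F then 0 else w i * sqrt (v i)) + (C / R) * (\<Sum>i\<in>F. w i * v i) + e"
      using C R by (intro add_mono mult_left_mono expected_tail(2) sum_mono md(3)) (auto simp: w less_imp_le)
    finally show ?thesis .
  qed
  have pw: "\<bar>g (Z \<omega>) - trig_poly l F (Z \<omega>)\<bar> \<le> h \<omega>" if \<omega>: "\<omega> \<in> space M" for \<omega>
  proof -
    let ?a = "\<lambda>i. if i \<in> F then R * sin (Z \<omega> i / R) else 0"
    have a: "?a \<in> l1_set w"
      unfolding l1_set_def mem_Collect_eq
      by (rule finite_nonzero_values_imp_summable_on, rule finite_subset[OF _ F]) auto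
    have s: "(\<lambda>i. w i * \<bar>Z \<omega> i\<bar>) summable_on UNIV" using l1[OF \<omega>] by (simp add: l1_set_def)
    have s2: "(\<lambda>i. if i \<in> F then 0 else w i * \<bar>Z \<omega> i\<bar>) summable_on UNIV"
      by (rule summable_on_abs_le[OF s]) (use w in \<open>auto simp: less_imp_le\<close>)
    have hs: "((\<lambda>i. (if i \<in> F then 0 else w i * \<bar>Z \<omega> i\<bar>) + (if i \<in> F then w i * ((Z \<omega> i)\<^sup>2 / R) else 0)) has_sum
        (\<Sum>\<^sub>\<infinity>i. if i \<in> F then 0 else w i * \<bar>Z \<omega> i\<bar>) + (\<Sum>i\<in>F. w i * ((Z \<omega> i)\<^sup>2 / R))) UNIV"
      by (intro has_sum_add has_sum_infsum s2) (rule has_sum_finite_neutralI[OF F], auto)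
    have "l1_dist w (Z \<omega>) ?a \<le> (\<Sum>\<^sub>\<infinity>i. if i \<in> F then 0 else w i * \<bar>Z \<omega> i\<bar>) + (\<Sum>i\<in>F. w i * ((Z \<omega> i)\<^sup>2 / R))"
      unfolding l1_dist_def infsumI[OF hs, symmetric]
    proof (rule infsum_mono[OF l1_set_diff[OF w l1[OF \<omega>] a] has_sum_imp_summable[OF hs]])
      show "w i * \<bar>Z \<omega> i - ?a i\<bar> \<le> (if i \<in> F then 0 else w i * \<bar>Z \<omega> i\<bar>) + (if i \<in> F then w i * ((Z \<omega> i)\<^sup>2 / R) else 0)" for i
        using mult_left_mono[OF sin_remainder[OF R, of "Z \<omega> i"], of "w i"] w[of i] by (auto simp: abs_minus_commute)
    qed
    from mult_left_mono[OF this C] gC[OF l1[OF \<omega>] a]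
    have "\<bar>g (Z \<omega>) - g ?a\<bar> \<le> C * (\<Sum>\<^sub>\<infinity>i. if i \<in> F then 0 else w i * \<bar>Z \<omega> i\<bar>) + C * (\<Sum>i\<in>F. w i * ((Z \<omega> i)\<^sup>2 / R))"
      by (simp add: distrib_left)
    moreover have "C * (\<Sum>i\<in>F. w i * ((Z \<omega> i)\<^sup>2 / R)) = (C / R) * (\<Sum>i\<in>F. w i * (Z \<omega> i)\<^sup>2)"
      by (simp add: sum_divide_distrib sum_distrib_left)
    ultimately show ?thesis using q[of "Z \<omega>"] by (simp add: h_def)
  qed
  have "\<bar>expectation (\<lambda>\<omega>. g (Z \<omega>)) - expectation (\<lambda>\<omega>. trig_poly l F (Z \<omega>))\<bar> = \<bar>expectation (\<lambda>\<omega>. g (Z \<omega>) - trig_poly l F (Z \<omega>))\<bar>"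
    using int1 int2 by simp
  also have "\<dots> \<le> expectation (\<lambda>\<omega>. \<bar>g (Z \<omega>) - trig_poly l F (Z \<omega>)\<bar>)"
    using integral_abs_bound by blast
  also have "\<dots> \<le> expectation h"
    by (rule integral_mono[OF _ hint pw]) (use int1 int2 in auto)
  finally show ?thesis using hE by simp
qed

text \<open>One trigonometric polynomial serves all \<open>Z k\<close> and the limit at once,
  because the approximation error depends on the law only through \<open>v\<close>. Its expectations
  converge term by term by the cosine hypothesis.\<close>

lemma clt_lipschitz:
  fixes Z :: "nat \<Rightarrow> 'w \<Rightarrow> 'i::countable \<Rightarrow> real" and L :: "'g \<Rightarrow> 'i \<Rightarrow> real"
  assumes Z: "\<And>k. l1_random M (Z k) w v" and L: "l1_random N L w v"
    and cs: "\<And>F t b. finite F \<Longrightarrow>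
      (\<lambda>k. \<integral>\<omega>. cos ((\<Sum>i\<in>F. t i * Z k \<omega> i) + b) \<partial>M) \<longlonglongrightarrow> (\<integral>\<omega>. cos ((\<Sum>i\<in>F. t i * L \<omega> i) + b) \<partial>N)"
    and gB: "\<And>a. a \<in> l1_set w \<Longrightarrow> \<bar>g a\<bar> \<le> B"
    and gC: "\<And>a b. a \<in> l1_set w \<Longrightarrow> b \<in> l1_set w \<Longrightarrow> \<bar>g a - g b\<bar> \<le> C * l1_dist w a b"
  shows "(\<lambda>k. \<integral>\<omega>. g (Z k \<omega>) \<partial>M) \<longlonglongrightarrow> (\<integral>\<omega>. g (L \<omega>) \<partial>N)"
proof (rule tendstoI)
  fix e :: real assume e: "e > 0"
  interpret L: l1_random N L w v by fact
  interpret Z: l1_random M "Z k" w v for k by fact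
  define C' where "C' = max C 1"
  have C': "C' \<ge> 0" "C' > 0" by (auto simp: C'_def)
  have gC': "\<bar>g a - g b\<bar> \<le> C' * l1_dist w a b" if "a \<in> l1_set w" "b \<in> l1_set w" for a b
  proof -
    have "0 \<le> l1_dist w a b" unfolding l1_dist_def by (rule infsum_nonneg) (simp add: L.w less_imp_le)
    then have "C * l1_dist w a b \<le> C' * l1_dist w a b" by (intro mult_right_mono) (auto simp: C'_def)
    with gC[OF that] show ?thesis by linarith
  qed
  obtain F where F: "finite F" "(\<Sum>\<^sub>\<infinity>i. if i \<in> F then 0 else w i * sqrt (v i)) < e / (9 * C')"
    using tail_small[OF L.wv, of "e / (9 * C')"] e C' by auto
  define Q where "Q = (\<Sum>i\<in>F. w i * v i)"
  have Q: "Q \<ge> 0" unfolding Q_def by (rule sum_nonneg) (simp add: L.w L.v_nonneg less_imp_le)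
  \<comment> \<open>Makes the sine substitution cost at most \<open>e / 9\<close>; the summand
    \<open>1\<close> keeps \<open>R\<close> positive when \<open>Q = 0\<close>.\<close>
  define R where "R = 9 * C' * (Q + 1) / e"
  have R: "R > 0" using e C' Q by (simp add: R_def)
  \<comment> \<open>On the box the distance is a finite weighted sum of coordinate differences, so a
    Lipschitz function is continuous for the product topology, as the approximation theorem
    requires.\<close>
  have cont: "continuous_on {a. \<forall>i. \<bar>a i\<bar> \<le> (if i \<in> F then R else 0)} g"
  proof -
    let ?S = "{a. \<forall>i. \<bar>a i\<bar> \<le> (if i \<in> F then R else 0)}"
    have S: "a i = 0" if "a \<in> ?S" "i \<notin> F" for a :: "'i \<Rightarrow> real" and i using that abs_le_zero_iff[of "a i"] unfolding mem_Collect_eq by metis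
    have Sl: "a \<in> l1_set w" if "a \<in> ?S" for a
      unfolding l1_set_def mem_Collect_eq
      by (rule finite_nonzero_values_imp_summable_on, rule finite_subset[OF _ F(1)]) (use S[OF that] in auto)
    have d: "l1_dist w a b = (\<Sum>i\<in>F. w i * \<bar>a i - b i\<bar>)" if "a \<in> ?S" "b \<in> ?S" for a b
      unfolding l1_dist_def by (rule infsumI, rule has_sum_finite_neutralI[OF F(1)]) (use S[OF that(1)] S[OF that(2)] in auto)
    show ?thesis unfolding continuous_on_def
    proof
      fix b assume b: "b \<in> ?S"
      have "continuous_on ?S (\<lambda>a. C' * (\<Sum>i\<in>F. w i * \<bar>a i - b i\<bar>))"
        by (intro continuous_intros continuous_on_subset[OF continuous_on_product_coordinates]) auto
      then have "((\<lambda>a. C' * (\<Sum>i\<in>F. w i * \<bar>a i - b i\<bar>)) \<longlongrightarrow> C' * (\<Sum>i\<in>F. w i * \<bar>b i - b i\<bar>)) (at b within ?S)"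
        using b unfolding continuous_on_def by blast
      then have l0: "((\<lambda>a. C' * (\<Sum>i\<in>F. w i * \<bar>a i - b i\<bar>)) \<longlongrightarrow> 0) (at b within ?S)" by simp
      have "((\<lambda>a. g a - g b) \<longlongrightarrow> 0) (at b within ?S)"
      proof (rule Lim_null_comparison[OF _ l0])
        show "\<forall>\<^sub>F a in at b within ?S. norm (g a - g b) \<le> C' * (\<Sum>i\<in>F. w i * \<bar>a i - b i\<bar>)"
          unfolding eventually_at_filter
          by (rule always_eventually) (use gC'[OF Sl Sl[OF b]] d[OF _ b] in auto)
      qed
      then show "(g \<longlongrightarrow> g b) (at b within ?S)" by (rule LIM_zero_cancel)
    qed
  qed
  obtain l where l: "\<And>a. \<bar>g (\<lambda>i. if i \<in> F then R * sin (a i / R) else 0) - trig_poly l F a\<bar> < e / 9"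
    using trig_approximation[where e="e / 9" and g=g, OF F(1) R _ cont] e by auto
  have "(\<lambda>k. \<integral>\<omega>. trig_poly l F (Z k \<omega>) \<partial>M) \<longlonglongrightarrow> (\<integral>\<omega>. trig_poly l F (L \<omega>) \<partial>N)"
  proof -
    show ?thesis
    proof (induction l)
      case (Cons x l)
      obtain t b c where x: "x = (t, b, c)" by (cases x)
      have eq: "(\<integral>\<omega>. trig_poly (x # l) F (Y \<omega>) \<partial>M') = c * (\<integral>\<omega>. cos ((\<Sum>i\<in>F. t i * Y \<omega> i) + b) \<partial>M') + (\<integral>\<omega>. trig_poly l F (Y \<omega>) \<partial>M')"
        if "l1_random M' Y w v" for M' :: "'z measure" and Y

      proof -
        interpret l1_random M' Y w v by fact
        have "trig_poly (x # l) F a = c * cos ((\<Sum>i\<in>F. t i * a i) + b) + trig_poly l F a" for a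
          by (simp add: trig_poly_def x)
        then show ?thesis using integrable_cos[where c=c and F=F and t=t and b=b] integrable_trig_poly[where l=l and F=F] by simp
      qed
      show ?case unfolding eq[OF Z] eq[OF L] by (intro tendsto_intros cs F(1) Cons.IH)
    qed (simp add: trig_poly_def)
  qed
  from tendstoD[OF this, of "e / 9"] e
  have ev: "\<forall>\<^sub>F k in sequentially. \<bar>(\<integral>\<omega>. trig_poly l F (Z k \<omega>) \<partial>M) - (\<integral>\<omega>. trig_poly l F (L \<omega>) \<partial>N)\<bar> < e / 9"
    by (simp add: dist_real_def)
  have err: "C' * (\<Sum>\<^sub>\<infinity>i. if i \<in> F then 0 else w i * sqrt (v i)) + C' * (\<Sum>i\<in>F. w i * v i) / R + e / 9 \<le> e / 3"
  proof -
    have "C' * (\<Sum>\<^sub>\<infinity>i. if i \<in> F then 0 else w i * sqrt (v i)) \<le> C' * (e / (9 * C'))"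
      using F(2) C' by (intro mult_left_mono) auto
    also have "\<dots> = e / 9" using C' by simp
    finally have 1: "C' * (\<Sum>\<^sub>\<infinity>i. if i \<in> F then 0 else w i * sqrt (v i)) \<le> e / 9" .
    have "e / 9 * R = C' * (Q + 1)" using e by (simp add: R_def)
    then have "C' * Q / R \<le> e / 9" using R C' by (simp add: pos_divide_le_eq)
    with 1 show ?thesis unfolding Q_def by linarith
  qed
  show "\<forall>\<^sub>F k in sequentially. dist (\<integral>\<omega>. g (Z k \<omega>) \<partial>M) (\<integral>\<omega>. g (L \<omega>) \<partial>N) < e"
    using ev
  proof eventually_elim
    case (elim k)
    have "\<bar>(\<integral>\<omega>. g (Z k \<omega>) \<partial>M) - (\<integral>\<omega>. trig_poly l F (Z k \<omega>) \<partial>M)\<bar> \<le> e / 3"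
      using Z.lipschitz_approximation[where k=k and g=g, OF gB gC' C'(1) F(1) R l] err by linarith
    moreover have "\<bar>(\<integral>\<omega>. g (L \<omega>) \<partial>N) - (\<integral>\<omega>. trig_poly l F (L \<omega>) \<partial>N)\<bar> \<le> e / 3"
      using L.lipschitz_approximation[where g=g, OF gB gC' C'(1) F(1) R l] err by linarith
    ultimately show ?case using elim e unfolding dist_real_def by linarith
  qed
qed

section \<open>Gaussian variables and empirical processes\<close>

text \<open>With characteristic functions, scaling, independent sums and limits become computations
  with \<open>v\<close>. The value \<open>v = 0\<close> stands for the point mass at
  \<open>0\<close>.\<close>

definition gauss :: "'w measure \<Rightarrow> ('w \<Rightarrow> real) \<Rightarrow> real \<Rightarrow> bool" where
  "gauss N Z v \<longleftrightarrow> Z \<in> borel_measurable N \<and> v \<ge> 0 \<and>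
     (\<forall>t. char (distr N borel Z) t = of_real (exp (- v * t\<^sup>2 / 2)))"

lemma gauss_measurable: "gauss N Z v \<Longrightarrow> Z \<in> borel_measurable N" by (simp add: gauss_def)

lemma char_distr: "Z \<in> borel_measurable N \<Longrightarrow> char (distr N borel Z) t = (CLINT \<omega>|N. iexp (t * Z \<omega>))"
  by (simp add: char_def integral_distr)

abbreviation "std_normal_scaled v \<equiv> distr std_normal_distribution borel (\<lambda>x. sqrt v * x)"

lemma char_std_normal_scaled:
  assumes "v \<ge> 0"
  shows "char (std_normal_scaled v) t = of_real (exp (- v * t\<^sup>2 / 2))"
proof -
  have "char (std_normal_scaled v) t = (CLINT x|std_normal_distribution. iexp ((t * sqrt v) * x))"
    by (subst char_distr) (simp_all add: mult.assoc)
  also have "\<dots> = char std_normal_distribution (t * sqrt v)" by (simp add: char_def)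
  finally show ?thesis using assms by (simp add: char_std_normal_distribution power_mult_distrib mult.commute)
qed

lemma real_distribution_of_rv: "prob_space N \<Longrightarrow> Z \<in> borel_measurable N \<Longrightarrow> real_distribution (distr N borel Z)"
  by (simp add: real_distribution_def real_distribution_axioms_def prob_space.prob_space_distr)

lemma gauss_iff_distr:
  assumes "prob_space N"
  shows "gauss N Z v \<longleftrightarrow> Z \<in> borel_measurable N \<and> v \<ge> 0 \<and> distr N borel Z = std_normal_scaled v"
proof -
  have "distr N borel Z = std_normal_scaled v"
    if "Z \<in> borel_measurable N" "v \<ge> 0" "\<forall>t. char (distr N borel Z) t = of_real (exp (- v * t\<^sup>2 / 2))"
    by (rule Levy_uniqueness[OF real_distribution_of_rv[OF assms that(1)] real_distribution_of_rv])
       (use that real_dist_normal_dist in \<open>auto simp: char_std_normal_scaled real_distribution_def\<close>)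
  then show ?thesis unfolding gauss_def by (auto simp: char_std_normal_scaled)
qed

lemma std_normal_scaled_0: "std_normal_scaled 0 = return borel 0"
proof -
  interpret real_distribution std_normal_distribution by (rule real_dist_normal_dist)
  show ?thesis by (simp add: distr_const)
qed

lemma std_normal_scaled_density:
  assumes "\<sigma> > 0"
  shows "std_normal_scaled (\<sigma>\<^sup>2) = density lborel (normal_density 0 \<sigma>)"
proof -
  interpret real_distribution std_normal_distribution by (rule real_dist_normal_dist)
  have "distributed std_normal_distribution lborel (\<lambda>x. x) (normal_density 0 1)"
    unfolding distributed_def
    by (auto intro!: measure_eqI simp: emeasure_distr) (simp add: emeasure_density)?
  from normal_density_affine[OF this, of \<sigma> 0] assms
  have "distributed std_normal_distribution lborel (\<lambda>x. \<sigma> * x) (normal_density 0 \<sigma>)" by simp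
  then have "distr std_normal_distribution lborel (\<lambda>x. \<sigma> * x) = density lborel (normal_density 0 \<sigma>)"
    by (simp add: distributed_def)
  moreover have "distr std_normal_distribution lborel (\<lambda>x. \<sigma> * x) = distr std_normal_distribution borel (\<lambda>x. \<sigma> * x)"
    by (rule distr_cong) auto
  ultimately show ?thesis using assms by simp
qed

lemma centered_normal_iff:
  assumes "prob_space N"
  shows "centered_normal N Z \<longleftrightarrow> (\<exists>v. gauss N Z v)"
proof
  assume c: "centered_normal N Z"
  then have m: "Z \<in> borel_measurable N" by (simp add: centered_normal_def)
  consider "distr N borel Z = return borel 0" | \<sigma> where "\<sigma> > 0" "distr N borel Z = density lborel (normal_density 0 \<sigma>)"
    using c by (auto simp: centered_normal_def)
  then show "\<exists>v. gauss N Z v"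
  proof cases
    case 1
    then show ?thesis using m std_normal_scaled_0 by (intro exI[of _ 0]) (simp add: gauss_iff_distr[OF assms])
  next
    case 2
    then show ?thesis using m std_normal_scaled_density[of \<sigma>] by (intro exI[of _ "\<sigma>\<^sup>2"]) (simp add: gauss_iff_distr[OF assms])
  qed
next
  assume "\<exists>v. gauss N Z v"
  then obtain v where v: "Z \<in> borel_measurable N" "v \<ge> 0" "distr N borel Z = std_normal_scaled v"
    using gauss_iff_distr[OF assms] by blast
  show "centered_normal N Z"
  proof (cases "v = 0")
    case True
    then show ?thesis using v std_normal_scaled_0 by (simp add: centered_normal_def)
  next
    case False
    then have "sqrt v > 0" using v by simp
    moreover have "distr N borel Z = density lborel (normal_density 0 (sqrt v))"
      using v std_normal_scaled_density[of "sqrt v"] \<open>sqrt v > 0\<close> by simp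
    ultimately show ?thesis unfolding centered_normal_def using v(1)
      by (intro conjI disjI2 exI[of _ "sqrt v"])
  qed
qed

lemma gauss_moments:
  assumes "prob_space N" "gauss N Z v"
  shows "integrable N (\<lambda>\<omega>. (Z \<omega>)\<^sup>2)" "(\<integral>\<omega>. (Z \<omega>)\<^sup>2 \<partial>N) = v" "integrable N Z" "(\<integral>\<omega>. Z \<omega> \<partial>N) = 0"
proof -
  have g: "Z \<in> borel_measurable N" "v \<ge> 0" "distr N borel Z = std_normal_scaled v"
    using assms(2) gauss_iff_distr[OF assms(1)] by auto
  note m = g(1)
  have i1: "integrable std_normal_distribution (\<lambda>x. x ^ k)" for k by (rule integrable_std_normal_distribution_moment)
  have s2: "(\<integral>x. x\<^sup>2 \<partial>std_normal_distribution) = 1"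
    using std_normal_distribution_even_moments(1)[of 1] by (simp add: fact_numeral)
  have s1: "(\<integral>x. x \<partial>std_normal_distribution) = 0"
    using integral_std_normal_distribution_moment_odd[of 1] by simp
  have "integrable (distr N borel Z) (\<lambda>x. x ^ k)" for k
    unfolding g(3) by (subst integrable_distr_eq) (use i1[of k] in \<open>auto simp: power_mult_distrib\<close>)
  then have i: "integrable N (\<lambda>\<omega>. (Z \<omega>) ^ k)" for k
    by (subst (asm) integrable_distr_eq) (use m in auto)
  show "integrable N (\<lambda>\<omega>. (Z \<omega>)\<^sup>2)" by (rule i)
  show "integrable N Z" using i[of 1] by simp
  have e: "(\<integral>\<omega>. (Z \<omega>) ^ k \<partial>N) = (\<integral>x. (sqrt v * x) ^ k \<partial>std_normal_distribution)" for k
  proof -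
    have "(\<integral>\<omega>. (Z \<omega>) ^ k \<partial>N) = (\<integral>x. x ^ k \<partial>distr N borel Z)"
      by (rule integral_distr[symmetric]) (use m in auto)
    also have "\<dots> = (\<integral>x. (sqrt v * x) ^ k \<partial>std_normal_distribution)"
      unfolding g(3) by (rule integral_distr) auto
    finally show ?thesis .
  qed
  show "(\<integral>\<omega>. (Z \<omega>)\<^sup>2 \<partial>N) = v" using e[of 2] s2 g(2) by (simp add: power_mult_distrib)
  show "(\<integral>\<omega>. Z \<omega> \<partial>N) = 0" using e[of 1] s1 by simp
qed

text \<open>Links the cosine moments of the convergence criterion to characteristic functions; the
  phase becomes the constant factor \<open>iexp b\<close>.\<close>

lemma cos_integral_char:
  assumes "prob_space N" "Z \<in> borel_measurable N"
  shows "(\<integral>\<omega>. cos (Z \<omega> + b) \<partial>N) = Re (iexp b * char (distr N borel Z) 1)"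
proof -
  interpret prob_space N by fact
  have "(\<integral>\<omega>. cos (Z \<omega> + b) \<partial>N) = (\<integral>\<omega>. Re (iexp b * iexp (Z \<omega>)) \<partial>N)"
    by (intro Bochner_Integration.integral_cong) (auto simp: cos_add Re_exp Im_exp cis_conv_exp[symmetric])
  also have "\<dots> = Re (CLINT \<omega>|N. iexp b * iexp (Z \<omega>))"
  proof (intro integral_Re integrable_mult_right integrable_iexp)
    show "(\<lambda>\<omega>. complex_of_real (Z \<omega>)) \<in> borel_measurable N" using assms(2) by measurable
  qed simp
  also have "(CLINT \<omega>|N. iexp b * iexp (Z \<omega>)) = iexp b * char (distr N borel Z) 1"
    using assms by (simp add: char_distr)
  finally show ?thesis .
qed

lemma gauss_scale: "gauss N Z v \<Longrightarrow> gauss N (\<lambda>\<omega>. c * Z \<omega>) (c\<^sup>2 * v)"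
proof -
  assume g: "gauss N Z v"
  note m = gauss_measurable[OF g]
  have "char (distr N borel (\<lambda>\<omega>. c * Z \<omega>)) t = char (distr N borel Z) (t * c)" for t
    using m by (simp add: char_distr mult.assoc)
  then show ?thesis using g by (auto simp: gauss_def power_mult_distrib mult_ac)
qed

lemma gauss_add:
  assumes "prob_space N" "gauss N Z v" "gauss N Z' v'" "prob_space.indep_var N borel Z borel Z'"
  shows "gauss N (\<lambda>\<omega>. Z \<omega> + Z' \<omega>) (v + v')"
  using assms prob_space.char_distr_add[OF assms(1,4)]
  by (auto simp: gauss_def exp_add[symmetric] algebra_simps add_divide_distrib diff_divide_distrib simp flip: of_real_mult)

text \<open>Dominated convergence gives convergence of the characteristic functions. The limit is
  continuous with value \<open>1\<close> at \<open>0\<close>, hence nonzero at some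
  \<open>t \<noteq> 0\<close>; taking logarithms there forces the variances to converge, and the
  limit has Gaussian form.\<close>

lemma gauss_limit:
  fixes Z :: "nat \<Rightarrow> 'w \<Rightarrow> real"
  assumes N: "prob_space N" and g: "\<And>n. gauss N (Z n) (v n)"
    and lim: "AE \<omega> in N. (\<lambda>n. Z n \<omega>) \<longlonglongrightarrow> Y \<omega>" and Y: "Y \<in> borel_measurable N"
  obtains v' where "v \<longlonglongrightarrow> v'" "gauss N Y v'"
proof -
  interpret prob_space N by fact
  note m = gauss_measurable[OF g]
  have ch: "(\<lambda>n. char (distr N borel (Z n)) t) \<longlonglongrightarrow> char (distr N borel Y) t" for t
    unfolding char_distr[OF m] char_distr[OF Y]
  proof (rule integral_dominated_convergence[where w="\<lambda>_. 1"])
    show "AE \<omega> in N. (\<lambda>n. iexp (t * Z n \<omega>)) \<longlonglongrightarrow> iexp (t * Y \<omega>)"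
      using lim by eventually_elim (intro tendsto_intros)
  qed (use m Y in auto)
  then have ch': "(\<lambda>n. complex_of_real (exp (- v n * t\<^sup>2 / 2))) \<longlonglongrightarrow> char (distr N borel Y) t" for t
    using g by (simp add: gauss_def)
  interpret Y: real_distribution "distr N borel Y" by (rule real_distribution_of_rv[OF N Y])
  have "\<forall>\<^sub>F t in at 0. char (distr N borel Y) t \<noteq> 0"
    using Y.isCont_char[of 0] Y.char_zero unfolding isCont_def by (metis tendsto_imp_eventually_ne zero_neq_one)
  then obtain t where t: "t \<noteq> 0" "char (distr N borel Y) t \<noteq> 0"
    unfolding eventually_at by (metis (mono_tags, lifting) UNIV_I dist_commute dist_0_norm field_lbound_gt_zero norm_zero real_norm_def abs_of_pos less_irrefl)
  define c where "c = Re (char (distr N borel Y) t)"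
  have lc: "(\<lambda>n. exp (- v n * t\<^sup>2 / 2)) \<longlonglongrightarrow> c"
    using tendsto_Re[OF ch'[of t]] by (simp add: c_def)
  have "char (distr N borel Y) t = of_real c"
    using LIMSEQ_unique[OF ch'[of t] tendsto_of_real[OF lc]] .
  then have "c \<noteq> 0" using t(2) by auto
  moreover have "c \<ge> 0" by (rule LIMSEQ_le_const[OF lc]) auto
  ultimately have c: "c > 0" by simp
  have "(\<lambda>n. ln (exp (- v n * t\<^sup>2 / 2))) \<longlonglongrightarrow> ln c" by (rule tendsto_ln[OF lc]) (use c in simp)
  then have "(\<lambda>n. - 2 / t\<^sup>2 * ln (exp (- v n * t\<^sup>2 / 2))) \<longlonglongrightarrow> - 2 / t\<^sup>2 * ln c"
    by (rule tendsto_mult[OF tendsto_const])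
  then have vl: "v \<longlonglongrightarrow> - 2 / t\<^sup>2 * ln c" using t(1) by (simp add: field_simps)
  have v0: "v n \<ge> 0" for n using g[of n] by (simp add: gauss_def)
  have "gauss N Y (- 2 / t\<^sup>2 * ln c)"
    unfolding gauss_def
  proof (intro conjI allI Y)
    show "0 \<le> - 2 / t\<^sup>2 * ln c" by (rule LIMSEQ_le_const[OF vl]) (use v0 in auto)
    fix u
    have "(\<lambda>n. complex_of_real (exp (- v n * u\<^sup>2 / 2))) \<longlonglongrightarrow> complex_of_real (exp (- (- 2 / t\<^sup>2 * ln c) * u\<^sup>2 / 2))"
      by (intro tendsto_intros vl) auto
    from LIMSEQ_unique[OF ch'[of u] this] show "char (distr N borel Y) u = complex_of_real (exp (- (- 2 / t\<^sup>2 * ln c) * u\<^sup>2 / 2))" .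
  qed
  with vl show thesis by (rule that)
qed

text \<open>The variance of \<open>\<Sum>x\<in>F. t x * of_bool (y = x)\<close> for \<open>y\<close>
  drawn from \<open>p\<close>, in other words the quadratic form of the multinomial
  covariance.\<close>

definition multi_var :: "'x pmf \<Rightarrow> 'x set \<Rightarrow> ('x \<Rightarrow> real) \<Rightarrow> real" where
  "multi_var p F t = (\<Sum>x\<in>F. (t x)\<^sup>2 * pmf p x) - (\<Sum>x\<in>F. t x * pmf p x)\<^sup>2"

lemma multi_var_cov:
  assumes "finite F"
  shows "(\<Sum>x\<in>F. \<Sum>x'\<in>F. t x * t x' * multinomial_cov p x x') = multi_var p F t"
proof -
  have mc: "multinomial_cov p x x' = (if x' = x then pmf p x else 0) - pmf p x * pmf p x'" for x x'
    by (simp add: multinomial_cov_def algebra_simps)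
  have "(\<Sum>x\<in>F. \<Sum>x'\<in>F. t x * t x' * multinomial_cov p x x') =
      (\<Sum>x\<in>F. \<Sum>x'\<in>F. (if x' = x then t x * t x' * pmf p x else 0) - (t x * pmf p x) * (t x' * pmf p x'))"
    by (intro sum.cong refl) (simp add: mc right_diff_distrib)
  also have "\<dots> = (\<Sum>x\<in>F. (t x)\<^sup>2 * pmf p x) - (\<Sum>x\<in>F. t x * pmf p x)\<^sup>2"
    using assms by (simp add: sum_subtractf sum.delta sum_distrib_left[symmetric] sum_distrib_right[symmetric] power2_eq_square)
  finally show ?thesis by (simp add: multi_var_def)
qed

lemma integrable_mult_square:
  fixes f g :: "'w \<Rightarrow> real"
  assumes "f \<in> borel_measurable M" "g \<in> borel_measurable M"
    "integrable M (\<lambda>\<omega>. (f \<omega>)\<^sup>2)" "integrable M (\<lambda>\<omega>. (g \<omega>)\<^sup>2)"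
  shows "integrable M (\<lambda>\<omega>. f \<omega> * g \<omega>)"
proof (rule Bochner_Integration.integrable_bound)
  show "integrable M (\<lambda>\<omega>. (f \<omega>)\<^sup>2 + (g \<omega>)\<^sup>2)" using assms by simp
  have "\<bar>a * b\<bar> \<le> a\<^sup>2 + b\<^sup>2" for a b :: real
  proof -
    have "2 * \<bar>a\<bar> * \<bar>b\<bar> \<le> a\<^sup>2 + b\<^sup>2" using sum_squares_bound[of "\<bar>a\<bar>" "\<bar>b\<bar>"] by simp
    moreover have "0 \<le> \<bar>a\<bar> * \<bar>b\<bar>" by simp
    ultimately show ?thesis unfolding abs_mult by linarith
  qed
  then show "AE \<omega> in M. norm (f \<omega> * g \<omega>) \<le> norm ((f \<omega>)\<^sup>2 + (g \<omega>)\<^sup>2)" by simp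
qed (use assms in measurable)

text \<open>Gaussianity provides some variance; it equals the second moment, which expands into the
  prescribed covariances. So all limit processes for \<open>p\<close> share their finite-dimensional
  laws.\<close>

lemma (in prob_space) limit_process_gauss:
  assumes lp: "limit_process f p M G" and F: "finite F"
  shows "gauss M (\<lambda>\<omega>. \<Sum>x\<in>F. t x * G \<omega> x) (multi_var p F t)"
proof -
  have cg: "\<And>F t. finite F \<Longrightarrow> centered_normal M (\<lambda>\<omega>. \<Sum>z\<in>F. t z * G \<omega> z)" and cov: "covariance_fun M G = multinomial_cov p"
    using lp by (auto simp: limit_process_def centered_gaussian_def)
  have N: "prob_space M" by unfold_locales
  obtain v where v: "gauss M (\<lambda>\<omega>. \<Sum>x\<in>F. t x * G \<omega> x) v"
    using cg[OF F] centered_normal_iff[OF N] by blast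
  have coord: "integrable M (\<lambda>\<omega>. (G \<omega> x)\<^sup>2)" "expectation (\<lambda>\<omega>. G \<omega> x) = 0" "(\<lambda>\<omega>. G \<omega> x) \<in> borel_measurable M" for x
  proof -
    have "centered_normal M (\<lambda>\<omega>. \<Sum>z\<in>{x}. 1 * G \<omega> z)" by (rule cg) simp
    then obtain v where "gauss M (\<lambda>\<omega>. G \<omega> x) v" using centered_normal_iff[OF N] by auto
    then show "integrable M (\<lambda>\<omega>. (G \<omega> x)\<^sup>2)" "expectation (\<lambda>\<omega>. G \<omega> x) = 0" "(\<lambda>\<omega>. G \<omega> x) \<in> borel_measurable M"
      using gauss_moments[OF N] gauss_measurable by blast+
  qed
  have prod: "integrable M (\<lambda>\<omega>. G \<omega> x * G \<omega> x')" for x x'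
    by (rule integrable_mult_square) (use coord in auto)
  have "v = expectation (\<lambda>\<omega>. (\<Sum>x\<in>F. t x * G \<omega> x)\<^sup>2)" using gauss_moments(2)[OF N v] by simp
  also have "\<dots> = expectation (\<lambda>\<omega>. \<Sum>x\<in>F. \<Sum>x'\<in>F. t x * t x' * (G \<omega> x * G \<omega> x'))"
    by (intro Bochner_Integration.integral_cong) (auto simp: power2_eq_square sum_product mult_ac)
  also have "\<dots> = (\<Sum>x\<in>F. \<Sum>x'\<in>F. t x * t x' * expectation (\<lambda>\<omega>. G \<omega> x * G \<omega> x'))"
    using prod by (simp add: Bochner_Integration.integral_sum)
  also have "\<dots> = (\<Sum>x\<in>F. \<Sum>x'\<in>F. t x * t x' * multinomial_cov p x x')"
    by (simp add: cov[symmetric] covariance_fun_def coord)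
  finally show ?thesis using v multi_var_cov[OF F] by metis
qed

text \<open>The empirical process, with value \<open>0\<close> for the empty sample.\<close>

definition emp_proc :: "(nat \<Rightarrow> 'w \<Rightarrow> 'x) \<Rightarrow> 'x pmf \<Rightarrow> nat \<Rightarrow> 'w \<Rightarrow> 'x \<Rightarrow> real" where
  "emp_proc X p n \<omega> x = sqrt (real n) * (pmf (empirical_pmf X n \<omega>) x - pmf p x)"

lemma pmf_empirical:
  assumes "n > 0"
  shows "pmf (empirical_pmf X n \<omega>) x = (\<Sum>i<n. of_bool (X i \<omega> = x)) / real n"
proof -
  have ne: "{..<n} \<noteq> {}" using assms by auto
  have "pmf (empirical_pmf X n \<omega>) x = measure (pmf_of_set {..<n}) ((\<lambda>i. X i \<omega>) -` {x})"
    by (simp add: empirical_pmf_def pmf_map)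
  also have "\<dots> = real (card ({..<n} \<inter> (\<lambda>i. X i \<omega>) -` {x})) / real n"
    by (subst measure_pmf_of_set[OF ne]) auto
  also have "real (card ({..<n} \<inter> (\<lambda>i. X i \<omega>) -` {x})) = (\<Sum>i<n. of_bool (X i \<omega> = x))"
    by (simp add: of_bool_def sum.If_cases Int_def vimage_def)
  finally show ?thesis .
qed

text \<open>Reduces linear functionals of the empirical process to normalized sums over the sample.
  For \<open>n = 0\<close> both sides vanish, since division by \<open>sqrt 0\<close> gives
  \<open>0\<close>.\<close>

lemma emp_proc_sum:
  assumes "finite F"
  shows "(\<Sum>x\<in>F. t x * emp_proc X p n \<omega> x) =
    (\<Sum>i<n. (\<Sum>x\<in>F. t x * (of_bool (X i \<omega> = x) - pmf p x))) / sqrt (real n)"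
proof (cases "n = 0")
  case False
  have "emp_proc X p n \<omega> x = (\<Sum>i<n. (of_bool (X i \<omega> = x) - pmf p x)) / sqrt (real n)" for x
  proof -
    have "(\<Sum>i<n. (of_bool (X i \<omega> = x) - pmf p x)) = real n * (pmf (empirical_pmf X n \<omega>) x - pmf p x)"
      using False pmf_empirical[of n X \<omega> x] by (simp add: sum_subtractf algebra_simps)
    moreover have "sqrt (real n) * d * sqrt (real n) = real n * d" for d
      using real_sqrt_mult_self[of "real n"] by (simp add: mult.commute mult.left_commute)
    ultimately show ?thesis using False by (simp add: emp_proc_def eq_divide_eq)
  qed
  then have "(\<Sum>x\<in>F. t x * emp_proc X p n \<omega> x) = (\<Sum>x\<in>F. \<Sum>i<n. t x * (of_bool (X i \<omega> = x) - pmf p x)) / sqrt (real n)"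
    by (simp add: sum_divide_distrib sum_distrib_left)
  then show ?thesis by (subst (asm) sum.swap) simp
qed (simp add: emp_proc_def)

section \<open>Empirical processes of i.i.d. samples\<close>

locale sample =
  fixes M :: "'w measure" and X :: "nat \<Rightarrow> 'w \<Rightarrow> 'x" and p :: "'x pmf"
  assumes iid: "iid_sample M X p"

sublocale sample \<subseteq> prob_space M using iid by (simp add: iid_sample_def)

context sample begin

lemma X_meas [measurable]: "X i \<in> M \<rightarrow>\<^sub>M count_space UNIV"
  using iid unfolding iid_sample_def indep_vars_def by simp

lemma fX_meas [measurable]: "(\<lambda>\<omega>. f (X i \<omega>)) \<in> borel_measurable M" for f :: "'x \<Rightarrow> real"
  by (rule measurable_compose[OF X_meas]) simp

lemma fX_integrable: "(\<And>x. \<bar>f x\<bar> \<le> B) \<Longrightarrow> integrable M (\<lambda>\<omega>. f (X i \<omega>))" for f :: "'x \<Rightarrow> real"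
  by (rule integrable_const_bound[of _ B]) auto

lemma sum_fX_meas: "(\<lambda>\<omega>. \<Sum>i<n. f (X i \<omega>)) \<in> borel_measurable M" for f :: "'x \<Rightarrow> real"
  by (intro borel_measurable_sum fX_meas)

lemma sum_fX_bound: "(\<And>x. \<bar>f x\<bar> \<le> B) \<Longrightarrow> \<bar>\<Sum>i<n. f (X i \<omega>)\<bar> \<le> real n * B" for f :: "'x \<Rightarrow> real"
  using order_trans[OF sum_abs sum_bounded_above[of "{..<n}" "\<lambda>i. \<bar>f (X i \<omega>)\<bar>" B]] by simp

lemma distr_X: "distr M (count_space UNIV) (X i) = measure_pmf p"
  using iid by (simp add: iid_sample_def)

lemma integral_X: "expectation (\<lambda>\<omega>. f (X i \<omega>)) = measure_pmf.expectation p f" for f :: "'x \<Rightarrow> real"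
  unfolding distr_X[of i, symmetric] by (rule integral_distr[symmetric]) auto

lemma indep_f: "indep_vars (\<lambda>_. borel) (\<lambda>i \<omega>. f (X i \<omega>)) UNIV" for f :: "'x \<Rightarrow> real"
  by (rule indep_vars_compose2[where M'="\<lambda>_. count_space UNIV"]) (use iid in \<open>auto simp: iid_sample_def\<close>)

text \<open>For \<open>\<sigma> > 0\<close> this is the central limit theorem evaluated at
  \<open>t * \<sigma>\<close>. The functional may be degenerate, for instance when \<open>p\<close>
  sits on one point; then the summands vanish almost surely and the characteristic function is
  constantly \<open>1\<close>.\<close>

lemma clt_char:
  fixes f :: "'x \<Rightarrow> real"
  assumes B: "\<And>x. \<bar>f x\<bar> \<le> B" and f0: "measure_pmf.expectation p f = 0"
  shows "(\<lambda>n. char (distr M borel (\<lambda>\<omega>. (\<Sum>i<n. f (X i \<omega>)) / sqrt (real n))) t)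
    \<longlonglongrightarrow> of_real (exp (- measure_pmf.expectation p (\<lambda>x. (f x)\<^sup>2) * t\<^sup>2 / 2))"
proof -
  define \<sigma> where "\<sigma> = sqrt (measure_pmf.expectation p (\<lambda>x. (f x)\<^sup>2))"
  have s2: "\<sigma>\<^sup>2 = measure_pmf.expectation p (\<lambda>x. (f x)\<^sup>2)"
    unfolding \<sigma>_def by (rule real_sqrt_pow2) simp
  have fb2: "(f x)\<^sup>2 \<le> B\<^sup>2" for x using power_mono[OF B[of x], of 2] by simp
  have int: "integrable M (\<lambda>\<omega>. (f (X i \<omega>))\<^sup>2)" "integrable M (\<lambda>\<omega>. f (X i \<omega>))" for i
    using fX_integrable[of "\<lambda>x. (f x)\<^sup>2" "B\<^sup>2" i] fX_integrable[of f B i] fb2 B by auto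
  note mS = sum_fX_meas[of f]
  show ?thesis
  proof (cases "\<sigma> = 0")
    case True
    have "AE \<omega> in M. f (X i \<omega>) = 0" for i
    proof -
      have "expectation (\<lambda>\<omega>. (f (X i \<omega>))\<^sup>2) = 0" using integral_X[of "\<lambda>x. (f x)\<^sup>2" i] s2 True by simp
      then have "AE \<omega> in M. (f (X i \<omega>))\<^sup>2 = 0"
        by (subst (asm) integral_nonneg_eq_0_iff_AE) (use int in auto)
      then show ?thesis by auto
    qed
    then have ae: "AE \<omega> in M. \<forall>i. f (X i \<omega>) = 0" by (simp add: AE_all_countable)
    have "char (distr M borel (\<lambda>\<omega>. (\<Sum>i<n. f (X i \<omega>)) / sqrt (real n))) t = 1" for n
    proof -
      have "distr M borel (\<lambda>\<omega>. (\<Sum>i<n. f (X i \<omega>)) / sqrt (real n)) = distr M borel (\<lambda>_. 0)"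
        by (rule distr_cong_AE) (use mS ae in \<open>auto elim!: eventually_mono\<close>)
      then show ?thesis by (simp add: char_distr prob_space del: distr_const)
    qed
    then show ?thesis using True s2[symmetric] by simp
  next
    case False
    then have sp: "\<sigma> > 0" unfolding \<sigma>_def by (simp add: less_le)
    have mean: "expectation (\<lambda>\<omega>. f (X i \<omega>)) = 0" for i using integral_X f0 by simp
    have "weak_conv_m (\<lambda>n. distr M borel (\<lambda>\<omega>. (\<Sum>i<n. f (X i \<omega>)) / sqrt (n * \<sigma>\<^sup>2))) std_normal_distribution"
    proof (rule central_limit_theorem_zero_mean[where \<mu>="distr (measure_pmf p) borel f"])
      show "indep_vars (\<lambda>i. borel) (\<lambda>i \<omega>. f (X i \<omega>)) UNIV" by (rule indep_f)
      show "variance (\<lambda>\<omega>. f (X n \<omega>)) = \<sigma>\<^sup>2" for n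
        unfolding mean s2 using integral_X[of "\<lambda>x. (f x)\<^sup>2" n] by simp
      show "distr M borel (\<lambda>\<omega>. f (X n \<omega>)) = distr (measure_pmf p) borel f" for n
        unfolding distr_X[of n, symmetric] by (subst distr_distr) (auto simp: o_def)
    qed (use mean sp int in auto)
    then have "(\<lambda>n. char (distr M borel (\<lambda>\<omega>. (\<Sum>i<n. f (X i \<omega>)) / sqrt (n * \<sigma>\<^sup>2))) (t * \<sigma>)) \<longlonglongrightarrow> char std_normal_distribution (t * \<sigma>)"
      by (intro levy_continuity1 real_dist_normal_dist real_distribution_of_rv)
         (use mS prob_space_axioms in auto)
    moreover have "char (distr M borel (\<lambda>\<omega>. (\<Sum>i<n. f (X i \<omega>)) / sqrt (n * \<sigma>\<^sup>2))) (t * \<sigma>) =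
        char (distr M borel (\<lambda>\<omega>. (\<Sum>i<n. f (X i \<omega>)) / sqrt (real n))) t" for n
    proof -
      have "t * \<sigma> * (S / sqrt (real n * \<sigma>\<^sup>2)) = t * (S / sqrt (real n))" for S
        using sp by (simp add: real_sqrt_mult)
      then show ?thesis using mS by (subst (1 2) char_distr) auto
    qed
    ultimately show ?thesis using s2 by (simp add: char_std_normal_distribution power_mult_distrib mult.commute)
  qed
qed

text \<open>By independence and centering the mixed term between a new summand and the sum of the
  earlier ones has expectation \<open>0\<close>.\<close>

lemma second_moment_sum:
  fixes f :: "'x \<Rightarrow> real"
  assumes B: "\<And>x. \<bar>f x\<bar> \<le> B" and f0: "measure_pmf.expectation p f = 0"
  shows "expectation (\<lambda>\<omega>. (\<Sum>i<n. f (X i \<omega>))\<^sup>2) = real n * measure_pmf.expectation p (\<lambda>x. (f x)\<^sup>2)"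
proof (induction n)
  case (Suc n)
  let ?S = "\<lambda>\<omega>. \<Sum>i<n. f (X i \<omega>)"
  have fb2: "(f x)\<^sup>2 \<le> B\<^sup>2" for x using power_mono[OF B[of x], of 2] by simp
  note mS = sum_fX_meas[of f n]
  have Sb: "\<bar>?S \<omega>\<bar> \<le> real n * B" for \<omega>
    by (rule sum_fX_bound[OF B])
  have Sb2: "(?S \<omega>)\<^sup>2 \<le> (real n * B)\<^sup>2" for \<omega> using power_mono[OF Sb[of \<omega>], of 2] by simp
  have int: "integrable M (\<lambda>\<omega>. (f (X n \<omega>))\<^sup>2)" "integrable M (\<lambda>\<omega>. f (X n \<omega>))" "integrable M ?S" "integrable M (\<lambda>\<omega>. (?S \<omega>)\<^sup>2)"
    using fX_integrable[of "\<lambda>x. (f x)\<^sup>2" "B\<^sup>2" n] fX_integrable[of f B n] fb2 B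
      integrable_const_bound[of ?S "real n * B"] Sb mS
      integrable_const_bound[of "\<lambda>\<omega>. (?S \<omega>)\<^sup>2" "(real n * B)\<^sup>2"] Sb2 by auto
  have iv: "indep_var borel (\<lambda>\<omega>. f (X n \<omega>)) borel ?S"
    by (rule indep_vars_sum) (auto intro: indep_vars_subset[OF indep_f])
  have prod: "expectation (\<lambda>\<omega>. f (X n \<omega>) * ?S \<omega>) = 0"
    using indep_var_lebesgue_integral[OF iv int(2,3)] integral_X[of f n] f0 by simp
  have ip: "integrable M (\<lambda>\<omega>. f (X n \<omega>) * ?S \<omega>)" by (rule indep_var_integrable[OF iv int(2,3)])
  have "expectation (\<lambda>\<omega>. (\<Sum>i<Suc n. f (X i \<omega>))\<^sup>2) = expectation (\<lambda>\<omega>. (?S \<omega>)\<^sup>2 + (2 * (f (X n \<omega>) * ?S \<omega>) + (f (X n \<omega>))\<^sup>2))"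
    by (intro Bochner_Integration.integral_cong) (auto simp: power2_eq_square algebra_simps)
  also have "\<dots> = expectation (\<lambda>\<omega>. (?S \<omega>)\<^sup>2) + (2 * expectation (\<lambda>\<omega>. f (X n \<omega>) * ?S \<omega>) + expectation (\<lambda>\<omega>. (f (X n \<omega>))\<^sup>2))"
    using int ip by simp
  finally show ?case using Suc prod integral_X[of "\<lambda>x. (f x)\<^sup>2" n] by (simp add: algebra_simps)
qed simp

lemma indicator_moments:
  assumes "finite F"
  shows "\<bar>\<Sum>x\<in>F. t x * (of_bool (y = x) - pmf p x)\<bar> \<le> (\<Sum>x\<in>F. \<bar>t x\<bar>)"
    "measure_pmf.expectation p (\<lambda>y. \<Sum>x\<in>F. t x * (of_bool (y = x) - pmf p x)) = 0"
    "measure_pmf.expectation p (\<lambda>y. (\<Sum>x\<in>F. t x * (of_bool (y = x) - pmf p x))\<^sup>2) = multi_var p F t"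
proof -
  have b1: "\<bar>of_bool (y = x) - pmf p x\<bar> \<le> 1" for x y using pmf_le_1[of p x] by (auto simp: abs_le_iff intro: order_trans[OF _ pmf_nonneg])
  show "\<bar>\<Sum>x\<in>F. t x * (of_bool (y = x) - pmf p x)\<bar> \<le> (\<Sum>x\<in>F. \<bar>t x\<bar>)"
    by (rule order_trans[OF sum_abs sum_mono]) (use b1 in \<open>simp add: abs_mult mult_left_le\<close>)
  have i: "integrable (measure_pmf p) (\<lambda>y. of_bool (y = x) :: real)" for x
    by (rule measure_pmf.integrable_const_bound[of _ 1]) auto
  have e: "measure_pmf.expectation p (\<lambda>y. of_bool (y = x)) = pmf p x" for x
  proof -
    have "measure_pmf.expectation p (\<lambda>y. of_bool (y = x) :: real) = measure_pmf.expectation p (indicator {x})"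
      by (intro Bochner_Integration.integral_cong) (auto simp: indicator_def)
    then show ?thesis by (simp add: measure_pmf_single)
  qed
  show "measure_pmf.expectation p (\<lambda>y. \<Sum>x\<in>F. t x * (of_bool (y = x) - pmf p x)) = 0"
    using i by (simp add: e Bochner_Integration.integral_sum)
  define m where "m = (\<Sum>x\<in>F. t x * pmf p x)"
  \<comment> \<open>At most one indicator is active, so the square is again affine in the indicators
    and its expectation involves no mixed moments.\<close>
  have "(\<Sum>x\<in>F. t x * (of_bool (y = x) - pmf p x))\<^sup>2 = (\<Sum>x\<in>F. ((t x)\<^sup>2 - 2 * m * t x) * of_bool (y = x)) + m\<^sup>2" for y
  proof (cases "y \<in> F")
    case True
    have "(\<Sum>x\<in>F. g x * of_bool (y = x)) = g y" for g :: "'x \<Rightarrow> real"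
      using True assms by (simp add: of_bool_def if_distrib[of "(*) _"] sum.delta cong: if_cong)
    then show ?thesis by (simp add: right_diff_distrib sum_subtractf m_def[symmetric] power2_diff)
  next
    case False
    then have "(\<Sum>x\<in>F. g x * of_bool (y = x)) = 0" for g :: "'x \<Rightarrow> real" by (intro sum.neutral) auto
    then show ?thesis by (simp add: right_diff_distrib sum_subtractf m_def[symmetric])
  qed
  then have "measure_pmf.expectation p (\<lambda>y. (\<Sum>x\<in>F. t x * (of_bool (y = x) - pmf p x))\<^sup>2) = (\<Sum>x\<in>F. ((t x)\<^sup>2 - 2 * m * t x) * pmf p x) + m\<^sup>2"
    using i by (simp add: e Bochner_Integration.integral_sum)
  also have "\<dots> = multi_var p F t"
  proof -
    have "(\<Sum>x\<in>F. 2 * m * t x * pmf p x) = 2 * m * m" by (simp add: m_def sum_distrib_left mult.assoc)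
    then show ?thesis by (simp add: multi_var_def left_diff_distrib sum_subtractf m_def[symmetric] power2_eq_square)
  qed
  finally show "measure_pmf.expectation p (\<lambda>y. (\<Sum>x\<in>F. t x * (of_bool (y = x) - pmf p x))\<^sup>2) = multi_var p F t" .
qed

lemma emp_proc_measurable: "(\<lambda>\<omega>. emp_proc X p n \<omega> x) \<in> borel_measurable M"
  using emp_proc_sum[of "{x}" "\<lambda>_. 1" X p n] by simp

lemma emp_proc_char:
  assumes "finite F"
  shows "(\<lambda>n. char (distr M borel (\<lambda>\<omega>. \<Sum>x\<in>F. t x * emp_proc X p n \<omega> x)) 1) \<longlonglongrightarrow> of_real (exp (- multi_var p F t / 2))"
  using clt_char[OF indicator_moments(1,2)[OF assms], of t 1]
  unfolding emp_proc_sum[OF assms] indicator_moments(3)[OF assms] by simp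

text \<open>The variance is \<open>pmf p x * (1 - pmf p x)\<close> for every \<open>n > 0\<close>.
  Dropping the last factor gives a bound uniform in \<open>n\<close> that matches summability of the
  weight times \<open>sqrt (pmf p x)\<close>.\<close>

lemma emp_proc_moment: "moment_bounded M (emp_proc X p n) (pmf p)"
  unfolding moment_bounded_def
proof (intro allI conjI emp_proc_measurable)
  fix x
  let ?f = "\<lambda>y. \<Sum>x\<in>{x}. 1 * (of_bool (y = x) - pmf p x)"
  have eq: "emp_proc X p n \<omega> x = (\<Sum>i<n. ?f (X i \<omega>)) / sqrt (real n)" for \<omega>
    using emp_proc_sum[of "{x}" "\<lambda>_. 1" X p n \<omega>] by simp
  note im = indicator_moments[of "{x}" "\<lambda>_. 1"]
  have "\<bar>?f y\<bar> \<le> 1" for y using im(1)[of y] by simp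
  then have b: "\<bar>\<Sum>i<n. ?f (X i \<omega>)\<bar> \<le> real n" for \<omega>
    using sum_fX_bound[where f="?f" and B=1 and n=n and \<omega>=\<omega>] by simp
  have b2: "\<bar>emp_proc X p n \<omega> x\<bar> \<le> real n / sqrt (real n)" for \<omega>
    unfolding eq using divide_right_mono[OF b[of \<omega>], of "sqrt (real n)"] by simp
  show "integrable M (\<lambda>\<omega>. (emp_proc X p n \<omega> x)\<^sup>2)"
  proof (rule integrable_const_bound[of _ "(real n / sqrt (real n))\<^sup>2"])
    show "AE \<omega> in M. norm ((emp_proc X p n \<omega> x)\<^sup>2) \<le> (real n / sqrt (real n))\<^sup>2"
      using power_mono[OF b2, of _ 2] by simp
  qed (use emp_proc_measurable in measurable)
  show "expectation (\<lambda>\<omega>. (emp_proc X p n \<omega> x)\<^sup>2) \<le> pmf p x"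
  proof (cases "n = 0")
    case True then show ?thesis by (simp add: emp_proc_def)
  next
    case False
    have "expectation (\<lambda>\<omega>. (emp_proc X p n \<omega> x)\<^sup>2) = expectation (\<lambda>\<omega>. (\<Sum>i<n. ?f (X i \<omega>))\<^sup>2) / real n"
      unfolding eq power_divide by simp
    also have "\<dots> = multi_var p {x} (\<lambda>_. 1)"
      using False second_moment_sum[OF im(1,2)] im(3) by simp
    also have "\<dots> \<le> pmf p x" by (simp add: multi_var_def)
    finally show ?thesis .
  qed
qed

lemma AE_in_support: "AE \<omega> in M. \<forall>i. X i \<omega> \<in> set_pmf p"
proof -
  have "AE \<omega> in M. X i \<omega> \<in> set_pmf p" for i
  proof -
    have "AE x in distr M (count_space UNIV) (X i). x \<in> set_pmf p" unfolding distr_X by (rule AE_measure_pmf)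
    then show ?thesis by (subst (asm) AE_distr_iff) auto
  qed
  then show ?thesis by (simp add: AE_all_countable)
qed

end

lemma set_empirical: "n > 0 \<Longrightarrow> set_pmf (empirical_pmf X n \<omega>) = (\<lambda>i. X i \<omega>) ` {..<n}"
  unfolding empirical_pmf_def set_map_pmf by (subst set_pmf_of_set) auto

section \<open>Existence of the limit process\<close>

text \<open>Choose finite sets \<open>F j\<close> whose complements have mass below
  \<open>2^{-j}\<close>, and let \<open>g\<close> be one plus the number of \<open>j\<close> with
  \<open>x \<notin> F j\<close>. Summing over \<open>j\<close> last shows that the count adds at
  most \<open>2\<close> to the total mass, while a bounded count confines \<open>x\<close> to a
  finite union of the sets.\<close>

lemma coercive_weight:
  fixes w :: "'i::countable \<Rightarrow> real"
  assumes w: "w summable_on UNIV" "\<And>x. w x \<ge> 0"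
  obtains g :: "'i \<Rightarrow> real" where "\<And>x. g x \<ge> 1" "\<And>K. finite {x. g x \<le> K}" "(\<lambda>x. g x * w x) summable_on UNIV"
proof -
  have "\<exists>F. finite F \<and> (\<Sum>\<^sub>\<infinity>x. if x \<in> F then 0 else w x) < (1 / 2) ^ j" for j :: nat
    using tail_small[OF w(1), of "(1 / 2) ^ j"] by (metis zero_less_divide_1_iff zero_less_numeral zero_less_power)
  then obtain F0 where F0: "\<And>j. finite (F0 j)" "\<And>j :: nat. (\<Sum>\<^sub>\<infinity>x. if x \<in> F0 j then 0 else w x) < (1 / 2) ^ j"
    by metis
  \<comment> \<open>Adjoining \<open>exhaust j\<close> puts each \<open>x\<close> into all but
    finitely many \<open>F j\<close>, so that the count is finite.\<close>
  define F where "F j = F0 j \<union> exhaust j" for j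
  define J where "J x = {j. x \<notin> F j}" for x
  have Jfin: "finite (J x)" for x
    by (rule finite_subset[of _ "{..to_nat x}"]) (auto simp: J_def F_def exhaust_def not_less)
  define g where "g x = 1 + real (card (J x))" for x
  show thesis
  proof (rule that[of g])
    show "g x \<ge> 1" for x by (simp add: g_def)
    show "finite {x. g x \<le> K}" for K
    proof (rule finite_subset)
      show "{x. g x \<le> K} \<subseteq> (\<Union>j\<le>nat \<lceil>K\<rceil>. F j)"
      proof
        fix x assume "x \<in> {x. g x \<le> K}"
        then have x: "1 + real (card (J x)) \<le> K" by (simp add: g_def)
        show "x \<in> (\<Union>j\<le>nat \<lceil>K\<rceil>. F j)"
        proof (rule ccontr)
          assume "x \<notin> (\<Union>j\<le>nat \<lceil>K\<rceil>. F j)"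
          then have "{..nat \<lceil>K\<rceil>} \<subseteq> J x" by (auto simp: J_def)
          then have "card {..nat \<lceil>K\<rceil>} \<le> card (J x)" by (rule card_mono[OF Jfin])
          then have "real (nat \<lceil>K\<rceil>) + 1 \<le> real (card (J x))" by simp
          moreover have "K \<le> real (nat \<lceil>K\<rceil>)" by (rule real_nat_ceiling_ge)
          ultimately show False using x by linarith
        qed
      qed
      show "finite (\<Union>j\<le>nat \<lceil>K\<rceil>. F j)" using F0 by (auto simp: F_def)
    qed
    show "(\<lambda>x. g x * w x) summable_on UNIV"
    proof (rule nonneg_bdd_above_summable_on)
      show "0 \<le> g x * w x" for x using w(2)[of x] by (simp add: g_def)
      show "bdd_above (sum (\<lambda>x. g x * w x) ` {F. F \<subseteq> UNIV \<and> finite F})"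
      proof (rule bdd_aboveI2)
        fix S :: "'i set" assume "S \<in> {F. F \<subseteq> UNIV \<and> finite F}"
        then have S: "finite S" by simp
        obtain N where N: "\<And>x. x \<in> S \<Longrightarrow> J x \<subseteq> {..<N}"
        proof -
          have "finite (\<Union>x\<in>S. J x)" using S Jfin by auto
          then obtain N where "(\<Union>x\<in>S. J x) \<subseteq> {..<N}" using finite_nat_iff_bounded by blast
          then show thesis using that by blast
        qed
        have gx: "g x * w x = w x + (\<Sum>j<N. if x \<in> F j then 0 else w x)" if "x \<in> S" for x
        proof -
          have "(\<Sum>j<N. if x \<in> F j then 0 else w x) = (\<Sum>j\<in>{..<N} \<inter> J x. w x)"
            by (subst sum.inter_restrict) (auto simp: J_def intro!: sum.cong)
          also have "{..<N} \<inter> J x = J x" using N[OF that] by blast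
          finally show ?thesis by (simp add: g_def algebra_simps)
        qed
        have tail: "(\<Sum>x\<in>S. if x \<in> F j then 0 else w x) \<le> (1 / 2) ^ j" for j
        proof -
          have s: "(\<lambda>x. if x \<in> F0 j then 0 else w x) summable_on UNIV"
            by (rule summable_on_abs_le[OF w(1)]) (use w(2) in auto)
          have "(\<Sum>x\<in>S. if x \<in> F j then 0 else w x) \<le> (\<Sum>x\<in>S. if x \<in> F0 j then 0 else w x)"
            by (rule sum_mono) (use w(2) in \<open>auto simp: F_def\<close>)
          also have "\<dots> \<le> (\<Sum>\<^sub>\<infinity>x. if x \<in> F0 j then 0 else w x)"
            by (rule finite_sum_le_infsum[OF s S]) (use w(2) in auto)
          finally show ?thesis using F0(2)[of j] by linarith
        qed
        have "(\<Sum>x\<in>S. g x * w x) = sum w S + (\<Sum>j<N. \<Sum>x\<in>S. if x \<in> F j then 0 else w x)"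
          by (subst sum.swap) (simp add: gx sum.distrib)
        also have "\<dots> \<le> infsum w UNIV + (\<Sum>j<N. (1 / 2) ^ j)"
          by (intro add_mono sum_mono tail finite_sum_le_infsum[OF w(1) S]) (use w(2) in auto)
        also have "(\<Sum>j<N. (1 / 2) ^ j :: real) \<le> 2"
        proof -
          have "(\<Sum>j<N. (1 / 2) ^ j :: real) \<le> (\<Sum>j. (1 / 2) ^ j)"
            by (rule sum_le_suminf) (auto intro: summable_geometric)
          then show ?thesis by (simp add: suminf_geometric)
        qed
        finally show "(\<Sum>x\<in>S. g x * w x) \<le> infsum w UNIV + 2" by simp
      qed
    qed
  qed
qed

text \<open>Balls of a weighted \<open>\<ell>\<^sup>1\<close> space whose weight is coercive relative to \<open>w\<close> are compact: they are
  compact in the product topology, which refines the \<open>\<ell>\<^sup>1\<close> topology there.\<close>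

lemma compactin_l1_ball:
  fixes w g :: "'i::countable \<Rightarrow> real"
  assumes w: "\<And>x. w x > 0" and g: "\<And>x. g x \<ge> 1" "\<And>K. finite {x. g x \<le> K}" and B: "B > 0"
  shows "compactin (mtopology_of (l1_space w)) {a. \<forall>F. finite F \<longrightarrow> (\<Sum>x\<in>F. g x * w x * \<bar>a x\<bar>) \<le> B}"
proof -
  interpret l1: Metric_space "l1_set w" "l1_dist w" by (rule Metric_space_l1[OF w])
  have mt: "mtopology_of (l1_space w) = l1.mtopology"
    by (simp add: mtopology_of_def l1_space_simps[of w, OF w])
  define K where "K = {a :: 'i \<Rightarrow> real. \<forall>F. finite F \<longrightarrow> (\<Sum>x\<in>F. g x * w x * \<bar>a x\<bar>) \<le> B}"
  have gw: "g x * w x > 0" for x using w[of x] g(1)[of x] by simp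
  have Ksum: "(\<lambda>x. g x * w x * \<bar>a x\<bar>) summable_on UNIV" "(\<Sum>\<^sub>\<infinity>x. g x * w x * \<bar>a x\<bar>) \<le> B" if "a \<in> K" for a
  proof -
    show s: "(\<lambda>x. g x * w x * \<bar>a x\<bar>) summable_on UNIV"
      by (rule nonneg_bdd_above_summable_on) (use that gw in \<open>auto simp: K_def less_imp_le intro!: bdd_aboveI2\<close>)
    show "(\<Sum>\<^sub>\<infinity>x. g x * w x * \<bar>a x\<bar>) \<le> B"
      by (rule infsum_le_finite_sums[OF s]) (use that in \<open>auto simp: K_def\<close>)
  qed
  have Kl1: "a \<in> l1_set w" if "a \<in> K" for a unfolding l1_set_def mem_Collect_eq
  proof (rule summable_on_abs_le[OF Ksum(1)[OF that]])
    show "\<bar>w x * \<bar>a x\<bar>\<bar> \<le> g x * w x * \<bar>a x\<bar>" for x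
      using mult_right_mono[OF g(1)[of x], of "w x * \<bar>a x\<bar>"] w[of x] by (simp add: abs_mult mult.assoc)
  qed
  \<comment> \<open>Describing \<open>K\<close> through finite partial sums makes each condition
    continuous in finitely many coordinates.\<close>
  have "closed K"
  proof -
    have "K = (\<Inter>F\<in>{F. finite F}. {a. (\<Sum>x\<in>F. g x * w x * \<bar>a x\<bar>) \<le> B})" by (auto simp: K_def)
    moreover have "closed \<dots>"
      by (intro closed_INT ballI closed_Collect_le continuous_intros continuous_on_product_coordinates)
    ultimately show ?thesis by simp
  qed
  moreover have "K \<subseteq> {a. \<forall>x. \<bar>a x\<bar> \<le> B / (g x * w x)}"
  proof (intro subsetI CollectI allI)
    fix a x assume "a \<in> K"
    then have "(\<Sum>x\<in>{x}. g x * w x * \<bar>a x\<bar>) \<le> B" unfolding K_def by blast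
    then show "\<bar>a x\<bar> \<le> B / (g x * w x)" using gw[of x] by (simp add: pos_le_divide_eq mult.commute)
  qed
  ultimately have "compact K" using compact_Int_closed[OF compact_box[of "\<lambda>x. B / (g x * w x)"], of K]
    by (simp add: Int_absorb1)
  then have cK: "compactin (top_of_set K) K" by (simp add: compactin_subtopology)
  have "continuous_map (top_of_set K) l1.mtopology (\<lambda>a. a)"
    unfolding l1.continuous_map_to_metric
  proof (intro ballI allI impI)
    fix a \<epsilon> assume "a \<in> topspace (top_of_set K)" and \<epsilon>: "\<epsilon> > (0::real)"
    then have a: "a \<in> K" by simp
    \<comment> \<open>Outside \<open>F\<close> the weight \<open>w\<close> is at most
      \<open>\<epsilon> / (4 * B)\<close> times \<open>g * w\<close>, so two elements of the ball
      differ there by at most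
      \<open>\<epsilon> / (4 * B) * (2 * B) = \<epsilon> / 2\<close>.\<close>
    define F where "F = {x. g x \<le> 4 * B / \<epsilon>}"
    have F: "finite F" unfolding F_def by (rule g(2))
    let ?V = "{b. (\<Sum>x\<in>F. w x * \<bar>a x - b x\<bar>) < \<epsilon> / 2}"
    have "open ?V"
      by (intro open_Collect_less continuous_intros continuous_on_product_coordinates)
    then have op: "openin (top_of_set K) (K \<inter> ?V)" by (rule openin_open_Int)
    have "l1_dist w a b < \<epsilon>" if b: "b \<in> K" "b \<in> ?V" for b
    proof -
      have s: "(\<lambda>x. g x * w x * \<bar>a x\<bar> + g x * w x * \<bar>b x\<bar>) summable_on UNIV"
        by (intro summable_on_add Ksum a b)
      have hs: "((\<lambda>x. (if x \<in> F then w x * \<bar>a x - b x\<bar> else 0) + \<epsilon> / (4 * B) * (g x * w x * \<bar>a x\<bar> + g x * w x * \<bar>b x\<bar>)) has_sum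
          (\<Sum>x\<in>F. w x * \<bar>a x - b x\<bar>) + \<epsilon> / (4 * B) * (\<Sum>\<^sub>\<infinity>x. g x * w x * \<bar>a x\<bar> + g x * w x * \<bar>b x\<bar>)) UNIV"
        by (intro has_sum_add has_sum_cmult_right has_sum_infsum s) (rule has_sum_finite_neutralI[OF F], auto)
      have "l1_dist w a b \<le> (\<Sum>x\<in>F. w x * \<bar>a x - b x\<bar>) + \<epsilon> / (4 * B) * (\<Sum>\<^sub>\<infinity>x. g x * w x * \<bar>a x\<bar> + g x * w x * \<bar>b x\<bar>)"
        unfolding l1_dist_def infsumI[OF hs, symmetric]
      proof (rule infsum_mono[OF l1_set_diff[OF w Kl1[OF a] Kl1[OF b(1)]] has_sum_imp_summable[OF hs]])
        fix x
        let ?s = "\<epsilon> / (4 * B) * (g x * w x * \<bar>a x\<bar> + g x * w x * \<bar>b x\<bar>)"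
        have s0: "?s \<ge> 0" using \<epsilon> B gw[of x] by (simp add: less_imp_le)
        show "w x * \<bar>a x - b x\<bar> \<le> (if x \<in> F then w x * \<bar>a x - b x\<bar> else 0) + ?s"
        proof (cases "x \<in> F")
          case False
          then have "1 \<le> \<epsilon> / (4 * B) * g x" using \<epsilon> B by (simp add: F_def field_simps)
          then have "w x * (\<bar>a x\<bar> + \<bar>b x\<bar>) \<le> (\<epsilon> / (4 * B) * g x) * (w x * (\<bar>a x\<bar> + \<bar>b x\<bar>))"
            using mult_right_mono[of 1 "\<epsilon> / (4 * B) * g x" "w x * (\<bar>a x\<bar> + \<bar>b x\<bar>)"] w[of x] by simp
          moreover have "w x * \<bar>a x - b x\<bar> \<le> w x * (\<bar>a x\<bar> + \<bar>b x\<bar>)" using w[of x] by (intro mult_left_mono) auto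
          ultimately have "w x * \<bar>a x - b x\<bar> \<le> (\<epsilon> / (4 * B) * g x) * (w x * (\<bar>a x\<bar> + \<bar>b x\<bar>))" by linarith
          also have "\<dots> = ?s" by (simp add: algebra_simps)
          finally show ?thesis using False by simp
        qed (use s0 in simp)
      qed
      moreover have "\<epsilon> / (4 * B) * (\<Sum>\<^sub>\<infinity>x. g x * w x * \<bar>a x\<bar> + g x * w x * \<bar>b x\<bar>) \<le> \<epsilon> / (4 * B) * (2 * B)"
        using Ksum[OF a] Ksum[OF b(1)] \<epsilon> B by (intro mult_left_mono) (simp_all add: infsum_add)
      moreover have "\<epsilon> / (4 * B) * (2 * B) = \<epsilon> / 2" using B by simp
      ultimately show ?thesis using b(2) by simp
    qed
    then have "\<forall>b\<in>K \<inter> ?V. b \<in> l1.mball a \<epsilon>" using Kl1 a by (auto simp: l1.in_mball)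
    then show "\<exists>U. openin (top_of_set K) U \<and> a \<in> U \<and> (\<forall>b\<in>U. b \<in> l1.mball a \<epsilon>)"
      using op a \<epsilon> by (intro exI[of _ "K \<inter> ?V"]) auto
  qed
  from image_compactin[OF cK this] show ?thesis by (simp add: mt K_def)
qed

lemma gauss_sum_indep:
  assumes "prob_space N" "prob_space.indep_vars N (\<lambda>_. borel) W UNIV" "\<And>i. gauss N (W i) 1" "finite F"
  shows "gauss N (\<lambda>\<omega>. \<Sum>i\<in>F. c i * W i \<omega>) (\<Sum>i\<in>F. (c i)\<^sup>2)"
proof -
  interpret prob_space N by fact
  have g: "gauss N (\<lambda>\<omega>. c i * W i \<omega>) ((c i)\<^sup>2)" for i using gauss_scale[OF assms(3), of "c i"] by simp
  have "indep_vars (\<lambda>_. borel) (\<lambda>i \<omega>. c i * W i \<omega>) UNIV"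
    using indep_vars_compose2[OF assms(2), of "\<lambda>i x. c i * x" "\<lambda>_. borel"] by simp
  then have "indep_vars (\<lambda>_. borel) (\<lambda>i \<omega>. c i * W i \<omega>) F" by (rule indep_vars_subset) auto
  from char_distr_sum[OF this]
  have "char (distr N borel (\<lambda>\<omega>. \<Sum>i\<in>F. c i * W i \<omega>)) t = (\<Prod>i\<in>F. of_real (exp (- (c i)\<^sup>2 * t\<^sup>2 / 2)))" for t
    using g by (simp add: gauss_def)
  then show ?thesis using gauss_measurable[OF g] assms(4)
    unfolding gauss_def
    by (auto intro!: sum_nonneg borel_measurable_sum
        simp: exp_sum[symmetric] sum_negf sum_divide_distrib[symmetric] sum_distrib_right[symmetric] simp flip: of_real_prod)
qed

text \<open>The process \<open>\<surd>p\<^sub>x (W\<^sub>x - \<surd>p\<^sub>x \<Sum>\<^sub>y \<surd>p\<^sub>y W\<^sub>y)\<close> for independent standard normal \<open>W\<^sub>x\<close>. It is built in the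
  space with a coercive weight, which yields tightness in the original space.\<close>

lemma limit_process_exists:
  fixes p :: "'x::countable pmf" and f :: "'x \<Rightarrow> real"
  assumes f: "\<And>x. f x \<ge> 1" and fs: "(\<lambda>x. f x * sqrt (pmf p x)) summable_on UNIV"
  shows "\<exists>(N :: ('x \<Rightarrow> real) measure) G. limit_process f p N G"
proof -
  have fpos: "f x > 0" for x using f[of x] by linarith
  obtain g :: "'x \<Rightarrow> real" where g: "\<And>x. g x \<ge> 1" "\<And>K. finite {x. g x \<le> K}" "(\<lambda>x. g x * (f x * sqrt (pmf p x))) summable_on UNIV"
    by (rule coercive_weight[OF fs]) (use fpos in \<open>auto simp: less_imp_le\<close>)
  define h where "h x = g x * f x" for x
  have hge: "h x \<ge> 1" "h x \<ge> f x" "h x > 0" for x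
  proof -
    show "h x \<ge> f x" using mult_right_mono[OF g(1)[of x], of "f x"] fpos[of x] by (simp add: h_def)
    then show "h x \<ge> 1" "h x > 0" using f[of x] by linarith+
  qed
  have hs: "(\<lambda>x. h x * sqrt (pmf p x)) summable_on UNIV" using g(3) by (simp add: h_def mult.assoc)

  \<comment> \<open>Independent standard normal coordinates\<close>
  define N where "N = (\<Pi>\<^sub>M x\<in>(UNIV :: 'x set). std_normal_distribution)"
  have std: "prob_space std_normal_distribution"
    using real_dist_normal_dist by (simp add: real_distribution_def)
  interpret P: product_prob_space "\<lambda>_. std_normal_distribution" "UNIV :: 'x set"
    by (rule product_prob_spaceI) (rule std)
  have N: "prob_space N" unfolding N_def by (rule P.prob_space_axioms)
  interpret prob_space N by (rule N)
  define W where "W x \<omega> = (\<omega> x :: real)" for x :: 'x and \<omega>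
  have Wm0: "W x \<in> N \<rightarrow>\<^sub>M std_normal_distribution" for x unfolding N_def W_def[abs_def] by (rule measurable_component_singleton) simp
  then have Wm: "W x \<in> borel_measurable N" for x by (simp cong: measurable_cong_sets)
  have Wd: "distr N std_normal_distribution (W x) = std_normal_distribution" for x
    unfolding N_def W_def[abs_def] by (rule distr_PiM_component) (use std in auto)
  have Wg: "gauss N (W x) 1" for x
  proof -
    have "distr N borel (W x) = distr N std_normal_distribution (W x)" by (rule distr_cong) auto
    then have "distr N borel (W x) = std_normal_distribution" using Wd by simp
    then show ?thesis using Wm[of x] by (simp add: gauss_def char_std_normal_distribution)
  qed
  have Wi: "indep_vars (\<lambda>_. borel) W UNIV"
  proof -
    have "indep_vars (\<lambda>_. std_normal_distribution) W UNIV"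
    proof (subst indep_vars_iff_distr_eq_PiM)
      have "distr N (\<Pi>\<^sub>M i\<in>UNIV. std_normal_distribution) (\<lambda>x. \<lambda>i\<in>UNIV. W i x) = distr N N (\<lambda>x. x)"
        by (rule distr_cong) (auto simp: N_def W_def)
      then show "distr N (\<Pi>\<^sub>M i\<in>UNIV. std_normal_distribution) (\<lambda>x. \<lambda>i\<in>UNIV. W i x) = (\<Pi>\<^sub>M i\<in>UNIV. distr N std_normal_distribution (W i))"
        unfolding Wd by (simp add: distr_id2) (simp add: N_def)
    qed (use Wm0 in auto)
    from indep_vars_compose2[OF this, of "\<lambda>_ x. x" "\<lambda>_. borel"] show ?thesis by simp
  qed

  \<comment> \<open>Almost sure summability of the weighted coordinates\<close>
  define A where "A = {\<omega> \<in> space N. (\<lambda>x. h x * sqrt (pmf p x) * \<bar>W x \<omega>\<bar>) summable_on UNIV}"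
  define s where "s n \<omega> = (\<Sum>x\<in>exhaust n. h x * sqrt (pmf p x) * \<bar>W x \<omega>\<bar>)" for n \<omega>
  have t0: "h x * sqrt (pmf p x) * \<bar>W x \<omega>\<bar> \<ge> 0" for x \<omega> using hge(3)[of x] by (simp add: less_imp_le)
  have s_inc: "incseq (\<lambda>n. s n \<omega>)" for \<omega>
    unfolding s_def by (intro incseq_SucI sum_mono2 finite_exhaust exhaust_mono) (auto simp: t0)
  have sm: "s n \<in> borel_measurable N" for n unfolding s_def[abs_def] using Wm by (intro borel_measurable_sum) measurable
  \<comment> \<open>Partial sums along \<open>exhaust\<close> with a natural number as bound: a
    countable description, which makes \<open>A\<close> measurable.\<close>
  have A_iff: "\<omega> \<in> A \<longleftrightarrow> \<omega> \<in> space N \<and> (\<exists>B::nat. \<forall>n. s n \<omega> \<le> real B)" for \<omega>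
  proof (intro iffI conjI; (elim conjE)?)
    assume "\<omega> \<in> A"
    then have sum: "(\<lambda>x. h x * sqrt (pmf p x) * \<bar>W x \<omega>\<bar>) summable_on UNIV" and sp: "\<omega> \<in> space N" by (auto simp: A_def)
    show "\<omega> \<in> space N" by fact
    obtain B :: nat where "(\<Sum>\<^sub>\<infinity>x. h x * sqrt (pmf p x) * \<bar>W x \<omega>\<bar>) \<le> real B" using real_arch_simple by blast
    moreover have "s n \<omega> \<le> (\<Sum>\<^sub>\<infinity>x. h x * sqrt (pmf p x) * \<bar>W x \<omega>\<bar>)" for n
      unfolding s_def by (rule finite_sum_le_infsum[OF sum]) (auto simp: t0)
    ultimately show "\<exists>B::nat. \<forall>n. s n \<omega> \<le> real B" by (meson order_trans)
  next
    assume sp: "\<omega> \<in> space N" and "\<exists>B::nat. \<forall>n. s n \<omega> \<le> real B"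
    then obtain B :: nat where B: "\<And>n. s n \<omega> \<le> real B" by blast
    have "(\<lambda>x. h x * sqrt (pmf p x) * \<bar>W x \<omega>\<bar>) summable_on UNIV"
    proof (rule nonneg_bdd_above_summable_on[OF t0 bdd_aboveI2])
      fix S :: "'x set" assume "S \<in> {F. F \<subseteq> UNIV \<and> finite F}"
      then have S: "finite S" by simp
      then obtain n where n: "\<forall>x\<in>S. to_nat x < n" using finite_nat_set_iff_bounded[of "to_nat ` S"] by auto
      have "(\<Sum>x\<in>S. h x * sqrt (pmf p x) * \<bar>W x \<omega>\<bar>) \<le> s n \<omega>" unfolding s_def
        by (rule sum_mono2) (use n t0 in \<open>auto simp: exhaust_def[of n, symmetric]\<close>, auto simp: exhaust_def)
      with B[of n] show "(\<Sum>x\<in>S. h x * sqrt (pmf p x) * \<bar>W x \<omega>\<bar>) \<le> real B" by linarith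
    qed
    with sp show "\<omega> \<in> A" by (simp add: A_def)
  qed
  have A_meas: "A \<in> sets N"
  proof -
    have "A = {\<omega> \<in> space N. \<exists>B::nat. \<forall>n. s n \<omega> \<le> real B}" using A_iff by blast
    then show ?thesis using sm by simp
  qed
  have AE_A: "AE \<omega> in N. \<omega> \<in> A"
  proof -
    have bd: "(\<integral>\<^sup>+\<omega>. ennreal (s n \<omega>) \<partial>N) \<le> ennreal (\<Sum>\<^sub>\<infinity>x. h x * sqrt (pmf p x))" for n
    proof -
      note gm = gauss_moments[OF N Wg]
      have Wabs: "expectation (\<lambda>\<omega>. \<bar>W x \<omega>\<bar>) \<le> 1" for x
        using expectation_abs_le_sqrt(2)[OF Wm[of x] gm(1)[of x], of 1] gm(2)[of x] by simp
      have int: "integrable N (s n)" unfolding s_def[abs_def] using gm(3) by auto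
      have "expectation (s n) = (\<Sum>x\<in>exhaust n. h x * sqrt (pmf p x) * expectation (\<lambda>\<omega>. \<bar>W x \<omega>\<bar>))"
        unfolding s_def[abs_def] using gm(3) by (simp add: Bochner_Integration.integral_sum)
      also have "\<dots> \<le> (\<Sum>x\<in>exhaust n. h x * sqrt (pmf p x) * 1)"
        by (intro sum_mono mult_left_mono Wabs) (use hge(3) in \<open>auto simp: less_imp_le\<close>)
      also have "\<dots> \<le> (\<Sum>\<^sub>\<infinity>x. h x * sqrt (pmf p x))"
        unfolding mult_1_right by (rule finite_sum_le_infsum[OF hs]) (use hge(3) in \<open>auto simp: less_imp_le\<close>)
      finally have "expectation (s n) \<le> (\<Sum>\<^sub>\<infinity>x. h x * sqrt (pmf p x))" .
      then show ?thesis
        by (subst nn_integral_eq_integral[OF int]) (auto simp: s_def t0 sum_nonneg ennreal_leI)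
    qed
    have "(\<integral>\<^sup>+\<omega>. (SUP n. ennreal (s n \<omega>)) \<partial>N) = (SUP n. \<integral>\<^sup>+\<omega>. ennreal (s n \<omega>) \<partial>N)"
      by (rule nn_integral_monotone_convergence_SUP)
         (use sm s_inc in \<open>auto simp: incseq_def le_fun_def intro!: ennreal_leI\<close>)
    also have "\<dots> \<le> ennreal (\<Sum>\<^sub>\<infinity>x. h x * sqrt (pmf p x))" by (rule SUP_least) (rule bd)
    finally have "(\<integral>\<^sup>+\<omega>. (SUP n. ennreal (s n \<omega>)) \<partial>N) \<noteq> \<infinity>" by (auto simp: top_unique)
    then have "AE \<omega> in N. (SUP n. ennreal (s n \<omega>)) \<noteq> \<infinity>"
      by (intro nn_integral_noteq_infinite) (use sm in auto)
    then show ?thesis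
    proof (rule AE_mp, intro AE_I2 impI)
      fix \<omega> assume sp: "\<omega> \<in> space N" and fin: "(SUP n. ennreal (s n \<omega>)) \<noteq> \<infinity>"
      obtain B :: nat where B: "enn2real (SUP n. ennreal (s n \<omega>)) \<le> real B" using real_arch_simple by blast
      have "s n \<omega> \<le> real B" for n
      proof -
        have "ennreal (s n \<omega>) \<le> (SUP n. ennreal (s n \<omega>))" by (rule SUP_upper) simp
        then have "enn2real (ennreal (s n \<omega>)) \<le> enn2real (SUP n. ennreal (s n \<omega>))"
          using fin by (intro enn2real_mono) (auto simp only: less_top infinity_ennreal_def)
        then show ?thesis using B by (simp add: s_def t0 sum_nonneg)
      qed
      then show "\<omega> \<in> A" using A_iff sp by blast
    qed
  qed
  have psq: "pmf p x \<le> sqrt (pmf p x)" for x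
    using sqrt_ge_absD[of "pmf p x" "pmf p x"] real_le_rsqrt[of "pmf p x" "pmf p x"] mult_left_mono[OF pmf_le_1[of p x], of "pmf p x"]
    by (simp add: power2_eq_square)
  have Asum: "(\<lambda>x. sqrt (pmf p x) * W x \<omega>) summable_on UNIV" if "\<omega> \<in> A" for \<omega>
  proof (rule summable_on_abs_le)
    show "(\<lambda>x. h x * sqrt (pmf p x) * \<bar>W x \<omega>\<bar>) summable_on UNIV" using that by (simp add: A_def)
    show "\<bar>sqrt (pmf p x) * W x \<omega>\<bar> \<le> h x * sqrt (pmf p x) * \<bar>W x \<omega>\<bar>" for x
      using mult_right_mono[OF hge(1)[of x], of "sqrt (pmf p x) * \<bar>W x \<omega>\<bar>"] by (simp add: abs_mult mult.assoc)
  qed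

  \<comment> \<open>The process and its finite-dimensional laws\<close>
  define S where "S \<omega> = (\<Sum>\<^sub>\<infinity>x. if \<omega> \<in> A then sqrt (pmf p x) * W x \<omega> else 0)" for \<omega>
  \<comment> \<open>The value \<open>0\<close> on the null set outside \<open>A\<close> keeps every
    path in the sequence space, as a random element of that space requires.\<close>
  define G where "G \<omega> x = (if \<omega> \<in> A then sqrt (pmf p x) * (W x \<omega> - sqrt (pmf p x) * S \<omega>) else 0)" for \<omega> x
  have Sm: "S \<in> borel_measurable N" unfolding S_def[abs_def]
  proof (rule borel_measurable_infsum)
    show "(\<lambda>\<omega>. if \<omega> \<in> A then sqrt (pmf p i) * W i \<omega> else 0) \<in> borel_measurable N" for i
      using Wm[of i] A_meas by (intro measurable_If_set) auto
    show "(\<lambda>i. if \<omega> \<in> A then sqrt (pmf p i) * W i \<omega> else 0) summable_on UNIV" for \<omega>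
      using Asum[of \<omega>] by (cases "\<omega> \<in> A") auto
  qed
  have Gm: "(\<lambda>\<omega>. G \<omega> x) \<in> borel_measurable N" for x
    unfolding G_def using Wm[of x] Sm A_meas by (intro measurable_If_set) auto
  have Gl1: "G \<omega> \<in> l1_set h" for \<omega>
  proof (cases "\<omega> \<in> A")
    case True
    have s1: "(\<lambda>x. h x * sqrt (pmf p x) * \<bar>W x \<omega>\<bar> + h x * sqrt (pmf p x) * \<bar>S \<omega>\<bar>) summable_on UNIV"
      using True by (intro summable_on_add summable_on_cmult_left hs) (simp add: A_def)
    show ?thesis unfolding l1_set_def mem_Collect_eq
    proof (rule summable_on_abs_le[OF s1])
      fix x
      have "\<bar>G \<omega> x\<bar> \<le> sqrt (pmf p x) * \<bar>W x \<omega>\<bar> + pmf p x * \<bar>S \<omega>\<bar>"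
        using True abs_triangle_ineq4[of "W x \<omega>" "sqrt (pmf p x) * S \<omega>"]
          mult_left_mono[of "\<bar>W x \<omega> - sqrt (pmf p x) * S \<omega>\<bar>" "\<bar>W x \<omega>\<bar> + sqrt (pmf p x) * \<bar>S \<omega>\<bar>" "sqrt (pmf p x)"]
        by (simp add: G_def abs_mult distrib_left mult.assoc[symmetric])
      also have "\<dots> \<le> sqrt (pmf p x) * \<bar>W x \<omega>\<bar> + sqrt (pmf p x) * \<bar>S \<omega>\<bar>"
        by (intro add_left_mono mult_right_mono psq) simp
      finally have "h x * \<bar>G \<omega> x\<bar> \<le> h x * (sqrt (pmf p x) * \<bar>W x \<omega>\<bar> + sqrt (pmf p x) * \<bar>S \<omega>\<bar>)"
        using hge(3)[of x] by (intro mult_left_mono) auto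
      then show "\<bar>h x * \<bar>G \<omega> x\<bar>\<bar> \<le> h x * sqrt (pmf p x) * \<bar>W x \<omega>\<bar> + h x * sqrt (pmf p x) * \<bar>S \<omega>\<bar>"
        using hge(3)[of x] by (simp add: abs_mult algebra_simps)
    qed
  qed (simp add: G_def l1_set_def)
  have Gg: "gauss N (\<lambda>\<omega>. \<Sum>x\<in>F. t x * G \<omega> x) (multi_var p F t)" if F: "finite F" for F t
  proof -
    define m where "m = (\<Sum>x\<in>F. t x * pmf p x)"
    \<comment> \<open>The coefficient of \<open>W y\<close> in the given linear combination of the
      process: its own term minus the contribution through \<open>S\<close>. The combination is thus
      an almost sure limit of finite Gaussian sums.\<close>
    define c where "c y = ((if y \<in> F then t y else 0) - m) * sqrt (pmf p y)" for y
    have fs': "gauss N (\<lambda>\<omega>. \<Sum>y\<in>exhaust n. c y * W y \<omega>) (\<Sum>y\<in>exhaust n. (c y)\<^sup>2)" for n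
      by (rule gauss_sum_indep[OF N Wi Wg]) simp
    have val: "((\<lambda>y. c y * W y \<omega>) has_sum (\<Sum>x\<in>F. t x * G \<omega> x)) UNIV" if \<omega>: "\<omega> \<in> A" for \<omega>
    proof -
      have S: "((\<lambda>y. sqrt (pmf p y) * W y \<omega>) has_sum S \<omega>) UNIV" using Asum[OF \<omega>] \<omega> by (simp add: S_def)
      have "((\<lambda>y. (if y \<in> F then t y * (sqrt (pmf p y) * W y \<omega>) else 0) + - m * (sqrt (pmf p y) * W y \<omega>)) has_sum
          (\<Sum>y\<in>F. t y * (sqrt (pmf p y) * W y \<omega>)) + - m * S \<omega>) UNIV"
        by (intro has_sum_add has_sum_cmult_right S) (rule has_sum_finite_neutralI[OF F], auto)
      moreover have "(if y \<in> F then t y * (sqrt (pmf p y) * W y \<omega>) else 0) + - m * (sqrt (pmf p y) * W y \<omega>) = c y * W y \<omega>" for y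
        by (simp add: c_def algebra_simps)
      moreover have "(\<Sum>y\<in>F. t y * (sqrt (pmf p y) * W y \<omega>)) + - m * S \<omega> = (\<Sum>x\<in>F. t x * G \<omega> x)"
      proof -
        have "t x * G \<omega> x = t x * (sqrt (pmf p x) * W x \<omega>) - t x * pmf p x * S \<omega>" for x
        proof -
          have "sqrt (pmf p x) * (sqrt (pmf p x) * S \<omega>) = pmf p x * S \<omega>" by (simp add: mult.assoc[symmetric])
          then show ?thesis using \<omega> by (simp add: G_def right_diff_distrib)
        qed
        then show ?thesis by (simp add: sum_subtractf m_def sum_distrib_right)
      qed
      ultimately show ?thesis by simp
    qed
    have lim: "AE \<omega> in N. (\<lambda>n. \<Sum>y\<in>exhaust n. c y * W y \<omega>) \<longlonglongrightarrow> (\<Sum>x\<in>F. t x * G \<omega> x)"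
      using AE_A
    proof eventually_elim
      case (elim \<omega>)
      show ?case using infsum_LIMSEQ[OF has_sum_imp_summable[OF val[OF elim]]] infsumI[OF val[OF elim]] by simp
    qed
    obtain v where v: "(\<lambda>n. \<Sum>y\<in>exhaust n. (c y)\<^sup>2) \<longlonglongrightarrow> v" "gauss N (\<lambda>\<omega>. \<Sum>x\<in>F. t x * G \<omega> x) v"
      by (rule gauss_limit[OF N fs' lim]) (use Gm in auto)
    \<comment> \<open>The limiting variance is identified with \<open>multi_var\<close> by expanding
      the square and using that \<open>p\<close> has mass \<open>1\<close>.\<close>
    have cs: "((\<lambda>y. (c y)\<^sup>2) has_sum multi_var p F t) UNIV"
    proof -
      have "((\<lambda>y. (if y \<in> F then ((t y)\<^sup>2 - 2 * m * t y) * pmf p y else 0) + m\<^sup>2 * pmf p y) has_sum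
          (\<Sum>y\<in>F. ((t y)\<^sup>2 - 2 * m * t y) * pmf p y) + m\<^sup>2 * 1) UNIV"
        by (intro has_sum_add has_sum_cmult_right pmf_has_sum) (rule has_sum_finite_neutralI[OF F], auto)
      moreover have "(if y \<in> F then ((t y)\<^sup>2 - 2 * m * t y) * pmf p y else 0) + m\<^sup>2 * pmf p y = (c y)\<^sup>2" for y
        by (simp add: c_def power_mult_distrib power2_diff algebra_simps)
      moreover have "(\<Sum>y\<in>F. ((t y)\<^sup>2 - 2 * m * t y) * pmf p y) + m\<^sup>2 * 1 = multi_var p F t"
      proof -
        have "(\<Sum>x\<in>F. 2 * m * t x * pmf p x) = 2 * m * m" by (simp add: m_def sum_distrib_left mult.assoc)
        then show ?thesis by (simp add: multi_var_def left_diff_distrib sum_subtractf m_def[symmetric] power2_eq_square)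
      qed
      ultimately show ?thesis by simp
    qed
    have "v = multi_var p F t"
      using LIMSEQ_unique[OF v(1)] infsum_LIMSEQ[OF has_sum_imp_summable[OF cs]] infsumI[OF cs] by simp
    with v(2) show ?thesis by simp
  qed
  have gm: "gauss N (\<lambda>\<omega>. G \<omega> x) (pmf p x - (pmf p x)\<^sup>2)" for x
    using Gg[of "{x}" "\<lambda>_. 1"] by (simp add: multi_var_def)
  note gmom = gauss_moments[OF N gm]
  have Gf: "G \<omega> \<in> l1_set f" for \<omega>
  proof -
    have "(\<lambda>x. h x * \<bar>G \<omega> x\<bar>) summable_on UNIV" using Gl1[of \<omega>] by (simp add: l1_set_def)
    then show ?thesis unfolding l1_set_def mem_Collect_eq
      by (rule summable_on_abs_le) (use hge(2) fpos in \<open>auto simp: abs_mult less_imp_le intro!: mult_right_mono\<close>)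
  qed
  have cg: "centered_gaussian (l1_space f) N G"
    unfolding centered_gaussian_def
    using measurable_l1_space[OF fpos Gf Gm] Gg centered_normal_iff[OF N] by blast

  \<comment> \<open>Covariance and tightness\<close>
  have cov: "covariance_fun N G = multinomial_cov p"
  proof (intro ext)
    fix x x'
    have pr: "integrable N (\<lambda>\<omega>. G \<omega> x * G \<omega> x')" by (rule integrable_mult_square) (use Gm gmom in auto)
    have e: "covariance_fun N G x x' = expectation (\<lambda>\<omega>. G \<omega> x * G \<omega> x')"
      unfolding covariance_fun_def by (simp add: gmom)
    show "covariance_fun N G x x' = multinomial_cov p x x'"
    proof (cases "x = x'")
      case True
      then show ?thesis unfolding e using gmom(2)[of x] by (simp add: multinomial_cov_def power2_eq_square algebra_simps)
    next
      case False
      \<comment> \<open>Polarization: the variance of the sum of two coordinates is known, and so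
        are the single variances.\<close>
      have "gauss N (\<lambda>\<omega>. G \<omega> x + G \<omega> x') (pmf p x + pmf p x' - (pmf p x + pmf p x')\<^sup>2)"
        using Gg[of "{x, x'}" "\<lambda>_. 1"] False by (simp add: multi_var_def)
      from gauss_moments(2)[OF N this]
      have "pmf p x + pmf p x' - (pmf p x + pmf p x')\<^sup>2 = expectation (\<lambda>\<omega>. (G \<omega> x + G \<omega> x')\<^sup>2)" by simp
      also have "\<dots> = expectation (\<lambda>\<omega>. (G \<omega> x)\<^sup>2 + ((G \<omega> x')\<^sup>2 + 2 * (G \<omega> x * G \<omega> x')))"
        by (intro Bochner_Integration.integral_cong) (auto simp: power2_eq_square algebra_simps)
      also have "\<dots> = expectation (\<lambda>\<omega>. (G \<omega> x)\<^sup>2) + (expectation (\<lambda>\<omega>. (G \<omega> x')\<^sup>2) + 2 * expectation (\<lambda>\<omega>. G \<omega> x * G \<omega> x'))"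
        using gmom(1) pr by simp
      finally have "pmf p x + pmf p x' - (pmf p x + pmf p x')\<^sup>2 =
          (pmf p x - (pmf p x)\<^sup>2) + ((pmf p x' - (pmf p x')\<^sup>2) + 2 * expectation (\<lambda>\<omega>. G \<omega> x * G \<omega> x'))"
        unfolding gmom(2) .
      then show ?thesis unfolding e using False
        by (simp add: multinomial_cov_def power2_eq_square algebra_simps)
    qed
  qed
  interpret lr: l1_random N G h "pmf p"
  proof
    show "moment_bounded N G (pmf p)"
      unfolding moment_bounded_def using Gm gmom(1,2) by auto
  qed (use hge(3) Gl1 hs in auto)
  define T where "T = (\<Sum>\<^sub>\<infinity>x. h x * sqrt (pmf p x))"
  have T0: "T \<ge> 0" unfolding T_def by (rule infsum_nonneg) (use hge(3) in \<open>simp add: less_imp_le\<close>)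
  have tight: "tight_element (l1_space f) N G"
    unfolding tight_element_def
  proof (intro allI impI)
    fix \<epsilon> :: real assume \<epsilon>: "\<epsilon> > 0"
    \<comment> \<open>Chosen for Markov's inequality, applied to the norm with the larger weight
      \<open>h\<close>, whose expectation is at most \<open>T\<close>. The summand \<open>1\<close>
      keeps \<open>B\<close> positive.\<close>
    define B where "B = (T + 1) / \<epsilon>"
    have B: "B > 0" using T0 \<epsilon> by (simp add: B_def)
    define K where "K = {a :: 'x \<Rightarrow> real. \<forall>F. finite F \<longrightarrow> (\<Sum>x\<in>F. g x * f x * \<bar>a x\<bar>) \<le> B}"
    have "compactin (mtopology_of (l1_space f)) K"
      unfolding K_def by (rule compactin_l1_ball[OF fpos g(1,2) B])
    moreover have "prob {\<omega> \<in> space N. G \<omega> \<in> K} \<ge> 1 - \<epsilon>"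
    proof -
      define Y where "Y \<omega> = (\<Sum>\<^sub>\<infinity>x. h x * \<bar>G \<omega> x\<bar>)" for \<omega>
      have Yi: "integrable N Y" and YE: "expectation Y \<le> T"
        using lr.expected_norm by (auto simp: Y_def[abs_def] T_def)
      have Ym: "Y \<in> borel_measurable N" using Yi by simp
      have Y0: "Y \<omega> \<ge> 0" for \<omega> unfolding Y_def by (rule infsum_nonneg) (use hge(3) in \<open>simp add: less_imp_le\<close>)
      have KY: "G \<omega> \<in> K \<longleftrightarrow> Y \<omega> \<le> B" for \<omega>
      proof -
        have s: "(\<lambda>x. h x * \<bar>G \<omega> x\<bar>) summable_on UNIV" using Gl1[of \<omega>] by (simp add: l1_set_def)
        show ?thesis
        proof
          show "G \<omega> \<in> K \<Longrightarrow> Y \<omega> \<le> B" unfolding Y_def K_def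
            by (rule infsum_le_finite_sums[OF s]) (auto simp: h_def)
          assume Y: "Y \<omega> \<le> B"
          show "G \<omega> \<in> K" unfolding K_def
          proof (intro CollectI allI impI)
            fix F :: "'x set" assume F: "finite F"
            have "(\<Sum>x\<in>F. h x * \<bar>G \<omega> x\<bar>) \<le> Y \<omega>" unfolding Y_def
              by (rule finite_sum_le_infsum[OF s F]) (use hge(3) in \<open>auto simp: less_imp_le\<close>)
            with Y show "(\<Sum>x\<in>F. g x * f x * \<bar>G \<omega> x\<bar>) \<le> B" by (simp add: h_def)
          qed
        qed
      qed
      have "prob {\<omega> \<in> space N. Y \<omega> \<ge> B} \<le> expectation Y / B"
        by (rule integral_Markov_inequality_measure[OF Yi _ _ B]) (use Y0 in auto)
      also have "\<dots> \<le> \<epsilon>"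
      proof -
        have "\<epsilon> * B = T + 1" using \<epsilon> by (simp add: B_def)
        then show ?thesis using YE B by (simp add: pos_divide_le_eq)
      qed
      finally have "prob {\<omega> \<in> space N. Y \<omega> \<ge> B} \<le> \<epsilon>" .
      moreover have "prob {\<omega> \<in> space N. \<not> Y \<omega> \<le> B} \<le> prob {\<omega> \<in> space N. Y \<omega> \<ge> B}"
        by (rule finite_measure_mono) (use Ym in auto)
      moreover have "prob {\<omega> \<in> space N. \<not> Y \<omega> \<le> B} = 1 - prob {\<omega> \<in> space N. Y \<omega> \<le> B}"
        by (rule prob_neg) (use Ym in measurable)
      ultimately show ?thesis unfolding KY by linarith
    qed
    ultimately show "\<exists>K. compactin (mtopology_of (l1_space f)) K \<and> 1 - \<epsilon> \<le> measure N {\<omega> \<in> space N. G \<omega> \<in> K}" by blast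
  qed
  show ?thesis unfolding limit_process_def using N cg tight cov by blast
qed

section \<open>Differentiability of the plan\<close>

context plan_density begin

section \<open>Linearity and boundedness of the derivative\<close>

lemma BX_lin:
  assumes "h \<in> l1_set WY" "h' \<in> l1_set WY"
  shows "FF (\<lambda>y. c * h y + c' * h' y) x = c * FF h x + c' * FF h' x"
proof -
  have "(\<Sum>\<^sub>\<infinity>y. k x y * (if y \<in> set_pmf s then c * h y + c' * h' y else 0)) =
      (\<Sum>\<^sub>\<infinity>y. c * (k x y * (if y \<in> set_pmf s then h y else 0)) + c' * (k x y * (if y \<in> set_pmf s then h' y else 0)))"
    by (intro infsum_cong) (auto simp: algebra_simps)
  also have "\<dots> = c * (\<Sum>\<^sub>\<infinity>y. k x y * (if y \<in> set_pmf s then h y else 0)) + c' * (\<Sum>\<^sub>\<infinity>y. k x y * (if y \<in> set_pmf s then h' y else 0))"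
    unfolding infsum_cmult_right'[symmetric]
    by (intro infsum_add summable_on_cmult_right BX_sum(1) assms)
  finally show ?thesis by (simp add: BX_eq)
qed

lemma BY_lin:
  assumes "h \<in> l1_set CX" "h' \<in> l1_set CX"
  shows "GG (\<lambda>x. c * h x + c' * h' x) y = c * GG h y + c' * GG h' y"
proof -
  have "(\<Sum>\<^sub>\<infinity>x. k x y * (if x \<in> set_pmf r then c * h x + c' * h' x else 0)) =
      (\<Sum>\<^sub>\<infinity>x. c * (k x y * (if x \<in> set_pmf r then h x else 0)) + c' * (k x y * (if x \<in> set_pmf r then h' x else 0)))"
    by (intro infsum_cong) (auto simp: algebra_simps)
  also have "\<dots> = c * (\<Sum>\<^sub>\<infinity>x. k x y * (if x \<in> set_pmf r then h x else 0)) + c' * (\<Sum>\<^sub>\<infinity>x. k x y * (if x \<in> set_pmf r then h' x else 0))"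
    unfolding infsum_cmult_right'[symmetric]
    by (intro infsum_add summable_on_cmult_right BY_sum(1) assms)
  finally show ?thesis by (simp add: BY_eq)
qed

lemma l1_lin: "h \<in> l1_set f \<Longrightarrow> h' \<in> l1_set f \<Longrightarrow> (\<And>z. f z \<ge> 0) \<Longrightarrow> (\<lambda>z. c * h z + c' * h' z) \<in> l1_set f"
  unfolding l1_set_def mem_Collect_eq
proof (rule summable_on_abs_le)
  assume s: "(\<lambda>z. f z * \<bar>h z\<bar>) summable_on UNIV" "(\<lambda>z. f z * \<bar>h' z\<bar>) summable_on UNIV" and f: "\<And>z. f z \<ge> 0"
  show "(\<lambda>z. \<bar>c\<bar> * (f z * \<bar>h z\<bar>) + \<bar>c'\<bar> * (f z * \<bar>h' z\<bar>)) summable_on UNIV"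
    by (intro summable_on_add summable_on_cmult_right s)
  show "\<bar>f z * \<bar>c * h z + c' * h' z\<bar>\<bar> \<le> \<bar>c\<bar> * (f z * \<bar>h z\<bar>) + \<bar>c'\<bar> * (f z * \<bar>h' z\<bar>)" for z
    using mult_left_mono[OF abs_triangle_ineq[of "c * h z" "c' * h' z"] f[of z]] f[of z]
    by (simp add: abs_mult algebra_simps)
qed

text \<open>\<open>inv_into\<close> carries no linearity of its own. A linear combination of two
  solutions solves the system for the combined data, and by \<open>linear_stability\<close> the
  solution is unique.\<close>

lemma deriv_lin:
  assumes hX: "hX \<in> l1_set CX" "hX' \<in> l1_set CX" and hY: "hY \<in> l1_set WY" "hY' \<in> l1_set WY"
  shows "DD (\<lambda>x. c * hX x + c' * hX' x) (\<lambda>y. c * hY y + c' * hY' y) z = c * DD hX hY z + c' * DD hX' hY' z"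
proof -
  let ?X = "\<lambda>x. c * hX x + c' * hX' x" and ?Y = "\<lambda>y. c * hY y + c' * hY' y"
  have X: "?X \<in> l1_set CX" and Y: "?Y \<in> l1_set WY"
    using CX_pos WY_pos by (auto intro!: l1_lin hX hY simp: less_imp_le CY_pos \<phi>_pos)
  note d = deriv_eqs[OF X Y] and d1 = deriv_eqs[OF hX(1) hY(1)] and d2 = deriv_eqs[OF hX(2) hY(2)]
  let ?n = "nX ?X + nY ?Y" and ?n1 = "nX hX + nY hY" and ?n2 = "nX hX' + nY hY'"
  have n0: "cB * ?n \<ge> 0" "cB * ?n1 \<ge> 0" "cB * ?n2 \<ge> 0" "cA * ?n1 \<ge> 0" "cA * ?n2 \<ge> 0" "cA * ?n \<ge> 0"
    using cA_nonneg Q_pos nX_nonneg nY_nonneg by (auto simp: cB_def)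
  define a where "a x = c * da hX hY x + c' * da hX' hY' x" for x
  define b where "b y = c * db hX hY y + c' * db hX' hY' y" for y
  have Bb: "BB a y = c * BB (da hX hY) y + c' * BB (da hX' hY') y" for y
    unfolding a_def by (rule AY_lin[OF d1(3) d2(3)])
  have Ab: "AA b x = c * AA (db hX hY) x + c' * AA (db hX' hY') x" for x
    unfolding b_def by (rule AX_lin[OF growth1_3[OF d1(4)] n0(2) growth1_3[OF d2(4)] n0(3)])
  have a_eq: "a x = FF ?Y x - AA b x" for x
  proof -
    have "FF hY x = da hX hY x + AA (db hX hY) x" "FF hY' x = da hX' hY' x + AA (db hX' hY') x"
      using d1(1)[of x] d2(1)[of x] by linarith+
    then show ?thesis unfolding Ab BX_lin[OF hY] by (simp add: a_def distrib_left)
  qed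
  have b_eq: "b y = GG ?X y - BB a y" for y
  proof -
    have "GG hX y = db hX hY y + BB (da hX hY) y" "GG hX' y = db hX' hY' y + BB (da hX' hY') y"
      using d1(2)[of y] d2(2)[of y] by linarith+
    then show ?thesis unfolding Bb BY_lin[OF hX] by (simp add: b_def distrib_left)
  qed
  have a_bd: "\<bar>a x\<bar> \<le> \<bar>c\<bar> * (cA * ?n1) + \<bar>c'\<bar> * (cA * ?n2)" for x
    unfolding a_def by (rule order_trans[OF abs_triangle_ineq])
      (auto simp: abs_mult intro!: add_mono mult_left_mono d1(3) d2(3))
  have b_bd: "\<bar>b y\<bar> \<le> (\<bar>c\<bar> * (cB * ?n1) + \<bar>c'\<bar> * (cB * ?n2)) * \<phi> y" for y
  proof -
    have "\<bar>b y\<bar> \<le> \<bar>c\<bar> * (cB * ?n1 * \<phi> y) + \<bar>c'\<bar> * (cB * ?n2 * \<phi> y)"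
      unfolding b_def by (rule order_trans[OF abs_triangle_ineq])
        (auto simp: abs_mult intro!: add_mono mult_left_mono d1(4) d2(4))
    then show ?thesis by (simp add: algebra_simps)
  qed
  define e where "e x = da ?X ?Y x - a x" for x
  define e' where "e' y = db ?X ?Y y - b y" for y
  have e_bd: "\<bar>e x\<bar> \<le> cA * ?n + (\<bar>c\<bar> * (cA * ?n1) + \<bar>c'\<bar> * (cA * ?n2))" for x
    using d(3)[of x] a_bd[of x] unfolding e_def by linarith
  have "\<bar>e x\<bar> \<le> (0 + Q * 0 * S4) / eps" for x
  proof (rule linear_stability[where b=e' and g="\<lambda>_. 0" and f="\<lambda>_. 0", OF e_bd])
    show "e' y = 0 - BB e y" for y
      using d(2)[of y] b_eq[of y] AY_lin[where a="da ?X ?Y" and c=a and u=1 and v="- 1" and y=y, OF d(3) a_bd]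
      by (simp add: e'_def e_def[abs_def])
    have "\<bar>c\<bar> * (cB * ?n1) + \<bar>c'\<bar> * (cB * ?n2) \<ge> 0" using n0 by simp
    then show "e x = 0 - AA e' x" for x
      using d(1)[of x] a_eq[of x] AX_lin[where b="db ?X ?Y" and c=b and u=1 and v="- 1" and x=x, OF growth1_3[OF d(4)] n0(1) growth1_3[OF b_bd]]
      by (simp add: e_def e'_def[abs_def])
  qed auto
  then have ea: "da ?X ?Y = a" unfolding e_def by fastforce
  then have eb: "db ?X ?Y y = b y" for y using d(2)[of y] b_eq[of y] by simp
  have id: "P * (u * (c * h1 + c' * h2) + (c * g1 + c' * g2) * v) - q * ((c * a1 + c' * a2) + (c * b1 + c' * b2)) =
      c * (P * (u * h1 + g1 * v) - q * (a1 + b1)) + c' * (P * (u * h2 + g2 * v) - q * (a2 + b2))"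
    for P q u v h1 h2 g1 g2 a1 a2 b1 b2 :: real by (simp add: algebra_simps)
  obtain x y where z: "z = (x, y)" by (cases z)
  show ?thesis
  proof (cases "x \<in> set_pmf r \<and> y \<in> set_pmf s")
    case True
    then show ?thesis by (simp only: z plan_deriv_def ea eb prod.case if_True a_def b_def id simp_thms)
  qed (auto simp: z plan_deriv_def)
qed

definition SX :: real where "SX = (\<Sum>\<^sub>\<infinity>x. CX x * pmf r x)"
definition SY :: real where "SY = (\<Sum>\<^sub>\<infinity>y. WY y * pmf s y)"
definition cD :: real where "cD = 2 * Q * (SX + SY + (cA + cB) * SX * SY)"

lemma SX_nonneg: "SX \<ge> 0" unfolding SX_def by (rule infsum_nonneg) (simp add: CX_pos less_imp_le)
lemma SY_nonneg: "SY \<ge> 0" unfolding SY_def by (rule infsum_nonneg) (simp add: WY_pos less_imp_le)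

lemma infsum_prod_eq:
  fixes f :: "'a \<Rightarrow> real" and g :: "'b \<Rightarrow> real"
  assumes "f summable_on UNIV" "g summable_on UNIV"
  shows "((\<lambda>(x, y). f x * g y) has_sum infsum f UNIV * infsum g UNIV) UNIV"
proof -
  have a: "(\<lambda>x. \<bar>f x\<bar>) summable_on UNIV" "(\<lambda>x. \<bar>g x\<bar>) summable_on UNIV"
    using assms summable_on_iff_abs_summable_on_real by fastforce+
  have "\<bar>f x * g y\<bar> \<le> \<bar>f x\<bar> * \<bar>g y\<bar>" for x y by (simp add: abs_mult)
  from infsum_prod_dom(1,2)[OF a this] show ?thesis
    by (simp add: has_sum_iff infsum_cmult_left' infsum_cmult_right')
qed

text \<open>The derivative is dominated by three products of weighted marginals and perturbations.
  The kernel and the \<open>y\<close> potential cost one factor \<open>\<phi>\<close> each, within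
  the fourth power contained in the weight.\<close>

lemma deriv_bound:
  assumes hX: "hX \<in> l1_set CX" and hY: "hY \<in> l1_set WY"
  shows "DD hX hY \<in> l1_set wsum" "(\<Sum>\<^sub>\<infinity>z. wsum z * \<bar>DD hX hY z\<bar>) \<le> cD * (nX hX + nY hY)"
proof -
  note d = deriv_eqs[OF hX hY]
  let ?N = "nX hX + nY hY"
  have N0: "?N \<ge> 0" using nX_nonneg nY_nonneg by simp
  have sX: "(\<lambda>x. CX x * \<bar>hX x\<bar>) summable_on UNIV" and sY: "(\<lambda>y. WY y * \<bar>hY y\<bar>) summable_on UNIV"
    using hX hY by (auto simp: l1_set_def)
  define u where "u = (\<lambda>(x, y). 2 * Q * ((CX x * pmf r x) * (WY y * \<bar>hY y\<bar>)) + (2 * Q * ((CX x * \<bar>hX x\<bar>) * (WY y * pmf s y))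
      + 2 * Q * ((cA + cB) * ?N) * ((CX x * pmf r x) * (WY y * pmf s y))))"
  have us: "(u has_sum 2 * Q * (SX * nY hY) + (2 * Q * (nX hX * SY) + 2 * Q * ((cA + cB) * ?N) * (SX * SY))) UNIV"
    unfolding u_def case_prod_unfold
    by (intro has_sum_add has_sum_cmult_right; use infsum_prod_eq[OF rsum sY] infsum_prod_eq[OF sX ssum] infsum_prod_eq[OF rsum ssum] in \<open>simp add: SX_def SY_def case_prod_unfold\<close>)
  have le: "\<bar>wsum z * \<bar>DD hX hY z\<bar>\<bar> \<le> u z" for z
  proof (cases z)
    case (Pair x y)
    have u0: "u z \<ge> 0" unfolding Pair u_def using Q_pos CX_pos[of x] WY_pos[of y] N0 cA_nonneg
      by (auto simp: cB_def intro!: add_nonneg_nonneg mult_nonneg_nonneg simp: less_imp_le CY_pos \<phi>_pos)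
    show ?thesis
    proof (cases "x \<in> set_pmf r \<and> y \<in> set_pmf s")
      case False
      then have "DD hX hY z = 0" by (auto simp: Pair plan_deriv_def)
      then show ?thesis using u0 by simp
    next
      case True
      have pos: "pmf r x > 0" "pmf s y > 0" using True by (auto simp: pmf_positive)
      have D: "DD hX hY z = k x y * (pmf r x * hY y + hX x * pmf s y) - k x y * (pmf r x * pmf s y) * (da hX hY x + db hX hY y)"
        using True pos by (simp add: Pair plan_deriv_def \<pi> mult.assoc)
      have ab: "\<bar>da hX hY x + db hX hY y\<bar> \<le> (cA + cB) * ?N * \<phi> y"
      proof -
        have "0 \<le> cA * ?N" using cA_nonneg N0 by simp
        then have "cA * ?N * 1 \<le> cA * ?N * \<phi> y" by (intro mult_left_mono \<phi>_ge)
        then have "\<bar>da hX hY x + db hX hY y\<bar> \<le> cA * ?N * \<phi> y + cB * ?N * \<phi> y"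
          using d(3)[of x] d(4)[of y] by linarith
        then show ?thesis by (simp only: distrib_right)
      qed
      have p4: "\<phi> y \<le> \<phi> y ^ 4" "\<phi> y * \<phi> y \<le> \<phi> y ^ 4" "0 \<le> \<phi> y ^ 4"
        using \<phi>_mono[of 1 4 y] \<phi>_mono[of 2 4 y] \<phi>_pow_ge[of y 4] by (auto simp: power2_eq_square)
      have k4: "k x y \<le> Q * \<phi> y ^ 4" using k_le[of x y] mult_left_mono[OF p4(1), of Q] Q_pos by linarith
      have T1: "\<bar>k x y * (pmf r x * hY y + hX x * pmf s y)\<bar> \<le> Q * \<phi> y ^ 4 * (pmf r x * \<bar>hY y\<bar> + \<bar>hX x\<bar> * pmf s y)"
        unfolding abs_mult using k_nonneg[of x y] k4 abs_triangle_ineq[of "pmf r x * hY y" "hX x * pmf s y"]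
        by (intro mult_mono) (auto simp: abs_mult)
      have T2: "\<bar>k x y * (pmf r x * pmf s y) * (da hX hY x + db hX hY y)\<bar> \<le> Q * \<phi> y ^ 4 * (pmf r x * pmf s y) * ((cA + cB) * ?N)"
      proof -
        have "k x y * \<bar>da hX hY x + db hX hY y\<bar> \<le> (Q * \<phi> y) * ((cA + cB) * ?N * \<phi> y)"
          using k_le[of x y] k_nonneg[of x y] ab by (intro mult_mono) auto
        also have "\<dots> = Q * ((cA + cB) * ?N) * (\<phi> y * \<phi> y)" by simp
        also have "\<dots> \<le> Q * ((cA + cB) * ?N) * \<phi> y ^ 4"
          using Q_pos cA_nonneg N0 p4 by (intro mult_left_mono) (auto simp: cB_def)
        finally have "k x y * \<bar>da hX hY x + db hX hY y\<bar> \<le> Q * ((cA + cB) * ?N) * \<phi> y ^ 4" .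
        from mult_right_mono[OF this, of "pmf r x * pmf s y"] show ?thesis
          using k_nonneg[of x y] by (simp add: abs_mult mult_ac)
      qed
      have "\<bar>DD hX hY z\<bar> \<le> Q * \<phi> y ^ 4 * (pmf r x * \<bar>hY y\<bar> + \<bar>hX x\<bar> * pmf s y) + Q * \<phi> y ^ 4 * (pmf r x * pmf s y) * ((cA + cB) * ?N)"
        using T1 T2 unfolding D by linarith
      then have "wsum (x, y) * \<bar>DD hX hY z\<bar> \<le> (2 * (CX x * CY y)) * (Q * \<phi> y ^ 4 * (pmf r x * \<bar>hY y\<bar> + \<bar>hX x\<bar> * pmf s y) + Q * \<phi> y ^ 4 * (pmf r x * pmf s y) * ((cA + cB) * ?N))"
        using wsum_le[of x y] CX_pos[of x] CY_pos[of y] by (intro mult_mono) auto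
      also have "\<dots> = u z" by (simp add: Pair u_def algebra_simps)
      finally show ?thesis using wsum_le(2)[of x y] by (simp add: Pair abs_mult)
    qed
  qed
  show "DD hX hY \<in> l1_set wsum" unfolding l1_set_def mem_Collect_eq
    by (rule summable_on_abs_le[OF has_sum_imp_summable[OF us] le])
  have "(\<Sum>\<^sub>\<infinity>z. wsum z * \<bar>DD hX hY z\<bar>) \<le> infsum u UNIV"
    using infsum_abs_le[OF has_sum_imp_summable[OF us] le] by linarith
  also have "\<dots> \<le> cD * ?N"
  proof -
    have "2 * Q * (SX * nY hY) \<le> 2 * Q * (SX * ?N)" "2 * Q * (nX hX * SY) \<le> 2 * Q * (?N * SY)"
      using Q_pos SX_nonneg SY_nonneg nX_nonneg[of hX] nY_nonneg[of hY] by (auto intro!: mult_left_mono mult_right_mono)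
    then show ?thesis unfolding infsumI[OF us] cD_def by (simp add: algebra_simps)
  qed
  finally show "(\<Sum>\<^sub>\<infinity>z. wsum z * \<bar>DD hX hY z\<bar>) \<le> cD * ?N" .
qed

lemma cD_nonneg: "cD \<ge> 0"
  using Q_pos SX_nonneg SY_nonneg cA_nonneg by (simp add: cD_def cB_def)

end

text \<open>The row and column normalizations of \<open>k\<close> are the marginal conditions, and
  the majorant \<open>pmf r x * (f y * pmf s y)\<close> justifies exchanging the sums.\<close>

lemma pmf_from_density:
  fixes k :: "'x \<Rightarrow> 'y \<Rightarrow> real"
  assumes k0: "\<And>x y. 0 \<le> k x y" and k_le: "\<And>x y. k x y \<le> f y" and fs: "(\<lambda>y. f y * pmf s y) summable_on UNIV"
    and ks: "\<And>x. ((\<lambda>y. k x y * pmf s y) has_sum 1) UNIV" and kr: "\<And>y. ((\<lambda>x. k x y * pmf r x) has_sum 1) UNIV"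
  obtains \<pi> where "\<pi> \<in> couplings r s" "\<And>x y. pmf \<pi> (x, y) = k x y * pmf r x * pmf s y"
proof -
  define q where "q x y = k x y * pmf r x * pmf s y" for x y
  have q0: "q x y \<ge> 0" for x y by (simp add: q_def k0)
  have dom: "\<bar>q x y\<bar> \<le> pmf r x * (f y * pmf s y)" for x y
    using mult_right_mono[OF k_le[of x y], of "pmf r x * pmf s y"] k0[of x y]
    by (simp add: q_def abs_mult mult_ac)
  have domi: "\<bar>i x y * q x y\<bar> \<le> pmf r x * (f y * pmf s y)" if "\<And>x y. \<bar>i x y\<bar> \<le> 1" for i :: "'x \<Rightarrow> 'y \<Rightarrow> real" and x y
    using mult_mono[OF that[of x y] dom[of x y]] by (simp add: abs_mult)
  have qy: "(\<Sum>\<^sub>\<infinity>y. q x y) = pmf r x" for x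
  proof -
    have "(\<Sum>\<^sub>\<infinity>y. q x y) = (\<Sum>\<^sub>\<infinity>y. pmf r x * (k x y * pmf s y))" by (rule infsum_cong) (simp add: q_def mult_ac)
    then show ?thesis unfolding infsum_cmult_right' infsumI[OF ks] by simp
  qed
  have qx: "(\<Sum>\<^sub>\<infinity>x. q x y) = pmf s y" for y
  proof -
    have "(\<Sum>\<^sub>\<infinity>x. q x y) = (\<Sum>\<^sub>\<infinity>x. pmf s y * (k x y * pmf r x))" by (rule infsum_cong) (simp add: q_def mult_ac)
    then show ?thesis unfolding infsum_cmult_right' infsumI[OF kr] by simp
  qed
  note fub = infsum_prod_dom[OF pmf_summable fs dom]
  have tot: "(\<Sum>\<^sub>\<infinity>z. case z of (x, y) \<Rightarrow> q x y) = 1" using fub(2) by (simp add: qy)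
  have nn: "(\<integral>\<^sup>+z. ennreal (case z of (x, y) \<Rightarrow> q x y) \<partial>count_space UNIV) = 1"
  proof -
    have a: "Infinite_Set_Sum.abs_summable_on (\<lambda>z. case z of (x, y) \<Rightarrow> q x y) UNIV"
      unfolding abs_summable_equivalent[symmetric] using fub(1) by (rule summable_on_iff_abs_summable_on_real[THEN iffD1])
    show ?thesis using nn_integral_conv_infsetsum[OF a] infsetsum_infsum[OF a] tot q0 by (simp add: case_prod_unfold)
  qed
  define \<pi> where "\<pi> = embed_pmf (\<lambda>(x, y). q x y)"
  have pi: "pmf \<pi> z = (case z of (x, y) \<Rightarrow> q x y)" for z
    unfolding \<pi>_def by (rule pmf_embed_pmf) (use q0 nn in \<open>auto simp: case_prod_unfold\<close>)
  have "map_pmf fst \<pi> = r"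
  proof (rule pmf_eqI)
    fix x :: 'x
    let ?i = "\<lambda>(x'::'x) (y::'y). of_bool (x' = x) :: real"
    have "pmf (map_pmf fst \<pi>) x = (\<Sum>\<^sub>\<infinity>x'. of_bool (x' = x) * pmf (map_pmf fst \<pi>) x')"
      by (rule infsumI[symmetric], rule has_sum_finite_neutralI[of "{x}"]) auto
    also have "\<dots> = (\<Sum>\<^sub>\<infinity>z. of_bool (fst z = x) * pmf \<pi> z)"
      by (rule has_sum_map_pmf(2)[symmetric])
    also have "\<dots> = (\<Sum>\<^sub>\<infinity>(x', y). ?i x' y * q x' y)" by (rule infsum_cong) (simp add: pi case_prod_unfold)
    also have "\<dots> = (\<Sum>\<^sub>\<infinity>x'. \<Sum>\<^sub>\<infinity>y. ?i x' y * q x' y)"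
      by (rule infsum_prod_dom(2)[OF pmf_summable fs domi]) auto
    also have "\<dots> = (\<Sum>\<^sub>\<infinity>x'. of_bool (x' = x) * pmf r x')" by (simp add: infsum_cmult_right' qy)
    also have "\<dots> = pmf r x" by (rule infsumI, rule has_sum_finite_neutralI[of "{x}"]) auto
    finally show "pmf (map_pmf fst \<pi>) x = pmf r x" .
  qed
  moreover have "map_pmf snd \<pi> = s"
  proof (rule pmf_eqI)
    fix y :: 'y
    let ?i = "\<lambda>(x::'x) (y'::'y). of_bool (y' = y) :: real"
    have "pmf (map_pmf snd \<pi>) y = (\<Sum>\<^sub>\<infinity>y'. of_bool (y' = y) * pmf (map_pmf snd \<pi>) y')"
      by (rule infsumI[symmetric], rule has_sum_finite_neutralI[of "{y}"]) auto
    also have "\<dots> = (\<Sum>\<^sub>\<infinity>z. of_bool (snd z = y) * pmf \<pi> z)"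
      by (rule has_sum_map_pmf(2)[symmetric])
    also have "\<dots> = (\<Sum>\<^sub>\<infinity>(x, y'). ?i x y' * q x y')" by (rule infsum_cong) (simp add: pi case_prod_unfold)
    also have "\<dots> = (\<Sum>\<^sub>\<infinity>y'. \<Sum>\<^sub>\<infinity>x. ?i x y' * q x y')"
      by (rule infsum_prod_dom(3)[OF pmf_summable fs domi]) auto
    also have "\<dots> = (\<Sum>\<^sub>\<infinity>y'. of_bool (y' = y) * pmf s y')" by (simp add: infsum_cmult_right' qx)
    also have "\<dots> = pmf s y" by (rule infsumI, rule has_sum_finite_neutralI[of "{y}"]) auto
    finally show "pmf (map_pmf snd \<pi>) y = pmf s y" .
  qed
  ultimately show thesis using that[of \<pi>] pi by (simp add: couplings_def q_def)
qed

section \<open>The plan for a dominated cost\<close>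

locale erot_setting =
  fixes c :: "'x \<times> 'y \<Rightarrow> real" and lam :: real and cXm cXp :: "'x \<Rightarrow> real" and cYm cYp :: "'y \<Rightarrow> real"
    and L :: real
  assumes lam: "lam > 0" and dom: "dominating c cXm cXp cYm cYp" and L: "\<And>x. cXp x - cXm x \<le> L"
begin

definition CX :: "'x \<Rightarrow> real" where "CX = cost_weight cXm cXp"
definition CY :: "'y \<Rightarrow> real" where "CY = cost_weight cYm cYp"
definition \<phi> :: "'y \<Rightarrow> real" where "\<phi> = exp_weight lam cYm cYp"
definition WY :: "'y \<Rightarrow> real" where "WY y = CY y * \<phi> y ^ 4"
text \<open>The Gibbs kernel of the cost reduced by the lower dominating functions. The reduction
  makes it at most \<open>1\<close> and, as \<open>cXp - cXm\<close> is bounded by \<open>L\<close>,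
  at least \<open>1 / (B * \<phi> y)\<close>; the subtracted terms reappear in the
  potentials.\<close>

definition K :: "'x \<Rightarrow> 'y \<Rightarrow> real" where "K x y = exp (- (c (x, y) - cXm x - cYm y) / lam)"
definition B :: real where "B = exp (L / lam)"

lemma domD: "cXm x \<le> cXp x" "cYm y \<le> cYp y" "cXm x + cYm y \<le> c (x, y)" "c (x, y) \<le> cXp x + cYp y"
  using dom by (auto simp: dominating_def)

lemma L0: "L \<ge> 0" using L[of undefined] domD(1)[of undefined] by linarith
lemma CX_ge: "CX x \<ge> 1" and CY_ge: "CY y \<ge> 1" by (auto simp: CX_def CY_def cost_weight_def)
lemma phi_ge: "\<phi> y \<ge> 1" using domD(2)[of y] lam by (simp add: \<phi>_def exp_weight_def)
lemma B_ge: "B \<ge> 1" using L0 lam by (simp add: B_def)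
lemma K_le: "K x y \<le> 1" using domD(3)[of x y] lam by (simp add: K_def divide_le_0_iff)
lemma K_ge: "1 / (B * \<phi> y) \<le> K x y"
proof -
  have "1 / (B * \<phi> y) = exp (- (L / lam + (cYp y - cYm y) / lam))"
    by (simp only: B_def \<phi>_def exp_weight_def exp_minus exp_add inverse_eq_divide)
  also have "\<dots> \<le> K x y"
  proof -
    have "c (x, y) - cXm x - cYm y \<le> L + (cYp y - cYm y)" using domD(4)[of x y] L[of x] by linarith
    then have "(c (x, y) - cXm x - cYm y) / lam \<le> (L + (cYp y - cYm y)) / lam"
      using lam by (intro divide_right_mono) auto
    then show ?thesis
      by (simp only: K_def minus_divide_left[symmetric] exp_le_cancel_iff neg_le_iff_le add_divide_distrib)
  qed
  finally show ?thesis .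
qed

lemma phi_pow: "\<phi> y \<le> \<phi> y ^ 4" using power_increasing[of 1 4 "\<phi> y"] phi_ge[of y] by simp
lemma WY_ge: "WY y \<ge> \<phi> y" "WY y \<ge> CY y" "WY y \<ge> 1" "WY y > 0" "CX x > 0"
proof -
  have p: "\<phi> y ^ 4 \<ge> 1" using phi_ge[of y] by simp
  show "WY y \<ge> CY y" using mult_left_mono[OF p, of "CY y"] CY_ge[of y] by (simp add: WY_def)
  then show "WY y \<ge> 1" "WY y > 0" using CY_ge[of y] by linarith+
  show "WY y \<ge> \<phi> y" using mult_right_mono[OF CY_ge[of y], of "\<phi> y ^ 4"] phi_pow[of y] p by (simp add: WY_def)
  show "CX x > 0" using CX_ge[of x] by linarith
qed

lemma summable_weaken: "(\<lambda>y. WY y * pmf s y) summable_on UNIV \<Longrightarrow> (\<And>y. \<bar>f y\<bar> \<le> WY y) \<Longrightarrow> (\<lambda>y. f y * pmf s y) summable_on UNIV"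
  by (rule summable_on_abs_le) (auto simp: abs_mult intro: mult_right_mono)

definition Phi :: "'y pmf \<Rightarrow> real" where "Phi s = (\<Sum>\<^sub>\<infinity>y. \<phi> y * pmf s y)"
definition Psi :: "'y pmf \<Rightarrow> real" where "Psi s = (\<Sum>\<^sub>\<infinity>y. pmf s y / \<phi> y)"

text \<open>The Schroedinger solution defines a coupling, and the variational criterion identifies
  it with the plan. The potentials \<open>lam * ln u + cXm\<close> and
  \<open>lam * ln v + cYm\<close> are dominated by the cost weights because \<open>u\<close> is
  bounded above and below and \<open>lam * ln (v y)\<close> is at most
  \<open>L + (cYp y - cYm y)\<close>.\<close>

lemma plan_potentials:
  assumes r: "(\<lambda>x. CX x * pmf r x) summable_on UNIV" and s: "(\<lambda>y. WY y * pmf s y) summable_on UNIV"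
  obtains u v where "\<And>x. 1 / (B * Phi s) \<le> u x" "\<And>x. u x \<le> B / Psi s" "\<And>y. 1 \<le> v y" "\<And>y. v y \<le> B * \<phi> y"
    "\<And>x. ((\<lambda>y. K x y * u x * v y * pmf s y) has_sum 1) UNIV"
    "\<And>y. ((\<lambda>x. K x y * u x * v y * pmf r x) has_sum 1) UNIV"
    "\<And>x y. pmf (erot_plan c lam r s) (x, y) = K x y * u x * v y * pmf r x * pmf s y"
    "erot_plan c lam r s \<in> couplings r s" "Psi s > 0" "Phi s \<ge> 1"
proof -
  have ph: "(\<lambda>y. \<phi> y * pmf s y) summable_on UNIV"
    by (rule summable_weaken[OF s]) (use WY_ge(1) phi_ge order_trans[OF zero_le_one phi_ge] in auto)
  interpret bk: bounded_kernel K B \<phi> r s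
    by unfold_locales (rule K_le K_ge phi_ge B_ge ph)+
  have eqP: "bk.\<Phi> = Phi s" "bk.\<Psi> = Psi s" by (simp_all add: bk.\<Phi>_def bk.\<Psi>_def Phi_def Psi_def)
  obtain u v where uv: "\<And>x. 1 / (B * Phi s) \<le> u x" "\<And>x. u x \<le> B / Psi s" "\<And>y. 1 \<le> v y" "\<And>y. v y \<le> B * \<phi> y"
    "\<And>x. ((\<lambda>y. K x y * u x * v y * pmf s y) has_sum 1) UNIV"
    "\<And>y. ((\<lambda>x. K x y * u x * v y * pmf r x) has_sum 1) UNIV"
    by (rule bk.schroedinger_solution[unfolded eqP]) (rule that; assumption)
  have P: "Phi s \<ge> 1" "Psi s > 0" using bk.\<Phi>_ge bk.\<Psi>_pos by (simp_all add: eqP)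
  have Bp: "B > 0" by (simp add: B_def)
  have up: "u x > 0" for x using uv(1)[of x] P Bp by (meson divide_pos_pos less_le_trans mult_pos_pos zero_less_one)
  have vp: "v y > 0" for y using uv(3)[of y] by linarith
  have Kp: "K x y > 0" for x y by (simp add: K_def)
  have kle: "K x y * u x * v y \<le> (B / Psi s * B) * \<phi> y" for x y
  proof -
    have "K x y * u x \<le> 1 * (B / Psi s)" by (intro mult_mono K_le uv(2)) (use up[of x] in auto)
    then have "K x y * u x * v y \<le> (B / Psi s) * (B * \<phi> y)"
      using uv(4)[of y] vp[of y] P(2) Bp by (intro mult_mono) auto
    then show ?thesis by (simp add: mult_ac)
  qed
  obtain \<pi> where \<pi>: "\<pi> \<in> couplings r s" "\<And>x y. pmf \<pi> (x, y) = K x y * u x * v y * pmf r x * pmf s y"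
  proof (rule pmf_from_density[of "\<lambda>x y. K x y * u x * v y" "\<lambda>y. (B / Psi s * B) * \<phi> y" s r])
    show "(\<lambda>y. B / Psi s * B * \<phi> y * pmf s y) summable_on UNIV"
      using summable_on_cmult_right[OF ph, of "B / Psi s * B"] by (simp add: mult_ac)
  qed (use kle uv(5,6) Kp up vp in \<open>auto simp: less_imp_le\<close>)
  define \<alpha> where "\<alpha> x = lam * ln (u x) + cXm x" for x
  define \<beta> where "\<beta> y = lam * ln (v y) + cYm y" for y
  define U0 where "U0 = \<bar>ln (1 / (B * Phi s))\<bar> + \<bar>ln (B / Psi s)\<bar>"
  define A where "A = (lam * U0 + 1) + (L + 2)"
  have A0: "lam * U0 + 1 \<ge> 0" "L + 2 \<ge> 0" using lam L0 by (auto simp: U0_def)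
  have "erot_plan c lam r s = \<pi>"
  proof (rule erot_plan_eqI[where f=CX and g=CY and \<alpha>=\<alpha> and \<beta>=\<beta> and A=A])
    show "lam > 0" by (rule lam)
    show "\<bar>c (x, y)\<bar> \<le> CX x + CY y" for x y
      using domD(3,4)[of x y] unfolding CX_def CY_def cost_weight_def by linarith
    show "(\<lambda>x. CX x * pmf r x) summable_on UNIV" by (rule r)
    show "(\<lambda>y. CY y * pmf s y) summable_on UNIV"
      by (rule summable_weaken[OF s]) (use WY_ge(2) order_trans[OF zero_le_one CY_ge] in auto)
    show "\<bar>\<alpha> x\<bar> \<le> A * CX x" for x
    proof -
      have "ln (1 / (B * Phi s)) \<le> ln (u x)" "ln (u x) \<le> ln (B / Psi s)"
        using uv(1,2)[of x] up[of x] P Bp by (simp_all add: ln_le_cancel_iff del: ln_div)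
      then have "\<bar>ln (u x)\<bar> \<le> U0" by (auto simp: U0_def)
      then have "\<bar>\<alpha> x\<bar> \<le> lam * U0 + \<bar>cXm x\<bar>"
      proof -
        have "lam * \<bar>ln (u x)\<bar> \<le> lam * U0" using \<open>\<bar>ln (u x)\<bar> \<le> U0\<close> lam by (intro mult_left_mono) auto
        moreover have "\<bar>lam * ln (u x)\<bar> = lam * \<bar>ln (u x)\<bar>" using lam by (simp add: abs_mult)
        ultimately show ?thesis using abs_triangle_ineq[of "lam * ln (u x)" "cXm x"] unfolding \<alpha>_def by linarith
      qed
      also have "\<dots> \<le> lam * U0 * CX x + 1 * CX x"
      proof (rule add_mono)
        show "lam * U0 \<le> lam * U0 * CX x" using mult_left_mono[OF CX_ge[of x], of "lam * U0"] lam by (simp add: U0_def)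
      qed (simp add: CX_def cost_weight_def)
      also have "\<dots> \<le> A * CX x"
        unfolding distrib_right[symmetric] using A0 CX_ge[of x] by (intro mult_right_mono) (auto simp: A_def)
      finally show ?thesis .
    qed
    show "\<bar>\<beta> y\<bar> \<le> A * CY y" for y
    proof -
      have "ln (v y) \<le> ln (B * \<phi> y)" "0 \<le> ln (v y)" using uv(3,4)[of y] vp[of y] Bp phi_ge[of y] by (simp_all add: ln_le_cancel_iff del: ln_mult)
      moreover have "ln (B * \<phi> y) = L / lam + (cYp y - cYm y) / lam"
        by (simp add: B_def \<phi>_def exp_weight_def flip: exp_add)
      ultimately have "lam * \<bar>ln (v y)\<bar> \<le> L + (cYp y - cYm y)"
        using lam mult_left_mono[of "ln (v y)" "L / lam + (cYp y - cYm y) / lam" lam] by (simp add: distrib_left)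
      then have "\<bar>\<beta> y\<bar> \<le> L + (cYp y - cYm y) + \<bar>cYm y\<bar>"
        unfolding \<beta>_def using lam abs_triangle_ineq[of "lam * ln (v y)" "cYm y"] by (simp add: abs_mult)
      also have "\<dots> \<le> L * CY y + 2 * CY y"
      proof -
        have "L \<le> L * CY y" using mult_left_mono[OF CY_ge[of y] L0] by simp
        moreover have "(cYp y - cYm y) + \<bar>cYm y\<bar> \<le> 2 * CY y" by (simp add: CY_def cost_weight_def)
        ultimately show ?thesis by linarith
      qed
      also have "\<dots> \<le> A * CY y"
        unfolding distrib_right[symmetric] using A0 CY_ge[of y] by (intro mult_right_mono) (auto simp: A_def)
      finally show ?thesis .
    qed
    show "\<pi> \<in> couplings r s" by (rule \<pi>)
    show "pmf \<pi> (x, y) = exp ((\<alpha> x + \<beta> y - c (x, y)) / lam) * pmf r x * pmf s y" for x y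
    proof -
      have "(\<alpha> x + \<beta> y - c (x, y)) / lam = - (c (x, y) - cXm x - cYm y) / lam + ln (u x) + ln (v y)"
        using lam by (simp add: \<alpha>_def \<beta>_def field_simps)
      then show ?thesis using up[of x] vp[of y] by (simp add: \<pi>(2) exp_add K_def)
    qed
  qed
  with uv \<pi> P show thesis by (intro that[of u v]) auto
qed

lemma plan_in_l1:
  assumes r: "(\<lambda>x. CX x * pmf r x) summable_on UNIV" and s: "(\<lambda>y. WY y * pmf s y) summable_on UNIV"
  shows "pmf (erot_plan c lam r s) \<in> l1_set (weight_sum CX CY)"
proof -
  obtain u v where "erot_plan c lam r s \<in> couplings r s" using plan_potentials[OF r s] by metis
  from coupling_sums[OF this r summable_weaken[OF s, of CY]]
  have "(\<lambda>(x, y). (CX x + CY y) * pmf (erot_plan c lam r s) (x, y)) summable_on UNIV"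
    using WY_ge(2) order_trans[OF zero_le_one CY_ge] by (auto dest!: has_sum_imp_summable)
  then show ?thesis by (simp add: l1_set_def weight_sum_def case_prod_unfold)
qed

text \<open>The derivative only sees perturbations on the supports of \<open>r\<close> and \<open>s\<close>; the empirical measures stay
  there almost surely.\<close>

lemma frechet_uniform:
  assumes r: "(\<lambda>x. CX x * pmf r x) summable_on UNIV" and s: "(\<lambda>y. WY y * pmf s y) summable_on UNIV"
    and y1: "y1 \<in> set_pmf s"
  obtains k Q C0 \<delta> where "plan_density k Q \<phi> CX CY r s (erot_plan c lam r s) y1" "\<delta> > 0" "C0 \<ge> 0"
    "\<And>r' s' N. set_pmf r' \<subseteq> set_pmf r \<Longrightarrow> set_pmf s' \<subseteq> set_pmf s \<Longrightarrow>
      (\<lambda>x. CX x * pmf r' x) summable_on UNIV \<Longrightarrow> (\<lambda>y. WY y * pmf s' y) summable_on UNIV \<Longrightarrow>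
      N = (\<Sum>\<^sub>\<infinity>x. CX x * \<bar>pmf r' x - pmf r x\<bar>) + (\<Sum>\<^sub>\<infinity>y. WY y * \<bar>pmf s' y - pmf s y\<bar>) \<Longrightarrow> N \<le> \<delta> \<Longrightarrow>
      (\<Sum>\<^sub>\<infinity>z. weight_sum CX CY z * \<bar>pmf (erot_plan c lam r' s') z - pmf (erot_plan c lam r s) z
        - plan_deriv r s (erot_plan c lam r s) \<phi> y1 (\<lambda>x. pmf r' x - pmf r x) (\<lambda>y. pmf s' y - pmf s y) z\<bar>) \<le> C0 * N\<^sup>2"
proof -
  obtain u v where uv: "\<And>x. 1 / (B * Phi s) \<le> u x" "\<And>x. u x \<le> B / Psi s" "\<And>y. 1 \<le> v y" "\<And>y. v y \<le> B * \<phi> y"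
    "\<And>x. ((\<lambda>y. K x y * u x * v y * pmf s y) has_sum 1) UNIV"
    "\<And>y. ((\<lambda>x. K x y * u x * v y * pmf r x) has_sum 1) UNIV"
    "\<And>x y. pmf (erot_plan c lam r s) (x, y) = K x y * u x * v y * pmf r x * pmf s y"
    and P: "Psi s > 0" "Phi s \<ge> 1"
    by (rule plan_potentials[OF r s]) (rule that; assumption)
  \<comment> \<open>Large enough for all marginals near \<open>(r, s)\<close>, where
    \<open>Psi\<close> keeps at least half of its value and \<open>Phi\<close> grows by at most
    \<open>1\<close>.\<close>
  define Q where "Q = max (2 * B\<^sup>2 / Psi s) (B\<^sup>2 * (Phi s + 1))"
  have Bp: "B > 0" using B_ge by linarith
  have ph0: "\<phi> y > 0" for y using phi_ge[of y] by linarith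
  have Kp: "K x y > 0" for x y by (simp add: K_def)
  have Q_ge: "Q \<ge> 1"
  proof -
    have "1 * 1 \<le> B\<^sup>2 * (Phi s + 1)" using B_ge P by (intro mult_mono) auto
    then show ?thesis by (simp add: Q_def max_def)
  qed
  have bounds: "K x y * u' x * v' y \<le> Q * \<phi> y" "1 / (Q * \<phi> y) \<le> K x y * u' x * v' y" "u' x > 0" "v' y > 0"
    if u: "\<And>x. 1 / (B * Ph) \<le> u' x" "\<And>x. u' x \<le> B / Ps" "\<And>y. 1 \<le> v' y" "\<And>y. v' y \<le> B * \<phi> y"
      and p: "Ps \<ge> Psi s / 2" "Ph \<le> Phi s + 1" "Ph \<ge> 1" for u' v' Ps Ph x y
  proof -
    have Ps: "Ps > 0" using p P by linarith
    show up: "u' x > 0" using u(1)[of x] p(3) Bp by (meson divide_pos_pos less_le_trans mult_pos_pos zero_less_one)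
    show vp: "v' y > 0" using u(3)[of y] by linarith
    have "K x y * u' x \<le> 1 * (B / Ps)" by (intro mult_mono K_le u(2)) (use up in auto)
    also have "B / Ps \<le> B / (Psi s / 2)" using Bp P Ps p by (intro divide_left_mono) auto
    finally have "K x y * u' x * v' y \<le> (B / (Psi s / 2)) * (B * \<phi> y)"
      using u(4)[of y] vp P Bp by (intro mult_mono) auto
    also have "\<dots> = (2 * B\<^sup>2 / Psi s) * \<phi> y" by (simp add: power2_eq_square)
    also have "\<dots> \<le> Q * \<phi> y" using ph0[of y] by (intro mult_right_mono) (auto simp: Q_def)
    finally show "K x y * u' x * v' y \<le> Q * \<phi> y" .
    have "1 / (Q * \<phi> y) \<le> 1 / (B\<^sup>2 * (Phi s + 1) * \<phi> y)"
      using ph0[of y] Bp P Q_ge by (intro divide_left_mono mult_right_mono) (auto simp: Q_def less_max_iff_disj)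
    also have "\<dots> \<le> 1 / (B\<^sup>2 * Ph * \<phi> y)"
      using ph0[of y] Bp p by (intro divide_left_mono mult_right_mono mult_left_mono) auto
    also have "\<dots> = (1 / (B * \<phi> y)) * (1 / (B * Ph)) * 1" by (simp add: power2_eq_square)
    also have "\<dots> \<le> K x y * u' x * v' y"
      using Bp p ph0[of y] up Kp[of x y] by (intro mult_mono K_ge u(1) u(3)) auto
    finally show "1 / (Q * \<phi> y) \<le> K x y * u' x * v' y" .
  qed
  define k where "k x y = K x y * u x * v y" for x y
  note kb = bounds[where u'=u and v'=v and Ph="Phi s" and Ps="Psi s", OF uv(1-4)]
  have WYe: "(\<lambda>y. CY y * \<phi> y ^ 4 * pmf s y) summable_on UNIV" using s by (simp add: WY_def)
  interpret pd: plan_density k Q \<phi> CX CY r s "erot_plan c lam r s" y1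
  proof
    show "k x y \<le> Q * \<phi> y" "1 / (Q * \<phi> y) \<le> k x y" for x y using kb(1)[of x y] kb(2)[of y x] P by (auto simp: k_def)
    show "((\<lambda>y. k x y * pmf s y) has_sum 1) UNIV" "((\<lambda>x. k x y * pmf r x) has_sum 1) UNIV"
      "pmf (erot_plan c lam r s) (x, y) = k x y * pmf r x * pmf s y" for x y
      unfolding k_def using uv(5,6,7) by auto
  qed (use phi_ge Q_ge CX_ge CY_ge r y1 WYe in auto)
  have u_pos: "u x > 0" "v y > 0" for x y using kb(3)[of x] kb(4)[of y] P by auto
  \<comment> \<open>The three radii keep, in turn, the moments of \<open>\<phi>\<close>, the mass at
    \<open>y1\<close> and \<open>Psi\<close> under control.\<close>
  define \<delta> where "\<delta> = min (min 1 (pmf s y1 / 2)) (Psi s / 2)"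
  have \<delta>: "\<delta> > 0" using P y1 by (simp add: \<delta>_def pmf_positive)
  define S where "S = pd.S4 + 1"
  define e1 where "e1 = pmf s y1 / (2 * Q * \<phi> y1)"
  define C2 where "C2 = (Q + Q\<^sup>2 * S) / e1 * (Q * S) / e1"
  define C4 where "C4 = 2 * C2 + Q"
  define C5 where "C5 = Q * C4 + Q * C4\<^sup>2 * (S + 1)"
  define C6 where "C6 = (C5 + Q * C5 * pd.S4) / pd.eps"
  define E where "E = Q * C4\<^sup>2 + Q * C4 + Q * (2 * C6 + C5) + Q"
  have E0: "E \<ge> 0"
  proof -
    have a: "S \<ge> 0" "e1 \<ge> 0" "pd.S4 \<ge> 0" "pd.eps \<ge> 0" "Q \<ge> 0"
      using pd.S4_nonneg Q_ge ph0[of y1] pd.eps_pos by (auto simp: S_def e1_def)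
    then have "C2 \<ge> 0" by (simp add: C2_def)
    then have "C4 \<ge> 0" using a by (simp add: C4_def)
    then have "C5 \<ge> 0" using a by (simp add: C5_def)
    then have "C6 \<ge> 0" using a by (simp add: C6_def)
    then show ?thesis using \<open>C4 \<ge> 0\<close> \<open>C5 \<ge> 0\<close> a by (simp add: E_def)
  qed
  \<comment> \<open>\<open>U\<close> sums to at most \<open>SX + (SX + 1) + 1\<close>: the
    contributions of \<open>r\<close>, of \<open>r'\<close>, and of the perturbation divided by
    \<open>N\<close>. The same holds for \<open>V\<close>.\<close>
  define C0 where "C0 = 2 * E * ((2 * pd.SX + 2) * (2 * pd.SY + 2))"
  have C0: "C0 \<ge> 0" using E0 pd.SX_nonneg pd.SY_nonneg by (simp add: C0_def)
  show thesis
  proof (rule that[OF pd.plan_density_axioms \<delta> C0])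
    fix r' s' N
    assume supp: "set_pmf r' \<subseteq> set_pmf r" "set_pmf s' \<subseteq> set_pmf s"
      and r': "(\<lambda>x. CX x * pmf r' x) summable_on UNIV" and s': "(\<lambda>y. WY y * pmf s' y) summable_on UNIV"
      and N: "N = (\<Sum>\<^sub>\<infinity>x. CX x * \<bar>pmf r' x - pmf r x\<bar>) + (\<Sum>\<^sub>\<infinity>y. WY y * \<bar>pmf s' y - pmf s y\<bar>)" and small: "N \<le> \<delta>"
    define hX where "hX = (\<lambda>x. pmf r' x - pmf r x)"
    define hY where "hY = (\<lambda>y. pmf s' y - pmf s y)"
    have sX: "(\<lambda>x. CX x * \<bar>hX x\<bar>) summable_on UNIV"
      by (rule summable_on_abs_le[OF summable_on_add[OF r r']])
         (use WY_ge(5) in \<open>auto simp: hX_def abs_mult less_imp_le distrib_left[symmetric] abs_le_iff intro!: mult_left_mono add_increasing\<close>)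
    have sY: "(\<lambda>y. WY y * \<bar>hY y\<bar>) summable_on UNIV"
      by (rule summable_on_abs_le[OF summable_on_add[OF s s']])
         (use WY_ge(4) in \<open>auto simp: hY_def abs_mult less_imp_le distrib_left[symmetric] abs_le_iff intro!: mult_left_mono add_increasing\<close>)
    have NX0: "(\<Sum>\<^sub>\<infinity>x. CX x * \<bar>hX x\<bar>) \<ge> 0" by (rule infsum_nonneg) (simp add: WY_ge(5) less_imp_le)
    have NY0: "(\<Sum>\<^sub>\<infinity>y. WY y * \<bar>hY y\<bar>) \<ge> 0" by (rule infsum_nonneg) (simp add: WY_ge(4) less_imp_le)
    have N': "N = (\<Sum>\<^sub>\<infinity>x. CX x * \<bar>hX x\<bar>) + (\<Sum>\<^sub>\<infinity>y. WY y * \<bar>hY y\<bar>)" by (simp add: N hX_def hY_def)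
    have hl: "hX \<in> l1_set CX" "hY \<in> l1_set (\<lambda>y. CY y * \<phi> y ^ 4)"
      using sX sY by (auto simp: l1_set_def WY_def)
    show "(\<Sum>\<^sub>\<infinity>z. weight_sum CX CY z * \<bar>pmf (erot_plan c lam r' s') z - pmf (erot_plan c lam r s) z
        - plan_deriv r s (erot_plan c lam r s) \<phi> y1 (\<lambda>x. pmf r' x - pmf r x) (\<lambda>y. pmf s' y - pmf s y) z\<bar>) \<le> C0 * N\<^sup>2"
    proof (cases "N = 0")
      \<comment> \<open>The general estimate divides by \<open>N\<close>; for \<open>N = 0\<close>
        the marginals agree and both sides vanish.\<close>
      case True
      have zX: "hX x = 0" for x
      proof -
        have "CX x * \<bar>hX x\<bar> = 0"
          by (rule nonneg_infsum_le_0D[OF _ sX]) (use True N' NX0 NY0 WY_ge(5) in \<open>auto simp: less_imp_le\<close>)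
        then show ?thesis using WY_ge(5)[of x] by simp
      qed
      have zY: "hY y = 0" for y
      proof -
        have "WY y * \<bar>hY y\<bar> = 0"
          by (rule nonneg_infsum_le_0D[OF _ sY]) (use True N' NX0 NY0 WY_ge(4) in \<open>auto simp: less_imp_le\<close>)
        then show ?thesis using WY_ge(4)[of y] by simp
      qed
      have "r' = r" "s' = s" using zX zY by (auto intro!: pmf_eqI simp: hX_def hY_def)
      moreover have "pd.DD (\<lambda>x. 0) (\<lambda>y. 0) z = 0" for z
        using pd.deriv_lin[OF hl(1,1) hl(2,2), of 0 0 z] by simp
      ultimately show ?thesis by (simp add: True)
    next
      case False
      then have Npos: "N > 0" using N' NX0 NY0 by linarith
      have small': "N \<le> 1" "N \<le> pmf s y1 / 2" "N \<le> Psi s / 2" using small by (auto simp: \<delta>_def)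
      obtain u' v' where uv': "\<And>x. 1 / (B * Phi s') \<le> u' x" "\<And>x. u' x \<le> B / Psi s'" "\<And>y. 1 \<le> v' y" "\<And>y. v' y \<le> B * \<phi> y"
        "\<And>x. ((\<lambda>y. K x y * u' x * v' y * pmf s' y) has_sum 1) UNIV"
        "\<And>y. ((\<lambda>x. K x y * u' x * v' y * pmf r' x) has_sum 1) UNIV"
        "\<And>x y. pmf (erot_plan c lam r' s') (x, y) = K x y * u' x * v' y * pmf r' x * pmf s' y"
        and P': "Psi s' > 0" "Phi s' \<ge> 1"
        by (rule plan_potentials[OF r' s']) (rule that; assumption)
      have near: "\<bar>(\<Sum>\<^sub>\<infinity>y. f y * pmf s' y) - (\<Sum>\<^sub>\<infinity>y. f y * pmf s y)\<bar> \<le> N" if f: "\<And>y. \<bar>f y\<bar> \<le> WY y" for f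
      proof -
        have "(\<Sum>\<^sub>\<infinity>y. f y * pmf s' y) - (\<Sum>\<^sub>\<infinity>y. f y * pmf s y) = (\<Sum>\<^sub>\<infinity>y. f y * hY y)"
          unfolding hY_def right_diff_distrib
          by (rule infsum_diff_real[symmetric]) (intro summable_weaken[OF s'] summable_weaken[OF s] f)+
        moreover have "\<bar>\<Sum>\<^sub>\<infinity>y. f y * hY y\<bar> \<le> (\<Sum>\<^sub>\<infinity>y. WY y * \<bar>hY y\<bar>)"
          by (rule infsum_abs_le[OF sY]) (auto simp: abs_mult intro!: mult_right_mono f)
        ultimately show ?thesis using N' NX0 by linarith
      qed
      have "\<bar>Phi s' - Phi s\<bar> \<le> N" unfolding Phi_def
        by (rule near) (use WY_ge(1) ph0 in \<open>auto simp: less_imp_le\<close>)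
      moreover have "\<bar>Psi s' - Psi s\<bar> \<le> N"
      proof -
        have "\<bar>1 / \<phi> y\<bar> \<le> WY y" for y
          using phi_ge[of y] WY_ge(3)[of y] by (simp add: divide_le_eq) (smt (verit) mult_le_cancel_left1)
        from near[OF this] show ?thesis by (simp add: Psi_def)
      qed
      ultimately have pp: "Psi s / 2 \<le> Psi s'" "Phi s' \<le> Phi s + 1" using small' by linarith+
      note kb' = bounds[where u'=u' and v'=v' and Ph="Phi s'" and Ps="Psi s'", OF uv'(1-4) pp P'(2)]
      define k' where "k' x y = K x y * u' x * v' y" for x y
      \<comment> \<open>The two Schroedinger pairs are normalized separately, so their logarithms
        also differ by a constant. Moving it from \<open>\<beta>\<close> to \<open>\<alpha>\<close>
        achieves \<open>\<beta> y1 = 0\<close>.\<close>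
      define \<alpha> where "\<alpha> x = ln (u x) - ln (u' x) + (ln (v y1) - ln (v' y1))" for x
      define \<beta> where "\<beta> y = ln (v y) - ln (v' y) - (ln (v y1) - ln (v' y1))" for y
      have k'k: "k' x y = k x y * exp (- (\<alpha> x + \<beta> y))" for x y
      proof -
        have "- (\<alpha> x + \<beta> y) = (ln (u' x) + ln (v' y)) - (ln (u x) + ln (v y))" by (simp add: \<alpha>_def \<beta>_def)
        then have "exp (- (\<alpha> x + \<beta> y)) = u' x * v' y / (u x * v y)"
          using u_pos(1)[of x] u_pos(2)[of y] kb'(3)[of x] kb'(4)[of y] by (simp add: exp_diff exp_add)
        then show ?thesis using u_pos(1)[of x] u_pos(2)[of y] by (simp add: k_def k'_def)
      qed
      define M where "M = (\<bar>ln (1 / (B * Phi s))\<bar> + \<bar>ln (B / Psi s)\<bar>) + (\<bar>ln (1 / (B * Phi s'))\<bar> + \<bar>ln (B / Psi s')\<bar>) + \<bar>ln (v y1) - ln (v' y1)\<bar>"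
      have \<alpha>_bd: "\<bar>\<alpha> x\<bar> \<le> M" for x
      proof -
        have "ln (1 / (B * Phi s)) \<le> ln (u x)" "ln (u x) \<le> ln (B / Psi s)" "ln (1 / (B * Phi s')) \<le> ln (u' x)" "ln (u' x) \<le> ln (B / Psi s')"
          using uv(1,2)[of x] uv'(1,2)[of x] u_pos(1)[of x] kb'(3)[of x] P P' Bp by (simp_all add: ln_le_cancel_iff del: ln_div)
        then show ?thesis unfolding \<alpha>_def M_def by linarith
      qed
      define U where "U = (\<lambda>x. CX x * (pmf r x + pmf r' x + \<bar>hX x\<bar> / N))"
      define V where "V = (\<lambda>y. CY y * \<phi> y ^ 4 * (pmf s y + pmf s' y + \<bar>hY y\<bar> / N))"
      have pw: "pd.wsum (x, y) * \<bar>k' x y * pmf r' x * pmf s' y - pmf (erot_plan c lam r s) (x, y) - pd.DD hX hY (x, y)\<bar>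
          \<le> 2 * E * N\<^sup>2 * (U x * V y)" for x y
        by (rule pd.frechet_bound[where k'=k' and r'=r' and s'=s' and \<alpha>=\<alpha> and \<beta>=\<beta> and ?M0.0=M and hX=hX and hY=hY
            and N=N and S=S and ?e1.0=e1 and ?C2.0=C2 and ?C4.0=C4 and ?C5.0=C5 and ?C6.0=C6 and E=E and U=U and V=V])
           (use kb'(1,2) uv'(5,6) k'k \<alpha>_bd supp r' s' N' small' Npos in
            \<open>auto simp: k'_def \<beta>_def hX_def hY_def WY_def S_def e1_def C2_def C4_def C5_def C6_def E_def U_def V_def\<close>)
      have Us: "(U has_sum pd.SX + (\<Sum>\<^sub>\<infinity>x. CX x * pmf r' x) + (\<Sum>\<^sub>\<infinity>x. CX x * \<bar>hX x\<bar>) * (1 / N)) UNIV"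
      proof -
        have "((\<lambda>x. CX x * pmf r x + CX x * pmf r' x + CX x * \<bar>hX x\<bar> * (1 / N)) has_sum pd.SX + (\<Sum>\<^sub>\<infinity>x. CX x * pmf r' x) + (\<Sum>\<^sub>\<infinity>x. CX x * \<bar>hX x\<bar>) * (1 / N)) UNIV"
          unfolding pd.SX_def by (intro has_sum_add has_sum_cmult_left has_sum_infsum r r' sX)
        then show ?thesis by (simp add: U_def algebra_simps)
      qed
      have Vs: "(V has_sum pd.SY + (\<Sum>\<^sub>\<infinity>y. WY y * pmf s' y) + (\<Sum>\<^sub>\<infinity>y. WY y * \<bar>hY y\<bar>) * (1 / N)) UNIV"
      proof -
        have "((\<lambda>y. WY y * pmf s y + WY y * pmf s' y + WY y * \<bar>hY y\<bar> * (1 / N)) has_sum (\<Sum>\<^sub>\<infinity>y. WY y * pmf s y) + (\<Sum>\<^sub>\<infinity>y. WY y * pmf s' y) + (\<Sum>\<^sub>\<infinity>y. WY y * \<bar>hY y\<bar>) * (1 / N)) UNIV"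
          by (intro has_sum_add has_sum_cmult_left has_sum_infsum s s' sY)
        then show ?thesis by (simp add: V_def pd.SY_def WY_def algebra_simps)
      qed
      have Ule: "infsum U UNIV \<le> 2 * pd.SX + 2"
      proof -
        have "(\<Sum>\<^sub>\<infinity>x. CX x * pmf r' x) \<le> (\<Sum>\<^sub>\<infinity>x. CX x * pmf r x + CX x * \<bar>hX x\<bar>)"
          by (intro infsum_mono r' summable_on_add r sX)
             (use WY_ge(5) in \<open>auto simp: hX_def distrib_left[symmetric] less_imp_le intro!: mult_left_mono\<close>)
        also have "\<dots> = pd.SX + (\<Sum>\<^sub>\<infinity>x. CX x * \<bar>hX x\<bar>)" unfolding pd.SX_def by (rule infsum_add[OF r sX])
        finally have 1: "(\<Sum>\<^sub>\<infinity>x. CX x * pmf r' x) \<le> pd.SX + 1" using small' N' NY0 by linarith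
        have "(\<Sum>\<^sub>\<infinity>x. CX x * \<bar>hX x\<bar>) * (1 / N) \<le> 1" using Npos N' NY0 by (simp add: divide_le_eq)
        with 1 show ?thesis unfolding infsumI[OF Us] by linarith
      qed
      have Vle: "infsum V UNIV \<le> 2 * pd.SY + 2"
      proof -
        have "(\<Sum>\<^sub>\<infinity>y. WY y * pmf s' y) \<le> (\<Sum>\<^sub>\<infinity>y. WY y * pmf s y + WY y * \<bar>hY y\<bar>)"
          by (intro infsum_mono s' summable_on_add s sY)
             (use WY_ge(4) in \<open>auto simp: hY_def distrib_left[symmetric] less_imp_le intro!: mult_left_mono\<close>)
        also have "\<dots> = pd.SY + (\<Sum>\<^sub>\<infinity>y. WY y * \<bar>hY y\<bar>)" unfolding pd.SY_def WY_def[symmetric] by (rule infsum_add[OF s sY])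
        finally have 1: "(\<Sum>\<^sub>\<infinity>y. WY y * pmf s' y) \<le> pd.SY + 1" using small' N' NX0 by linarith
        have "(\<Sum>\<^sub>\<infinity>y. WY y * \<bar>hY y\<bar>) * (1 / N) \<le> 1" using Npos N' NX0 by (simp add: divide_le_eq)
        with 1 show ?thesis unfolding infsumI[OF Vs] by linarith
      qed
      have U0: "U x \<ge> 0" and V0: "V y \<ge> 0" for x y
        using WY_ge(4)[of y] WY_ge(5)[of x] Npos unfolding U_def V_def WY_def by (auto simp: less_imp_le)
      have UV: "((\<lambda>z. 2 * E * N\<^sup>2 * (case z of (x, y) \<Rightarrow> U x * V y)) has_sum 2 * E * N\<^sup>2 * (infsum U UNIV * infsum V UNIV)) UNIV"
        by (intro has_sum_cmult_right pd.infsum_prod_eq has_sum_imp_summable[OF Us] has_sum_imp_summable[OF Vs])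
      have "\<bar>\<Sum>\<^sub>\<infinity>z. weight_sum CX CY z * \<bar>pmf (erot_plan c lam r' s') z - pmf (erot_plan c lam r s) z - pd.DD hX hY z\<bar>\<bar>
          \<le> (\<Sum>\<^sub>\<infinity>z. 2 * E * N\<^sup>2 * (case z of (x, y) \<Rightarrow> U x * V y))"
      proof (rule infsum_abs_le[OF has_sum_imp_summable[OF UV]])
        fix z :: "'x \<times> 'y"
        obtain x y where z: "z = (x, y)" by (cases z)
        show "\<bar>weight_sum CX CY z * \<bar>pmf (erot_plan c lam r' s') z - pmf (erot_plan c lam r s) z - pd.DD hX hY z\<bar>\<bar> \<le> 2 * E * N\<^sup>2 * (case z of (x, y) \<Rightarrow> U x * V y)"
          using pw[of x y] pd.wsum_le(2)[of x y] uv'(7)[of x y]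
          by (simp add: z pd.wsum_def k'_def abs_mult)
      qed
      also have "\<dots> \<le> C0 * N\<^sup>2"
      proof -
        have "infsum U UNIV * infsum V UNIV \<le> (2 * pd.SX + 2) * (2 * pd.SY + 2)"
          using Ule Vle pd.SX_nonneg pd.SY_nonneg by (intro mult_mono infsum_nonneg V0) auto
        then have "2 * E * N\<^sup>2 * (infsum U UNIV * infsum V UNIV) \<le> 2 * E * N\<^sup>2 * ((2 * pd.SX + 2) * (2 * pd.SY + 2))"
          using E0 by (intro mult_left_mono) auto
        then show ?thesis unfolding infsumI[OF UV] by (simp add: C0_def mult_ac)
      qed
      finally show ?thesis by (simp add: hX_def hY_def)
    qed
  qed
qed

end

section \<open>The delta method\<close>

lemma sum_type_summable:
  fixes f :: "'a + 'b \<Rightarrow> real"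
  shows "f summable_on UNIV \<longleftrightarrow> (\<lambda>x. f (Inl x)) summable_on UNIV \<and> (\<lambda>y. f (Inr y)) summable_on UNIV"
    and "(\<lambda>x. f (Inl x)) summable_on UNIV \<Longrightarrow> (\<lambda>y. f (Inr y)) summable_on UNIV \<Longrightarrow>
      infsum f UNIV = (\<Sum>\<^sub>\<infinity>x. f (Inl x)) + (\<Sum>\<^sub>\<infinity>y. f (Inr y))"
proof -
  have l: "f summable_on range Inl \<longleftrightarrow> (\<lambda>x. f (Inl x)) summable_on UNIV"
    using summable_on_reindex[of Inl UNIV f] by (simp add: o_def)
  have r: "f summable_on range Inr \<longleftrightarrow> (\<lambda>x. f (Inr x)) summable_on UNIV"
    using summable_on_reindex[of Inr UNIV f] by (simp add: o_def)
  have d: "(range Inl :: ('a + 'b) set) \<inter> range Inr = {}" by auto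
  have U: "(UNIV :: ('a + 'b) set) = range Inl \<union> range Inr" by (rule UNIV_sum)
  show "f summable_on UNIV \<longleftrightarrow> (\<lambda>x. f (Inl x)) summable_on UNIV \<and> (\<lambda>y. f (Inr y)) summable_on UNIV"
  proof
    assume "f summable_on UNIV"
    then show "(\<lambda>x. f (Inl x)) summable_on UNIV \<and> (\<lambda>y. f (Inr y)) summable_on UNIV"
      using summable_on_subset_banach[of f UNIV "range Inl"] summable_on_subset_banach[of f UNIV "range Inr"] l r by auto
  next
    assume "(\<lambda>x. f (Inl x)) summable_on UNIV \<and> (\<lambda>y. f (Inr y)) summable_on UNIV"
    then show "f summable_on UNIV" unfolding U using l r d by (intro summable_on_Un_disjoint) auto
  qed
  assume "(\<lambda>x. f (Inl x)) summable_on UNIV" "(\<lambda>y. f (Inr y)) summable_on UNIV"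
  then have "infsum f (range Inl \<union> range Inr) = infsum f (range Inl) + infsum f (range Inr)"
    using l r d by (intro infsum_Un_disjoint) auto
  then show "infsum f UNIV = (\<Sum>\<^sub>\<infinity>x. f (Inl x)) + (\<Sum>\<^sub>\<infinity>y. f (Inr y))"
    unfolding U using infsum_reindex[of Inl UNIV f] infsum_reindex[of Inr UNIV f] by (simp add: o_def)
qed

lemma sum_sum_type:
  fixes f :: "'a + 'b \<Rightarrow> real"
  assumes "finite F"
  shows "sum f F = (\<Sum>x\<in>Inl -` F. f (Inl x)) + (\<Sum>y\<in>Inr -` F. f (Inr y))"
    "finite (Inl -` F)" "finite (Inr -` F)"
proof -
  show fin: "finite (Inl -` F)" "finite (Inr -` F)" using assms by (auto intro!: finite_vimageI)
  have "i \<in> F \<longleftrightarrow> i \<in> (Inl -` F) <+> (Inr -` F)" for i by (cases i) auto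
  then have "F = (Inl -` F) <+> (Inr -` F)" by blast
  then have "sum f F = sum f ((Inl -` F) <+> (Inr -` F))" by simp
  also have "\<dots> = (\<Sum>x\<in>Inl -` F. f (Inl x)) + (\<Sum>y\<in>Inr -` F. f (Inr y))"
    using fin by (simp add: sum.Plus o_def)
  finally show "sum f F = (\<Sum>x\<in>Inl -` F. f (Inl x)) + (\<Sum>y\<in>Inr -` F. f (Inr y))" .
qed

text \<open>On truncations the functional is a finite linear combination of coordinates, hence
  Gaussian. Truncations converge in norm and the functional is continuous, so
  \<open>gauss_limit\<close> applies.\<close>

lemma gauss_functional:
  fixes \<l> :: "('i::countable \<Rightarrow> real) \<Rightarrow> real"
  assumes N: "prob_space N" and w: "\<And>i. w i > 0" and l1: "\<And>\<omega>. \<omega> \<in> space N \<Longrightarrow> L \<omega> \<in> l1_set w"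
    and g: "\<And>F t. finite F \<Longrightarrow> \<exists>v. gauss N (\<lambda>\<omega>. \<Sum>i\<in>F. t i * L \<omega> i) v"
    and lin: "\<And>a b c d. a \<in> l1_set w \<Longrightarrow> b \<in> l1_set w \<Longrightarrow> \<l> (\<lambda>i. c * a i + d * b i) = c * \<l> a + d * \<l> b"
    and bd: "\<And>a. a \<in> l1_set w \<Longrightarrow> \<bar>\<l> a\<bar> \<le> C * (\<Sum>\<^sub>\<infinity>i. w i * \<bar>a i\<bar>)"
  shows "\<exists>v. gauss N (\<lambda>\<omega>. \<l> (L \<omega>)) v"
proof -
  define e where "e i = (\<lambda>j :: 'i. if j = i then 1 else 0 :: real)" for i
  have fin: "(\<lambda>i. if i \<in> F then a i else 0) \<in> l1_set w" if "finite F" for F and a :: "'i \<Rightarrow> real"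
    unfolding l1_set_def mem_Collect_eq
    by (rule finite_nonzero_values_imp_summable_on, rule finite_subset[OF _ that]) auto
  have e1: "e i \<in> l1_set w" for i using fin[of "{i}" "\<lambda>_. 1"] by (simp add: e_def)
  have trunc: "\<l> (\<lambda>i. if i \<in> F then a i else 0) = (\<Sum>i\<in>F. \<l> (e i) * a i)" if "finite F" for F a
    using that
  proof (induction F)
    case empty
    have "\<l> (\<lambda>i. 0) = 0" using lin[OF e1 e1, of 0 undefined 0 undefined] by simp
    then show ?case by simp
  next
    case (insert j F)
    have "(\<lambda>i. if i \<in> insert j F then a i else 0) = (\<lambda>i. 1 * (if i \<in> F then a i else 0) + a j * e j i)"
      using insert(2) by (auto simp: e_def fun_eq_iff)
    then have "\<l> (\<lambda>i. if i \<in> insert j F then a i else 0) = 1 * \<l> (\<lambda>i. if i \<in> F then a i else 0) + a j * \<l> (e j)"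
      using lin[OF fin[OF insert(1), of a] e1[of j], of 1 "a j"] by simp
    then show ?case using insert by simp
  qed
  have conv: "(\<lambda>n. \<Sum>i\<in>exhaust n. \<l> (e i) * a i) \<longlonglongrightarrow> \<l> a" if a: "a \<in> l1_set w" for a
  proof -
    have "(\<lambda>n. C * l1_dist w (\<lambda>i. if i \<in> exhaust n then a i else 0) a) \<longlonglongrightarrow> 0"
      by (rule tendsto_mult_right_zero[OF l1_truncation_tendsto[OF a]])
    moreover have "\<bar>(\<Sum>i\<in>exhaust n. \<l> (e i) * a i) - \<l> a\<bar> \<le> C * l1_dist w (\<lambda>i. if i \<in> exhaust n then a i else 0) a" for n
    proof -
      let ?T = "\<lambda>i. if i \<in> exhaust n then a i else 0"
      have T: "?T \<in> l1_set w" by (rule fin) simp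
      have "(\<lambda>i. w i * \<bar>?T i - a i\<bar>) summable_on UNIV" by (rule l1_set_diff[OF w T a])
      then have d: "(\<lambda>i. 1 * ?T i + (- 1) * a i) \<in> l1_set w" by (simp add: l1_set_def)
      have "(\<Sum>i\<in>exhaust n. \<l> (e i) * a i) - \<l> a = \<l> (\<lambda>i. 1 * ?T i + (- 1) * a i)"
        unfolding lin[OF T a] trunc[OF finite_exhaust] by simp
      then show ?thesis using bd[OF d] by (simp add: l1_dist_def)
    qed
    ultimately have "(\<lambda>n. (\<Sum>i\<in>exhaust n. \<l> (e i) * a i) - \<l> a) \<longlonglongrightarrow> 0"
      by (intro Lim_null_comparison[OF _ \<open>(\<lambda>n. C * l1_dist w (\<lambda>i. if i \<in> exhaust n then a i else 0) a) \<longlonglongrightarrow> 0\<close>]) (auto intro: always_eventually)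
    then show ?thesis by (rule LIM_zero_cancel)
  qed
  have "\<forall>n. \<exists>v. gauss N (\<lambda>\<omega>. \<Sum>i\<in>exhaust n. \<l> (e i) * L \<omega> i) v" using g by simp
  then obtain v where v: "\<And>n. gauss N (\<lambda>\<omega>. \<Sum>i\<in>exhaust n. \<l> (e i) * L \<omega> i) (v n)" by metis
  have lim: "(\<lambda>n. \<Sum>i\<in>exhaust n. \<l> (e i) * L \<omega> i) \<longlonglongrightarrow> \<l> (L \<omega>)" if "\<omega> \<in> space N" for \<omega>
    by (rule conv[OF l1[OF that]])
  have m: "(\<lambda>\<omega>. \<l> (L \<omega>)) \<in> borel_measurable N"
    by (rule borel_measurable_LIMSEQ_real[OF lim gauss_measurable[OF v]])
  show ?thesis
    by (rule gauss_limit[OF N v AE_I2[OF lim] m]) auto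
qed

context erot_setting begin

text \<open>A pair of perturbations of the two marginals is one sequence over the disjoint union of
  the index sets. The limit theory for a single sequence space then covers one and two samples
  alike.\<close>

definition W :: "'x + 'y \<Rightarrow> real" where "W = case_sum CX WY"

lemma W_simps [simp]: "W (Inl x) = CX x" "W (Inr y) = WY y" by (simp_all add: W_def)
lemma W_pos: "W i > 0" using WY_ge by (cases i) auto

lemma l1_W: "a \<in> l1_set W \<longleftrightarrow> (\<lambda>x. a (Inl x)) \<in> l1_set CX \<and> (\<lambda>y. a (Inr y)) \<in> l1_set WY"
  by (simp add: l1_set_def sum_type_summable(1))

definition Dop :: "'x pmf \<Rightarrow> 'y pmf \<Rightarrow> 'y \<Rightarrow> ('x + 'y \<Rightarrow> real) \<Rightarrow> 'x \<times> 'y \<Rightarrow> real" where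
  "Dop r s y1 a = plan_deriv r s (erot_plan c lam r s) \<phi> y1 (\<lambda>x. a (Inl x)) (\<lambda>y. a (Inr y))"

abbreviation "wsum \<equiv> weight_sum CX CY"

lemma wsum_pos: "wsum z > 0"
  using CX_ge[of "fst z"] CY_ge[of "snd z"] by (simp add: weight_sum_def case_prod_unfold)

lemma Dop_linear:
  assumes r: "(\<lambda>x. CX x * pmf r x) summable_on UNIV" and s: "(\<lambda>y. WY y * pmf s y) summable_on UNIV" and y1: "y1 \<in> set_pmf s"
  shows "a \<in> l1_set W \<Longrightarrow> b \<in> l1_set W \<Longrightarrow> Dop r s y1 (\<lambda>i. u * a i + v * b i) z = u * Dop r s y1 a z + v * Dop r s y1 b z"
    and "a \<in> l1_set W \<Longrightarrow> Dop r s y1 a \<in> l1_set wsum"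
    and "\<exists>C\<ge>0. \<forall>a\<in>l1_set W. (\<Sum>\<^sub>\<infinity>z. wsum z * \<bar>Dop r s y1 a z\<bar>) \<le> C * (\<Sum>\<^sub>\<infinity>i. W i * \<bar>a i\<bar>)"
proof -
  obtain k Q where "plan_density k Q \<phi> CX CY r s (erot_plan c lam r s) y1"
    using frechet_uniform[OF r s y1] by metis
  then interpret pd: plan_density k Q \<phi> CX CY r s "erot_plan c lam r s" y1 .
  have WYe: "(\<lambda>y. CY y * \<phi> y ^ 4) = WY" by (simp add: WY_def fun_eq_iff)
  show "Dop r s y1 (\<lambda>i. u * a i + v * b i) z = u * Dop r s y1 a z + v * Dop r s y1 b z" if "a \<in> l1_set W" "b \<in> l1_set W"
    unfolding Dop_def using that by (intro pd.deriv_lin) (auto simp: l1_W WYe)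
  show "Dop r s y1 a \<in> l1_set wsum" if "a \<in> l1_set W"
    unfolding Dop_def using that pd.deriv_bound(1) by (auto simp: l1_W WYe pd.wsum_def)
  have "(\<Sum>\<^sub>\<infinity>z. wsum z * \<bar>Dop r s y1 a z\<bar>) \<le> pd.cD * (\<Sum>\<^sub>\<infinity>i. W i * \<bar>a i\<bar>)" if a: "a \<in> l1_set W" for a
  proof -
    have "(\<Sum>\<^sub>\<infinity>i. W i * \<bar>a i\<bar>) = (\<Sum>\<^sub>\<infinity>x. CX x * \<bar>a (Inl x)\<bar>) + (\<Sum>\<^sub>\<infinity>y. WY y * \<bar>a (Inr y)\<bar>)"
      using a[unfolded l1_W] by (subst sum_type_summable(2)) (simp_all add: l1_set_def)
    then show ?thesis unfolding Dop_def using a pd.deriv_bound(2)[of "\<lambda>x. a (Inl x)" "\<lambda>y. a (Inr y)"]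
      by (simp add: l1_W WYe pd.wsum_def WY_def[symmetric])
  qed
  then show "\<exists>C\<ge>0. \<forall>a\<in>l1_set W. (\<Sum>\<^sub>\<infinity>z. wsum z * \<bar>Dop r s y1 a z\<bar>) \<le> C * (\<Sum>\<^sub>\<infinity>i. W i * \<bar>a i\<bar>)"
    using pd.cD_nonneg by blast
qed

end

locale erot_countable = erot_setting c lam cXm cXp cYm cYp L
  for c :: "'x::countable \<times> 'y::countable \<Rightarrow> real" and lam cXm cXp cYm cYp L +
  fixes r :: "'x pmf" and s :: "'y pmf" and y1 :: 'y
  assumes rsum: "(\<lambda>x. CX x * pmf r x) summable_on UNIV" and ssum: "(\<lambda>y. WY y * pmf s y) summable_on UNIV"
    and y1: "y1 \<in> set_pmf s"
begin

abbreviation "Dp \<equiv> Dop r s y1"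

lemma Dp_lipschitz: "\<exists>C\<ge>0. \<forall>a\<in>l1_set W. \<forall>b\<in>l1_set W. l1_dist wsum (Dp a) (Dp b) \<le> C * l1_dist W a b"
proof -
  obtain C where C: "C \<ge> 0" "\<And>a. a \<in> l1_set W \<Longrightarrow> (\<Sum>\<^sub>\<infinity>z. wsum z * \<bar>Dp a z\<bar>) \<le> C * (\<Sum>\<^sub>\<infinity>i. W i * \<bar>a i\<bar>)"
    using Dop_linear(3)[OF rsum ssum y1] by blast
  have "l1_dist wsum (Dp a) (Dp b) \<le> C * l1_dist W a b" if ab: "a \<in> l1_set W" "b \<in> l1_set W" for a b
  proof -
    have "(\<lambda>i. 1 * a i + (- 1) * b i) \<in> l1_set W"
      using l1_set_diff[OF W_pos ab] by (simp add: l1_set_def)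
    from C(2)[OF this] show ?thesis
      unfolding Dop_linear(1)[OF rsum ssum y1 ab] by (simp add: l1_dist_def)
  qed
  with C(1) show ?thesis by blast
qed

lemma Dp_functional:
  assumes N: "prob_space N" and l1: "\<And>\<omega>. \<omega> \<in> space N \<Longrightarrow> Lw \<omega> \<in> l1_set W"
    and g: "\<And>F t. finite F \<Longrightarrow> \<exists>v. gauss N (\<lambda>\<omega>. \<Sum>i\<in>F. t i * Lw \<omega> i) v" and F: "finite F"
  shows "\<exists>v. gauss N (\<lambda>\<omega>. \<Sum>z\<in>F. t z * Dp (Lw \<omega>) z) v"
proof -
  obtain C where C: "C \<ge> 0" "\<And>a. a \<in> l1_set W \<Longrightarrow> (\<Sum>\<^sub>\<infinity>z. wsum z * \<bar>Dp a z\<bar>) \<le> C * (\<Sum>\<^sub>\<infinity>i. W i * \<bar>a i\<bar>)"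
    using Dop_linear(3)[OF rsum ssum y1] by blast
  show ?thesis
  proof (rule gauss_functional[where \<l>="\<lambda>a. \<Sum>z\<in>F. t z * Dp a z" and C="(\<Sum>z\<in>F. \<bar>t z\<bar> / wsum z) * C", OF N W_pos l1 g])
    show "(\<Sum>z\<in>F. t z * Dp (\<lambda>i. u * a i + v * b i) z) = u * (\<Sum>z\<in>F. t z * Dp a z) + v * (\<Sum>z\<in>F. t z * Dp b z)"
      if "a \<in> l1_set W" "b \<in> l1_set W" for a b u v
      unfolding Dop_linear(1)[OF rsum ssum y1 that] by (simp add: sum_distrib_left sum.distrib[symmetric] algebra_simps)
    fix a assume a: "a \<in> l1_set W"
    let ?n = "\<Sum>\<^sub>\<infinity>i. W i * \<bar>a i\<bar>"
    have s: "(\<lambda>z. wsum z * \<bar>Dp a z\<bar>) summable_on UNIV" using Dop_linear(2)[OF rsum ssum y1 a] by (simp add: l1_set_def)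
    have "\<bar>t z * Dp a z\<bar> \<le> \<bar>t z\<bar> / wsum z * (C * ?n)" for z
    proof -
      have "infsum (\<lambda>z. wsum z * \<bar>Dp a z\<bar>) {z} \<le> (\<Sum>\<^sub>\<infinity>z. wsum z * \<bar>Dp a z\<bar>)"
        by (rule infsum_mono2) (use s wsum_pos in \<open>auto simp: less_imp_le\<close>)
      then have "wsum z * \<bar>Dp a z\<bar> \<le> C * ?n" using C(2)[OF a] by simp
      then have "\<bar>t z\<bar> / wsum z * (wsum z * \<bar>Dp a z\<bar>) \<le> \<bar>t z\<bar> / wsum z * (C * ?n)"
        using wsum_pos[of z] by (intro mult_left_mono) auto
      moreover have "wsum z \<noteq> 0" using wsum_pos[of z] by simp
      ultimately show ?thesis by (simp add: abs_mult)
    qed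
    then have "\<bar>\<Sum>z\<in>F. t z * Dp a z\<bar> \<le> (\<Sum>z\<in>F. \<bar>t z\<bar> / wsum z * (C * ?n))"
      by (intro order_trans[OF sum_abs] sum_mono)
    then show "\<bar>\<Sum>z\<in>F. t z * Dp a z\<bar> \<le> (\<Sum>z\<in>F. \<bar>t z\<bar> / wsum z) * C * ?n"
      by (simp add: sum_distrib_right mult.assoc)
  qed (use F in auto)
qed

text \<open>\<open>H\<close> is the rescaled error of the marginals, \<open>Z\<close> that of the
  plan. Near \<open>(r, s)\<close> they satisfy that \<open>Z\<close> differs from
  \<open>Dp H\<close> by at most \<open>C0 * (X k \<omega>)\<^sup>2 / \<rho> k\<close>, with
  \<open>X\<close> the norm of \<open>H\<close>; this is small while \<open>X\<close> stays below a
  fixed level, and larger values are rare since \<open>X\<close> has bounded expectation.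
  \<open>Dp H\<close> converges because test functions composed with \<open>Dp\<close> remain
  Lipschitz. The guard \<open>\<rho> k > 0\<close> sets aside empty samples, whose empirical measure
  is unspecified.\<close>

lemma plan_limit:
  fixes M :: "'w measure" and N :: "'g measure" and R :: "nat \<Rightarrow> 'w \<Rightarrow> 'x pmf" and S :: "nat \<Rightarrow> 'w \<Rightarrow> 'y pmf" and \<rho> :: "nat \<Rightarrow> real"
  defines "H \<equiv> \<lambda>k \<omega>. case_sum (\<lambda>x. \<rho> k * (pmf (R k \<omega>) x - pmf r x)) (\<lambda>y. \<rho> k * (pmf (S k \<omega>) y - pmf s y))"
    and "Z \<equiv> \<lambda>k \<omega> z. \<rho> k * (pmf (erot_plan c lam (R k \<omega>) (S k \<omega>)) z - pmf (erot_plan c lam r s) z)"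
  assumes \<rho>0: "\<And>k. \<rho> k \<ge> 0" and \<rho>: "filterlim \<rho> at_top sequentially"
    and good: "\<And>k \<omega>. \<omega> \<in> space M \<Longrightarrow> \<rho> k > 0 \<Longrightarrow>
      (\<lambda>x. CX x * pmf (R k \<omega>) x) summable_on UNIV \<and> (\<lambda>y. WY y * pmf (S k \<omega>) y) summable_on UNIV"
    and supp: "AE \<omega> in M. \<forall>k. \<rho> k > 0 \<longrightarrow> set_pmf (R k \<omega>) \<subseteq> set_pmf r \<and> set_pmf (S k \<omega>) \<subseteq> set_pmf s"
    and lrH: "\<And>k. l1_random M (H k) W v" and lrL: "l1_random N Lw W v"
    and cs: "\<And>F t b. finite F \<Longrightarrow>
      (\<lambda>k. \<integral>\<omega>. cos ((\<Sum>i\<in>F. t i * H k \<omega> i) + b) \<partial>M) \<longlonglongrightarrow> (\<integral>\<omega>. cos ((\<Sum>i\<in>F. t i * Lw \<omega> i) + b) \<partial>N)"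
    and Zm: "\<And>k z. (\<lambda>\<omega>. Z k \<omega> z) \<in> borel_measurable M"
    and gL: "\<And>F t. finite F \<Longrightarrow> \<exists>v. gauss N (\<lambda>\<omega>. \<Sum>i\<in>F. t i * Lw \<omega> i) v"
  shows "converges_in_distribution (l1_space wsum) M Z N (\<lambda>\<omega>. Dp (Lw \<omega>))"
    and "centered_gaussian (l1_space wsum) N (\<lambda>\<omega>. Dp (Lw \<omega>))"
proof -
  interpret L: l1_random N Lw W v by (rule lrL)
  interpret H: l1_random M "H k" W v for k by (rule lrH)
  note sp = l1_space_simps[of wsum, OF wsum_pos] and spW = l1_space_simps[of W, OF W_pos]
  interpret l1: Metric_space "l1_set wsum" "l1_dist wsum" by (rule Metric_space_l1[OF wsum_pos])
  have gD: "\<exists>v. gauss N (\<lambda>\<omega>. \<Sum>z\<in>F. t z * Dp (Lw \<omega>) z) v" if "finite F" for F t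
    by (rule Dp_functional[OF L.prob_space_axioms L.l1 gL that])
  have Dm: "(\<lambda>\<omega>. Dp (Lw \<omega>) z) \<in> borel_measurable N" for z
    using gD[of "{z}" "\<lambda>_. 1"] gauss_measurable by auto
  have Dl1: "Dp a \<in> l1_set wsum" if "a \<in> l1_set W" for a by (rule Dop_linear(2)[OF rsum ssum y1 that])
  have LD: "(\<lambda>\<omega>. Dp (Lw \<omega>)) \<in> N \<rightarrow>\<^sub>M borel_metric (l1_space wsum)"
    by (rule measurable_l1_space[OF wsum_pos Dl1[OF L.l1] Dm])
  show "centered_gaussian (l1_space wsum) N (\<lambda>\<omega>. Dp (Lw \<omega>))"
    unfolding centered_gaussian_def using LD gD centered_normal_iff[OF L.prob_space_axioms] by blast
  have Zl1: "Z k \<omega> \<in> l1_set wsum" if "\<omega> \<in> space M" for k \<omega>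
  proof (cases "\<rho> k > 0")
    case True
    have p: "pmf (erot_plan c lam (R k \<omega>) (S k \<omega>)) \<in> l1_set wsum" "pmf (erot_plan c lam r s) \<in> l1_set wsum"
      using plan_in_l1 good[OF that True] rsum ssum by blast+
    from l1_set_diff[OF wsum_pos p] have "(\<lambda>z. \<rho> k * (wsum z * \<bar>pmf (erot_plan c lam (R k \<omega>) (S k \<omega>)) z - pmf (erot_plan c lam r s) z\<bar>)) summable_on UNIV"
      by (rule summable_on_cmult_right)
    then show ?thesis using True by (simp add: Z_def l1_set_def abs_mult mult_ac)
  next
    case False
    then have "\<rho> k = 0" using \<rho>0[of k] by linarith
    then show ?thesis by (simp add: Z_def l1_set_def)
  qed
  have Zmeas: "Z k \<in> M \<rightarrow>\<^sub>M borel_metric (l1_space wsum)" for k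
    by (rule measurable_l1_space[OF wsum_pos Zl1 Zm])
  define X where "X k \<omega> = (\<Sum>\<^sub>\<infinity>i. W i * \<bar>H k \<omega> i\<bar>)" for k \<omega>
  define T where "T = (\<Sum>\<^sub>\<infinity>i. W i * sqrt (v i))"
  have X0: "X k \<omega> \<ge> 0" for k \<omega> unfolding X_def by (rule infsum_nonneg) (simp add: W_pos less_imp_le)
  have Xint: "integrable M (X k)" and XE: "H.expectation (X k) \<le> T" for k
    using H.expected_norm[of k] by (auto simp: X_def[abs_def] T_def)
  have T0: "T \<ge> 0" unfolding T_def by (rule infsum_nonneg) (simp add: W_pos less_imp_le L.v_nonneg)
  obtain k0 Q C0 \<delta> where \<delta>: "\<delta> > 0" and C0: "C0 \<ge> 0" and fre:
    "\<And>r' s' N. set_pmf r' \<subseteq> set_pmf r \<Longrightarrow> set_pmf s' \<subseteq> set_pmf s \<Longrightarrow>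
      (\<lambda>x. CX x * pmf r' x) summable_on UNIV \<Longrightarrow> (\<lambda>y. WY y * pmf s' y) summable_on UNIV \<Longrightarrow>
      N = (\<Sum>\<^sub>\<infinity>x. CX x * \<bar>pmf r' x - pmf r x\<bar>) + (\<Sum>\<^sub>\<infinity>y. WY y * \<bar>pmf s' y - pmf s y\<bar>) \<Longrightarrow> N \<le> \<delta> \<Longrightarrow>
      (\<Sum>\<^sub>\<infinity>z. wsum z * \<bar>pmf (erot_plan c lam r' s') z - pmf (erot_plan c lam r s) z
        - plan_deriv r s (erot_plan c lam r s) \<phi> y1 (\<lambda>x. pmf r' x - pmf r x) (\<lambda>y. pmf s' y - pmf s y) z\<bar>) \<le> C0 * N\<^sup>2"
    by (rule frechet_uniform[OF rsum ssum y1]) (rule that; assumption)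
  have near: "l1_dist wsum (Z k \<omega>) (Dp (H k \<omega>)) \<le> C0 * (X k \<omega>)\<^sup>2 / \<rho> k"
    if \<omega>: "\<omega> \<in> space M" and \<rho>k: "\<rho> k > 0" and sup: "set_pmf (R k \<omega>) \<subseteq> set_pmf r" "set_pmf (S k \<omega>) \<subseteq> set_pmf s"
      and small: "X k \<omega> / \<rho> k \<le> \<delta>" for k \<omega>
  proof -
    define h where "h = case_sum (\<lambda>x. pmf (R k \<omega>) x - pmf r x) (\<lambda>y. pmf (S k \<omega>) y - pmf s y)"
    have Hh: "H k \<omega> i = \<rho> k * h i" for i by (cases i) (simp_all add: H_def h_def)
    have Xh: "X k \<omega> = \<rho> k * (\<Sum>\<^sub>\<infinity>i. W i * \<bar>h i\<bar>)"
      unfolding X_def Hh infsum_cmult_right'[symmetric] using \<rho>k by (intro infsum_cong) (simp add: abs_mult)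
    have hl1: "h \<in> l1_set W"
    proof -
      have "(\<lambda>i. (1 / \<rho> k) * (W i * \<bar>H k \<omega> i\<bar>)) summable_on UNIV"
        using H.l1[OF \<omega>, of k] by (intro summable_on_cmult_right) (simp add: l1_set_def)
      then show ?thesis using \<rho>k by (simp add: l1_set_def Hh abs_mult)
    qed
    let ?N = "\<Sum>\<^sub>\<infinity>i. W i * \<bar>h i\<bar>"
    have N: "?N = (\<Sum>\<^sub>\<infinity>x. CX x * \<bar>pmf (R k \<omega>) x - pmf r x\<bar>) + (\<Sum>\<^sub>\<infinity>y. WY y * \<bar>pmf (S k \<omega>) y - pmf s y\<bar>)"
      using hl1[unfolded l1_W] by (subst sum_type_summable(2)) (simp_all add: l1_set_def h_def)
    have "?N \<le> \<delta>" using small Xh \<rho>k by simp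
    from fre[OF sup conjunct1[OF good[OF \<omega> \<rho>k]] conjunct2[OF good[OF \<omega> \<rho>k]] N this]
    have f: "(\<Sum>\<^sub>\<infinity>z. wsum z * \<bar>pmf (erot_plan c lam (R k \<omega>) (S k \<omega>)) z - pmf (erot_plan c lam r s) z - Dp h z\<bar>) \<le> C0 * ?N\<^sup>2"
      by (simp add: Dop_def h_def)
    have DH: "Dp (H k \<omega>) z = \<rho> k * Dp h z" for z
      using Dop_linear(1)[OF rsum ssum y1 hl1 hl1, of "\<rho> k" 0 z] by (simp add: Hh[abs_def])
    have "l1_dist wsum (Z k \<omega>) (Dp (H k \<omega>)) = \<rho> k * (\<Sum>\<^sub>\<infinity>z. wsum z * \<bar>pmf (erot_plan c lam (R k \<omega>) (S k \<omega>)) z - pmf (erot_plan c lam r s) z - Dp h z\<bar>)"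
      unfolding l1_dist_def infsum_cmult_right'[symmetric] DH Z_def right_diff_distrib[symmetric]
      using \<rho>k by (intro infsum_cong) (simp add: abs_mult)
    also have "\<dots> \<le> \<rho> k * (C0 * ?N\<^sup>2)" using f \<rho>k by (intro mult_left_mono) auto
    also have "\<dots> = C0 * (X k \<omega>)\<^sup>2 / \<rho> k" using \<rho>k by (simp add: Xh power2_eq_square)
    finally show ?thesis .
  qed
  show "converges_in_distribution (l1_space wsum) M Z N (\<lambda>\<omega>. Dp (Lw \<omega>))"
  proof (rule converges_in_distributionI[OF H.prob_space_axioms L.prob_space_axioms Zmeas LD])
    fix g :: "('x \<times> 'y \<Rightarrow> real) \<Rightarrow> real" and Bg Cg
    assume gB0: "\<And>a. a \<in> mspace (l1_space wsum) \<Longrightarrow> \<bar>g a\<bar> \<le> Bg"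
      and gC0: "\<And>a b. a \<in> mspace (l1_space wsum) \<Longrightarrow> b \<in> mspace (l1_space wsum) \<Longrightarrow> \<bar>g a - g b\<bar> \<le> Cg * mdist (l1_space wsum) a b"
    have gB: "\<bar>g a\<bar> \<le> Bg" if "a \<in> l1_set wsum" for a using gB0 that by (simp add: sp)
    define C where "C = max Cg 0"
    have gC: "\<bar>g a - g b\<bar> \<le> C * l1_dist wsum a b" if "a \<in> l1_set wsum" "b \<in> l1_set wsum" for a b
      using gC0[of a b] that mult_right_mono[of Cg C "l1_dist wsum a b"] l1.nonneg[of a b] by (simp add: sp C_def)
    have C: "C \<ge> 0" by (simp add: C_def)
    have "\<bar>g (Dp (\<lambda>_. 0))\<bar> \<le> Bg" by (rule gB[OF Dl1]) (simp add: l1_set_def)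
    then have Bg: "Bg \<ge> 0" by linarith
    obtain CD where CD: "CD \<ge> 0" "\<And>a b. a \<in> l1_set W \<Longrightarrow> b \<in> l1_set W \<Longrightarrow> l1_dist wsum (Dp a) (Dp b) \<le> CD * l1_dist W a b"
      using Dp_lipschitz by blast
    have g'C: "\<bar>g (Dp a) - g (Dp b)\<bar> \<le> (C * CD) * l1_dist W a b" if "a \<in> l1_set W" "b \<in> l1_set W" for a b
      using gC[OF Dl1[OF that(1)] Dl1[OF that(2)]] mult_left_mono[OF CD(2)[OF that] C] by (simp add: mult.assoc)
    have main: "(\<lambda>k. \<integral>\<omega>. g (Dp (H k \<omega>)) \<partial>M) \<longlonglongrightarrow> (\<integral>\<omega>. g (Dp (Lw \<omega>)) \<partial>N)"
      by (rule clt_lipschitz[where g="\<lambda>a. g (Dp a)", OF lrH lrL cs gB[OF Dl1] g'C])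
    have gm: "g \<in> borel_measurable (borel_metric (l1_space wsum))"
      by (rule lipschitz_borel_measurable[of _ _ C]) (use gC in \<open>simp add: sp\<close>)
    have g'm: "(\<lambda>a. g (Dp a)) \<in> borel_measurable (borel_metric (l1_space W))"
      by (rule lipschitz_borel_measurable[of _ _ "C * CD"]) (use g'C in \<open>simp add: spW\<close>)
    have i1: "integrable M (\<lambda>\<omega>. g (Z k \<omega>))" for k
      by (rule H.integrable_const_bound[of _ Bg]) (auto intro!: AE_I2 gB Zl1 measurable_compose[OF Zmeas gm])
    have i2: "integrable M (\<lambda>\<omega>. g (Dp (H k \<omega>)))" for k
      by (rule H.integrable_const_bound[of _ Bg]) (auto intro!: AE_I2 gB Dl1 H.l1 measurable_compose[OF H.meas g'm])
    have bound: "\<bar>(\<integral>\<omega>. g (Z k \<omega>) \<partial>M) - (\<integral>\<omega>. g (Dp (H k \<omega>)) \<partial>M)\<bar> \<le> C * (C0 * A\<^sup>2 / \<rho> k) + 2 * Bg * (T / A)"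
      if A: "A > 0" and \<rho>k: "\<rho> k > 0" and small: "A / \<rho> k \<le> \<delta>" for k A
    proof -
      \<comment> \<open>If the norm is at most \<open>A\<close>, the remainder bound applies.
        Otherwise \<open>X k \<omega> / A\<close> exceeds \<open>1\<close>, so the trivial bound
        \<open>2 * Bg\<close> may be multiplied by it; this is Markov's inequality built into the
        integrand.\<close>
      have "AE \<omega> in M. \<bar>g (Z k \<omega>) - g (Dp (H k \<omega>))\<bar> \<le> C * (C0 * A\<^sup>2 / \<rho> k) + 2 * Bg * (X k \<omega> / A)"
        using supp AE_space
      proof eventually_elim
        case (elim \<omega>)
        have nn: "0 \<le> C * (C0 * A\<^sup>2 / \<rho> k)" "0 \<le> 2 * Bg * (X k \<omega> / A)"
          using C C0 \<rho>k Bg X0[of k \<omega>] A by auto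
        show ?case
        proof (cases "X k \<omega> \<le> A")
          case True
          have "X k \<omega> / \<rho> k \<le> A / \<rho> k" using True \<rho>k by (intro divide_right_mono) auto
          then have "l1_dist wsum (Z k \<omega>) (Dp (H k \<omega>)) \<le> C0 * (X k \<omega>)\<^sup>2 / \<rho> k"
            using near[OF elim(2) \<rho>k] elim(1) \<rho>k small by auto
          also have "\<dots> \<le> C0 * A\<^sup>2 / \<rho> k"
            using True X0[of k \<omega>] \<rho>k C0 by (intro divide_right_mono mult_left_mono power_mono) auto
          finally have "C * l1_dist wsum (Z k \<omega>) (Dp (H k \<omega>)) \<le> C * (C0 * A\<^sup>2 / \<rho> k)"
            by (intro mult_left_mono C)
          then show ?thesis using gC[OF Zl1[OF elim(2)] Dl1[OF H.l1[OF elim(2)]], of k k] nn by linarith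
        next
          case False
          then have "1 \<le> X k \<omega> / A" using A by simp
          then have "2 * Bg \<le> 2 * Bg * (X k \<omega> / A)" using mult_left_mono[of 1 "X k \<omega> / A" "2 * Bg"] Bg by simp
          then show ?thesis using gB[OF Zl1[OF elim(2), of k]] gB[OF Dl1[OF H.l1[OF elim(2), of k]]] nn by linarith
        qed
      qed
      then have "H.expectation (\<lambda>\<omega>. \<bar>g (Z k \<omega>) - g (Dp (H k \<omega>))\<bar>) \<le> H.expectation (\<lambda>\<omega>. C * (C0 * A\<^sup>2 / \<rho> k) + 2 * Bg * (X k \<omega> / A))"
        using i1 i2 Xint by (intro integral_mono_AE) auto
      also have "\<dots> = C * (C0 * A\<^sup>2 / \<rho> k) + 2 * Bg * (H.expectation (X k) / A)"
        using Xint by (simp add: H.prob_space)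
      also have "\<dots> \<le> C * (C0 * A\<^sup>2 / \<rho> k) + 2 * Bg * (T / A)"
        using XE[of k] A Bg by (intro add_left_mono mult_left_mono divide_right_mono) auto
      finally have "H.expectation (\<lambda>\<omega>. \<bar>g (Z k \<omega>) - g (Dp (H k \<omega>))\<bar>) \<le> C * (C0 * A\<^sup>2 / \<rho> k) + 2 * Bg * (T / A)" .
      moreover have "\<bar>(\<integral>\<omega>. g (Z k \<omega>) \<partial>M) - (\<integral>\<omega>. g (Dp (H k \<omega>)) \<partial>M)\<bar> \<le> H.expectation (\<lambda>\<omega>. \<bar>g (Z k \<omega>) - g (Dp (H k \<omega>))\<bar>)"
        using integral_abs_bound[of M "\<lambda>\<omega>. g (Z k \<omega>) - g (Dp (H k \<omega>))"] i1 i2 by simp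
      ultimately show ?thesis by linarith
    qed
    have "(\<lambda>k. (\<integral>\<omega>. g (Z k \<omega>) \<partial>M) - (\<integral>\<omega>. g (Dp (H k \<omega>)) \<partial>M)) \<longlonglongrightarrow> 0"
    proof (rule LIMSEQ_I)
      fix e :: real assume e: "e > 0"
      \<comment> \<open>First \<open>A\<close> is fixed so that large norms cost at most
        \<open>e / 2\<close>; then \<open>K\<close> is chosen so that for
        \<open>\<rho> k \<ge> K\<close> the quotient \<open>A / \<rho> k\<close> lies within the
        radius \<open>\<delta>\<close> and the remainder costs at most \<open>e / 4\<close>.\<close>
      define A where "A = 4 * Bg * (T + 1) / e + 1"
      have A: "A > 0" using Bg T0 e by (simp add: A_def add_nonneg_pos)
      have small: "2 * Bg * (T / A) < e / 2 + e / 4"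
      proof -
        have "4 * Bg * T \<le> e * A"
        proof -
          have "e * A = 4 * Bg * (T + 1) + e" using e by (simp add: A_def distrib_left add_divide_distrib)
          then show ?thesis using Bg e by (simp add: distrib_left)
        qed
        then have "2 * Bg * (T / A) \<le> e / 2" using A by (simp add: divide_le_eq)
        then show ?thesis using e by linarith
      qed
      define K where "K = max (A / \<delta>) (4 * (C * (C0 * A\<^sup>2) + 1) / e) + 1"
      have "\<forall>\<^sub>F k in sequentially. \<rho> k \<ge> K" using \<rho> by (simp add: filterlim_at_top)
      then obtain k1 where k1: "\<And>k. k \<ge> k1 \<Longrightarrow> \<rho> k \<ge> K" unfolding eventually_sequentially by blast
      have "norm ((\<integral>\<omega>. g (Z k \<omega>) \<partial>M) - (\<integral>\<omega>. g (Dp (H k \<omega>)) \<partial>M) - 0) < e" if "k \<ge> k1" for k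
      proof -
        have rk: "\<rho> k \<ge> A / \<delta>" "\<rho> k \<ge> 4 * (C * (C0 * A\<^sup>2) + 1) / e" "\<rho> k > 0"
          using k1[OF that] divide_pos_pos[OF A \<delta>] by (auto simp: K_def)
        have "A / \<rho> k \<le> \<delta>" using rk \<delta> by (simp add: field_simps)
        from bound[OF A rk(3) this]
        have "\<bar>(\<integral>\<omega>. g (Z k \<omega>) \<partial>M) - (\<integral>\<omega>. g (Dp (H k \<omega>)) \<partial>M)\<bar> \<le> C * (C0 * A\<^sup>2 / \<rho> k) + 2 * Bg * (T / A)" .
        moreover have "C * (C0 * A\<^sup>2 / \<rho> k) \<le> e / 4"
        proof -
          have "4 * (C * (C0 * A\<^sup>2) + 1) \<le> \<rho> k * e" using rk(2) e by (simp add: divide_le_eq)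
          then have "C * (C0 * A\<^sup>2) \<le> e / 4 * \<rho> k" by (simp add: field_simps)
          then show ?thesis using rk(3) by (simp add: divide_le_eq)
        qed
        ultimately show ?thesis using small unfolding real_norm_def diff_0_right by linarith
      qed
      then show "\<exists>no. \<forall>k\<ge>no. norm ((\<integral>\<omega>. g (Z k \<omega>) \<partial>M) - (\<integral>\<omega>. g (Dp (H k \<omega>)) \<partial>M) - 0) < e" by blast
    qed
    from tendsto_add[OF this main] show "(\<lambda>k. \<integral>\<omega>. g (Z k \<omega>) \<partial>M) \<longlonglongrightarrow> (\<integral>\<omega>. g (Dp (Lw \<omega>)) \<partial>N)" by simp
  qed
qed

end

section \<open>Independence and transfer of limit processes\<close>

text \<open>Composition with a measurable function generates a smaller sigma-algebra, and
  independence passes to subfamilies.\<close>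

lemma indep_elements_compose:
  fixes f :: "'u \<Rightarrow> real" and g :: "'v \<Rightarrow> real"
  assumes M: "prob_space M" and UV: "indep_elements M S U T V"
    and f: "f \<in> borel_measurable S" and g: "g \<in> borel_measurable T"
  shows "prob_space.indep_var M borel (\<lambda>\<omega>. f (U \<omega>)) borel (\<lambda>\<omega>. g (V \<omega>))"
proof -
  interpret prob_space M by fact
  have U: "U \<in> M \<rightarrow>\<^sub>M S" and V: "V \<in> M \<rightarrow>\<^sub>M T" using UV by (simp_all add: indep_elements_def)
  have sub: "sigma_sets (space M) {(\<lambda>\<omega>. h (Q \<omega>)) -` A \<inter> space M | A. A \<in> sets borel}
      \<subseteq> sigma_sets (space M) {Q -` A \<inter> space M | A. A \<in> sets R}"
    if Q: "Q \<in> M \<rightarrow>\<^sub>M R" and h: "h \<in> borel_measurable R" for Q and R :: "'z measure" and h :: "'z \<Rightarrow> real"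
  proof (rule sigma_sets_mono, rule subsetI)
    fix B assume "B \<in> {(\<lambda>\<omega>. h (Q \<omega>)) -` A \<inter> space M | A. A \<in> sets borel}"
    then obtain A where A: "A \<in> sets borel" "B = (\<lambda>\<omega>. h (Q \<omega>)) -` A \<inter> space M" by blast
    have "B = Q -` (h -` A \<inter> space R) \<inter> space M" using measurable_space[OF Q] A(2) by auto
    then show "B \<in> sigma_sets (space M) {Q -` A \<inter> space M | A. A \<in> sets R}"
      using measurable_sets[OF h A(1)] by (intro sigma_sets.Basic) blast
  qed
  have "indep_set (sigma_sets (space M) {U -` A \<inter> space M | A. A \<in> sets S})
      (sigma_sets (space M) {V -` B \<inter> space M | B. B \<in> sets T})"
    using UV by (simp add: indep_elements_def)
  then have "indep_set (sigma_sets (space M) {(\<lambda>\<omega>. f (U \<omega>)) -` A \<inter> space M | A. A \<in> sets borel})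
      (sigma_sets (space M) {(\<lambda>\<omega>. g (V \<omega>)) -` A \<inter> space M | A. A \<in> sets borel})"
    using sub[OF U f] sub[OF V g] unfolding indep_sets2_eq by (meson subset_iff)
  then show ?thesis
    unfolding indep_var_eq using measurable_compose[OF U f] measurable_compose[OF V g] by blast
qed

lemma distr_pair_snd:
  assumes "prob_space M" "prob_space N"
  shows "distr (M \<Otimes>\<^sub>M N) N snd = N"
proof -
  interpret pair_prob_space M N using assms by (simp add: pair_prob_space_def pair_sigma_finite_def prob_space_imp_sigma_finite)
  have "distr (M \<Otimes>\<^sub>M N) N snd = distr (distr (N \<Otimes>\<^sub>M M) (M \<Otimes>\<^sub>M N) (\<lambda>(x, y). (y, x))) N snd"
    using distr_pair_swap by simp
  also have "\<dots> = distr (N \<Otimes>\<^sub>M M) N fst" by (subst distr_distr) (auto simp: o_def case_prod_unfold)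
  also have "\<dots> = N" by (rule prob_space.distr_pair_fst[OF assms(1)])
  finally show ?thesis .
qed

lemma indep_elements_pair:
  assumes M: "prob_space M" and N: "prob_space N" and U: "U \<in> M \<rightarrow>\<^sub>M S" and V: "V \<in> N \<rightarrow>\<^sub>M T"
  shows "indep_elements (M \<Otimes>\<^sub>M N) S (\<lambda>\<omega>. U (fst \<omega>)) T (\<lambda>\<omega>. V (snd \<omega>))"
proof -
  interpret M: prob_space M by fact
  interpret N: prob_space N by fact
  interpret pair_prob_space M N by unfold_locales
  have U': "(\<lambda>\<omega>. U (fst \<omega>)) \<in> M \<Otimes>\<^sub>M N \<rightarrow>\<^sub>M S" and V': "(\<lambda>\<omega>. V (snd \<omega>)) \<in> M \<Otimes>\<^sub>M N \<rightarrow>\<^sub>M T"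
    by (rule measurable_compose[OF measurable_fst U] measurable_compose[OF measurable_snd V])+
  have st: "Int_stable {Q -` A \<inter> \<Omega> | A. A \<in> sets R}" for Q and R :: "'z measure" and \<Omega> :: "('m \<times> 'n) set"
    unfolding Int_stable_def
  proof safe
    fix A B assume "A \<in> sets R" "B \<in> sets R"
    then show "\<exists>C. (Q -` A \<inter> \<Omega>) \<inter> (Q -` B \<inter> \<Omega>) = Q -` C \<inter> \<Omega> \<and> C \<in> sets R"
      by (intro exI[of _ "A \<inter> B"]) auto
  qed
  have "prob ((\<lambda>\<omega>. U (fst \<omega>)) -` A \<inter> space (M \<Otimes>\<^sub>M N) \<inter> ((\<lambda>\<omega>. V (snd \<omega>)) -` B \<inter> space (M \<Otimes>\<^sub>M N)))
      = prob ((\<lambda>\<omega>. U (fst \<omega>)) -` A \<inter> space (M \<Otimes>\<^sub>M N)) * prob ((\<lambda>\<omega>. V (snd \<omega>)) -` B \<inter> space (M \<Otimes>\<^sub>M N))"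
    if AB: "A \<in> sets S" "B \<in> sets T" for A B
  proof -
    let ?A = "U -` A \<inter> space M" and ?B = "V -` B \<inter> space N"
    have s: "?A \<in> sets M" "?B \<in> sets N" using measurable_sets[OF U AB(1)] measurable_sets[OF V AB(2)] .
    have t: "measure (M \<Otimes>\<^sub>M N) (C \<times> D) = measure M C * measure N D" if "C \<in> sets M" "D \<in> sets N" for C D
      using that by (simp add: measure_def N.emeasure_pair_measure_Times enn2real_mult)
    have "(\<lambda>\<omega>. U (fst \<omega>)) -` A \<inter> space (M \<Otimes>\<^sub>M N) = ?A \<times> space N"
      "(\<lambda>\<omega>. V (snd \<omega>)) -` B \<inter> space (M \<Otimes>\<^sub>M N) = space M \<times> ?B"
      "(?A \<times> space N) \<inter> (space M \<times> ?B) = ?A \<times> ?B"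
      by (auto simp: space_pair_measure)
    then show ?thesis using s by (simp add: t M.prob_space N.prob_space)
  qed
  then have "indep_set {(\<lambda>\<omega>. U (fst \<omega>)) -` A \<inter> space (M \<Otimes>\<^sub>M N) | A. A \<in> sets S}
      {(\<lambda>\<omega>. V (snd \<omega>)) -` B \<inter> space (M \<Otimes>\<^sub>M N) | B. B \<in> sets T}"
    using measurable_sets[OF U'] measurable_sets[OF V'] by (intro indep_setI) blast+
  from indep_set_sigma_sets[OF this st st] U' V' show ?thesis by (simp add: indep_elements_def)
qed

lemma limit_process_l1:
  assumes lp: "limit_process f p N G" and f: "\<And>x. f x > 0"
  shows "\<omega> \<in> space N \<Longrightarrow> G \<omega> \<in> l1_set f" "(\<lambda>\<omega>. G \<omega> x) \<in> borel_measurable N"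
  using lp measurable_l1_coordinate[of f G N, OF f] by (auto simp: limit_process_def centered_gaussian_def)

lemma limit_process_moment:
  assumes lp: "limit_process f p N G" and f: "\<And>x. f x > 0"
  shows "moment_bounded N G (pmf p)"
  unfolding moment_bounded_def
proof (intro allI conjI)
  fix x
  interpret prob_space N using lp by (simp add: limit_process_def)
  have g: "gauss N (\<lambda>\<omega>. G \<omega> x) (multi_var p {x} (\<lambda>_. 1))"
    using limit_process_gauss[OF lp, of "{x}" "\<lambda>_. 1"] by simp
  show "(\<lambda>\<omega>. G \<omega> x) \<in> borel_measurable N" by (rule limit_process_l1(2)[OF lp f])
  show "integrable N (\<lambda>\<omega>. (G \<omega> x)\<^sup>2)" by (rule gauss_moments(1)[OF prob_space_axioms g])
  show "(\<integral>\<omega>. (G \<omega> x)\<^sup>2 \<partial>N) \<le> pmf p x"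
    unfolding gauss_moments(2)[OF prob_space_axioms g] by (simp add: multi_var_def)
qed

text \<open>Every defining property depends on the law only, so it survives composition with a
  measure preserving map. This carries processes to a product space, where they become
  independent.\<close>

lemma limit_process_distr:
  fixes G :: "'g \<Rightarrow> 'x::countable \<Rightarrow> real"
  assumes lp: "limit_process f p N G" and f: "\<And>x. f x > 0"
    and T: "T \<in> N' \<rightarrow>\<^sub>M N" and d: "distr N' N T = N" and N': "prob_space N'"
  shows "limit_process f p N' (\<lambda>\<omega>. G (T \<omega>))"
proof -
  have G: "G \<in> N \<rightarrow>\<^sub>M borel_metric (l1_space f)" using lp by (simp add: limit_process_def centered_gaussian_def)
  note m = limit_process_l1(2)[OF lp f]
  have int: "(\<integral>\<omega>. h (T \<omega>) \<partial>N') = (\<integral>\<omega>. h \<omega> \<partial>N)" if "h \<in> borel_measurable N" for h :: "'g \<Rightarrow> real"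
    using integral_distr[OF T that] d by simp
  have dis: "distr N' borel (\<lambda>\<omega>. h (T \<omega>)) = distr N borel h" if "h \<in> borel_measurable N" for h :: "'g \<Rightarrow> real"
    using distr_distr[OF that T] d by (simp add: o_def)
  have cn: "centered_normal N (\<lambda>\<omega>. \<Sum>z\<in>F. t z * G \<omega> z)" if "finite F" for F t
    using lp that by (simp add: limit_process_def centered_gaussian_def)
  have cn': "centered_normal N' (\<lambda>\<omega>. \<Sum>z\<in>F. t z * G (T \<omega>) z)" if "finite F" for F t
  proof -
    have "(\<lambda>\<omega>. \<Sum>z\<in>F. t z * G \<omega> z) \<in> borel_measurable N" using cn[OF that] by (simp add: centered_normal_def)
    from dis[OF this] measurable_compose[OF T this] cn[OF that, of t] show ?thesis
      by (simp add: centered_normal_def)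
  qed
  have cov: "covariance_fun N' (\<lambda>\<omega>. G (T \<omega>)) = covariance_fun N G"
    unfolding covariance_fun_def int[OF m] fun_eq_iff
    by (intro allI int borel_measurable_times borel_measurable_diff m borel_measurable_const)
  have tight: "tight_element (l1_space f) N' (\<lambda>\<omega>. G (T \<omega>))"
    unfolding tight_element_def
  proof (intro allI impI)
    fix e :: real assume "e > 0"
    then obtain K where K: "compactin (mtopology_of (l1_space f)) K" "measure N {\<omega> \<in> space N. G \<omega> \<in> K} \<ge> 1 - e"
      using lp by (auto simp: limit_process_def tight_element_def)
    \<comment> \<open>Probabilities are transported for measurable sets only; compact sets are
      closed, hence Borel.\<close>
    have "closedin (mtopology_of (l1_space f)) K"
      by (rule compactin_imp_closedin[OF _ K(1)]) (simp add: mtopology_of_def Metric_space.Hausdorff_space_mtopology)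
    then have "openin (mtopology_of (l1_space f)) (mspace (l1_space f) - K)" "K \<subseteq> mspace (l1_space f)"
      by (auto simp: closedin_def)
    then have "mspace (l1_space f) - (mspace (l1_space f) - K) \<in> sets (borel_metric (l1_space f))"
      unfolding sets_borel_metric by (intro sigma_sets.Compl sigma_sets.Basic) simp
    then have "K \<in> sets (borel_metric (l1_space f))"
      using \<open>K \<subseteq> mspace (l1_space f)\<close> by (simp add: double_diff)
    from measurable_sets[OF G this] have s: "G -` K \<inter> space N \<in> sets N" .
    have "measure N (G -` K \<inter> space N) = measure N' (T -` (G -` K \<inter> space N) \<inter> space N')"
      using measure_distr[OF T s] d by simp
    moreover have "T -` (G -` K \<inter> space N) \<inter> space N' = {\<omega> \<in> space N'. G (T \<omega>) \<in> K}"
      using measurable_space[OF T] by auto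
    moreover have "G -` K \<inter> space N = {\<omega> \<in> space N. G \<omega> \<in> K}" by auto
    ultimately show "\<exists>K. compactin (mtopology_of (l1_space f)) K \<and> measure N' {\<omega> \<in> space N'. G (T \<omega>) \<in> K} \<ge> 1 - e"
      using K by auto
  qed
  show ?thesis
    unfolding limit_process_def centered_gaussian_def
    using N' measurable_compose[OF T G] cn' tight cov lp by (auto simp: limit_process_def)
qed

lemma cos_limit_gauss:
  assumes M: "prob_space M" and N: "prob_space N" and U: "\<And>k. U k \<in> borel_measurable M"
    and ch: "(\<lambda>k. char (distr M borel (U k)) 1) \<longlonglongrightarrow> of_real (exp (- v / 2))" and g: "gauss N L v"
  shows "(\<lambda>k. \<integral>\<omega>. cos (U k \<omega> + b) \<partial>M) \<longlonglongrightarrow> (\<integral>\<omega>. cos (L \<omega> + b) \<partial>N)"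
proof -
  have "char (distr N borel L) 1 = of_real (exp (- v / 2))" using g by (simp add: gauss_def)
  then show ?thesis
    unfolding cos_integral_char[OF M U] cos_integral_char[OF N gauss_measurable[OF g]]
    by (intro tendsto_Re tendsto_mult tendsto_const) (use ch in simp)
qed

lemma moment_bounded_scale:
  assumes "moment_bounded M A v" "\<bar>c\<bar> \<le> 1"
  shows "moment_bounded M (\<lambda>\<omega> x. c * A \<omega> x) v"
  unfolding moment_bounded_def
proof (intro allI conjI)
  fix x
  have m: "(\<lambda>\<omega>. A \<omega> x) \<in> borel_measurable M" "integrable M (\<lambda>\<omega>. (A \<omega> x)\<^sup>2)" "(\<integral>\<omega>. (A \<omega> x)\<^sup>2 \<partial>M) \<le> v x"
    using assms(1) by (simp_all add: moment_bounded_def)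
  show "(\<lambda>\<omega>. c * A \<omega> x) \<in> borel_measurable M" using m(1) by simp
  show "integrable M (\<lambda>\<omega>. (c * A \<omega> x)\<^sup>2)" using m(2) by (simp add: power_mult_distrib)
  have "c\<^sup>2 \<le> 1" using assms(2) by (simp add: abs_square_le_1)
  then have "c\<^sup>2 * (\<integral>\<omega>. (A \<omega> x)\<^sup>2 \<partial>M) \<le> 1 * (\<integral>\<omega>. (A \<omega> x)\<^sup>2 \<partial>M)" by (intro mult_right_mono) auto
  then show "(\<integral>\<omega>. (c * A \<omega> x)\<^sup>2 \<partial>M) \<le> v x" using m(3) by (simp add: power_mult_distrib)
qed

lemma moment_bounded_case_sum:
  assumes "moment_bounded M A u" "moment_bounded M B v"
  shows "moment_bounded M (\<lambda>\<omega>. case_sum (A \<omega>) (B \<omega>)) (case_sum u v)"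
  using assms by (auto simp: moment_bounded_def split: sum.split)

lemma moment_bounded_zero: "moment_bounded M (\<lambda>\<omega> x. 0) (\<lambda>x. 0)"
  by (simp add: moment_bounded_def)

text \<open>The empirical measure is a function of the list of the first \<open>n\<close>
  observations, which takes countably many values. Any function of it is therefore measurable, and
  no regularity of the map from marginals to plans has to be examined.\<close>

lemma measurable_empirical:
  fixes X :: "nat \<Rightarrow> 'w \<Rightarrow> 'x::countable" and f :: "'x pmf \<Rightarrow> 'w \<Rightarrow> real"
  assumes X: "\<And>i. X i \<in> M \<rightarrow>\<^sub>M count_space UNIV"
    and f: "\<And>q. f q \<in> borel_measurable M" and n: "n > 0"
  shows "(\<lambda>\<omega>. f (empirical_pmf X n \<omega>) \<omega>) \<in> borel_measurable M"
proof -
  have l: "(\<lambda>\<omega>. map (\<lambda>i. X i \<omega>) [0..<k]) \<in> M \<rightarrow>\<^sub>M count_space UNIV" for k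
  proof (induction k)
    case (Suc k)
    have "(\<lambda>\<omega>. map (\<lambda>i. X i \<omega>) [0..<k] @ [a]) \<in> M \<rightarrow>\<^sub>M count_space UNIV" for a
      by (rule measurable_compose[OF Suc]) simp
    from measurable_compose_countable[OF this X[of k]] show ?case by simp
  qed simp
  define E where "E l = map_pmf (\<lambda>i. l ! i) (pmf_of_set {..<n})" for l :: "'x list"
  have "empirical_pmf X n \<omega> = E (map (\<lambda>i. X i \<omega>) [0..<n])" for \<omega>
    unfolding E_def empirical_pmf_def using n
    by (intro map_pmf_cong refl) (auto simp: set_pmf_of_set lessThan_empty_iff)
  then have "(\<lambda>\<omega>. f (empirical_pmf X n \<omega>) \<omega>) = (\<lambda>\<omega>. (\<lambda>l. f (E l)) (map (\<lambda>i. X i \<omega>) [0..<n]) \<omega>)" by simp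
  also have "\<dots> \<in> borel_measurable M" by (rule measurable_compose_countable[OF f l])
  finally show ?thesis .
qed

section \<open>Limit laws of the plan\<close>

lemma summable_pmf_of_sqrt:
  assumes f: "\<And>x. f x \<ge> 0" and s: "(\<lambda>x. f x * sqrt (pmf p x)) summable_on UNIV"
  shows "(\<lambda>x. f x * pmf p x) summable_on UNIV"
proof (rule summable_on_abs_le[OF s])
  fix x
  have "pmf p x = sqrt (pmf p x) * sqrt (pmf p x)" by simp
  also have "\<dots> \<le> 1 * sqrt (pmf p x)" by (intro mult_right_mono) (auto simp: pmf_le_1)
  finally show "\<bar>f x * pmf p x\<bar> \<le> f x * sqrt (pmf p x)"
    using f[of x] by (simp add: abs_mult mult_left_mono)
qed

lemma summable_empirical:
  assumes "n > 0"
  shows "(\<lambda>x. f x * pmf (empirical_pmf X n \<omega>) x :: real) summable_on UNIV"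
proof (rule finite_nonzero_values_imp_summable_on)
  have "{x \<in> UNIV. f x * pmf (empirical_pmf X n \<omega>) x \<noteq> 0} \<subseteq> set_pmf (empirical_pmf X n \<omega>)"
    by (auto simp: set_pmf_iff)
  then show "finite {x \<in> UNIV. f x * pmf (empirical_pmf X n \<omega>) x \<noteq> 0}"
    by (rule finite_subset) (simp add: set_empirical[OF assms])
qed

lemma emp_proc_l1:
  assumes f: "\<And>x. f x > 0" and p: "(\<lambda>x. f x * pmf p x) summable_on UNIV"
  shows "emp_proc X p n \<omega> \<in> l1_set f"
proof (cases "n = 0")
  case False
  then have "(\<lambda>x. sqrt (real n) * (f x * \<bar>pmf (empirical_pmf X n \<omega>) x - pmf p x\<bar>)) summable_on UNIV"
    by (intro summable_on_cmult_right l1_set_diff f)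
       (use p in \<open>auto simp: l1_set_def intro: summable_empirical\<close>)
  then show ?thesis by (simp add: l1_set_def emp_proc_def abs_mult mult_ac)
qed (simp add: emp_proc_def l1_set_def)

lemma l1_set_scale: "a \<in> l1_set f \<Longrightarrow> (\<lambda>x. c * a x) \<in> l1_set f"
  using summable_on_cmult_right[of "\<lambda>x. f x * \<bar>a x\<bar>" UNIV "\<bar>c\<bar>"] by (simp add: l1_set_def abs_mult mult_ac)

lemma sum_path_measurable:
  fixes h :: "'z \<Rightarrow> real" and n :: nat
  shows "(\<lambda>\<xi>. (\<Sum>i<n. h (\<xi> i)) / c) \<in> borel_measurable (\<Pi>\<^sub>M i\<in>UNIV. count_space UNIV)"
proof -
  have "(\<lambda>\<xi>. h (\<xi> i)) \<in> borel_measurable (\<Pi>\<^sub>M i\<in>UNIV. count_space UNIV)" for i :: nat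
    by (rule measurable_compose[OF measurable_component_singleton[of i UNIV "\<lambda>_. count_space UNIV"]]) auto
  then show ?thesis by (intro borel_measurable_divide borel_measurable_sum) auto
qed

text \<open>Each functional is a measurable function of one sample path, and the two paths are
  independent.\<close>

lemma indep_emp_proc:
  assumes M: "prob_space M" and i: "indep_samples M X Y" and F: "finite F" "finite F'"
  shows "prob_space.indep_var M borel (\<lambda>\<omega>. \<Sum>x\<in>F. t x * emp_proc X p n \<omega> x)
    borel (\<lambda>\<omega>. \<Sum>y\<in>F'. t' y * emp_proc Y q m \<omega> y)"
  unfolding emp_proc_sum[OF F(1)] emp_proc_sum[OF F(2)]
  by (rule indep_elements_compose[OF M i[unfolded indep_samples_def]
      sum_path_measurable[of "\<lambda>a. \<Sum>x\<in>F. t x * (of_bool (a = x) - pmf p x)"]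
      sum_path_measurable[of "\<lambda>a. \<Sum>y\<in>F'. t' y * (of_bool (a = y) - pmf q y)"]])

lemma cos_lipschitz: "\<bar>cos u - cos v\<bar> \<le> \<bar>u - v\<bar>" for u v :: real
proof -
  have "\<bar>cos u - cos v\<bar> = 2 * \<bar>sin ((u + v) / 2)\<bar> * \<bar>sin ((v - u) / 2)\<bar>"
    by (simp add: cos_diff_cos abs_mult)
  also have "\<dots> \<le> 2 * 1 * \<bar>(v - u) / 2\<bar>"
    by (intro mult_mono abs_sin_x_le_abs_x) (auto simp: abs_le_iff)
  finally show ?thesis by simp
qed

context erot_countable begin

lemma W_case_sum:
  "case_sum a b \<in> l1_set W \<longleftrightarrow> a \<in> l1_set CX \<and> b \<in> l1_set WY"
  "(\<lambda>i. W i * sqrt (case_sum u v i)) summable_on UNIV \<longleftrightarrow>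
    (\<lambda>x. CX x * sqrt (u x)) summable_on UNIV \<and> (\<lambda>y. WY y * sqrt (v y)) summable_on UNIV"
  by (simp_all add: l1_W sum_type_summable(1))

lemma l1_random_case_sum:
  assumes M: "prob_space M" and A: "\<And>\<omega>. \<omega> \<in> space M \<Longrightarrow> A \<omega> \<in> l1_set CX" and Bk: "\<And>\<omega>. \<omega> \<in> space M \<Longrightarrow> Bk \<omega> \<in> l1_set WY"
    and mA: "moment_bounded M A u" and mB: "moment_bounded M Bk v"
    and u: "(\<lambda>x. CX x * sqrt (u x)) summable_on UNIV" and v: "(\<lambda>y. WY y * sqrt (v y)) summable_on UNIV"
  shows "l1_random M (\<lambda>\<omega>. case_sum (A \<omega>) (Bk \<omega>)) W (case_sum u v)"
proof (rule l1_random.intro)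
  show "moment_bounded M (\<lambda>\<omega>. case_sum (A \<omega>) (Bk \<omega>)) (case_sum u v)"
    by (rule moment_bounded_case_sum[OF mA mB])
  show "case_sum (A \<omega>) (Bk \<omega>) \<in> l1_set W" if "\<omega> \<in> space M" for \<omega>
    unfolding W_case_sum(1) using A[OF that] Bk[OF that] by (rule conjI)
  show "(\<lambda>i. W i * sqrt (case_sum u v i)) summable_on UNIV"
    unfolding W_case_sum(2) using u v by (rule conjI)
  show "prob_space M" by (rule M)
  show "W i > 0" for i by (rule W_pos)
qed

lemma Dp_case_sum: "Dp (case_sum a b) = plan_deriv r s (erot_plan c lam r s) \<phi> y1 a b"
  by (simp add: Dop_def fun_eq_iff)

lemma linear_combination_case_sum:
  fixes t :: "'x + 'y \<Rightarrow> real"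
  assumes "finite F"
  shows "(\<Sum>i\<in>F. t i * case_sum a b i) =
    (\<Sum>x\<in>Inl -` F. t (Inl x) * a x) + (\<Sum>y\<in>Inr -` F. t (Inr y) * b y)"
  using sum_sum_type(1)[OF assms, of "\<lambda>i. t i * case_sum a b i"] by simp

lemma plan_limit_X:
  fixes M :: "'w measure" and N :: "'g measure" and X :: "nat \<Rightarrow> 'w \<Rightarrow> 'x"
  assumes X: "iid_sample M X r" and rs: "(\<lambda>x. CX x * sqrt (pmf r x)) summable_on UNIV"
    and G: "limit_process CX r N G"
  shows "converges_in_distribution (l1_space wsum) M
      (\<lambda>n \<omega> z. sqrt (real n) * (pmf (erot_plan c lam (empirical_pmf X n \<omega>) s) z - pmf (erot_plan c lam r s) z))
      N (\<lambda>\<omega>. plan_deriv r s (erot_plan c lam r s) \<phi> y1 (G \<omega>) (\<lambda>_. 0))"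
    and "centered_gaussian (l1_space wsum) N (\<lambda>\<omega>. plan_deriv r s (erot_plan c lam r s) \<phi> y1 (G \<omega>) (\<lambda>_. 0))"
proof -
  interpret X: sample M X r by standard (rule X)
  interpret N: prob_space N using G by (simp add: limit_process_def)
  have g: "gauss N (\<lambda>\<omega>. \<Sum>i\<in>F. t i * case_sum (G \<omega>) (\<lambda>_. 0) i) (multi_var r (Inl -` F) (\<lambda>x. t (Inl x)))"
    if F: "finite F" for F :: "('x + 'y) set" and t
    unfolding linear_combination_case_sum[OF F] using N.limit_process_gauss[OF G sum_sum_type(2)[OF F]] by simp
  have gE: "\<exists>v. gauss N (\<lambda>\<omega>. \<Sum>i\<in>F. t i * case_sum (G \<omega>) (\<lambda>_. 0) i) v" if "finite F" for F :: "('x + 'y) set" and t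
    using g[OF that] by (rule exI)
  \<comment> \<open>Only one marginal is estimated, so the other component of the perturbation is
    identically \<open>0\<close>, with moment bound \<open>0\<close>.\<close>
  have H: "case_sum (\<lambda>x. sqrt (real n) * (pmf (empirical_pmf X n \<omega>) x - pmf r x)) (\<lambda>y. sqrt (real n) * (pmf s y - pmf s y))
      = case_sum (emp_proc X r n \<omega>) (\<lambda>_. 0)" for n \<omega>
    by (simp add: emp_proc_def[abs_def])
  note pl = plan_limit[where M=M and N=N and R="empirical_pmf X" and S="\<lambda>_ _. s" and \<rho>="\<lambda>n. sqrt (real n)"
      and Lw="\<lambda>\<omega>. case_sum (G \<omega>) (\<lambda>_. 0)" and v="case_sum (pmf r) (\<lambda>_. 0)", unfolded H Dp_case_sum]
  have 1: "filterlim (\<lambda>n. sqrt (real n)) at_top sequentially"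
    by (rule filterlim_compose[OF sqrt_at_top filterlim_real_sequentially])
  have 2: "(\<lambda>x. CX x * pmf (empirical_pmf X n \<omega>) x) summable_on UNIV \<and> (\<lambda>y. WY y * pmf s y) summable_on UNIV"
    if "sqrt (real n) > 0" for n \<omega> using that ssum summable_empirical[of n] by simp
  have 3: "AE \<omega> in M. \<forall>n. sqrt (real n) > 0 \<longrightarrow> set_pmf (empirical_pmf X n \<omega>) \<subseteq> set_pmf r \<and> set_pmf s \<subseteq> set_pmf s"
    using X.AE_in_support by eventually_elim (auto simp: set_empirical)
  have 4: "l1_random M (\<lambda>\<omega>. case_sum (emp_proc X r n \<omega>) (\<lambda>_. 0)) W (case_sum (pmf r) (\<lambda>_. 0))" for n
    by (rule l1_random_case_sum[OF X.prob_space_axioms emp_proc_l1[OF WY_ge(5) rsum] _ X.emp_proc_moment moment_bounded_zero rs])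
       (auto simp: l1_set_def)
  have 5: "l1_random N (\<lambda>\<omega>. case_sum (G \<omega>) (\<lambda>_. 0)) W (case_sum (pmf r) (\<lambda>_. 0))"
    by (rule l1_random_case_sum[OF N.prob_space_axioms limit_process_l1(1)[OF G WY_ge(5)] _ limit_process_moment[OF G WY_ge(5)] moment_bounded_zero rs])
       (auto simp: l1_set_def)
  have 6: "(\<lambda>n. \<integral>\<omega>. cos ((\<Sum>i\<in>F. t i * case_sum (emp_proc X r n \<omega>) (\<lambda>_. 0) i) + b) \<partial>M)
      \<longlonglongrightarrow> (\<integral>\<omega>. cos ((\<Sum>i\<in>F. t i * case_sum (G \<omega>) (\<lambda>_. 0) i) + b) \<partial>N)" if F: "finite F" for F :: "('x + 'y) set" and t b
  proof (rule cos_limit_gauss[OF X.prob_space_axioms N.prob_space_axioms _ _ g[OF F]])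
    show "(\<lambda>\<omega>. \<Sum>i\<in>F. t i * case_sum (emp_proc X r n \<omega>) (\<lambda>_. 0) i) \<in> borel_measurable M" for n
      unfolding linear_combination_case_sum[OF F]
      by (intro borel_measurable_add borel_measurable_sum borel_measurable_times borel_measurable_const X.emp_proc_measurable)
    show "(\<lambda>n. char (distr M borel (\<lambda>\<omega>. \<Sum>i\<in>F. t i * case_sum (emp_proc X r n \<omega>) (\<lambda>_. 0) i)) 1)
        \<longlonglongrightarrow> of_real (exp (- multi_var r (Inl -` F) (\<lambda>x. t (Inl x)) / 2))"
      unfolding linear_combination_case_sum[OF F] using X.emp_proc_char[OF sum_sum_type(2)[OF F], of "\<lambda>x. t (Inl x)"] by simp
  qed
  have 7: "(\<lambda>\<omega>. sqrt (real n) * (pmf (erot_plan c lam (empirical_pmf X n \<omega>) s) z - pmf (erot_plan c lam r s) z)) \<in> borel_measurable M" for n z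
  proof (cases "n > 0")
    case True
    show ?thesis
      by (rule measurable_empirical[where f="\<lambda>q \<omega>. sqrt (real n) * (pmf (erot_plan c lam q s) z - pmf (erot_plan c lam r s) z)", OF X.X_meas _ True])
         simp
  qed simp
  note pl' = pl[OF real_sqrt_ge_zero[OF of_nat_0_le_iff] 1 2 3 4 5 6 7 gE]
  show "converges_in_distribution (l1_space wsum) M
      (\<lambda>n \<omega> z. sqrt (real n) * (pmf (erot_plan c lam (empirical_pmf X n \<omega>) s) z - pmf (erot_plan c lam r s) z))
      N (\<lambda>\<omega>. plan_deriv r s (erot_plan c lam r s) \<phi> y1 (G \<omega>) (\<lambda>_. 0))"
    by (rule pl'(1))
  show "centered_gaussian (l1_space wsum) N (\<lambda>\<omega>. plan_deriv r s (erot_plan c lam r s) \<phi> y1 (G \<omega>) (\<lambda>_. 0))"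
    by (rule pl'(2))
qed

lemma plan_limit_Y:
  fixes M :: "'w measure" and N :: "'g measure" and Y :: "nat \<Rightarrow> 'w \<Rightarrow> 'y"
  assumes Y: "iid_sample M Y s" and ss: "(\<lambda>y. WY y * sqrt (pmf s y)) summable_on UNIV"
    and G: "limit_process WY s N G"
  shows "converges_in_distribution (l1_space wsum) M
      (\<lambda>n \<omega> z. sqrt (real n) * (pmf (erot_plan c lam r (empirical_pmf Y n \<omega>)) z - pmf (erot_plan c lam r s) z))
      N (\<lambda>\<omega>. plan_deriv r s (erot_plan c lam r s) \<phi> y1 (\<lambda>_. 0) (G \<omega>))"
    and "centered_gaussian (l1_space wsum) N (\<lambda>\<omega>. plan_deriv r s (erot_plan c lam r s) \<phi> y1 (\<lambda>_. 0) (G \<omega>))"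
proof -
  interpret Y: sample M Y s by standard (rule Y)
  interpret N: prob_space N using G by (simp add: limit_process_def)
  have g: "gauss N (\<lambda>\<omega>. \<Sum>i\<in>F. t i * case_sum (\<lambda>_. 0) (G \<omega>) i) (multi_var s (Inr -` F) (\<lambda>y. t (Inr y)))"
    if F: "finite F" for F :: "('x + 'y) set" and t
    unfolding linear_combination_case_sum[OF F] using N.limit_process_gauss[OF G sum_sum_type(3)[OF F]] by simp
  have gE: "\<exists>v. gauss N (\<lambda>\<omega>. \<Sum>i\<in>F. t i * case_sum (\<lambda>_. 0) (G \<omega>) i) v" if "finite F" for F :: "('x + 'y) set" and t
    using g[OF that] by (rule exI)
  have H: "case_sum (\<lambda>x. sqrt (real n) * (pmf r x - pmf r x)) (\<lambda>y. sqrt (real n) * (pmf (empirical_pmf Y n \<omega>) y - pmf s y))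
      = case_sum (\<lambda>_. 0) (emp_proc Y s n \<omega>)" for n \<omega>
    by (simp add: emp_proc_def[abs_def])
  note pl = plan_limit[where M=M and N=N and R="\<lambda>_ _. r" and S="empirical_pmf Y" and \<rho>="\<lambda>n. sqrt (real n)"
      and Lw="\<lambda>\<omega>. case_sum (\<lambda>_. 0) (G \<omega>)" and v="case_sum (\<lambda>_. 0) (pmf s)", unfolded H Dp_case_sum]
  have 1: "filterlim (\<lambda>n. sqrt (real n)) at_top sequentially"
    by (rule filterlim_compose[OF sqrt_at_top filterlim_real_sequentially])
  have 2: "(\<lambda>x. CX x * pmf r x) summable_on UNIV \<and> (\<lambda>y. WY y * pmf (empirical_pmf Y n \<omega>) y) summable_on UNIV"
    if "sqrt (real n) > 0" for n \<omega> using that rsum summable_empirical[of n] by simp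
  have 3: "AE \<omega> in M. \<forall>n. sqrt (real n) > 0 \<longrightarrow> set_pmf r \<subseteq> set_pmf r \<and> set_pmf (empirical_pmf Y n \<omega>) \<subseteq> set_pmf s"
    using Y.AE_in_support by eventually_elim (auto simp: set_empirical)
  have 4: "l1_random M (\<lambda>\<omega>. case_sum (\<lambda>_. 0) (emp_proc Y s n \<omega>)) W (case_sum (\<lambda>_. 0) (pmf s))" for n
    by (rule l1_random_case_sum[OF Y.prob_space_axioms _ emp_proc_l1[OF WY_ge(4) ssum] moment_bounded_zero Y.emp_proc_moment _ ss])
       (auto simp: l1_set_def)
  have 5: "l1_random N (\<lambda>\<omega>. case_sum (\<lambda>_. 0) (G \<omega>)) W (case_sum (\<lambda>_. 0) (pmf s))"
    by (rule l1_random_case_sum[OF N.prob_space_axioms _ limit_process_l1(1)[OF G WY_ge(4)] moment_bounded_zero limit_process_moment[OF G WY_ge(4)] _ ss])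
       (auto simp: l1_set_def)
  have 6: "(\<lambda>n. \<integral>\<omega>. cos ((\<Sum>i\<in>F. t i * case_sum (\<lambda>_. 0) (emp_proc Y s n \<omega>) i) + b) \<partial>M)
      \<longlonglongrightarrow> (\<integral>\<omega>. cos ((\<Sum>i\<in>F. t i * case_sum (\<lambda>_. 0) (G \<omega>) i) + b) \<partial>N)" if F: "finite F" for F :: "('x + 'y) set" and t b
  proof (rule cos_limit_gauss[OF Y.prob_space_axioms N.prob_space_axioms _ _ g[OF F]])
    show "(\<lambda>\<omega>. \<Sum>i\<in>F. t i * case_sum (\<lambda>_. 0) (emp_proc Y s n \<omega>) i) \<in> borel_measurable M" for n
      unfolding linear_combination_case_sum[OF F]
      by (intro borel_measurable_add borel_measurable_sum borel_measurable_times borel_measurable_const Y.emp_proc_measurable)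
    show "(\<lambda>n. char (distr M borel (\<lambda>\<omega>. \<Sum>i\<in>F. t i * case_sum (\<lambda>_. 0) (emp_proc Y s n \<omega>) i)) 1)
        \<longlonglongrightarrow> of_real (exp (- multi_var s (Inr -` F) (\<lambda>y. t (Inr y)) / 2))"
      unfolding linear_combination_case_sum[OF F] using Y.emp_proc_char[OF sum_sum_type(3)[OF F], of "\<lambda>y. t (Inr y)"] by simp
  qed
  have 7: "(\<lambda>\<omega>. sqrt (real n) * (pmf (erot_plan c lam r (empirical_pmf Y n \<omega>)) z - pmf (erot_plan c lam r s) z)) \<in> borel_measurable M" for n z
  proof (cases "n > 0")
    case True
    show ?thesis
      by (rule measurable_empirical[where f="\<lambda>q \<omega>. sqrt (real n) * (pmf (erot_plan c lam r q) z - pmf (erot_plan c lam r s) z)", OF Y.X_meas _ True])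
         simp
  qed simp
  note pl' = pl[OF real_sqrt_ge_zero[OF of_nat_0_le_iff] 1 2 3 4 5 6 7 gE]
  show "converges_in_distribution (l1_space wsum) M
      (\<lambda>n \<omega> z. sqrt (real n) * (pmf (erot_plan c lam r (empirical_pmf Y n \<omega>)) z - pmf (erot_plan c lam r s) z))
      N (\<lambda>\<omega>. plan_deriv r s (erot_plan c lam r s) \<phi> y1 (\<lambda>_. 0) (G \<omega>))"
    by (rule pl'(1))
  show "centered_gaussian (l1_space wsum) N (\<lambda>\<omega>. plan_deriv r s (erot_plan c lam r s) \<phi> y1 (\<lambda>_. 0) (G \<omega>))"
    by (rule pl'(2))
qed

lemma Dp_measurable: "(\<lambda>a. Dp a z) \<in> borel_measurable (borel_metric (l1_space W))"
proof -
  note spW = l1_space_simps[of W, OF W_pos]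
  obtain C where C: "\<And>a b. a \<in> l1_set W \<Longrightarrow> b \<in> l1_set W \<Longrightarrow> l1_dist wsum (Dp a) (Dp b) \<le> C * l1_dist W a b"
    using Dp_lipschitz by blast
  show ?thesis
  proof (rule lipschitz_borel_measurable[of _ _ "C / wsum z"])
    fix a b assume "a \<in> mspace (l1_space W)" "b \<in> mspace (l1_space W)"
    then have ab: "a \<in> l1_set W" "b \<in> l1_set W" by (simp_all add: spW)
    have "wsum z * \<bar>Dp a z - Dp b z\<bar> \<le> C * l1_dist W a b"
      using l1_coordinate[of wsum "Dp a" "Dp b" z, OF wsum_pos] Dop_linear(2)[OF rsum ssum y1] ab C[OF ab] by force
    then show "\<bar>Dp a z - Dp b z\<bar> \<le> C / wsum z * mdist (l1_space W) a b"
      using wsum_pos[of z] by (simp add: spW field_simps)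
  qed
qed

lemma Dp_measurable_marginal:
  "(\<lambda>a. Dp (case_sum a (\<lambda>_. 0)) z) \<in> borel_measurable (borel_metric (l1_space CX))"
  "(\<lambda>b. Dp (case_sum (\<lambda>_. 0) b) z) \<in> borel_measurable (borel_metric (l1_space WY))"
proof -
  have z: "(\<lambda>_. 0) \<in> l1_set f" for f :: "'z \<Rightarrow> real" by (simp add: l1_set_def)
  have X: "(\<lambda>a. a) \<in> borel_metric (l1_space CX) \<rightarrow>\<^sub>M borel_metric (l1_space CX)"
    and Y: "(\<lambda>a. a) \<in> borel_metric (l1_space WY) \<rightarrow>\<^sub>M borel_metric (l1_space WY)"
    by (rule measurable_ident_sets[OF refl])+
  note mX = measurable_l1_coordinate[OF WY_ge(5) X] and mY = measurable_l1_coordinate[OF WY_ge(4) Y]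
  have "(\<lambda>a. case_sum a (\<lambda>_. 0)) \<in> borel_metric (l1_space CX) \<rightarrow>\<^sub>M borel_metric (l1_space W)"
  proof (rule measurable_l1_space[OF W_pos])
    show "(\<lambda>a. case_sum a (\<lambda>_. 0) i) \<in> borel_measurable (borel_metric (l1_space CX))" for i
      using mX(1) by (cases i) auto
  qed (use mX(2) z in \<open>auto simp: W_case_sum\<close>)
  from measurable_compose[OF this Dp_measurable]
  show "(\<lambda>a. Dp (case_sum a (\<lambda>_. 0)) z) \<in> borel_measurable (borel_metric (l1_space CX))" .
  have "(\<lambda>b. case_sum (\<lambda>_. 0) b) \<in> borel_metric (l1_space WY) \<rightarrow>\<^sub>M borel_metric (l1_space W)"
  proof (rule measurable_l1_space[OF W_pos])
    show "(\<lambda>b. case_sum (\<lambda>_. 0) b i) \<in> borel_measurable (borel_metric (l1_space WY))" for i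
      using mY(1) by (cases i) auto
  qed (use mY(2) z in \<open>auto simp: W_case_sum\<close>)
  from measurable_compose[OF this Dp_measurable]
  show "(\<lambda>b. Dp (case_sum (\<lambda>_. 0) b) z) \<in> borel_measurable (borel_metric (l1_space WY))" .
qed

lemma plan_limit_XY:
  fixes M :: "'w measure" and N :: "'g measure" and X :: "nat \<Rightarrow> 'w \<Rightarrow> 'x" and Y :: "nat \<Rightarrow> 'w \<Rightarrow> 'y"
    and n m :: "nat \<Rightarrow> nat"
  assumes X: "iid_sample M X r" and Y: "iid_sample M Y s" and XY: "indep_samples M X Y"
    and rs: "(\<lambda>x. CX x * sqrt (pmf r x)) summable_on UNIV" and ss: "(\<lambda>y. WY y * sqrt (pmf s y)) summable_on UNIV"
    and Gr: "limit_process CX r N Gr" and Gs: "limit_process WY s N Gs"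
    and ind: "indep_elements N (borel_metric (l1_space CX)) Gr (borel_metric (l1_space WY)) Gs"
    and nm: "filterlim (\<lambda>k. min (m k) (n k)) at_top sequentially"
    and ratio: "(\<lambda>k. real (m k) / (real (m k) + real (n k))) \<longlonglongrightarrow> \<delta>" and \<delta>: "0 < \<delta>" "\<delta> < 1"
  defines "D \<equiv> plan_deriv r s (erot_plan c lam r s) \<phi> y1"
    and "Lm \<equiv> \<lambda>\<omega>. plan_deriv r s (erot_plan c lam r s) \<phi> y1 (\<lambda>x. sqrt \<delta> * Gr \<omega> x) (\<lambda>y. sqrt (1 - \<delta>) * Gs \<omega> y)"
  shows "converges_in_distribution (l1_space wsum) M
      (\<lambda>k \<omega> z. sqrt (real (n k) * real (m k) / (real (n k) + real (m k))) *
         (pmf (erot_plan c lam (empirical_pmf X (n k) \<omega>) (empirical_pmf Y (m k) \<omega>)) z - pmf (erot_plan c lam r s) z)) N Lm"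
    and "centered_gaussian (l1_space wsum) N Lm"
    and "covariance_fun N Lm = (\<lambda>z z'. \<delta> * covariance_fun N (\<lambda>\<omega>. D (Gr \<omega>) (\<lambda>_. 0)) z z' +
                   (1 - \<delta>) * covariance_fun N (\<lambda>\<omega>. D (\<lambda>_. 0) (Gs \<omega>)) z z')"
proof -
  interpret X: sample M X r by standard (rule X)
  interpret Y: sample M Y s by standard (rule Y)
  interpret N: prob_space N using Gr by (simp add: limit_process_def)
  note lX = limit_process_l1[OF Gr WY_ge(5)] and lY = limit_process_l1[OF Gs WY_ge(4)]
  \<comment> \<open>The common rate factors as
    \<open>\<rho> k = \<alpha> k * sqrt (n k) = \<beta> k * sqrt (m k)\<close>, with
    \<open>\<alpha>\<close> and \<open>\<beta>\<close> tending to \<open>sqrt \<delta>\<close> and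
    \<open>sqrt (1 - \<delta>)\<close>. Both are at most \<open>1\<close>, so the moment bounds of
    the empirical processes survive.\<close>
  define \<rho> where "\<rho> k = sqrt (real (n k) * real (m k) / (real (n k) + real (m k)))" for k
  define \<alpha> where "\<alpha> k = sqrt (real (m k) / (real (m k) + real (n k)))" for k
  define \<beta> where "\<beta> k = sqrt (real (n k) / (real (m k) + real (n k)))" for k
  define a where "a = sqrt \<delta>"
  define d where "d = sqrt (1 - \<delta>)"
  have ad: "a\<^sup>2 = \<delta>" "d\<^sup>2 = 1 - \<delta>" "\<bar>a\<bar> \<le> 1" "\<bar>d\<bar> \<le> 1" using \<delta> by (auto simp: a_def d_def)
  have \<alpha>1: "\<bar>\<alpha> k\<bar> \<le> 1" and \<beta>1: "\<bar>\<beta> k\<bar> \<le> 1" for k by (auto simp: \<alpha>_def \<beta>_def divide_le_eq_1)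
  have nlim: "filterlim n at_top sequentially" and mlim: "filterlim m at_top sequentially"
    by (rule filterlim_at_top_mono[OF nm]; simp)+
  have \<alpha>lim: "\<alpha> \<longlonglongrightarrow> a" unfolding \<alpha>_def[abs_def] a_def by (rule tendsto_real_sqrt[OF ratio])
  have \<beta>lim: "\<beta> \<longlonglongrightarrow> d"
  proof -
    have "(\<lambda>k. sqrt (1 - real (m k) / (real (m k) + real (n k)))) \<longlonglongrightarrow> d"
      unfolding d_def by (intro tendsto_real_sqrt tendsto_diff tendsto_const ratio)
    moreover have "\<forall>\<^sub>F k in sequentially. n k \<ge> 1" using nlim by (simp add: filterlim_at_top)
    then have "\<forall>\<^sub>F k in sequentially. sqrt (1 - real (m k) / (real (m k) + real (n k))) = \<beta> k"
      by eventually_elim (simp add: \<beta>_def field_simps)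
    ultimately show ?thesis by (rule Lim_transform_eventually)
  qed
  have \<rho>lim: "filterlim \<rho> at_top sequentially"
  proof -
    have "filterlim (\<lambda>k. real (m k) / (real (m k) + real (n k)) * real (n k)) at_top sequentially"
      by (rule filterlim_tendsto_pos_mult_at_top[OF ratio \<delta>(1) filterlim_compose[OF filterlim_real_sequentially nlim]])
    then have "filterlim (\<lambda>k. real (n k) * real (m k) / (real (n k) + real (m k))) at_top sequentially"
      by (simp add: mult.commute add.commute)
    then show ?thesis unfolding \<rho>_def[abs_def] by (rule filterlim_compose[OF sqrt_at_top])
  qed
  have \<rho>0: "\<rho> k \<ge> 0" for k by (simp add: \<rho>_def)
  \<comment> \<open>A vanishing sample size makes \<open>\<rho> k = 0\<close>, the quotient
    \<open>0 / 0\<close> included.\<close>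
  have pos: "n k > 0 \<and> m k > 0" if "\<rho> k > 0" for k
    using that unfolding \<rho>_def by (cases "n k = 0"; cases "m k = 0") auto
  define U where "U k \<omega> = case_sum (\<lambda>x. \<alpha> k * emp_proc X r (n k) \<omega> x) (\<lambda>y. \<beta> k * emp_proc Y s (m k) \<omega> y)" for k \<omega>
  define G where "G \<omega> = case_sum (\<lambda>x. a * Gr \<omega> x) (\<lambda>y. d * Gs \<omega> y)" for \<omega>
  have \<rho>\<alpha>: "\<rho> k = \<alpha> k * sqrt (real (n k))" "\<rho> k = \<beta> k * sqrt (real (m k))" for k
    by (simp_all add: \<rho>_def \<alpha>_def \<beta>_def real_sqrt_mult[symmetric] mult.commute add.commute)
  have H: "case_sum (\<lambda>x. \<rho> k * (pmf (empirical_pmf X (n k) \<omega>) x - pmf r x)) (\<lambda>y. \<rho> k * (pmf (empirical_pmf Y (m k) \<omega>) y - pmf s y)) = U k \<omega>" for k \<omega>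
  proof (intro ext)
    fix i
    show "case_sum (\<lambda>x. \<rho> k * (pmf (empirical_pmf X (n k) \<omega>) x - pmf r x)) (\<lambda>y. \<rho> k * (pmf (empirical_pmf Y (m k) \<omega>) y - pmf s y)) i = U k \<omega> i"
      by (cases i) (simp_all only: sum.case U_def emp_proc_def \<rho>\<alpha>(1) mult.assoc, simp add: \<rho>\<alpha>(1)[symmetric] \<rho>\<alpha>(2) mult.assoc)
  qed
  have Lm: "Lm = (\<lambda>\<omega>. Dp (G \<omega>))" by (simp add: Lm_def G_def Dp_case_sum a_def d_def)
  have gN: "gauss N (\<lambda>\<omega>. \<Sum>i\<in>F. t i * G \<omega> i)
      (multi_var r (Inl -` F) (\<lambda>x. a * t (Inl x)) + multi_var s (Inr -` F) (\<lambda>y. d * t (Inr y)))" if F: "finite F" for F :: "('x + 'y) set" and t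
  proof -
    have c: "(\<lambda>h. \<Sum>z\<in>F'. t' z * h z) \<in> borel_measurable (borel_metric (l1_space w))" if "\<And>z. w z > 0"
      for F' and t' :: "'z::countable \<Rightarrow> real" and w
      by (intro borel_measurable_sum borel_measurable_times borel_measurable_const
          measurable_l1_coordinate(1)[OF that measurable_ident_sets[OF refl]])
    have "gauss N (\<lambda>\<omega>. (\<Sum>x\<in>Inl -` F. a * t (Inl x) * Gr \<omega> x) + (\<Sum>y\<in>Inr -` F. d * t (Inr y) * Gs \<omega> y))
        (multi_var r (Inl -` F) (\<lambda>x. a * t (Inl x)) + multi_var s (Inr -` F) (\<lambda>y. d * t (Inr y)))"
      by (rule gauss_add[OF N.prob_space_axioms N.limit_process_gauss[OF Gr sum_sum_type(2)[OF F]] N.limit_process_gauss[OF Gs sum_sum_type(3)[OF F]]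
            indep_elements_compose[OF N.prob_space_axioms ind c[OF WY_ge(5)] c[OF WY_ge(4)]]])
    then show ?thesis unfolding G_def linear_combination_case_sum[OF F] by (simp add: mult_ac)
  qed
  have gE: "\<exists>v. gauss N (\<lambda>\<omega>. \<Sum>i\<in>F. t i * G \<omega> i) v" if "finite F" for F :: "('x + 'y) set" and t
    using gN[OF that] by (rule exI)
  have 2: "(\<lambda>x. CX x * pmf (empirical_pmf X (n k) \<omega>) x) summable_on UNIV \<and> (\<lambda>y. WY y * pmf (empirical_pmf Y (m k) \<omega>) y) summable_on UNIV"
    if "\<rho> k > 0" for k \<omega> using pos[OF that] by (simp add: summable_empirical)
  have 3: "AE \<omega> in M. \<forall>k. \<rho> k > 0 \<longrightarrow> set_pmf (empirical_pmf X (n k) \<omega>) \<subseteq> set_pmf r \<and> set_pmf (empirical_pmf Y (m k) \<omega>) \<subseteq> set_pmf s"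
    using X.AE_in_support Y.AE_in_support by eventually_elim (auto simp: set_empirical dest!: pos)
  have 4: "l1_random M (U k) W (case_sum (pmf r) (pmf s))" for k
    unfolding U_def
    by (rule l1_random_case_sum[OF X.prob_space_axioms l1_set_scale[OF emp_proc_l1[OF WY_ge(5) rsum]] l1_set_scale[OF emp_proc_l1[OF WY_ge(4) ssum]]
          moment_bounded_scale[OF X.emp_proc_moment \<alpha>1] moment_bounded_scale[OF Y.emp_proc_moment \<beta>1] rs ss])
  have 5: "l1_random N G W (case_sum (pmf r) (pmf s))"
    unfolding G_def
    by (rule l1_random_case_sum[OF N.prob_space_axioms l1_set_scale[OF lX(1)] l1_set_scale[OF lY(1)]
          moment_bounded_scale[OF limit_process_moment[OF Gr WY_ge(5)] ad(3)] moment_bounded_scale[OF limit_process_moment[OF Gs WY_ge(4)] ad(4)] rs ss])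
  have 6: "(\<lambda>k. \<integral>\<omega>. cos ((\<Sum>i\<in>F. t i * U k \<omega> i) + b) \<partial>M) \<longlonglongrightarrow> (\<integral>\<omega>. cos ((\<Sum>i\<in>F. t i * G \<omega> i) + b) \<partial>N)"
    if F: "finite F" for F :: "('x + 'y) set" and t b
  proof -
    note fX = sum_sum_type(2)[OF F] and fY = sum_sum_type(3)[OF F]
    define A where "A k \<omega> = (\<Sum>x\<in>Inl -` F. t (Inl x) * emp_proc X r (n k) \<omega> x)" for k \<omega>
    define Bk where "Bk k \<omega> = (\<Sum>y\<in>Inr -` F. t (Inr y) * emp_proc Y s (m k) \<omega> y)" for k \<omega>
    have Am: "A k \<in> borel_measurable M" for k
      unfolding A_def[abs_def]
      by (intro borel_measurable_sum borel_measurable_times borel_measurable_const X.emp_proc_measurable)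
    have Bm: "Bk k \<in> borel_measurable M" for k
      unfolding Bk_def[abs_def]
      by (intro borel_measurable_sum borel_measurable_times borel_measurable_const Y.emp_proc_measurable)
    have abs_le: "integrable M (\<lambda>\<omega>. \<Sum>z\<in>F'. t' z * Q \<omega> z)"
        "X.expectation (\<lambda>\<omega>. \<bar>\<Sum>z\<in>F'. t' z * Q \<omega> z\<bar>) \<le> (\<Sum>z\<in>F'. \<bar>t' z\<bar> * sqrt (q z))"
      if Q: "moment_bounded M Q q" for F' t' q and Q :: "'w \<Rightarrow> 'z \<Rightarrow> real"
    proof -
      note md = X.moment_boundedD[OF Q]
      show i: "integrable M (\<lambda>\<omega>. \<Sum>z\<in>F'. t' z * Q \<omega> z)" using md(4) by auto
      have "X.expectation (\<lambda>\<omega>. \<bar>\<Sum>z\<in>F'. t' z * Q \<omega> z\<bar>) \<le> X.expectation (\<lambda>\<omega>. \<Sum>z\<in>F'. \<bar>t' z\<bar> * \<bar>Q \<omega> z\<bar>)"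
        using i md(4) by (intro integral_mono order_trans[OF sum_abs] sum_mono) (auto simp: abs_mult)
      also have "\<dots> = (\<Sum>z\<in>F'. \<bar>t' z\<bar> * X.expectation (\<lambda>\<omega>. \<bar>Q \<omega> z\<bar>))" using md(4) by simp
      also have "\<dots> \<le> (\<Sum>z\<in>F'. \<bar>t' z\<bar> * sqrt (q z))" using md(5) by (intro sum_mono mult_left_mono) auto
      finally show "X.expectation (\<lambda>\<omega>. \<bar>\<Sum>z\<in>F'. t' z * Q \<omega> z\<bar>) \<le> (\<Sum>z\<in>F'. \<bar>t' z\<bar> * sqrt (q z))" .
    qed
    define TA where "TA = (\<Sum>x\<in>Inl -` F. \<bar>t (Inl x)\<bar> * sqrt (pmf r x))"
    define TB where "TB = (\<Sum>y\<in>Inr -` F. \<bar>t (Inr y)\<bar> * sqrt (pmf s y))"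
    have Ai: "integrable M (A k)" "X.expectation (\<lambda>\<omega>. \<bar>A k \<omega>\<bar>) \<le> TA" for k
      unfolding A_def[abs_def] TA_def by (rule abs_le[OF X.emp_proc_moment])+
    have Bi: "integrable M (Bk k)" "X.expectation (\<lambda>\<omega>. \<bar>Bk k \<omega>\<bar>) \<le> TB" for k
      unfolding Bk_def[abs_def] TB_def by (rule abs_le[OF Y.emp_proc_moment])+
    \<comment> \<open>With the limiting coefficients \<open>a\<close> and \<open>d\<close> in place
      of \<open>\<alpha> k\<close> and \<open>\<beta> k\<close>, independence factors the
      characteristic function and each factor converges along its own sample size. The replacement
      is justified afterwards.\<close>
    have main: "(\<lambda>k. \<integral>\<omega>. cos ((a * A k \<omega> + d * Bk k \<omega>) + b) \<partial>M) \<longlonglongrightarrow> (\<integral>\<omega>. cos ((\<Sum>i\<in>F. t i * G \<omega> i) + b) \<partial>N)"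
    proof (rule cos_limit_gauss[OF X.prob_space_axioms N.prob_space_axioms _ _ gN[OF F]])
      show "(\<lambda>\<omega>. a * A k \<omega> + d * Bk k \<omega>) \<in> borel_measurable M" for k using Am Bm by simp
      have eq: "a * A k \<omega> = (\<Sum>x\<in>Inl -` F. (a * t (Inl x)) * emp_proc X r (n k) \<omega> x)"
        "d * Bk k \<omega> = (\<Sum>y\<in>Inr -` F. (d * t (Inr y)) * emp_proc Y s (m k) \<omega> y)" for k \<omega>
        by (simp_all add: A_def Bk_def sum_distrib_left mult.assoc)
      have "char (distr M borel (\<lambda>\<omega>. a * A k \<omega> + d * Bk k \<omega>)) 1 =
          char (distr M borel (\<lambda>\<omega>. a * A k \<omega>)) 1 * char (distr M borel (\<lambda>\<omega>. d * Bk k \<omega>)) 1" for k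
        unfolding eq by (rule X.char_distr_add[OF indep_emp_proc[OF X.prob_space_axioms XY fX fY]])
      moreover have "(\<lambda>k. char (distr M borel (\<lambda>\<omega>. a * A k \<omega>)) 1 * char (distr M borel (\<lambda>\<omega>. d * Bk k \<omega>)) 1) \<longlonglongrightarrow>
          of_real (exp (- multi_var r (Inl -` F) (\<lambda>x. a * t (Inl x)) / 2)) * of_real (exp (- multi_var s (Inr -` F) (\<lambda>y. d * t (Inr y)) / 2))"
        unfolding eq
        by (intro tendsto_mult filterlim_compose[OF X.emp_proc_char[OF fX] nlim] filterlim_compose[OF Y.emp_proc_char[OF fY] mlim])
      ultimately show "(\<lambda>k. char (distr M borel (\<lambda>\<omega>. a * A k \<omega> + d * Bk k \<omega>)) 1) \<longlonglongrightarrow>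
          of_real (exp (- (multi_var r (Inl -` F) (\<lambda>x. a * t (Inl x)) + multi_var s (Inr -` F) (\<lambda>y. d * t (Inr y))) / 2))"
        by (simp add: exp_add[symmetric] add_divide_distrib diff_divide_distrib flip: of_real_mult)
    qed
    have Ut: "(\<Sum>i\<in>F. t i * U k \<omega> i) = \<alpha> k * A k \<omega> + \<beta> k * Bk k \<omega>" for k \<omega>
      unfolding U_def linear_combination_case_sum[OF F] A_def Bk_def by (simp add: sum_distrib_left mult_ac)
    \<comment> \<open>Cosine is Lipschitz and both functionals have first absolute moments bounded
      uniformly in \<open>k\<close>, so exchanging the coefficients costs at most
      \<open>\<bar>\<alpha> k - a\<bar> * TA + \<bar>\<beta> k - d\<bar> * TB\<close>.\<close>
    have "(\<lambda>k. (\<integral>\<omega>. cos ((\<Sum>i\<in>F. t i * U k \<omega> i) + b) \<partial>M) - (\<integral>\<omega>. cos ((a * A k \<omega> + d * Bk k \<omega>) + b) \<partial>M)) \<longlonglongrightarrow> 0"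
    proof (rule Lim_null_comparison[OF always_eventually[OF allI]])
      fix k
      have i1: "integrable M (\<lambda>\<omega>. cos ((u * A k \<omega> + v * Bk k \<omega>) + b))" for u v
        by (rule X.integrable_const_bound[of _ 1]) (use Am Bm in auto)
      have i2: "integrable M (\<lambda>\<omega>. \<bar>\<alpha> k - a\<bar> * \<bar>A k \<omega>\<bar> + \<bar>\<beta> k - d\<bar> * \<bar>Bk k \<omega>\<bar>)" using Ai(1) Bi(1) by auto
      have "norm ((\<integral>\<omega>. cos ((\<Sum>i\<in>F. t i * U k \<omega> i) + b) \<partial>M) - (\<integral>\<omega>. cos ((a * A k \<omega> + d * Bk k \<omega>) + b) \<partial>M))
          = \<bar>X.expectation (\<lambda>\<omega>. cos ((\<alpha> k * A k \<omega> + \<beta> k * Bk k \<omega>) + b) - cos ((a * A k \<omega> + d * Bk k \<omega>) + b))\<bar>"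
        unfolding Ut Bochner_Integration.integral_diff[OF i1 i1] by simp
      also have "\<dots> \<le> X.expectation (\<lambda>\<omega>. \<bar>cos ((\<alpha> k * A k \<omega> + \<beta> k * Bk k \<omega>) + b) - cos ((a * A k \<omega> + d * Bk k \<omega>) + b)\<bar>)"
        by (rule integral_abs_bound)
      also have "\<dots> \<le> X.expectation (\<lambda>\<omega>. \<bar>\<alpha> k - a\<bar> * \<bar>A k \<omega>\<bar> + \<bar>\<beta> k - d\<bar> * \<bar>Bk k \<omega>\<bar>)"
      proof (rule integral_mono[OF _ i2])
        show "integrable M (\<lambda>\<omega>. \<bar>cos ((\<alpha> k * A k \<omega> + \<beta> k * Bk k \<omega>) + b) - cos ((a * A k \<omega> + d * Bk k \<omega>) + b)\<bar>)"
          by (intro integrable_abs Bochner_Integration.integrable_diff i1)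
        fix \<omega>
        have "(\<alpha> k * A k \<omega> + \<beta> k * Bk k \<omega> + b) - (a * A k \<omega> + d * Bk k \<omega> + b) = (\<alpha> k - a) * A k \<omega> + (\<beta> k - d) * Bk k \<omega>"
          by (simp add: algebra_simps)
        then show "\<bar>cos ((\<alpha> k * A k \<omega> + \<beta> k * Bk k \<omega>) + b) - cos ((a * A k \<omega> + d * Bk k \<omega>) + b)\<bar>
            \<le> \<bar>\<alpha> k - a\<bar> * \<bar>A k \<omega>\<bar> + \<bar>\<beta> k - d\<bar> * \<bar>Bk k \<omega>\<bar>"
          using cos_lipschitz[of "\<alpha> k * A k \<omega> + \<beta> k * Bk k \<omega> + b" "a * A k \<omega> + d * Bk k \<omega> + b"]
            abs_triangle_ineq[of "(\<alpha> k - a) * A k \<omega>" "(\<beta> k - d) * Bk k \<omega>"] by (simp add: abs_mult)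
      qed
      also have "\<dots> = \<bar>\<alpha> k - a\<bar> * X.expectation (\<lambda>\<omega>. \<bar>A k \<omega>\<bar>) + \<bar>\<beta> k - d\<bar> * X.expectation (\<lambda>\<omega>. \<bar>Bk k \<omega>\<bar>)"
        using Ai(1) Bi(1) by simp
      also have "\<dots> \<le> \<bar>\<alpha> k - a\<bar> * TA + \<bar>\<beta> k - d\<bar> * TB"
        by (intro add_mono mult_left_mono Ai Bi) auto
      finally show "norm ((\<integral>\<omega>. cos ((\<Sum>i\<in>F. t i * U k \<omega> i) + b) \<partial>M) - (\<integral>\<omega>. cos ((a * A k \<omega> + d * Bk k \<omega>) + b) \<partial>M))
          \<le> \<bar>\<alpha> k - a\<bar> * TA + \<bar>\<beta> k - d\<bar> * TB" .
    next
      show "(\<lambda>k. \<bar>\<alpha> k - a\<bar> * TA + \<bar>\<beta> k - d\<bar> * TB) \<longlonglongrightarrow> 0"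
        by (intro tendsto_add_zero tendsto_mult_left_zero tendsto_rabs_zero LIM_zero \<alpha>lim \<beta>lim)
    qed
    from tendsto_add[OF this main] show ?thesis by simp
  qed
  have 7: "(\<lambda>\<omega>. \<rho> k * (pmf (erot_plan c lam (empirical_pmf X (n k) \<omega>) (empirical_pmf Y (m k) \<omega>)) z - pmf (erot_plan c lam r s) z)) \<in> borel_measurable M" for k z
  proof (cases "\<rho> k > 0")
    case True
    \<comment> \<open>Two applications of \<open>measurable_empirical\<close>: first the
      \<open>x\<close> marginal is frozen at \<open>q\<close>, then it is replaced by the empirical
      one.\<close>
    have "(\<lambda>\<omega>. \<rho> k * (pmf (erot_plan c lam q (empirical_pmf Y (m k) \<omega>)) z - pmf (erot_plan c lam r s) z)) \<in> borel_measurable M" for q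
      by (rule measurable_empirical[where f="\<lambda>q' \<omega>. \<rho> k * (pmf (erot_plan c lam q q') z - pmf (erot_plan c lam r s) z)", OF Y.X_meas _ conjunct2[OF pos[OF True]]])
         simp
    from measurable_empirical[where f="\<lambda>q \<omega>. \<rho> k * (pmf (erot_plan c lam q (empirical_pmf Y (m k) \<omega>)) z - pmf (erot_plan c lam r s) z)", OF X.X_meas this conjunct1[OF pos[OF True]]]
    show ?thesis .
  next
    case False
    then have "\<rho> k = 0" using \<rho>0[of k] by linarith
    then show ?thesis by simp
  qed
  note pl = plan_limit[where M=M and N=N and R="\<lambda>k. empirical_pmf X (n k)" and S="\<lambda>k. empirical_pmf Y (m k)" and \<rho>=\<rho>
      and Lw=G and v="case_sum (pmf r) (pmf s)", unfolded H, OF \<rho>0 \<rho>lim 2 3 4 5 6 7 gE]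
  show "converges_in_distribution (l1_space wsum) M
      (\<lambda>k \<omega> z. sqrt (real (n k) * real (m k) / (real (n k) + real (m k))) *
         (pmf (erot_plan c lam (empirical_pmf X (n k) \<omega>) (empirical_pmf Y (m k) \<omega>)) z - pmf (erot_plan c lam r s) z)) N Lm"
    unfolding Lm \<rho>_def[symmetric] by (rule pl(1))
  show "centered_gaussian (l1_space wsum) N Lm"
    unfolding Lm by (rule pl(2))

  \<comment> \<open>Covariance of the two-sample limit\<close>
  define P where "P \<omega> = D (Gr \<omega>) (\<lambda>_. 0)" for \<omega>
  define Q where "Q \<omega> = D (\<lambda>_. 0) (Gs \<omega>)" for \<omega>
  have single: "\<exists>v. gauss N (\<lambda>\<omega>. h \<omega> z) v" if "centered_gaussian (l1_space wsum) N h" for h and z :: "'x \<times> 'y"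
  proof -
    have "\<forall>F t. finite F \<longrightarrow> centered_normal N (\<lambda>\<omega>. \<Sum>z\<in>F. t z * h \<omega> z)"
      using that by (simp add: centered_gaussian_def)
    from this[rule_format, of "{z}" "\<lambda>_. 1"] show ?thesis by (simp add: centered_normal_iff[OF N.prob_space_axioms])
  qed
  have mom: "(\<lambda>\<omega>. h \<omega> z) \<in> borel_measurable N" "integrable N (\<lambda>\<omega>. (h \<omega> z)\<^sup>2)" "integrable N (\<lambda>\<omega>. h \<omega> z)" "N.expectation (\<lambda>\<omega>. h \<omega> z) = 0"
    if "centered_gaussian (l1_space wsum) N h" for h and z :: "'x \<times> 'y"
    using single[OF that, of z] gauss_measurable gauss_moments[OF N.prob_space_axioms] by blast+
  have cP: "centered_gaussian (l1_space wsum) N P" unfolding P_def[abs_def] D_def by (rule plan_limit_X(2)[OF X rs Gr])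
  have cQ: "centered_gaussian (l1_space wsum) N Q" unfolding Q_def[abs_def] D_def by (rule plan_limit_Y(2)[OF Y ss Gs])
  note mP = mom[OF cP] and mQ = mom[OF cQ] and mL = mom[OF \<open>centered_gaussian (l1_space wsum) N Lm\<close>]
  have iPP: "integrable N (\<lambda>\<omega>. P \<omega> z * P \<omega> z')" and iQQ: "integrable N (\<lambda>\<omega>. Q \<omega> z * Q \<omega> z')"
    and iPQ: "integrable N (\<lambda>\<omega>. P \<omega> z * Q \<omega> z')" for z z'
    by (rule integrable_mult_square; rule mP(1) mP(2) mQ(1) mQ(2))+
  \<comment> \<open>\<open>P\<close> depends on \<open>Gr\<close> alone and \<open>Q\<close> on
    \<open>Gs\<close> alone; both are centered, so the mixed second moments vanish.\<close>
  have PQ: "N.expectation (\<lambda>\<omega>. P \<omega> z * Q \<omega> z') = 0" for z z'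
  proof -
    have "N.indep_var borel (\<lambda>\<omega>. P \<omega> z) borel (\<lambda>\<omega>. Q \<omega> z')"
      unfolding P_def Q_def D_def Dp_case_sum[symmetric]
      by (rule indep_elements_compose[OF N.prob_space_axioms ind Dp_measurable_marginal])
    from N.indep_var_lebesgue_integral[OF this mP(3) mQ(3)] show ?thesis by (simp add: mP(4))
  qed
  have Ldec: "Lm \<omega> z = a * P \<omega> z + d * Q \<omega> z" if "\<omega> \<in> space N" for \<omega> z
  proof -
    have "G \<omega> = (\<lambda>i. a * case_sum (Gr \<omega>) (\<lambda>_. 0) i + d * case_sum (\<lambda>_. 0) (Gs \<omega>) i)"
      by (auto simp: G_def fun_eq_iff split: sum.split)
    moreover have "case_sum (Gr \<omega>) (\<lambda>_. 0) \<in> l1_set W" "case_sum (\<lambda>_. 0) (Gs \<omega>) \<in> l1_set W"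
      using lX(1)[OF that] lY(1)[OF that] unfolding W_case_sum by (auto simp: l1_set_def)
    ultimately show ?thesis
      unfolding Lm by (simp add: Dop_linear(1)[OF rsum ssum y1] P_def Q_def D_def Dp_case_sum)
  qed
  have cov0: "covariance_fun N h z z' = N.expectation (\<lambda>\<omega>. h \<omega> z * h \<omega> z')" if "centered_gaussian (l1_space wsum) N h"
    for h and z z' :: "'x \<times> 'y"
    unfolding covariance_fun_def mom(4)[OF that] by simp
  have "covariance_fun N Lm z z' = \<delta> * covariance_fun N P z z' + (1 - \<delta>) * covariance_fun N Q z z'" for z z'
  proof -
    have "covariance_fun N Lm z z' = N.expectation (\<lambda>\<omega>. a\<^sup>2 * (P \<omega> z * P \<omega> z') + a * d * (P \<omega> z * Q \<omega> z') + a * d * (P \<omega> z' * Q \<omega> z) + d\<^sup>2 * (Q \<omega> z * Q \<omega> z'))"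
      unfolding cov0[OF \<open>centered_gaussian (l1_space wsum) N Lm\<close>]
      by (rule Bochner_Integration.integral_cong) (auto simp: Ldec power2_eq_square algebra_simps)
    also have "\<dots> = a\<^sup>2 * N.expectation (\<lambda>\<omega>. P \<omega> z * P \<omega> z') + d\<^sup>2 * N.expectation (\<lambda>\<omega>. Q \<omega> z * Q \<omega> z')"
      using iPP iPQ iQQ by (simp add: PQ)
    finally show ?thesis by (simp add: ad cov0[OF cP] cov0[OF cQ])
  qed
  then show "covariance_fun N Lm = (\<lambda>z z'. \<delta> * covariance_fun N (\<lambda>\<omega>. D (Gr \<omega>) (\<lambda>_. 0)) z z' +
      (1 - \<delta>) * covariance_fun N (\<lambda>\<omega>. D (\<lambda>_. 0) (Gs \<omega>)) z z')"
    by (simp add: P_def[abs_def] Q_def[abs_def] fun_eq_iff)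
qed

end

theorem theorem3p5:
  fixes c :: "'x::countable \<times> 'y::countable \<Rightarrow> real"
    and lam :: real
    and cXm cXp CX :: "'x \<Rightarrow> real"
    and cYm cYp CY \<phi>Y :: "'y \<Rightarrow> real"
    and r :: "'x pmf" and s :: "'y pmf" and y1 :: 'y
    and D :: "('x \<Rightarrow> real) \<Rightarrow> ('y \<Rightarrow> real) \<Rightarrow> 'x \<times> 'y \<Rightarrow> real"
    and M :: "'w measure"
    and X :: "nat \<Rightarrow> 'w \<Rightarrow> 'x" and Y :: "nat \<Rightarrow> 'w \<Rightarrow> 'y"
  assumes lam: "lam > 0"
    and dom: "dominating c cXm cXp cYm cYp"
    and bdd: "bounded (range (\<lambda>x. cXp x - cXm x))"
    and CX: "CX = cost_weight cXm cXp"
    and CY: "CY = cost_weight cYm cYp"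
    and \<phi>Y: "\<phi>Y = exp_weight lam cYm cYp"
    and y1: "y1 \<in> set_pmf s"
    and D: "D = plan_deriv r s (erot_plan c lam r s) \<phi>Y y1"
  shows
    "(iid_sample M X r \<and>
      (\<lambda>x. CX x * sqrt (pmf r x)) summable_on UNIV \<and>
      (\<lambda>y. CY y * \<phi>Y y ^ 4 * pmf s y) summable_on UNIV
      \<longrightarrow>
      (\<exists>(N :: ('x \<Rightarrow> real) measure) Gr. limit_process CX r N Gr) \<and>
      (\<forall>(N :: 'g measure) Gr. limit_process CX r N Gr \<longrightarrow>
        converges_in_distribution (l1_space (weight_sum CX CY)) M
          (\<lambda>n \<omega> z. sqrt (real n) *
             (pmf (erot_plan c lam (empirical_pmf X n \<omega>) s) z - pmf (erot_plan c lam r s) z))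
          N (\<lambda>\<omega>. D (Gr \<omega>) (\<lambda>_. 0)) \<and>
        centered_gaussian (l1_space (weight_sum CX CY)) N (\<lambda>\<omega>. D (Gr \<omega>) (\<lambda>_. 0))))
     \<and>
     (iid_sample M Y s \<and>
      (\<lambda>x. CX x * pmf r x) summable_on UNIV \<and>
      (\<lambda>y. CY y * \<phi>Y y ^ 4 * sqrt (pmf s y)) summable_on UNIV
      \<longrightarrow>
      (\<exists>(N :: ('y \<Rightarrow> real) measure) Gs. limit_process (\<lambda>y. CY y * \<phi>Y y ^ 4) s N Gs) \<and>
      (\<forall>(N :: 'g measure) Gs. limit_process (\<lambda>y. CY y * \<phi>Y y ^ 4) s N Gs \<longrightarrow>
        converges_in_distribution (l1_space (weight_sum CX CY)) M
          (\<lambda>m \<omega> z. sqrt (real m) *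
             (pmf (erot_plan c lam r (empirical_pmf Y m \<omega>)) z - pmf (erot_plan c lam r s) z))
          N (\<lambda>\<omega>. D (\<lambda>_. 0) (Gs \<omega>)) \<and>
        centered_gaussian (l1_space (weight_sum CX CY)) N (\<lambda>\<omega>. D (\<lambda>_. 0) (Gs \<omega>))))
     \<and>
     (iid_sample M X r \<and> iid_sample M Y s \<and> indep_samples M X Y \<and>
      (\<lambda>x. CX x * sqrt (pmf r x)) summable_on UNIV \<and>
      (\<lambda>y. CY y * \<phi>Y y ^ 4 * sqrt (pmf s y)) summable_on UNIV
      \<longrightarrow>
      (\<exists>(N :: (('x \<Rightarrow> real) \<times> ('y \<Rightarrow> real)) measure) Gr Gs.
         limit_process CX r N Gr \<and> limit_process (\<lambda>y. CY y * \<phi>Y y ^ 4) s N Gs \<and>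
         indep_elements N (borel_metric (l1_space CX)) Gr
           (borel_metric (l1_space (\<lambda>y. CY y * \<phi>Y y ^ 4))) Gs) \<and>
      (\<forall>(N :: 'g measure) Gr Gs (n :: nat \<Rightarrow> nat) (m :: nat \<Rightarrow> nat) (\<delta> :: real).
         limit_process CX r N Gr \<and> limit_process (\<lambda>y. CY y * \<phi>Y y ^ 4) s N Gs \<and>
         indep_elements N (borel_metric (l1_space CX)) Gr
           (borel_metric (l1_space (\<lambda>y. CY y * \<phi>Y y ^ 4))) Gs \<and>
         filterlim (\<lambda>k. min (m k) (n k)) at_top sequentially \<and>
         (\<lambda>k. real (m k) / (real (m k) + real (n k))) \<longlonglongrightarrow> \<delta> \<and> 0 < \<delta> \<and> \<delta> < 1
         \<longrightarrow>
         converges_in_distribution (l1_space (weight_sum CX CY)) M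
           (\<lambda>k \<omega> z. sqrt (real (n k) * real (m k) / (real (n k) + real (m k))) *
              (pmf (erot_plan c lam (empirical_pmf X (n k) \<omega>) (empirical_pmf Y (m k) \<omega>)) z
               - pmf (erot_plan c lam r s) z))
           N (\<lambda>\<omega>. D (\<lambda>x. sqrt \<delta> * Gr \<omega> x) (\<lambda>y. sqrt (1 - \<delta>) * Gs \<omega> y)) \<and>
         centered_gaussian (l1_space (weight_sum CX CY)) N
           (\<lambda>\<omega>. D (\<lambda>x. sqrt \<delta> * Gr \<omega> x) (\<lambda>y. sqrt (1 - \<delta>) * Gs \<omega> y)) \<and>
         covariance_fun N (\<lambda>\<omega>. D (\<lambda>x. sqrt \<delta> * Gr \<omega> x) (\<lambda>y. sqrt (1 - \<delta>) * Gs \<omega> y)) =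
           (\<lambda>z z'. \<delta> * covariance_fun N (\<lambda>\<omega>. D (Gr \<omega>) (\<lambda>_. 0)) z z' +
                   (1 - \<delta>) * covariance_fun N (\<lambda>\<omega>. D (\<lambda>_. 0) (Gs \<omega>)) z z')))"
proof -
  obtain L where L: "\<And>x. cXp x - cXm x \<le> L" using bdd unfolding bounded_iff by (auto simp: abs_le_iff)
  interpret e: erot_setting c lam cXm cXp cYm cYp L by standard (rule lam dom L)+
  have weights: "CX = e.CX" "CY = e.CY" and \<phi>': "\<phi>Y = e.\<phi>"
    by (simp_all add: CX CY \<phi>Y e.CX_def e.CY_def e.\<phi>_def)
  have W: "e.CY y * e.\<phi> y ^ 4 = e.WY y" for y by (simp add: e.WY_def)
  have D': "D = plan_deriv r s (erot_plan c lam r s) e.\<phi> y1" by (simp add: D \<phi>')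
  have ec: "erot_countable c lam cXm cXp cYm cYp L r s y1"
    if "(\<lambda>x. e.CX x * pmf r x) summable_on UNIV" "(\<lambda>y. e.WY y * pmf s y) summable_on UNIV"
    by standard (rule that y1)+
  have rs: "(\<lambda>x. e.CX x * pmf r x) summable_on UNIV" if "(\<lambda>x. e.CX x * sqrt (pmf r x)) summable_on UNIV"
    by (rule summable_pmf_of_sqrt[OF less_imp_le[OF e.WY_ge(5)] that])
  have ss: "(\<lambda>y. e.WY y * pmf s y) summable_on UNIV" if "(\<lambda>y. e.WY y * sqrt (pmf s y)) summable_on UNIV"
    by (rule summable_pmf_of_sqrt[OF less_imp_le[OF e.WY_ge(4)] that])
  show ?thesis
    unfolding weights \<phi>' D' W
  proof (intro conjI impI allI; elim conjE)
    assume h: "(\<lambda>x. e.CX x * sqrt (pmf r x)) summable_on UNIV" "(\<lambda>y. e.WY y * pmf s y) summable_on UNIV" "iid_sample M X r"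
    show "\<exists>(N :: ('x \<Rightarrow> real) measure) Gr. limit_process e.CX r N Gr"
      by (rule limit_process_exists[OF e.CX_ge h(1)])
    interpret erot_countable c lam cXm cXp cYm cYp L r s y1 by (rule ec[OF rs[OF h(1)] h(2)])
    fix N :: "'g measure" and Gr assume G: "limit_process e.CX r N Gr"
    show "converges_in_distribution (l1_space e.wsum) M
      (\<lambda>n \<omega> z. sqrt (real n) * (pmf (erot_plan c lam (empirical_pmf X n \<omega>) s) z - pmf (erot_plan c lam r s) z))
      N (\<lambda>\<omega>. plan_deriv r s (erot_plan c lam r s) e.\<phi> y1 (Gr \<omega>) (\<lambda>_. 0))"
      "centered_gaussian (l1_space e.wsum) N (\<lambda>\<omega>. plan_deriv r s (erot_plan c lam r s) e.\<phi> y1 (Gr \<omega>) (\<lambda>_. 0))"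
      by (rule plan_limit_X[OF h(3,1) G])+
  next
    assume h: "(\<lambda>x. e.CX x * pmf r x) summable_on UNIV" "(\<lambda>y. e.WY y * sqrt (pmf s y)) summable_on UNIV" "iid_sample M Y s"
    show "\<exists>(N :: ('y \<Rightarrow> real) measure) Gs. limit_process e.WY s N Gs"
      by (rule limit_process_exists[OF e.WY_ge(3) h(2)])
    interpret erot_countable c lam cXm cXp cYm cYp L r s y1 by (rule ec[OF h(1) ss[OF h(2)]])
    fix N :: "'g measure" and Gs assume G: "limit_process e.WY s N Gs"
    show "converges_in_distribution (l1_space e.wsum) M
      (\<lambda>m \<omega> z. sqrt (real m) * (pmf (erot_plan c lam r (empirical_pmf Y m \<omega>)) z - pmf (erot_plan c lam r s) z))
      N (\<lambda>\<omega>. plan_deriv r s (erot_plan c lam r s) e.\<phi> y1 (\<lambda>_. 0) (Gs \<omega>))"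
      "centered_gaussian (l1_space e.wsum) N (\<lambda>\<omega>. plan_deriv r s (erot_plan c lam r s) e.\<phi> y1 (\<lambda>_. 0) (Gs \<omega>))"
      by (rule plan_limit_Y[OF h(3,2) G])+
  next
    assume h: "(\<lambda>x. e.CX x * sqrt (pmf r x)) summable_on UNIV" "(\<lambda>y. e.WY y * sqrt (pmf s y)) summable_on UNIV"
      "iid_sample M X r" "iid_sample M Y s" "indep_samples M X Y"
    obtain N1 :: "('x \<Rightarrow> real) measure" and G1 where 1: "limit_process e.CX r N1 G1"
      using limit_process_exists[OF e.CX_ge h(1)] by blast
    obtain N2 :: "('y \<Rightarrow> real) measure" and G2 where 2: "limit_process e.WY s N2 G2"
      using limit_process_exists[OF e.WY_ge(3) h(2)] by blast
    have p: "prob_space N1" "prob_space N2" using 1 2 by (simp_all add: limit_process_def)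
    \<comment> \<open>Independent limit processes are realized as functions of the two coordinates
      of a product of separate probability spaces.\<close>
    have pp: "prob_space (N1 \<Otimes>\<^sub>M N2)" by (rule prob_space_pair[OF p])
    have "limit_process e.CX r (N1 \<Otimes>\<^sub>M N2) (\<lambda>\<omega>. G1 (fst \<omega>))"
      by (rule limit_process_distr[OF 1 e.WY_ge(5) measurable_fst prob_space.distr_pair_fst[OF p(2)] pp])
    moreover have "limit_process e.WY s (N1 \<Otimes>\<^sub>M N2) (\<lambda>\<omega>. G2 (snd \<omega>))"
      by (rule limit_process_distr[OF 2 e.WY_ge(4) measurable_snd distr_pair_snd[OF p] pp])
    moreover have "indep_elements (N1 \<Otimes>\<^sub>M N2) (borel_metric (l1_space e.CX)) (\<lambda>\<omega>. G1 (fst \<omega>))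
        (borel_metric (l1_space e.WY)) (\<lambda>\<omega>. G2 (snd \<omega>))"
      by (rule indep_elements_pair[OF p]) (use 1 2 in \<open>simp_all add: limit_process_def centered_gaussian_def\<close>)
    ultimately show "\<exists>(N :: (('x \<Rightarrow> real) \<times> ('y \<Rightarrow> real)) measure) Gr Gs. limit_process e.CX r N Gr \<and>
        limit_process e.WY s N Gs \<and> indep_elements N (borel_metric (l1_space e.CX)) Gr (borel_metric (l1_space e.WY)) Gs"
      by blast
    interpret erot_countable c lam cXm cXp cYm cYp L r s y1 by (rule ec[OF rs[OF h(1)] ss[OF h(2)]])
    fix N :: "'g measure" and Gr Gs and n m :: "nat \<Rightarrow> nat" and \<delta> :: real
    assume g: "limit_process e.CX r N Gr" "limit_process e.WY s N Gs"
        "indep_elements N (borel_metric (l1_space e.CX)) Gr (borel_metric (l1_space e.WY)) Gs"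
        "filterlim (\<lambda>k. min (m k) (n k)) at_top sequentially"
        "(\<lambda>k. real (m k) / (real (m k) + real (n k))) \<longlonglongrightarrow> \<delta>" "0 < \<delta>" "\<delta> < 1"
    note pl = plan_limit_XY[OF h(3-5,1,2) g]
    show "converges_in_distribution (l1_space e.wsum) M
        (\<lambda>k \<omega> z. sqrt (real (n k) * real (m k) / (real (n k) + real (m k))) *
          (pmf (erot_plan c lam (empirical_pmf X (n k) \<omega>) (empirical_pmf Y (m k) \<omega>)) z - pmf (erot_plan c lam r s) z)) N
        (\<lambda>\<omega>. plan_deriv r s (erot_plan c lam r s) e.\<phi> y1 (\<lambda>x. sqrt \<delta> * Gr \<omega> x) (\<lambda>y. sqrt (1 - \<delta>) * Gs \<omega> y))"
      by (rule pl(1))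
    show "centered_gaussian (l1_space e.wsum) N
        (\<lambda>\<omega>. plan_deriv r s (erot_plan c lam r s) e.\<phi> y1 (\<lambda>x. sqrt \<delta> * Gr \<omega> x) (\<lambda>y. sqrt (1 - \<delta>) * Gs \<omega> y))"
      by (rule pl(2))
    show "covariance_fun N (\<lambda>\<omega>. plan_deriv r s (erot_plan c lam r s) e.\<phi> y1 (\<lambda>x. sqrt \<delta> * Gr \<omega> x) (\<lambda>y. sqrt (1 - \<delta>) * Gs \<omega> y)) =
        (\<lambda>z z'. \<delta> * covariance_fun N (\<lambda>\<omega>. plan_deriv r s (erot_plan c lam r s) e.\<phi> y1 (Gr \<omega>) (\<lambda>_. 0)) z z' +
          (1 - \<delta>) * covariance_fun N (\<lambda>\<omega>. plan_deriv r s (erot_plan c lam r s) e.\<phi> y1 (\<lambda>_. 0) (Gs \<omega>)) z z')"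
      by (rule pl(3))
  qed
qed

end
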